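(* For every positive integer $n$ such that a connected, nontraceable, locally linear graph with $n$ vertices exists, the minimum number of edges of a connected, nontraceable, locally linear graph with $n$ vertices is $2n+3$.
   Context: All graphs are finite, simple and connected. For a vertex $v$ of a graph $G$, $N(v)$ is the set of neighbours of $v$ and $G[S]$ is the subgraph induced by a vertex set $S$. A graph $G$ is locally linear if for every vertex $v$ of $G$ the induced subgraph $G[N(v)]$ is a path. A graph is traceable if it contains a path through all of its vertices; otherwise it is nontraceable. The size of a graph is its number of edges. *)

theory Defs
  imports "Graph_Theory.Graph_Theory"
begin

text \<open>
  Finite simple graphs are the \<^locale>\<open>pair_graph\<close>s of the library: symmetric
  loop-free relations on a finite vertex set, so every undirected edge is represented
  by two opposite arcs. The undirected edges are therefore recovered as the sets of end points.
\<close>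

definition uedges :: "('a,'b) pre_digraph \<Rightarrow> 'a set set" where
  "uedges G = (\<lambda>e. {tail G e, head G e}) ` arcs G"

definition neighbours :: "('a,'b) pre_digraph \<Rightarrow> 'a \<Rightarrow> 'a set" where
  "neighbours G v = {u. v \<rightarrow>\<^bsub>G\<^esub> u}"

text \<open>
  A graph is a path if its vertices can be listed without repetition such that the
  edges are exactly the pairs of consecutive vertices. A single vertex is a path; the
  empty graph is not, since \<^const>\<open>vpath\<close> requires a nonempty list.
\<close>

definition path_graph :: "('a,'b) pre_digraph \<Rightarrow> bool" where
  "path_graph H \<longleftrightarrow> (\<exists>p. vpath p H \<and> set p = verts H \<and>
     arcs_ends H = set (vwalk_arcs p) \<union> (set (vwalk_arcs p))\<inverse>)"

definition locally_linear :: "('a,'b) pre_digraph \<Rightarrow> bool" where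
  "locally_linear G \<longleftrightarrow> (\<forall>v \<in> verts G. path_graph (G \<restriction> neighbours G v))"

definition traceable :: "('a,'b) pre_digraph \<Rightarrow> bool" where
  "traceable G \<longleftrightarrow> (\<exists>p. vpath p G \<and> set p = verts G)"

definition nontraceable_locally_linear_graph :: "nat \<Rightarrow> 'a pair_pre_digraph \<Rightarrow> bool" where
  "nontraceable_locally_linear_graph n G \<longleftrightarrow>
     pair_graph G \<and> Digraph_Component.connected (with_proj G) \<and>
     \<not> traceable (with_proj G) \<and> locally_linear (with_proj G) \<and> card (pverts G) = n"

end

theory Submission
  imports Defs
begin

text \<open>
  In a connected locally linear graph every edge lies in one or two triangles, and the edges in exactly one
  triangle, the boundary edges, form disjoint cycles covering all vertices: the graph triangulates a
  surface with boundary whose vertices all lie on the boundary. Let \<open>c\<close> be the number of boundary cycles.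

  Counting pairs of edges and triangles gives \<open>3 t = 2 m - n\<close>. The edges crossed by a spanning tree of the
  dual graph, whose nodes are the triangles and the boundary cycles, can be deleted without disconnecting
  the graph, since every closed walk around a face crosses a cut an even number of times. Hence
  \<open>m - (t + c - 1) \<ge> n - 1\<close>, that is, \<open>m \<ge> 2 n + 3 (c - 2)\<close>. For \<open>c \<le> 2\<close> the boundary cycles
  can be concatenated to a spanning path, so a nontraceable graph has \<open>c \<ge> 3\<close> and \<open>m \<ge> 2 n + 3\<close>.

  For every \<open>n \<ge> 20\<close> the bound is attained by a graph in which six vertices separate eight components.
  It remains to show that a nontraceable graph has at least 20 vertices. This is clear for \<open>c \<ge> 5\<close>, as
  boundary cycles have length at least 4. For \<open>c = 3\<close> and \<open>c = 4\<close> one studies which vertices of a boundary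
  cycle have neighbours on which other boundary cycles: around a vertex the neighbours on another cycle
  come in sections of its link, a cycle is seen from outside by at least four vertices, and two
  consecutive vertices of a cycle that see different cycles allow one to
  concatenate the cycles to a spanning path.
\<close>

text \<open>The surface may have any genus, so no planar argument is available: a side or an order
  of directions exists only in the link of a single vertex, where it is a comparison of positions.
  Whatever surrounds a boundary cycle is therefore described by frontiers, sets of vertices closed
  under passing from a section of a link to the vertices that flank it. The combinatorial core is
  the question how far the frontiers of two disjoint sets can overlap; the small overlaps are
  excluded one by one.

  The number 20 arises in two ways. The smallest example has 6 hexagon vertices, two holes with 4
  vertices each and 6 ears, and triangulates a sphere with three holes, the case of equality. For
  the bound, a set that separates two boundary cycles has at least 10, 11 or 12 vertices according
  as none, one or both of these cycles have length 4, and 10 + 5 + 5 = 11 + 4 + 5 = 12 + 4 + 4 = 20.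
  With four cycles, all of length at least 4 and with sum at most 19, at least three have length at
  most 5, which leaves few patterns of adjacency between the cycles.\<close>

definition link_path :: "('a \<Rightarrow> 'a \<Rightarrow> bool) \<Rightarrow> 'a \<Rightarrow> 'a list \<Rightarrow> bool" where
  "link_path adj v xs \<longleftrightarrow> distinct xs \<and> set xs = {u. adj v u} \<and> xs \<noteq> [] \<and>
     (\<forall>i<length xs. \<forall>j<length xs. adj (xs ! i) (xs ! j) \<longleftrightarrow> i = Suc j \<or> j = Suc i)"

locale ll_graph =
  fixes V :: "'a set" and adj :: "'a \<Rightarrow> 'a \<Rightarrow> bool"
  assumes finite_V: "finite V"
    and adj_sym: "adj u v \<Longrightarrow> adj v u"
    and adj_irrefl: "\<not> adj u u"
    and adj_V: "adj u v \<Longrightarrow> u \<in> V"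
    and connected: "u \<in> V \<Longrightarrow> v \<in> V \<Longrightarrow> (u, v) \<in> {(x, y). adj x y}\<^sup>*"
    and link: "v \<in> V \<Longrightarrow> \<exists>xs. link_path adj v xs"
    and card_V: "card V > 2"
begin

section \<open>Positions in links and boundary edges\<close>

definition nb :: "'a \<Rightarrow> 'a set" where "nb v = {u. adj v u}"

lemma nb_iff [simp]: "u \<in> nb v \<longleftrightarrow> adj v u"
  by (simp add: nb_def)

lemma adj_commute: "adj u v \<longleftrightarrow> adj v u"
  using adj_sym by blast

lemma adj_V2: "adj u v \<Longrightarrow> v \<in> V"
  using adj_V adj_sym by blast

lemma nb_subset: "nb v \<subseteq> V"
  using adj_V2 by auto

lemma closed_set_eq_V:
  assumes "S \<subseteq> V" "S \<noteq> {}" "\<And>u v. u \<in> S \<Longrightarrow> adj u v \<Longrightarrow> v \<in> S"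
  shows "S = V"
proof -
  obtain s where s: "s \<in> S" using assms by blast
  have "v \<in> S" if "v \<in> V" for v
  proof -
    have "(s, v) \<in> {(x, y). adj x y}\<^sup>*" using connected s assms(1) that by blast
    then show ?thesis by (induction) (use s assms(3) in auto)
  qed
  then show ?thesis using assms(1) by blast
qed

definition lk :: "'a \<Rightarrow> 'a list" where "lk v = (SOME xs. link_path adj v xs)"
definition deg :: "'a \<Rightarrow> nat" where "deg v = length (lk v)"
definition pos :: "'a \<Rightarrow> 'a \<Rightarrow> nat" where "pos v x = (THE i. i < deg v \<and> lk v ! i = x)"

lemma link_path_lk: "v \<in> V \<Longrightarrow> link_path adj v (lk v)"
  unfolding lk_def using link by (rule someI_ex)

lemma pos_unique: "\<lbrakk>v \<in> V; x \<in> nb v\<rbrakk> \<Longrightarrow> \<exists>!i. i < deg v \<and> lk v ! i = x"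
  using link_path_lk[of v] unfolding link_path_def deg_def
  by (metis distinct_Ex1 mem_Collect_eq nb_iff)

lemma pos_less: "adj v x \<Longrightarrow> pos v x < deg v"
  and lk_pos: "adj v x \<Longrightarrow> lk v ! pos v x = x"
  using theI'[OF pos_unique[of v x]] adj_V[of v x] unfolding pos_def by auto

lemma pos_lk: "\<lbrakk>v \<in> V; i < deg v\<rbrakk> \<Longrightarrow> adj v (lk v ! i) \<and> pos v (lk v ! i) = i"
  using link_path_lk[of v] pos_unique[of v "lk v ! i"] pos_less lk_pos
  unfolding link_path_def deg_def
  by (metis mem_Collect_eq nb_iff nth_mem)

lemma pos_surj: "\<lbrakk>v \<in> V; i < deg v\<rbrakk> \<Longrightarrow> \<exists>x. adj v x \<and> pos v x = i"
  using pos_lk by blast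

lemma pos_inj: "\<lbrakk>adj v x; adj v y\<rbrakk> \<Longrightarrow> pos v x = pos v y \<longleftrightarrow> x = y"
  using lk_pos by metis

lemma adj_pos: "\<lbrakk>adj v x; adj v y\<rbrakk> \<Longrightarrow> adj x y \<longleftrightarrow> pos v x = Suc (pos v y) \<or> pos v y = Suc (pos v x)"
  using link_path_lk[of v] adj_V[of v x] pos_less[of v x] pos_less[of v y] lk_pos[of v x] lk_pos[of v y]
  unfolding link_path_def deg_def by metis

lemma deg_pos: "v \<in> V \<Longrightarrow> deg v > 0"
  using link_path_lk[of v] unfolding link_path_def deg_def by simp

text \<open>A vertex \<open>v\<close> whose only neighbour is \<open>u\<close> is isolated in the
  link of \<open>u\<close>, which is a path; hence \<open>v\<close> is the only neighbour of
  \<open>u\<close>, and the graph would be the single edge excluded by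
  \<open>card_V\<close>.\<close>

lemma deg_ge_2:
  assumes "v \<in> V" shows "deg v \<ge> 2"
proof (rule ccontr)
  assume "\<not> ?thesis"
  then have d1: "deg v = 1" using deg_pos[OF assms] by linarith
  then obtain u where u: "adj v u" using pos_surj[OF assms, of 0] by auto
  have nbv: "x = u" if "adj v x" for x
    using pos_less[OF that] pos_less[OF u] pos_inj[OF that u] d1 by auto
  have uV: "u \<in> V" and vu: "adj u v" using u adj_V2 adj_sym by blast+
  have nbu: "x = v" if x: "adj u x" for x
  proof (rule ccontr)
    assume "x \<noteq> v"
    then have ne: "pos u x \<noteq> pos u v" using pos_inj x vu by blast
    have "\<exists>i<deg u. i = Suc (pos u v) \<or> pos u v = Suc i"
    proof (cases "pos u x < pos u v")
      case True then show ?thesis using pos_less[OF vu] by (intro exI[of _ "pos u v - 1"]) auto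
    next
      case False then show ?thesis using ne pos_less[OF x] by (intro exI[of _ "Suc (pos u v)"]) auto
    qed
    then obtain y where y: "adj u y" "pos u y = Suc (pos u v) \<or> pos u v = Suc (pos u y)"
      using pos_surj[OF uV] by metis
    then have "adj v y" using adj_pos[OF vu y(1)] by blast
    then show False using nbv[of y] y(1) adj_irrefl by blast
  qed
  have "{u, v} = V"
    by (rule closed_set_eq_V) (use assms uV nbv nbu in auto)
  moreover have "card {u, v} \<le> 2" by (simp add: card_insert_if)
  ultimately have "card V \<le> 2" by simp
  then show False using card_V by simp
qed

definition bnd :: "'a \<Rightarrow> 'a \<Rightarrow> bool" where
  "bnd u v \<longleftrightarrow> adj u v \<and> (\<exists>!x. adj u x \<and> adj v x)"

lemma bnd_sym: "bnd u v \<Longrightarrow> bnd v u"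
  unfolding bnd_def using adj_sym by metis

lemma bnd_adj: "bnd u v \<Longrightarrow> adj u v"
  by (simp add: bnd_def)

lemma common_iff: "adj u v \<Longrightarrow> adj u x \<and> adj v x \<longleftrightarrow> adj u x \<and> (pos u x = Suc (pos u v) \<or> pos u v = Suc (pos u x))"
  using adj_pos by blast

text \<open>The common neighbours of \<open>u\<close> and \<open>v\<close> are the vertices next to
  \<open>v\<close> on the link of \<open>u\<close>, so there is exactly one when \<open>v\<close> is
  an end of that path.\<close>

lemma bnd_iff: "bnd u v \<longleftrightarrow> adj u v \<and> (pos u v = 0 \<or> Suc (pos u v) = deg u)"
proof (cases "adj u v")
  case True
  have uV: "u \<in> V" using True adj_V by blast
  have d: "deg u \<ge> 2" "pos u v < deg u" using deg_ge_2 uV pos_less True by auto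
  show ?thesis
  proof (cases "pos u v = 0 \<or> Suc (pos u v) = deg u")
    case t: True
    define k where "k = (if pos u v = 0 then 1 else pos u v - 1)"
    have k: "k < deg u" "\<And>j. j < deg u \<Longrightarrow> j = Suc (pos u v) \<or> pos u v = Suc j \<longleftrightarrow> j = k"
      using t d unfolding k_def by auto
    obtain x where x: "adj u x" "pos u x = k" using pos_surj[OF uV k(1)] by blast
    have "\<exists>!x. adj u x \<and> adj v x"
    proof (rule ex1I[of _ x])
      show "adj u x \<and> adj v x" using common_iff[OF True, of x] x k pos_less by metis
      fix y assume "adj u y \<and> adj v y"
      then have "adj u y" "pos u y = k" using common_iff[OF True, of y] k(2)[of "pos u y"] pos_less by blast+
      then show "y = x" using pos_inj x by metis
    qed
    then show ?thesis using True t bnd_def by blast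
  next
    case f: False
    have lt: "Suc (pos u v) < deg u" "pos u v - 1 < deg u" using f d by auto
    obtain x where x: "adj u x" "pos u x = Suc (pos u v)" using pos_surj[OF uV lt(1)] by blast
    obtain y where y: "adj u y" "pos u y = pos u v - 1" using pos_surj[OF uV lt(2)] by blast
    have "x \<noteq> y" using x y f by auto
    moreover have "adj v x" "adj v y" using adj_pos[OF True x(1)] adj_pos[OF True y(1)] x(2) y(2) f by auto
    ultimately have "\<not> bnd u v" using x y bnd_def by metis
    then show ?thesis using f by blast
  qed
qed (simp add: bnd_def)

lemma adj_imp_common: "adj u v \<Longrightarrow> \<exists>x. adj u x \<and> adj v x"
proof -
  assume a: "adj u v"
  have uV: "u \<in> V" using a adj_V by blast
  have d: "deg u \<ge> 2" "pos u v < deg u" using deg_ge_2 uV pos_less a by auto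
  then have "\<exists>i<deg u. i = Suc (pos u v) \<or> pos u v = Suc i"
    by (cases "pos u v") (auto intro: exI[of _ 1] exI[of _ "pos u v - 1"])
  then show ?thesis using common_iff[OF a] pos_surj[OF uV] by metis
qed

lemma nonbnd_common:
  assumes "adj u v" "\<not> bnd u v"
  shows "\<exists>x y. x \<noteq> y \<and> adj u x \<and> adj v x \<and> adj u y \<and> adj v y"
  using assms adj_imp_common bnd_def by metis

lemma common_at_most_two:
  assumes "adj u v" "adj u x" "adj v x" "adj u y" "adj v y" "adj u z" "adj v z" "x \<noteq> y" "x \<noteq> z" "y \<noteq> z"
  shows False
  using adj_pos[OF assms(1,2)] adj_pos[OF assms(1,4)] adj_pos[OF assms(1,6)] assms pos_inj[of u]
  by (metis nat.inject)

lemma bnd_common_unique: "\<lbrakk>bnd u v; adj u x; adj v x; adj u y; adj v y\<rbrakk> \<Longrightarrow> x = y"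
  unfolding bnd_def by blast

lemma bnd_ex2: "v \<in> V \<Longrightarrow> \<exists>a b. a \<noteq> b \<and> {w. bnd v w} = {a, b}"
proof -
  assume v: "v \<in> V"
  have d: "deg v \<ge> 2" using deg_ge_2 v by blast
  obtain a where a: "adj v a" "pos v a = 0" using pos_surj[OF v, of 0] d by auto
  obtain b where b: "adj v b" "pos v b = deg v - 1" using pos_surj[OF v, of "deg v - 1"] d by auto
  have "{w. bnd v w} = {a, b}"
  proof (intro set_eqI iffI)
    fix w assume "w \<in> {w. bnd v w}"
    then have w: "adj v w" "pos v w = 0 \<or> Suc (pos v w) = deg v" using bnd_iff by auto
    show "w \<in> {a, b}" using w(2)
    proof
      assume "pos v w = 0" then show ?thesis using pos_inj[OF w(1) a(1)] a by simp
    next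
      assume "Suc (pos v w) = deg v"
      then have "pos v w = pos v b" using b(2) by linarith
      then show ?thesis using pos_inj[OF w(1) b(1)] by simp
    qed
  next
    fix w assume "w \<in> {a, b}" then show "w \<in> {w. bnd v w}" using a b d bnd_iff by auto
  qed
  moreover have "a \<noteq> b" using a b d by auto
  ultimately show ?thesis by blast
qed

subsection \<open>Sections of a link\<close>

text \<open>The neighbours of \<open>u\<close> strictly between \<open>p\<close> and \<open>q\<close> in the link of \<open>u\<close> form a maximal block inside \<open>X\<close>.\<close>

definition sec :: "'a set \<Rightarrow> 'a \<Rightarrow> 'a \<Rightarrow> 'a \<Rightarrow> bool" where
  "sec X u p q \<longleftrightarrow> adj u p \<and> adj u q \<and> p \<notin> X \<and> q \<notin> X \<and>
     (Suc (pos u p) < pos u q \<or> Suc (pos u q) < pos u p) \<and>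
     (\<forall>x. adj u x \<longrightarrow> (pos u p < pos u x \<and> pos u x < pos u q \<or> pos u q < pos u x \<and> pos u x < pos u p) \<longrightarrow> x \<in> X)"

lemma sec_sym: "sec X u p q \<Longrightarrow> sec X u q p"
  unfolding sec_def by blast

lemma sec_adj:
  assumes "sec X u p q"
  shows "adj u p" "adj u q" "p \<notin> X" "q \<notin> X" "p \<noteq> q" "\<not> adj p q"
proof -
  show a: "adj u p" "adj u q" "p \<notin> X" "q \<notin> X" using assms unfolding sec_def by blast+
  have d: "Suc (pos u p) < pos u q \<or> Suc (pos u q) < pos u p" using assms unfolding sec_def by blast
  then show "p \<noteq> q" by auto
  have "\<not> (pos u p = Suc (pos u q) \<or> pos u q = Suc (pos u p))" using d by linarith
  then show "\<not> adj p q" using adj_pos[OF a(1,2)] by blast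
qed

lemma sec_mid: assumes "sec X u p q" shows "\<exists>x\<in>X. adj u x \<and> adj p x"
proof -
  have p: "adj u p" "adj u q" using sec_adj[OF assms] by blast+
  then have uV: "u \<in> V" using adj_V by blast
  define k where "k = (if pos u p < pos u q then Suc (pos u p) else pos u p - 1)"
  have d: "Suc (pos u p) < pos u q \<or> Suc (pos u q) < pos u p" using assms unfolding sec_def by blast
  have k: "k < deg u" "k = Suc (pos u p) \<or> pos u p = Suc k"
    "pos u p < k \<and> k < pos u q \<or> pos u q < k \<and> k < pos u p"
    using d pos_less[OF p(1)] pos_less[OF p(2)] unfolding k_def by (auto split: if_splits)
  obtain x where x: "adj u x" "pos u x = k" using pos_surj[OF uV k(1)] by blast
  then have "x \<in> X" using assms k unfolding sec_def by blast
  moreover have "adj p x" using adj_pos[OF p(1) x(1)] x(2) k(2) by metis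
  ultimately show ?thesis using x by blast
qed

text \<open>A section is nonempty by definition, so the vertex next to \<open>p\<close> would belong
  to both sets.\<close>

lemma sec_disjoint: "\<lbrakk>sec X u p q; sec Y u p q; X \<inter> Y = {}\<rbrakk> \<Longrightarrow> False"
proof -
  assume a: "sec X u p q" "sec Y u p q" "X \<inter> Y = {}"
  have p: "adj u p" "adj u q" using sec_adj[OF a(1)] by blast+
  then have uV: "u \<in> V" using adj_V by blast
  define k where "k = (if pos u p < pos u q then Suc (pos u p) else pos u p - 1)"
  have d: "Suc (pos u p) < pos u q \<or> Suc (pos u q) < pos u p" using a(1) unfolding sec_def by blast
  have k: "k < deg u" "pos u p < k \<and> k < pos u q \<or> pos u q < k \<and> k < pos u p"
    using d pos_less[OF p(1)] pos_less[OF p(2)] unfolding k_def by (auto split: if_splits)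
  obtain x where x: "adj u x" "pos u x = k" using pos_surj[OF uV k(1)] by blast
  then have "x \<in> X" "x \<in> Y" using a k unfolding sec_def by blast+
  then show False using a by blast
qed

lemma sec_not_between:
  "\<lbrakk>sec X u p q; adj u r; r \<notin> X\<rbrakk> \<Longrightarrow>
    \<not> (pos u p < pos u r \<and> pos u r < pos u q) \<and> \<not> (pos u q < pos u r \<and> pos u r < pos u p)"
  unfolding sec_def by blast

lemma sec_pos_neq: assumes "sec X u p q" shows "pos u p \<noteq> pos u q"
  using sec_adj[OF assms] pos_inj by metis

text \<open>One of the three positions lies between the other two and would have to belong to their
  section.\<close>

lemma sec_triangle:
  assumes "sec X u p q" "sec Y u q r" "sec Z u r p" "r \<notin> X" "p \<notin> Y" "q \<notin> Z"
  shows False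
proof -
  note n1 = sec_not_between[OF assms(1) sec_adj(2)[OF assms(2)] assms(4)]
  note n2 = sec_not_between[OF assms(2) sec_adj(1)[OF assms(1)] assms(5)]
  note n3 = sec_not_between[OF assms(3) sec_adj(1)[OF assms(2)] assms(6)]
  have n4: "pos u p \<noteq> pos u q" "pos u q \<noteq> pos u r" "pos u r \<noteq> pos u p"
    using assms(1-3) sec_pos_neq by blast+
  define a b c where "a = pos u p" and "b = pos u q" and "c = pos u r"
  show False using n1 n2 n3 n4 unfolding a_def[symmetric] b_def[symmetric] c_def[symmetric] by linarith
qed

text \<open>A neighbour of \<open>p\<close> on the link that is not in the section starting at
  \<open>p\<close> stands on the other side of \<open>p\<close>.\<close>

lemma sec_beside:
  assumes "sec X u p q" "adj u r" "adj p r" "r \<notin> X"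
  shows "pos u r < pos u p \<longleftrightarrow> pos u p < pos u q"
proof -
  have p: "adj u p" using sec_adj[OF assms(1)] by blast
  have d: "pos u p = Suc (pos u r) \<or> pos u r = Suc (pos u p)" using adj_pos[OF p assms(2)] assms(3) by blast
  have e: "Suc (pos u p) < pos u q \<or> Suc (pos u q) < pos u p" using assms(1) unfolding sec_def by blast
  show ?thesis using d e sec_not_between[OF assms(1,2,4)] by linarith
qed

text \<open>A path contains no 4-cycle. Most of the configurations below end in this
  contradiction.\<close>

lemma link_no_four_cycle:
  assumes "adj x a" "adj x b" "adj x c" "adj x d" "adj a b" "adj b c" "adj c d" "adj d a" "a \<noteq> c" "b \<noteq> d"
  shows False
proof -
  have "pos x a \<noteq> pos x c" "pos x b \<noteq> pos x d" using pos_inj assms by blast+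
  moreover have "pos x a = Suc (pos x b) \<or> pos x b = Suc (pos x a)" using adj_pos assms by blast
  moreover have "pos x b = Suc (pos x c) \<or> pos x c = Suc (pos x b)" using adj_pos assms by blast
  moreover have "pos x c = Suc (pos x d) \<or> pos x d = Suc (pos x c)" using adj_pos assms by blast
  moreover have "pos x d = Suc (pos x a) \<or> pos x a = Suc (pos x d)" using adj_pos assms by blast
  ultimately show False by linarith
qed

text \<open>The ends of the link are boundary neighbours of \<open>u\<close> and hence outside
  \<open>X\<close>. So the walk from \<open>p\<close> through \<open>x\<close> leaves
  \<open>X\<close> again before the link ends, and \<open>q\<close> is the first vertex
  outside.\<close>

lemma sec_step:
  assumes "adj u p" "p \<notin> X" "x \<in> X" "adj u x" "adj p x" "\<And>w. bnd u w \<Longrightarrow> w \<notin> X"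
  shows "\<exists>q. sec X u p q \<and> (pos u p < pos u q \<longleftrightarrow> pos u p < pos u x)"
proof -
  have uV: "u \<in> V" using assms adj_V by blast
  have px: "pos u p = Suc (pos u x) \<or> pos u x = Suc (pos u p)" using adj_pos[OF assms(1,4)] assms by blast
  have deg: "pos u x < deg u" using pos_less assms by blast
  define el where "el i = lk u ! i" for i
  have el: "adj u (el i) \<and> pos u (el i) = i" if "i < deg u" for i unfolding el_def using pos_lk uV that by blast
  have eli: "el (pos u y) = y" if "adj u y" for y unfolding el_def using lk_pos that by blast
  have d0: "0 < deg u" "deg u - 1 < deg u" using deg by auto
  have e0: "el 0 \<notin> X" using assms(6)[of "el 0"] bnd_iff[of u "el 0"] el[OF d0(1)] by simp
  have e1: "el (deg u - 1) \<notin> X" using assms(6)[of "el (deg u - 1)"] bnd_iff[of u "el (deg u - 1)"] el[OF d0(2)] d0 by simp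
  have elx: "el (pos u x) = x" using eli assms(4) by blast
  have mk: "\<exists>q. sec X u p q \<and> pos u q = j"
    if j: "j < deg u" "el j \<notin> X" "Suc (pos u p) < j \<or> Suc j < pos u p"
      and bt: "\<And>i. pos u p < i \<and> i < j \<or> j < i \<and> i < pos u p \<Longrightarrow> el i \<in> X" for j
  proof -
    have ej: "adj u (el j)" "pos u (el j) = j" using el[OF j(1)] by blast+
    have "sec X u p (el j)" unfolding sec_def ej(2)
    proof (intro conjI allI impI)
      fix y assume "adj u y" "pos u p < pos u y \<and> pos u y < j \<or> j < pos u y \<and> pos u y < pos u p"
      then show "y \<in> X" using bt[of "pos u y"] eli[of y] by metis
    qed (fact assms(1) ej(1) assms(2) j(2) j(3))+
    then show ?thesis using ej(2) by blast
  qed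
  show ?thesis using px
  proof
    assume a: "pos u x = Suc (pos u p)"
    let ?P = "\<lambda>j. pos u x < j \<and> j < deg u \<and> el j \<notin> X"
    have "pos u x \<noteq> deg u - 1" using e1 elx assms(3) by auto
    then have ex: "?P (deg u - 1)" using e1 deg by auto
    define j where "j = (LEAST j. ?P j)"
    have j: "?P j" unfolding j_def by (rule LeastI[of ?P], rule ex)
    have jl: "el i \<in> X" if "pos u x < i" "i < j" for i
      using not_less_Least[of i ?P] that j unfolding j_def[symmetric] by auto
    have "\<exists>q. sec X u p q \<and> pos u q = j"
    proof (rule mk[of j])
      fix i assume "pos u p < i \<and> i < j \<or> j < i \<and> i < pos u p"
      then have "i = pos u x \<or> pos u x < i \<and> i < j" using a j by linarith
      then show "el i \<in> X" using jl elx assms(3) by auto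
    qed (use j a in auto)
    then show ?thesis using j a by auto
  next
    assume a: "pos u p = Suc (pos u x)"
    let ?P = "\<lambda>j. j < pos u x \<and> el j \<notin> X"
    have "pos u x \<noteq> 0" using e0 elx assms(3) by metis
    then have ex: "?P 0" using e0 by auto
    define j where "j = (GREATEST j. ?P j)"
    have j: "?P j" unfolding j_def by (rule GreatestI_nat[of ?P 0 "pos u x"]) (use ex in auto)
    have jl: "el i \<in> X" if i: "j < i" "i < pos u x" for i
    proof (rule ccontr)
      assume "el i \<notin> X"
      then have "i \<le> j" unfolding j_def using i by (intro Greatest_le_nat[of ?P i "pos u x"]) auto
      then show False using i by simp
    qed
    have "\<exists>q. sec X u p q \<and> pos u q = j"
    proof (rule mk[of j])
      fix i assume "pos u p < i \<and> i < j \<or> j < i \<and> i < pos u p"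
      then have "i = pos u x \<or> j < i \<and> i < pos u x" using a j by linarith
      then show "el i \<in> X" using jl elx assms(3) by auto
    qed (use j a deg in auto)
    then show ?thesis using j a by auto
  qed
qed

lemma sec_exists:
  assumes "x \<in> X" "adj u x" "\<And>w. bnd u w \<Longrightarrow> w \<notin> X"
  shows "\<exists>p q. sec X u p q"
proof -
  have uV: "u \<in> V" using assms adj_V by blast
  have deg: "pos u x < deg u" using pos_less assms by blast
  have e0: "lk u ! 0 \<notin> X" using assms(3) bnd_iff pos_lk[OF uV, of 0] deg by auto
  let ?P = "\<lambda>j. j \<le> pos u x \<and> lk u ! j \<notin> X"
  define j where "j = (GREATEST j. ?P j)"
  have j: "?P j" unfolding j_def by (rule GreatestI_nat[of ?P 0 "pos u x"]) (use e0 in auto)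
  have jx: "j < pos u x" using j lk_pos[OF assms(2)] assms(1) by (metis le_neq_implies_less)
  have jl: "lk u ! (Suc j) \<in> X"
  proof (rule ccontr)
    assume "lk u ! (Suc j) \<notin> X"
    then have "Suc j \<le> j" unfolding j_def using jx[unfolded j_def]
      by (intro Greatest_le_nat[of ?P _ "pos u x"]) auto
    then show False by simp
  qed
  have p: "adj u (lk u ! j)" "pos u (lk u ! j) = j" and y: "adj u (lk u ! Suc j)" "pos u (lk u ! Suc j) = Suc j"
    using pos_lk[OF uV] jx deg by auto
  have "adj (lk u ! j) (lk u ! Suc j)" using adj_pos[OF p(1) y(1)] p y by simp
  then show ?thesis using sec_step[OF p(1) _ jl y(1)] j assms by blast
qed

subsection \<open>Spanning paths and cycles\<close>

definition hpath :: "'a set \<Rightarrow> 'a \<Rightarrow> 'a \<Rightarrow> bool" where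
  "hpath S a b \<longleftrightarrow> (\<exists>p. p \<noteq> [] \<and> distinct p \<and> set p = S \<and> hd p = a \<and> last p = b \<and> successively adj p)"

text \<open>The relation is a parameter because both boundary cycles (\<open>bnd\<close>) and cycles
  obtained by merging them (\<open>adj\<close>) occur.\<close>

definition cyc :: "('a \<Rightarrow> 'a \<Rightarrow> bool) \<Rightarrow> 'a list \<Rightarrow> bool" where
  "cyc R xs \<longleftrightarrow> distinct xs \<and> 3 \<le> length xs \<and> (\<forall>i<length xs. R (xs ! i) (xs ! (Suc i mod length xs)))"

definition cons :: "'a list \<Rightarrow> 'a \<Rightarrow> 'a \<Rightarrow> bool" where
  "cons xs u v \<longleftrightarrow> (\<exists>i<length xs. u = xs ! i \<and> v = xs ! (Suc i mod length xs) \<or> v = xs ! i \<and> u = xs ! (Suc i mod length xs))"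

lemma cons_sym: "cons xs u v \<Longrightarrow> cons xs v u"
  unfolding cons_def by blast

lemma cons_mem: "cons xs u v \<Longrightarrow> u \<in> set xs \<and> v \<in> set xs"
  unfolding cons_def by (metis length_pos_if_in_set list.size(3) mod_less_divisor not_less_zero nth_mem gr0I)

lemma cyc_cons: assumes "cyc R xs" "symp R" "cons xs u v" shows "R u v"
  using assms sympD unfolding cyc_def cons_def by metis

lemma symp_adj: "symp adj" using adj_sym by (rule sympI)
lemma symp_bnd: "symp bnd" using bnd_sym by (rule sympI)

lemma hpath_sym: "hpath S a b \<Longrightarrow> hpath S b a"
  unfolding hpath_def
proof (elim exE conjE)
  fix p assume p: "p \<noteq> []" "distinct p" "set p = S" "hd p = a" "last p = b" "successively adj p"
  have "successively adj (rev p)" using p(6) adj_commute by (simp add: successively_rev)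
  then show "\<exists>p. p \<noteq> [] \<and> distinct p \<and> set p = S \<and> hd p = b \<and> last p = a \<and> successively adj p"
    using p by (intro exI[of _ "rev p"]) (auto simp: hd_rev last_rev)
qed

lemma hpath_append:
  assumes "hpath S a b" "hpath T c d" "adj b c" "S \<inter> T = {}"
  shows "hpath (S \<union> T) a d"
proof -
  obtain p where p: "p \<noteq> []" "distinct p" "set p = S" "hd p = a" "last p = b" "successively adj p"
    using assms(1) unfolding hpath_def by blast
  obtain q where q: "q \<noteq> []" "distinct q" "set q = T" "hd q = c" "last q = d" "successively adj q"
    using assms(2) unfolding hpath_def by blast
  show ?thesis unfolding hpath_def
    using p q assms(3,4) by (intro exI[of _ "p @ q"]) (auto simp: successively_append_iff)
qed

lemma cyc_rotate: assumes "cyc R xs" shows "cyc R (rotate m xs)" "set (rotate m xs) = set xs" "length (rotate m xs) = length xs"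
proof -
  have l: "length xs > 0" and d: "distinct xs" "3 \<le> length xs" using assms unfolding cyc_def by auto
  have "R (rotate m xs ! i) (rotate m xs ! (Suc i mod length xs))" if "i < length xs" for i
  proof -
    have "rotate m xs ! i = xs ! ((m + i) mod length xs)" using nth_rotate that by blast
    moreover have "rotate m xs ! (Suc i mod length xs) = xs ! ((m + Suc i mod length xs) mod length xs)"
      using nth_rotate l by (metis mod_less_divisor)
    moreover have "(m + Suc i mod length xs) mod length xs = Suc ((m + i) mod length xs) mod length xs"
      by (simp add: mod_simps)
    ultimately show ?thesis using assms l unfolding cyc_def by simp
  qed
  then show "cyc R (rotate m xs)" using d unfolding cyc_def by simp
qed auto

lemma cons_rotate: assumes "xs \<noteq> []" shows "cons (rotate m xs) u v \<longleftrightarrow> cons xs u v"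
proof -
  have l: "length xs > 0" using assms by simp
  have s: "rotate m xs ! (Suc i mod length xs) = xs ! (Suc ((m + i) mod length xs) mod length xs)"
    "rotate m xs ! i = xs ! ((m + i) mod length xs)" if "i < length xs" for i
    using nth_rotate[of "Suc i mod length xs" xs m] nth_rotate[OF that] l by (simp_all add: mod_simps)
  have on: "\<exists>i<length xs. j = (m + i) mod length xs" if "j < length xs" for j
  proof -
    let ?i = "(j + (length xs - m mod length xs)) mod length xs"
    have "(m + ?i) mod length xs = (m mod length xs + (j + (length xs - m mod length xs))) mod length xs"
      by (simp add: mod_simps)
    also have "\<dots> = (j + length xs) mod length xs"
    proof -
      have "m mod length xs < length xs" using l by simp
      then have "m mod length xs + (j + (length xs - m mod length xs)) = j + length xs" by linarith
      then show ?thesis by simp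
    qed
    also have "\<dots> = j" using that by simp
    finally show ?thesis using l by (intro exI[of _ ?i]) auto
  qed
  show ?thesis
  proof
    assume "cons (rotate m xs) u v"
    then show "cons xs u v" unfolding cons_def using s l by (metis length_rotate mod_less_divisor)
  next
    assume "cons xs u v"
    then obtain j where j: "j < length xs" "u = xs ! j \<and> v = xs ! (Suc j mod length xs) \<or> v = xs ! j \<and> u = xs ! (Suc j mod length xs)"
      unfolding cons_def by blast
    then obtain i where "i < length xs" "j = (m + i) mod length xs" using on by blast
    then show "cons (rotate m xs) u v" unfolding cons_def using s j by (metis length_rotate)
  qed
qed

text \<open>Cut the cycle at the edge \<open>uv\<close>: a suitable rotation of the list is the
  path.\<close>

lemma cyc_hpath:
  assumes "cyc adj xs" "cons xs u v"
  shows "hpath (set xs) u v"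
proof -
  have l: "length xs \<ge> 3" "distinct xs" using assms unfolding cyc_def by auto
  have main: "hpath (set xs) (xs ! (Suc i mod length xs)) (xs ! i)" if i: "i < length xs" for i
  proof -
    let ?p = "rotate (Suc i) xs"
    have p: "cyc adj ?p" "length ?p = length xs" using cyc_rotate assms(1) by blast+
    have "hd ?p = xs ! (Suc i mod length xs)" using hd_rotate_conv_nth l by (metis list.size(3) not_numeral_le_zero)
    moreover have "last ?p = xs ! i"
    proof -
      have "last ?p = ?p ! (length xs - 1)" using l p(2) last_conv_nth by (metis list.size(3) not_numeral_le_zero)
      also have "\<dots> = xs ! ((Suc i + (length xs - 1)) mod length xs)" by (rule nth_rotate) (use i in auto)
      also have "Suc i + (length xs - 1) = i + length xs" using i by linarith
      also have "(i + length xs) mod length xs = i" using i by simp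
      finally show ?thesis .
    qed
    moreover have "successively adj ?p" unfolding successively_conv_nth
    proof (intro allI impI)
      fix j assume "Suc j < length ?p"
      then have "j < length ?p" "Suc j mod length ?p = Suc j" by auto
      then show "adj (?p ! j) (?p ! (Suc j))" using p(1) unfolding cyc_def by metis
    qed
    ultimately show ?thesis unfolding hpath_def using l by (intro exI[of _ ?p]) auto
  qed
  obtain i where "i < length xs" "u = xs ! i \<and> v = xs ! (Suc i mod length xs) \<or> v = xs ! i \<and> u = xs ! (Suc i mod length xs)"
    using assms(2) unfolding cons_def by blast
  then show ?thesis using main hpath_sym by metis
qed

lemma hpath_cyc:
  assumes "hpath S a b" "adj b a" "card S \<ge> 3"
  shows "\<exists>zs. cyc adj zs \<and> set zs = S"
proof -
  obtain p where p: "p \<noteq> []" "distinct p" "set p = S" "hd p = a" "last p = b" "successively adj p"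
    using assms(1) unfolding hpath_def by blast
  have l: "length p \<ge> 3" using assms(3) p distinct_card by metis
  have "adj (p ! i) (p ! (Suc i mod length p))" if i: "i < length p" for i
  proof (cases "Suc i = length p")
    case True
    then have "i = length p - 1" by simp
    then have "p ! i = b" "p ! (Suc i mod length p) = a" using p True last_conv_nth[of p] hd_conv_nth[of p] by auto
    then show ?thesis using assms(2) by simp
  next
    case False
    then have "Suc i mod length p = Suc i" "Suc i < length p" using i by auto
    then show ?thesis using p(6) unfolding successively_conv_nth by simp
  qed
  then show ?thesis using p l unfolding cyc_def by blast
qed

text \<open>The edges \<open>uu'\<close> and \<open>vv'\<close> are exchanged for \<open>uv\<close>
  and \<open>u'v'\<close>.\<close>

lemma merge_cycles:
  assumes "cyc adj xs" "cyc adj ys" "set xs \<inter> set ys = {}" "cons xs u u'" "cons ys v v'" "adj u v" "adj u' v'"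
  shows "\<exists>zs. cyc adj zs \<and> set zs = set xs \<union> set ys"
proof (rule hpath_cyc)
  show "hpath (set xs \<union> set ys) u' v'"
    using hpath_append[OF cyc_hpath[OF assms(1) cons_sym[OF assms(4)]] cyc_hpath[OF assms(2,5)] assms(6,3)] .
  show "adj v' u'" using assms(7) adj_sym by blast
  have "card (set xs) \<ge> 3" using assms(1) distinct_card unfolding cyc_def by metis
  then show "card (set xs \<union> set ys) \<ge> 3" by (meson List.finite_set card_mono finite_UnI le_trans Un_upper1)
qed

lemma cons_ex:
  assumes "cyc R xs" "u \<in> set xs"
  shows "\<exists>v w. v \<noteq> w \<and> cons xs u v \<and> cons xs u w \<and> v \<noteq> u \<and> w \<noteq> u"
proof -
  have l: "length xs \<ge> 3" "distinct xs" using assms unfolding cyc_def by auto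
  obtain i where i: "i < length xs" "u = xs ! i" using assms by (metis in_set_conv_nth)
  define j where "j = (if i = 0 then length xs - 1 else i - 1)"
  have j: "j < length xs" "Suc j mod length xs = i" "j \<noteq> i" using i l unfolding j_def by auto
  have k: "Suc i mod length xs < length xs" "Suc i mod length xs \<noteq> i" "Suc i mod length xs \<noteq> j"
    using i l unfolding j_def by (auto simp: mod_Suc split: if_splits)
  show ?thesis
    by (rule exI[of _ "xs ! j"], rule exI[of _ "xs ! (Suc i mod length xs)"])
      (use i j k l nth_eq_iff_index_eq cons_def in auto)
qed

lemma cons_unique:
  assumes "cyc R xs" "cons xs u v" "cons xs u w" "v \<noteq> w" "cons xs u x"
  shows "x = v \<or> x = w"
proof -
  have l: "length xs \<ge> 3" "distinct xs" using assms unfolding cyc_def by auto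
  have ii: "a = b" if "xs ! a = xs ! b" "a < length xs" "b < length xs" for a b
    using nth_eq_iff_index_eq that l by blast
  obtain i where i: "i < length xs" "u = xs ! i" using cons_mem[OF assms(2)] by (metis in_set_conv_nth)
  have "x = xs ! (Suc i mod length xs) \<or> x = xs ! (if i = 0 then length xs - 1 else i - 1)" if x: "cons xs u x" for x
  proof -
    obtain j where j: "j < length xs" "u = xs ! j \<and> x = xs ! (Suc j mod length xs) \<or> x = xs ! j \<and> u = xs ! (Suc j mod length xs)"
      using x unfolding cons_def by blast
    show ?thesis using j(2)
    proof
      assume "u = xs ! j \<and> x = xs ! (Suc j mod length xs)"
      then show ?thesis using ii[of i j] i j by auto
    next
      assume a: "x = xs ! j \<and> u = xs ! (Suc j mod length xs)"
      have "Suc j mod length xs < length xs" using i by (intro mod_less_divisor) auto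
      then have "i = Suc j mod length xs" using ii[of i "Suc j mod length xs"] i a by metis
      then have "j = (if i = 0 then length xs - 1 else i - 1)" using j(1) l by (auto simp: mod_Suc split: if_splits)
      then show ?thesis using a by blast
    qed
  qed
  then show ?thesis using assms by metis
qed

lemma cyc_mono: "cyc bnd xs \<Longrightarrow> cyc adj xs"
  unfolding cyc_def using bnd_adj by blast

lemma bcyc_cons_iff:
  assumes "cyc bnd xs" "u \<in> set xs"
  shows "bnd u v \<longleftrightarrow> cons xs u v"
proof
  assume "cons xs u v" then show "bnd u v" using cyc_cons assms symp_bnd by blast
next
  assume b: "bnd u v"
  obtain v1 w1 where vw: "v1 \<noteq> w1" "cons xs u v1" "cons xs u w1" using cons_ex[OF assms] by blast
  then have "bnd u v1" "bnd u w1" using cyc_cons assms symp_bnd by blast+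
  moreover have "u \<in> V" using b bnd_adj adj_V by blast
  ultimately have "v = v1 \<or> v = w1" using bnd_ex2[of u] b vw(1) by (metis insert_iff mem_Collect_eq singletonD)
  then show "cons xs u v" using vw by blast
qed

text \<open>Within \<open>V\<close> these sets are the unions of boundary cycles. Sections and
  frontiers are taken of such sets, since then the ends of the link of an outside vertex are outside
  as well.\<close>

definition bclosed :: "'a set \<Rightarrow> bool" where
  "bclosed X \<longleftrightarrow> (\<forall>u v. u \<in> X \<longrightarrow> bnd u v \<longrightarrow> v \<in> X)"

lemma bcyc_bclosed: "cyc bnd xs \<Longrightarrow> bclosed (set xs)"
  unfolding bclosed_def using bcyc_cons_iff cons_mem by blast

lemma bclosed_Un: "bclosed X \<Longrightarrow> bclosed Y \<Longrightarrow> bclosed (X \<union> Y)"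
  unfolding bclosed_def by blast

lemma bclosed_Diff: "bclosed X \<Longrightarrow> bclosed Y \<Longrightarrow> bclosed (X - Y)"
  unfolding bclosed_def using bnd_sym by blast

lemma bclosed_V: "bclosed V"
  unfolding bclosed_def using bnd_adj adj_V2 by blast

lemma bclosed_outside: "bclosed X \<Longrightarrow> u \<notin> X \<Longrightarrow> bnd u w \<Longrightarrow> w \<notin> X"
  unfolding bclosed_def using bnd_sym by blast

text \<open>Take a longest path along boundary edges. Both boundary neighbours of its last vertex
  lie on it, and the one that is not the predecessor closes a cycle; it stands at least two places
  before the end, so the cycle has length at least 3.\<close>

lemma bcyc_in_bclosed:
  assumes "bclosed W" "W \<subseteq> V" "W \<noteq> {}"
  shows "\<exists>xs. cyc bnd xs \<and> set xs \<subseteq> W"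
proof -
  let ?Q = "\<lambda>p. p \<noteq> [] \<and> distinct p \<and> set p \<subseteq> W \<and> successively bnd p"
  obtain w where w: "w \<in> W" using assms by blast
  have fW: "finite W" using assms finite_V finite_subset by blast
  have "length p \<le> card W" if "?Q p" for p
    using that fW by (metis card_mono distinct_card)
  then have "\<forall>y. ?Q y \<longrightarrow> length y < Suc (card W)" using le_imp_less_Suc by blast
  moreover have "?Q [w]" using w by simp
  ultimately have "\<exists>p. ?Q p \<and> (\<forall>q. ?Q q \<longrightarrow> length q \<le> length p)"
    using ex_has_greatest_nat[of ?Q "[w]" length "Suc (card W)"] by blast
  then obtain p where p: "?Q p" and mx: "\<And>q. ?Q q \<Longrightarrow> length q \<le> length p" by blast
  let ?k = "length p"
  have lW: "last p \<in> W" using p by auto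
  have inp: "v \<in> set p" if "bnd (last p) v" for v
  proof (rule ccontr)
    assume "v \<notin> set p"
    moreover have "v \<in> W" using assms(1) lW that unfolding bclosed_def by blast
    ultimately have "?Q (p @ [v])" using p that by (auto simp: successively_append_iff)
    then have "length (p @ [v]) \<le> length p" by (rule mx)
    then show False by simp
  qed
  obtain a b where ab: "a \<noteq> b" "bnd (last p) a" "bnd (last p) b" using bnd_ex2[of "last p"] lW assms(2) by blast
  have lastn: "last p = p ! (?k - 1)" using p last_conv_nth by blast
  have step: "bnd (p ! i) (p ! (Suc i))" if "Suc i < ?k" for i
    using p that unfolding successively_conv_nth by auto
  have "\<exists>j. Suc (Suc j) < ?k \<and> bnd (last p) (p ! j)"
  proof -
    obtain i where i: "i < ?k" "a = p ! i" using inp ab by (metis in_set_conv_nth)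
    obtain j where j: "j < ?k" "b = p ! j" using inp ab by (metis in_set_conv_nth)
    have "i \<noteq> ?k - 1" "j \<noteq> ?k - 1" using ab i j lastn bnd_adj adj_irrefl by metis+
    moreover have "i \<noteq> j" using ab i j by blast
    ultimately have "Suc (Suc i) < ?k \<or> Suc (Suc j) < ?k" using i j by linarith
    then show ?thesis using i j ab by blast
  qed
  then obtain j where j: "Suc (Suc j) < ?k" "bnd (last p) (p ! j)" by blast
  let ?c = "drop j p"
  have lc: "length ?c = ?k - j" by simp
  have "bnd (?c ! i) (?c ! (Suc i mod length ?c))" if i: "i < length ?c" for i
  proof (cases "Suc i = length ?c")
    case True
    then have e: "j + i = ?k - 1" using lc j by linarith
    have "?c ! i = p ! (j + i)" using i nth_drop j by auto
    then have "?c ! i = last p" using e lastn by simp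
    moreover have "?c ! (Suc i mod length ?c) = p ! j" using True j by simp
    ultimately show ?thesis using j by simp
  next
    case False
    then have "Suc i mod length ?c = Suc i" "Suc (j + i) < ?k" using i by auto
    then show ?thesis using step[of "j + i"] by simp
  qed
  then have "cyc bnd ?c" unfolding cyc_def using p j by auto
  then show ?thesis using p set_drop_subset[of j p] by blast
qed

lemma bcyc_decomposition:
  assumes "bclosed W" "W \<subseteq> V"
  shows "\<exists>cs. (\<forall>xs\<in>set cs. cyc bnd xs) \<and> distinct (concat cs) \<and> set (concat cs) = W"
  using assms
proof (induction "card W" arbitrary: W rule: less_induct)
  case less
  show ?case
  proof (cases "W = {}")
    case True then show ?thesis by (intro exI[of _ "[]"]) simp
  next
    case False
    then obtain xs where xs: "cyc bnd xs" "set xs \<subseteq> W" using bcyc_in_bclosed less by blast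
    have fW: "finite W" using less finite_V finite_subset by blast
    have "xs \<noteq> []" using xs unfolding cyc_def by auto
    then have "card (W - set xs) < card W" using xs fW
      by (metis Diff_disjoint Diff_subset inf.absorb_iff2 inf_commute psubset_card_mono psubset_eq set_empty)
    moreover have "bclosed (W - set xs)" using bclosed_Diff less xs bcyc_bclosed by blast
    ultimately obtain cs where cs: "\<forall>ys\<in>set cs. cyc bnd ys" "distinct (concat cs)" "set (concat cs) = W - set xs"
      using less.hyps[of "W - set xs"] less.prems by blast
    have "distinct xs" using xs unfolding cyc_def by blast
    then show ?thesis using cs xs by (intro exI[of _ "xs # cs"]) auto
  qed
qed

text \<open>In a boundary triangle the two ends of each link are adjacent, so each link has only two
  vertices and the triangle is the whole graph.\<close>

lemma bcyc_length:
  assumes "cyc bnd xs" "set xs \<noteq> V"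
  shows "length xs \<ge> 4"
proof (rule ccontr)
  assume "\<not> ?thesis"
  then have l: "length xs = 3" using assms unfolding cyc_def by linarith
  then obtain a b c where xs: "xs = [a, b, c]" by (metis length_0_conv length_Suc_conv numeral_3_eq_3)
  have R: "\<And>i. i < 3 \<Longrightarrow> bnd (xs ! i) (xs ! (Suc i mod 3))" and dis: "distinct xs" using assms l unfolding cyc_def by auto
  have abc: "bnd a b" "bnd b c" "bnd c a" using R[of 0] R[of 1] R[of 2] xs by (auto simp: numeral_2_eq_2)
  have two: "nb x \<subseteq> {y, z}" if "bnd x y" "bnd x z" "adj y z" "y \<noteq> z" for x y z
  proof
    fix w assume "w \<in> nb x"
    then have w: "adj x w" by simp
    have yz: "adj x y" "adj x z" using that bnd_adj by blast+
    have e: "pos x y = 0 \<or> Suc (pos x y) = deg x" "pos x z = 0 \<or> Suc (pos x z) = deg x" using that bnd_iff by blast+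
    have ne: "pos x y \<noteq> pos x z" using pos_inj yz that by blast
    have ad: "pos x y = Suc (pos x z) \<or> pos x z = Suc (pos x y)" using adj_pos yz that by blast
    have "pos x w = pos x y \<or> pos x w = pos x z" using e ne ad pos_less[OF w] by linarith
    then show "w \<in> {y, z}" using pos_inj w yz by blast
  qed
  have ad: "adj a b" "adj b c" "adj c a" using abc bnd_adj by blast+
  have d: "a \<noteq> b" "b \<noteq> c" "a \<noteq> c" using dis xs by auto
  have "{a, b, c} = V"
  proof (rule closed_set_eq_V)
    show "{a, b, c} \<subseteq> V" using ad adj_V by blast
    fix u v assume "u \<in> {a, b, c}" "adj u v"
    then show "v \<in> {a, b, c}"
      using two[OF abc(1) bnd_sym[OF abc(3)] ad(2) d(2)] two[OF abc(2) bnd_sym[OF abc(1)] ad(3)[THEN adj_sym, THEN adj_sym]]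
        two[OF abc(3) bnd_sym[OF abc(2)] ad(1) d(1)] d by auto
  qed simp
  then show False using assms(2) xs by simp
qed

subsection \<open>Frontiers\<close>

text \<open>\<open>S\<close> is a frontier of \<open>X\<close>: walking along the edges that bound the sections of \<open>X\<close> never leaves \<open>S\<close>.\<close>

definition fl :: "'a set \<Rightarrow> 'a set \<Rightarrow> bool" where
  "fl X S \<longleftrightarrow> bclosed X \<and> S \<inter> X = {} \<and> (\<forall>u\<in>S. \<exists>x\<in>X. adj u x) \<and>
     (\<forall>u\<in>S. \<forall>p x. x \<in> X \<longrightarrow> adj u x \<longrightarrow> adj u p \<longrightarrow> adj p x \<longrightarrow> p \<notin> X \<longrightarrow> p \<in> S)"

lemma sec_ne:
  assumes "sec X u p q"
  shows "q \<noteq> u" "p \<noteq> u" "q \<noteq> p" "adj p v \<Longrightarrow> q \<noteq> v" "adj v p \<Longrightarrow> q \<noteq> v" "\<not> adj u v \<Longrightarrow> q \<noteq> v" "\<not> adj u v \<Longrightarrow> p \<noteq> v"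
    "adj q v \<Longrightarrow> p \<noteq> v" "adj v q \<Longrightarrow> p \<noteq> v"
  using sec_adj[OF assms] adj_irrefl adj_sym by metis+

lemma fl_mem: assumes "fl X S" "u \<in> S" "sec X u p q" shows "p \<in> S" "q \<in> S"
  using assms sec_mid[OF assms(3)] sec_mid[OF sec_sym[OF assms(3)]] sec_adj[OF assms(3)]
  unfolding fl_def by blast+

lemma fl_bnd: "fl X S \<Longrightarrow> u \<in> S \<Longrightarrow> bnd u w \<Longrightarrow> w \<notin> X"
  unfolding fl_def using bclosed_outside by blast

lemma fl_sec: assumes "fl X S" "u \<in> S" shows "\<exists>p q. sec X u p q"
proof -
  obtain x where "x \<in> X" "adj u x" using assms unfolding fl_def by blast
  then show ?thesis using sec_exists fl_bnd[OF assms] by blast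
qed

lemma fl_step:
  assumes "fl X S" "u \<in> S" "x \<in> X" "adj u x" "adj u p" "adj p x" "p \<notin> X"
  shows "\<exists>q. sec X u p q \<and> (pos u p < pos u q \<longleftrightarrow> pos u p < pos u x)"
  using sec_step[OF assms(5,7,3,4,6)] fl_bnd[OF assms(1,2)] by blast

text \<open>The vertex of the section next to \<open>p\<close> is a common neighbour of
  \<open>u\<close> and \<open>p\<close>, so \<open>u\<close> in turn flanks a section at
  \<open>p\<close>. Iterating this is the walk around \<open>X\<close>.\<close>

lemma fl_cont: assumes "fl X S" "u \<in> S" "sec X u p q" shows "\<exists>r. sec X p u r"
proof -
  obtain x where x: "x \<in> X" "adj u x" "adj p x" using sec_mid[OF assms(3)] by blast
  have "u \<notin> X" using assms unfolding fl_def by blast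
  then show ?thesis using fl_step[OF assms(1) fl_mem(1)[OF assms] x(1,3) adj_sym[OF sec_adj(1)[OF assms(3)]] x(2)] by blast
qed

text \<open>Let \<open>a\<close> and \<open>c\<close> flank a section at \<open>b\<close>, and
  continue from \<open>b\<close> through \<open>c\<close> to \<open>d\<close>. Flanks of one section
  are not adjacent, and \<open>d\<close> is adjacent to \<open>c\<close> while \<open>a\<close> is
  not, which separates \<open>d\<close> from \<open>a\<close>.\<close>

lemma fl_four:
  assumes "fl X S" "S \<noteq> {}"
  shows "\<exists>a b c d. {a, b, c, d} \<subseteq> S \<and> distinct [a, b, c, d] \<and> sec X b a c \<and> sec X c b d"
proof -
  obtain b where b: "b \<in> S" using assms by blast
  then obtain a c where ac: "sec X b a c" using fl_sec[OF assms(1)] by blast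
  then have c: "c \<in> S" "a \<in> S" using fl_mem[OF assms(1) b] by blast+
  obtain d where d: "sec X c b d" using fl_cont[OF assms(1) b sec_sym[OF ac]] by blast
  then have "d \<in> S" using fl_mem[OF assms(1) c(1)] by blast
  moreover have "distinct [a, b, c, d]"
    using sec_adj[OF ac] sec_adj[OF d] adj_irrefl adj_sym by auto
  ultimately show ?thesis using ac d b c by blast
qed

lemma fl_card: assumes "fl X S" "S \<noteq> {}" "finite S" shows "card S \<ge> 4"
proof -
  obtain a b c d where s: "{a, b, c, d} \<subseteq> S" "distinct [a, b, c, d]" using fl_four[OF assms(1,2)] by blast
  have "card {a, b, c, d} = 4" using s(2) by simp
  then show ?thesis using card_mono[OF assms(3) s(1)] by simp
qed

section \<open>Frontiers with four vertices\<close>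

definition c4 :: "'a set \<Rightarrow> 'a \<Rightarrow> 'a \<Rightarrow> 'a \<Rightarrow> 'a \<Rightarrow> bool" where
  "c4 X a b c d \<longleftrightarrow> distinct [a, b, c, d] \<and> sec X a d b \<and> sec X b a c \<and> sec X c b d \<and> sec X d c a"

lemma c4_rot: "c4 X a b c d \<Longrightarrow> c4 X b c d a"
  unfolding c4_def by auto

lemma c4_refl: "c4 X a b c d \<Longrightarrow> c4 X a d c b"
  unfolding c4_def using sec_sym by auto

lemma c4_adj: assumes "c4 X a b c d"
  shows "adj a b" "adj b c" "adj c d" "adj d a" "adj b a" "adj c b" "adj d c" "adj a d" "\<not> adj a c" "\<not> adj b d" "\<not> adj c a" "\<not> adj d b"
  using assms sec_adj adj_sym unfolding c4_def by metis+

lemma c4_at: assumes "c4 X a b c d" "v \<in> {a, b, c, d}"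
  shows "\<exists>b' c' d'. c4 X v b' c' d' \<and> {v, b', c', d'} = {a, b, c, d}"
proof -
  have "c4 X a b c d" "c4 X b c d a" "c4 X c d a b" "c4 X d a b c" using assms(1) c4_rot by blast+
  then have "\<exists>b' c' d'. c4 X v b' c' d' \<and> {v, b', c', d'} = {a, b, c, d}" if "v = a \<or> v = b \<or> v = c \<or> v = d"
    using that by (elim disjE) (simp, blast)+
  then show ?thesis using assms(2) by simp
qed

text \<open>The walk of \<open>fl_four\<close> exhausts \<open>S\<close>. Continuing it at
  \<open>d\<close> and at \<open>a\<close>, all vertices but one are excluded as the next flank, so
  it closes up to an induced 4-cycle.\<close>

lemma fl_c4:
  assumes "fl X S" "card S = 4"
  shows "\<exists>a b c d. S = {a, b, c, d} \<and> c4 X a b c d"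
proof -
  have fin: "finite S" "S \<noteq> {}" using assms(2) card_ge_0_finite by (force, auto)
  obtain a b c d where s: "{a, b, c, d} \<subseteq> S" "distinct [a, b, c, d]" "sec X b a c" "sec X c b d"
    using fl_four[OF assms(1) fin(2)] by blast
  have S: "S = {a, b, c, d}"
    using card_subset_eq[OF fin(1) s(1)] s(2) assms(2) by auto
  have mem: "a \<in> S" "b \<in> S" "c \<in> S" "d \<in> S" using S by auto
  note s3 = sec_adj[OF s(3)] and s4 = sec_adj[OF s(4)]
  obtain r where r: "sec X d c r" using fl_cont[OF assms(1) mem(3) sec_sym[OF s(4)]] by blast
  have rS: "r \<in> {a, b, c, d}" using fl_mem(2)[OF assms(1) mem(4) r] S by simp
  have "r \<noteq> c" "r \<noteq> d" "r \<noteq> b" using sec_ne[OF r] s4(1) by blast+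
  then have 1: "sec X d c a" using r rS by simp
  obtain t where t: "sec X a b t" using fl_cont[OF assms(1) mem(2) s(3)] by blast
  have tS: "t \<in> {a, b, c, d}" using fl_mem(2)[OF assms(1) mem(1) t] S by simp
  have "t \<noteq> a" "t \<noteq> b" "t \<noteq> c" using sec_ne[OF t] s3(2) by blast+
  then have "sec X a b d" using t tS by simp
  then have "sec X a d b" using sec_sym by blast
  then show ?thesis using S s 1 unfolding c4_def by blast
qed

lemma c4_flank: assumes "c4 X a b c d" "p \<in> {a, b, c, d}" "adj a p" shows "p = b \<or> p = d"
proof -
  have "p \<noteq> a" "p \<noteq> c" using assms(3) c4_adj[OF assms(1)] adj_irrefl by metis+
  then show ?thesis using assms(2) by simp
qed

section \<open>Frontiers of two disjoint sets and their small overlaps\<close>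

definition two :: "'a set \<Rightarrow> 'a set \<Rightarrow> 'a set \<Rightarrow> 'a set \<Rightarrow> bool" where
  "two P Q S T \<longleftrightarrow> fl P S \<and> fl Q T \<and> P \<inter> Q = {} \<and> S \<inter> Q = {} \<and> T \<inter> P = {}"

lemma two_sym: "two P Q S T \<Longrightarrow> two Q P T S"
  unfolding two_def by blast

lemma two_fl: assumes "two P Q S T" shows "fl P S" "fl Q T" "P \<inter> Q = {}" "Q \<inter> P = {}"
  using assms unfolding two_def by blast+

lemma two_out: assumes "two P Q S T" "u \<in> S \<or> u \<in> T" shows "u \<notin> P" "u \<notin> Q"
  using assms unfolding two_def fl_def by blast+

text \<open>In an induced 4-cycle the flanks of any section at \<open>a\<close> can only be the two
  neighbours \<open>b\<close> and \<open>d\<close>; the section between them would lie in both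
  \<open>P\<close> and \<open>Q\<close>.\<close>

lemma two_eq4: assumes t: "two P Q S S" and c: "card S = 4" shows False
proof -
  obtain a b c d where S: "S = {a, b, c, d}" "c4 P a b c d" using fl_c4[OF two_fl(1)[OF t] c] by blast
  have aS: "a \<in> S" using S by simp
  obtain p q where pq: "sec Q a p q" using fl_sec[OF two_fl(2)[OF t] aS] by blast
  have "p \<in> {a, b, c, d}" "q \<in> {a, b, c, d}" using fl_mem[OF two_fl(2)[OF t] aS pq] S(1) by simp_all
  then have "p = b \<or> p = d" "q = b \<or> q = d" using c4_flank[OF S(2)] sec_adj[OF pq] by blast+
  then have "sec Q a d b" using pq sec_sym sec_adj(5)[OF pq] by blast
  then show False using sec_disjoint two_fl(3)[OF t] S(2) unfolding c4_def by blast
qed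

text \<open>The \<open>P\<close>-section at a vertex of \<open>S\<close> is flanked by its two cycle
  neighbours, so its \<open>Q\<close>-section is flanked by \<open>e\<close> and by a cycle
  neighbour that is not adjacent to \<open>e\<close>. But then all vertices of \<open>S\<close> are
  adjacent to \<open>e\<close>.\<close>

lemma two_41: assumes t: "two P Q S T" and c: "card S = 4" and T: "T = insert e S" "e \<notin> S" shows False
proof -
  have key: "adj a e \<and> (\<not> adj b e \<or> \<not> adj d e)" if k: "c4 P a b c d" "S = {a, b, c, d}" for a b c d
  proof -
    have aT: "a \<in> T" using k T by simp
    obtain p q where pq: "sec Q a p q" using fl_sec[OF two_fl(2)[OF t] aT] by blast
    have m: "p \<in> {a, b, c, d} \<or> p = e" "q \<in> {a, b, c, d} \<or> q = e" using fl_mem[OF two_fl(2)[OF t] aT pq] T(1) k(2) by auto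
    have "p = b \<or> p = d \<or> p = e" "q = b \<or> q = d \<or> q = e" using m c4_flank[OF k(1)] sec_adj[OF pq] by blast+
    moreover have "\<not> sec Q a d b" "\<not> sec Q a b d" using sec_disjoint two_fl(3)[OF t] k(1) sec_sym unfolding c4_def by blast+
    ultimately show ?thesis using sec_adj[OF pq] pq adj_sym by metis
  qed
  obtain a b c d where S: "S = {a, b, c, d}" "c4 P a b c d" using fl_c4[OF two_fl(1)[OF t] c] by blast
  have 2: "c4 P b c d a" "c4 P d a b c" using S c4_rot by blast+
  have "S = {b, c, d, a}" "S = {d, a, b, c}" using S by auto
  then show False using key[OF S(2,1)] key[OF 2(1)] key[OF 2(2)] by blast
qed

text \<open>A vertex with two non-neighbours in \<open>S\<close> has only two candidates for flanks,
  and its \<open>P\<close>- and \<open>Q\<close>-sections would have the same flanks; so each vertex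
  has at most one non-neighbour in \<open>S\<close>. At \<open>u\<close>, which has the
  non-neighbour \<open>z\<close>, four flanks lie among three vertices. A flank common to both
  sections has both opposite flanks as non-neighbours, so these coincide and again the two pairs are
  equal.\<close>

lemma two_5: assumes t: "two P Q S S" and c: "card S = 5" shows False
proof -
  have fin: "finite S" using c card_ge_0_finite by force
  note f = two_fl[OF t]
  have ne: "{p, q} \<noteq> {r, s}" if "sec P u p q" "sec Q u r s" for u p q r s
    using sec_disjoint[OF that(1) _ f(3)] that sec_sym by (metis doubleton_eq_iff)
  have am: "x = y" if h: "v \<in> S" "x \<in> S" "y \<in> S" "x \<noteq> v" "y \<noteq> v" "\<not> adj v x" "\<not> adj v y" for v x y
  proof (rule ccontr)
    assume xy: "x \<noteq> y"
    obtain p q where pq: "sec P v p q" using fl_sec[OF f(1) h(1)] by blast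
    obtain r s where rs: "sec Q v r s" using fl_sec[OF f(2) h(1)] by blast
    let ?D = "S - {v, x, y}"
    have cd: "card ?D = 2" using c fin h xy by (simp add: card_Diff_subset)
    have "{p, q} \<subseteq> ?D" "{r, s} \<subseteq> ?D"
      using fl_mem[OF f(1) h(1) pq] fl_mem[OF f(2) h(1) rs] sec_adj[OF pq] sec_adj[OF rs] h adj_irrefl by auto
    then have "{p, q} = ?D" "{r, s} = ?D"
      using card_subset_eq[of ?D] cd fin sec_adj(5)[OF pq] sec_adj(5)[OF rs] by (metis card_2_iff finite_Diff)+
    then show False using ne[OF pq rs] by simp
  qed
  obtain u where u: "u \<in> S" using c by fastforce
  obtain p q where pq: "sec P u p q" using fl_sec[OF f(1) u] by blast
  obtain r s where rs: "sec Q u r s" using fl_sec[OF f(2) u] by blast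
  obtain z where z: "sec P p u z" using fl_cont[OF f(1) u pq] by blast
  have pS: "p \<in> S" "q \<in> S" "r \<in> S" "s \<in> S" using fl_mem[OF f(1) u pq] fl_mem[OF f(2) u rs] by auto
  have zS: "z \<in> S" "z \<noteq> u" "\<not> adj u z" using fl_mem[OF f(1) pS(1) z] sec_adj[OF z] by auto
  let ?D = "S - {u, z}"
  have cd: "card ?D = 3" using c fin u zS by (simp add: card_Diff_subset)
  have D: "{p, q, r, s} \<subseteq> ?D" using pS sec_adj[OF pq] sec_adj[OF rs] zS adj_irrefl by auto
  have "card {p, q, r, s} \<le> 3" using card_mono[OF _ D] cd fin by simp
  then have "p = r \<or> p = s \<or> q = r \<or> q = s" using sec_adj(5)[OF pq] sec_adj(5)[OF rs] by (auto simp: card_insert_if split: if_splits)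
  then show False
    using am pS ne[OF pq rs] sec_adj[OF pq] sec_adj[OF rs] adj_sym by (smt (verit) insert_commute)
qed

text \<open>Let \<open>c'\<close> be opposite to the vertex \<open>a\<close> that \<open>T\<close>
  misses. The neighbours \<open>b\<close> and \<open>d\<close> of \<open>c'\<close> on the cycle
  \<open>S\<close> lie in \<open>T\<close>, so they flank its \<open>Q\<close>-section as well as
  its \<open>P\<close>-section.\<close>

lemma two_3a: assumes t: "two P Q S T" and c: "card S = 4" "card T = 4" "card (S \<inter> T) = 3" shows False
proof -
  note f = two_fl[OF t]
  have fin: "finite S" using c card_ge_0_finite by force
  have "S \<inter> T \<noteq> S" using c by auto
  then obtain a where a: "a \<in> S" "a \<notin> T" by blast
  have "S \<inter> T = S - {a}"
    using card_subset_eq[of "S - {a}" "S \<inter> T"] a c fin by (simp add: subset_Diff_insert)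
  then have ST: "\<And>x. x \<in> S \<Longrightarrow> x \<noteq> a \<Longrightarrow> x \<in> T" by blast
  obtain b c' d where S1: "c4 P a b c' d" "{a, b, c', d} = S" using fl_c4[OF f(1) c(1)] c4_at a(1) by metis
  have "distinct [a, b, c', d]" using S1(1) unfolding c4_def by blast
  then have S: "c4 P a b c' d" "{a, b, c', d} = S" "b \<in> T" "c' \<in> T" "d \<in> T" using S1 ST by auto
  obtain y z w where T: "c4 Q c' y z w" "{c', y, z, w} = T" using fl_c4[OF f(2) c(2)] c4_at S(4) by metis
  have "b = y \<or> b = w" using c4_flank[OF T(1), of b] S(3) T(2) c4_adj(6)[OF S(1)] by simp
  moreover have "d = y \<or> d = w" using c4_flank[OF T(1), of d] S(5) T(2) c4_adj(3)[OF S(1)] by simp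
  moreover have "b \<noteq> d" using S(1) unfolding c4_def by auto
  ultimately have "sec Q c' b d" using T(1) sec_sym unfolding c4_def by blast
  then show False using sec_disjoint[OF _ _ f(3)] S(1) unfolding c4_def by blast
qed

text \<open>At the vertex \<open>c'\<close> opposite to the missing vertex the
  \<open>Q\<close>-section cannot be flanked by \<open>b\<close> and \<open>d\<close>, which flank
  its \<open>P\<close>-section, nor by the adjacent vertices \<open>e\<close> and \<open>f\<close>;
  so it has one flank from each pair. In \<open>key\<close> the walk around \<open>Q\<close> is
  followed in both directions from such a section, until a second \<open>Q\<close>-section at that
  vertex and the two known ones contradict \<open>sec_triangle\<close>.\<close>

lemma two_3b:
  assumes t: "two P Q S T" and c: "card S = 4" "card (S \<inter> T) = 3" and T: "T - S = {e, f}" "adj e f"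
  shows False
proof -
  note f = two_fl[OF t]
  have fin: "finite S" using c card_ge_0_finite by force
  have "S \<inter> T \<noteq> S" using c by auto
  then obtain a where a: "a \<in> S" "a \<notin> T" by blast
  have ST: "S \<inter> T = S - {a}"
    using card_subset_eq[of "S - {a}" "S \<inter> T"] a c fin by (simp add: subset_Diff_insert)
  obtain b c' d where S: "c4 P a b c' d" "{a, b, c', d} = S"
    using fl_c4[OF f(1) c(1)] c4_at a(1) by metis
  have d4: "distinct [a, b, c', d]" using S(1) unfolding c4_def by blast
  have TT: "T = {b, c', d, e, f}" using ST S(2) T(1) d4 by auto
  have nS: "e \<notin> S" "f \<notin> S" using T by auto
  have key: False if k: "c4 P a b c d" "T = {b, c, d, e, f}" "adj e f" "sec Q c d e" "distinct [b, c, d, e, f]" for b c d e f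
  proof -
    note ad = c4_adj[OF k(1)]
    have P: "sec P c b d" using k(1) unfolding c4_def by blast
    have mem: "b \<in> T" "c \<in> T" "d \<in> T" "e \<in> T" "f \<in> T" using k(2) by simp_all
    have out: "b \<notin> Q" "d \<notin> Q" "e \<notin> P" using two_out[OF t] mem by blast+
    have eq: "\<not> adj d e" "adj c e" using sec_adj[OF k(4)] by blast+
    obtain z where z: "sec Q d c z" using fl_cont[OF f(2) mem(2) k(4)] by blast
    have zT: "z \<in> {b, c, d, e, f}" using fl_mem(2)[OF f(2) mem(3) z] k(2) by simp
    have "z \<noteq> b" "z \<noteq> c" "z \<noteq> d" "z \<noteq> e" using sec_ne[OF z] ad(12) eq(1) by blast+
    then have "z = f" using zT by simp
    then have cf: "\<not> adj c f" using sec_adj[OF z] by blast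
    obtain p q where pq: "sec Q b p q" using fl_sec[OF f(2) mem(1)] by blast
    have pT: "p \<in> {b, c, d, e, f}" "q \<in> {b, c, d, e, f}" using fl_mem[OF f(2) mem(1) pq] k(2) by simp_all
    have "p \<noteq> b" "p \<noteq> d" "q \<noteq> b" "q \<noteq> d" using sec_ne[OF pq] ad(10) by blast+
    moreover have "\<not> (p \<in> {e, f} \<and> q \<in> {e, f})" using sec_adj[OF pq] k(3) adj_sym by blast
    ultimately have "p = c \<or> q = c" using pT by auto
    then obtain y where y: "sec Q b c y" using pq sec_sym by blast
    obtain w where w: "sec Q c b w" using fl_cont[OF f(2) mem(1) y] by blast
    have wT: "w \<in> {b, c, d, e, f}" using fl_mem(2)[OF f(2) mem(2) w] k(2) by simp
    have "w \<noteq> d" using sec_disjoint[OF P _ f(3)] w by blast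
    moreover have "w \<noteq> b" "w \<noteq> c" "w \<noteq> f" using sec_ne[OF w] cf by blast+
    ultimately have "w = e" using wT by simp
    then have "sec Q c b e" using w by simp
    then show False using sec_triangle[OF k(4) sec_sym P] out by blast
  qed
  have dT: "distinct [b, c', d, e, f]" using d4 nS S(2) T(2) adj_irrefl by auto
  have cT: "c' \<in> T" using TT by simp
  obtain p q where pq: "sec Q c' p q" using fl_sec[OF f(2) cT] by blast
  have pT: "p \<in> {b, c', d, e, f}" "q \<in> {b, c', d, e, f}" using fl_mem[OF f(2) cT pq] TT by simp_all
  have nn: "\<not> sec Q c' b d" "\<not> sec Q c' d b" using sec_disjoint[OF _ _ f(3)] S(1) sec_sym unfolding c4_def by blast+
  have ef: "\<not> (p \<in> {e, f} \<and> q \<in> {e, f})" using sec_adj[OF pq] T(2) adj_sym by blast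
  have bd: "\<not> (p \<in> {b, d} \<and> q \<in> {b, d})" using nn pq sec_adj(5)[OF pq] by blast
  have "p \<noteq> c'" "q \<noteq> c'" using sec_ne[OF pq] by blast+
  then have "p \<in> {b, d} \<and> q \<in> {e, f} \<or> q \<in> {b, d} \<and> p \<in> {e, f}" using pT ef bd by auto
  then obtain v g where vg: "sec Q c' v g" "v = b \<or> v = d" "g = e \<or> g = f" using pq sec_sym by blast
  have r: "c4 P a d c' b" using c4_refl[OF S(1)] .
  have fe: "adj f e" using T(2) adj_sym by blast
  have T1: "T = {b, c', d, f, e}" "T = {d, c', b, e, f}" "T = {d, c', b, f, e}" using TT by auto
  have D1: "distinct [b, c', d, f, e]" "distinct [d, c', b, e, f]" "distinct [d, c', b, f, e]" using dT by auto
  show False using vg(2,3)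
  proof (elim disjE)
    assume "v = b" "g = e" then show False using key[OF r T1(2) T(2) _ D1(2)] vg(1) by blast
  next
    assume "v = b" "g = f" then show False using key[OF r T1(3) fe _ D1(3)] vg(1) by blast
  next
    assume "v = d" "g = e" then show False using key[OF S(1) TT T(2) _ dT] vg(1) by blast
  next
    assume "v = d" "g = f" then show False using key[OF S(1) T1(1) fe _ D1(1)] vg(1) by blast
  qed
qed

text \<open>The overlap that is not impossible by itself: the walk around \<open>Q\<close> follows
  \<open>x a b y\<close> and \<open>x c d y\<close>, using two opposite edges of the 4-cycle around
  \<open>P\<close>. It is excluded only later, by the number of further vertices it needs.\<close>

lemma two_42_structure:
  assumes t: "two P Q S T" and c: "card S = 4" and T: "S \<subseteq> T" "T - S = {e, f}" "adj e f"
  shows "\<exists>a b c d x y. c4 P a b c d \<and> S = {a, b, c, d} \<and> {x, y} = {e, f} \<and> adj x y \<and>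
    sec Q a b x \<and> sec Q b a y \<and> sec Q c d x \<and> sec Q d c y"
proof -
  note f = two_fl[OF t]
  have key: "\<exists>v g. sec Q a v g \<and> (v = b \<or> v = d) \<and> g \<in> {e, f}" if k: "c4 P a b c d" "S = {a, b, c, d}" for a b c d
  proof -
    have aT: "a \<in> T" using k T by auto
    obtain p q where pq: "sec Q a p q" using fl_sec[OF f(2) aT] by blast
    have m: "p \<in> {a, b, c, d} \<or> p \<in> {e, f}" "q \<in> {a, b, c, d} \<or> q \<in> {e, f}"
      using fl_mem[OF f(2) aT pq] k(2) T(2) by blast+
    have "p = b \<or> p = d \<or> p \<in> {e, f}" "q = b \<or> q = d \<or> q \<in> {e, f}" using m c4_flank[OF k(1)] sec_adj[OF pq] by blast+
    moreover have "\<not> sec Q a d b" "\<not> sec Q a b d" using sec_disjoint[OF _ _ f(3)] k(1) sec_sym unfolding c4_def by blast+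
    moreover have "\<not> (p \<in> {e, f} \<and> q \<in> {e, f})" using sec_adj[OF pq] T(3) adj_sym by blast
    ultimately show ?thesis using pq sec_sym sec_adj(5)[OF pq] by metis
  qed
  obtain a0 b0 c0 d0 where S0: "S = {a0, b0, c0, d0}" "c4 P a0 b0 c0 d0" using fl_c4[OF f(1) c] by blast
  obtain v g where vg: "sec Q a0 v g" "v = b0 \<or> v = d0" "g \<in> {e, f}" using key[OF S0(2,1)] by blast
  have "\<exists>a b c d. c4 P a b c d \<and> S = {a, b, c, d} \<and> sec Q a b g"
  proof (cases "v = b0")
    case True then show ?thesis using S0 vg by blast
  next
    case False
    then have "c4 P a0 d0 c0 b0" "S = {a0, d0, c0, b0}" "sec Q a0 d0 g" using S0 vg c4_refl by auto
    then show ?thesis by blast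
  qed
  then obtain a b c d where k: "c4 P a b c d" "S = {a, b, c, d}" and x: "sec Q a b g" by blast
  obtain y where y: "{g, y} = {e, f}" "adj g y" using vg(3) T(3) adj_sym by blast
  have TT: "T = {a, b, c, d, g, y}" using T k(2) y(1) by blast
  note ad = c4_adj[OF k(1)]
  have mem: "a \<in> T" "b \<in> T" "c \<in> T" "d \<in> T" "g \<in> T" "y \<in> T" using TT by simp_all
  have Psec: "sec P a d b" "sec P b a c" "sec P c b d" "sec P d c a" using k(1) unfolding c4_def by blast+
  have out: "u \<notin> P" "u \<notin> Q" if "u \<in> T" for u using two_out[OF t] that by blast+
  have xa: "adj a g" "\<not> adj b g" using sec_adj[OF x] by blast+
  obtain z where z: "sec Q b a z" using fl_cont[OF f(2) mem(1) x] by blast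
  have zT: "z \<in> {a, b, c, d, g, y}" using fl_mem(2)[OF f(2) mem(2) z] TT by simp
  have "z \<noteq> c" using sec_disjoint[OF Psec(2) _ f(3)] z by blast
  moreover have "z \<noteq> a" "z \<noteq> b" "z \<noteq> d" "z \<noteq> g" using sec_ne[OF z] ad(8) xa(1) by blast+
  ultimately have "z = y" using zT by simp
  then have by_: "sec Q b a y" using z by simp
  have yb: "adj b y" "\<not> adj a y" using sec_adj[OF by_] by blast+
  have noQ: "\<not> sec Q b c z" for z
  proof
    assume z: "sec Q b c z"
    have zT: "z \<in> {a, b, c, d, g, y}" using fl_mem(2)[OF f(2) mem(2) z] TT by simp
    have "z \<noteq> a" using sec_disjoint[OF sec_sym[OF Psec(2)] _ f(3)] z by blast
    moreover have "z \<noteq> b" "z \<noteq> c" "z \<noteq> d" "z \<noteq> g" using sec_ne[OF z] ad(3) xa(2) by blast+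
    ultimately have "z = y" using zT by simp
    then show False using sec_triangle[OF sec_sym[OF by_] Psec(2)] z out mem by blast
  qed
  have k2: "c4 P c d a b" "S = {c, d, a, b}" using k c4_rot by (blast, auto)
  obtain v g' where vg': "sec Q c v g'" "v = d \<or> v = b" "g' \<in> {e, f}" using key[OF k2] by blast
  have "v \<noteq> b"
  proof
    assume "v = b"
    then obtain z where "sec Q b c z" using fl_cont[OF f(2) mem(3) vg'(1)] by blast
    then show False using noQ by blast
  qed
  then have cd: "sec Q c d g'" using vg' by blast
  have g': "g' = g \<or> g' = y" using vg'(3) y(1) by blast
  obtain z where z: "sec Q d c z" using fl_cont[OF f(2) mem(3) cd] by blast
  have zT: "z \<in> {a, b, c, d, g, y}" using fl_mem(2)[OF f(2) mem(4) z] TT by simp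
  have "z \<noteq> a" using sec_disjoint[OF Psec(4) _ f(3)] z by blast
  moreover have "z \<noteq> b" "z \<noteq> c" "z \<noteq> d" "z \<noteq> g'" using sec_ne[OF z] ad(12) sec_adj(2)[OF cd] by blast+
  ultimately have zz: "z = g \<or> z = y" "z \<noteq> g'" using zT by simp_all
  \<comment> \<open>Otherwise the \<open>Q\<close>-sections at \<open>g\<close> that start at the
    adjacent vertices \<open>a\<close> and \<open>d\<close> both end at \<open>y\<close>. Then
    \<open>d\<close> lies beyond \<open>a\<close> as seen from \<open>y\<close>, and
    \<open>a\<close> lies beyond \<open>d\<close>.\<close>
  have "g' \<noteq> y"
  proof
    assume g'y: "g' = y"
    then have zg: "z = g" using zz by blast
    have dg: "adj d g" "\<not> adj c g" using sec_adj[OF z] zg by blast+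
    have gn: "\<not> adj g b" "\<not> adj g c" using xa dg adj_sym by blast+
    obtain r where r: "sec Q g a r" using fl_cont[OF f(2) mem(1) sec_sym[OF x]] by blast
    have rT: "r \<in> {a, b, c, d, g, y}" using fl_mem(2)[OF f(2) mem(5) r] TT by simp
    have "r \<noteq> a" "r \<noteq> b" "r \<noteq> c" "r \<noteq> d" "r \<noteq> g" using sec_ne[OF r] gn ad(8) by blast+
    then have ry: "r = y" using rT by simp
    obtain s where s: "sec Q g d s" using fl_cont[OF f(2) mem(4) sec_sym[OF z]] zg by blast
    have sT: "s \<in> {a, b, c, d, g, y}" using fl_mem(2)[OF f(2) mem(5) s] TT by simp
    have "s \<noteq> a" "s \<noteq> b" "s \<noteq> c" "s \<noteq> d" "s \<noteq> g" using sec_ne[OF s] gn ad(4) by blast+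
    then have sy: "s = y" using sT by simp
    have 1: "sec Q g a y" "sec Q g d y" using r s ry sy by auto
    have q: "a \<notin> Q" "d \<notin> Q" using out mem by blast+
    note n = sec_beside[OF 1(1) adj_sym[OF dg(1)] ad(8) q(2)] sec_beside[OF 1(2) adj_sym[OF xa(1)] ad(4) q(1)]
    have n2: "pos g a \<noteq> pos g y" "pos g d \<noteq> pos g y" using 1 sec_pos_neq by blast+
    have "a \<noteq> d" using ad adj_irrefl by blast
    then have n3: "pos g a \<noteq> pos g d" using pos_inj[OF adj_sym[OF xa(1)] adj_sym[OF dg(1)]] by blast
    have n4: "\<not> (pos g a < pos g d \<and> pos g d < pos g y) \<and> \<not> (pos g y < pos g d \<and> pos g d < pos g a)"
      using sec_not_between[OF 1(1) adj_sym[OF dg(1)] q(2)] by blast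
    have n5: "\<not> (pos g d < pos g a \<and> pos g a < pos g y) \<and> \<not> (pos g y < pos g a \<and> pos g a < pos g d)"
      using sec_not_between[OF 1(2) adj_sym[OF xa(1)] q(1)] by blast
    show False using n n2 n3 n4 n5 by linarith
  qed
  then have "g' = g" "z = y" using g' zz by blast+
  then show ?thesis using k x by_ cd z y by blast
qed

text \<open>Since \<open>p\<close> is not an end of the link of \<open>i\<close>, the link continues
  beyond \<open>p\<close> on the side without other frontier vertices. The next vertex
  \<open>g\<close> there is in neither \<open>P\<close> nor \<open>Q\<close>, because a section
  starting in that direction would have to end at a frontier vertex.\<close>

lemma outer_neighbour:
  assumes fP: "fl P S" and fQ: "fl Q T" and i: "i \<in> S" "i \<in> T" and p: "adj i p" "\<not> bnd i p" "p \<notin> P" "p \<notin> Q"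
    and side: "\<And>v. v \<in> S \<or> v \<in> T \<Longrightarrow> adj i v \<Longrightarrow> v \<noteq> p \<Longrightarrow> pos i p < pos i v \<longleftrightarrow> B"
  shows "\<exists>g. adj i g \<and> adj p g \<and> g \<notin> P \<and> g \<notin> Q \<and> g \<notin> S \<and> g \<notin> T \<and> (pos i p < pos i g \<longleftrightarrow> \<not> B)"
proof -
  have iV: "i \<in> V" using p adj_V by blast
  have e: "pos i p \<noteq> 0" "Suc (pos i p) \<noteq> deg i" "pos i p < deg i" using p(1,2) bnd_iff[of i p] pos_less[OF p(1)] by simp_all
  define k where "k = (if B then pos i p - 1 else Suc (pos i p))"
  have k: "k < deg i" "k = Suc (pos i p) \<or> pos i p = Suc k" "pos i p < k \<longleftrightarrow> \<not> B"
    using e unfolding k_def by auto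
  obtain g where g: "adj i g" "pos i g = k" using pos_surj[OF iV k(1)] by blast
  have pg: "adj p g" using adj_pos[OF p(1) g(1)] g(2) k(2) by metis
  have sd: "pos i p < pos i g \<longleftrightarrow> \<not> B" using g(2) k(3) by simp
  have gp: "g \<noteq> p" using pg adj_irrefl by blast
  have nST: "g \<notin> S" "g \<notin> T" using side[of g] g(1) gp sd by blast+
  have nP: "g \<notin> P"
  proof
    assume gP: "g \<in> P"
    obtain z where z: "sec P i p z" "pos i p < pos i z \<longleftrightarrow> pos i p < pos i g" using fl_step[OF fP i(1) gP g(1) p(1) pg p(3)] by blast
    have "z \<in> S" using fl_mem(2)[OF fP i(1) z(1)] .
    then show False using side[of z] sec_adj[OF z(1)] z(2) sd by blast
  qed
  have nQ: "g \<notin> Q"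
  proof
    assume gP: "g \<in> Q"
    obtain z where z: "sec Q i p z" "pos i p < pos i z \<longleftrightarrow> pos i p < pos i g" using fl_step[OF fQ i(2) gP g(1) p(1) pg p(4)] by blast
    have "z \<in> T" using fl_mem(2)[OF fQ i(2) z(1)] .
    then show False using side[of z] sec_adj[OF z(1)] z(2) sd by blast
  qed
  show ?thesis using g(1) pg nP nQ nST sd by blast
qed

lemma sec_order:
  assumes "sec P i p q" "sec Q i q r" "p \<notin> Q" "r \<notin> P" "P \<inter> Q = {}"
  shows "pos i p < pos i q \<and> pos i q < pos i r \<or> pos i r < pos i q \<and> pos i q < pos i p"
proof -
  have pr: "p \<noteq> r" using sec_disjoint[OF assms(1) _ assms(5)] assms(2) sec_sym by blast
  have ad: "adj i p" "adj i r" using sec_adj[OF assms(1)] sec_adj[OF assms(2)] by blast+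
  have "pos i p \<noteq> pos i r" using pos_inj ad pr by blast
  then show ?thesis
    using sec_pos_neq[OF assms(1)] sec_pos_neq[OF assms(2)] sec_not_between[OF assms(1) ad(2) assms(4)] sec_not_between[OF assms(2) ad(1) assms(3)]
    by linarith
qed

text \<open>The link of \<open>i\<close> contains \<open>p\<close>, a section of \<open>P\<close>,
  \<open>q\<close>, a section of \<open>Q\<close> and \<open>r\<close> in this order, and
  \<open>outer_neighbour\<close> applies at both \<open>p\<close> and \<open>r\<close>.\<close>

lemma outer_pair:
  assumes t: "two P Q S T" and i: "i \<in> S" "i \<in> T" and s: "sec P i p q" "sec Q i q r"
    and lab: "\<And>v. v \<in> S \<or> v \<in> T \<Longrightarrow> adj i v \<Longrightarrow> v = p \<or> v = q \<or> v = r" and nb: "\<not> bnd i p" "\<not> bnd i r"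
  shows "\<exists>g h. adj i g \<and> adj p g \<and> adj i h \<and> adj r h \<and> g \<notin> P \<and> g \<notin> Q \<and> h \<notin> P \<and> h \<notin> Q \<and> g \<notin> T \<and> h \<notin> T \<and> g \<noteq> h"
proof -
  note f = two_fl[OF t]
  have m: "p \<in> S" "q \<in> S" "r \<in> T" using fl_mem[OF f(1) i(1) s(1)] fl_mem[OF f(2) i(2) s(2)] by auto
  have o: "p \<notin> P" "p \<notin> Q" "r \<notin> P" "r \<notin> Q" using two_out[OF t] m by blast+
  have ad: "adj i p" "adj i q" "adj i r" using sec_adj[OF s(1)] sec_adj[OF s(2)] by blast+
  note ord = sec_order[OF s o(2,3) f(3)]
  have 1: "\<exists>g. adj i g \<and> adj p g \<and> g \<notin> P \<and> g \<notin> Q \<and> g \<notin> S \<and> g \<notin> T \<and> (pos i p < pos i g \<longleftrightarrow> \<not> (pos i p < pos i q))"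
  proof (rule outer_neighbour[OF f(1,2) i ad(1) nb(1) o(1,2)])
    fix v assume "v \<in> S \<or> v \<in> T" "adj i v" "v \<noteq> p"
    then have "v = q \<or> v = r" using lab by blast
    then show "pos i p < pos i v \<longleftrightarrow> pos i p < pos i q" using ord by auto
  qed
  have 2: "\<exists>g. adj i g \<and> adj r g \<and> g \<notin> P \<and> g \<notin> Q \<and> g \<notin> S \<and> g \<notin> T \<and> (pos i r < pos i g \<longleftrightarrow> \<not> (pos i r < pos i q))"
  proof (rule outer_neighbour[OF f(1,2) i ad(3) nb(2) o(3,4)])
    fix v assume "v \<in> S \<or> v \<in> T" "adj i v" "v \<noteq> r"
    then have "v = q \<or> v = p" using lab by blast
    then show "pos i r < pos i v \<longleftrightarrow> pos i r < pos i q" using ord by auto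
  qed
  obtain g where g: "adj i g" "adj p g" "g \<notin> P" "g \<notin> Q" "g \<notin> T" "pos i p < pos i g \<longleftrightarrow> \<not> (pos i p < pos i q)" using 1 by blast
  obtain h where h: "adj i h" "adj r h" "h \<notin> P" "h \<notin> Q" "h \<notin> T" "pos i r < pos i h \<longleftrightarrow> \<not> (pos i r < pos i q)" using 2 by blast
  have "g \<noteq> p" "h \<noteq> r" using g h adj_irrefl by blast+
  then have "pos i g \<noteq> pos i p" "pos i h \<noteq> pos i r" using pos_inj g h ad by blast+
  then have "pos i g \<noteq> pos i h" using g(6) h(6) ord by linarith
  then have "g \<noteq> h" by blast
  then show ?thesis using g h by blast
qed

text \<open>In the link of \<open>x\<close> the vertex \<open>g\<close> stands between
  \<open>a\<close> and \<open>c\<close>, so the \<open>Q\<close>-sections starting at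
  \<open>a\<close> and at \<open>c\<close> run in opposite directions away from \<open>g\<close>.
  Only \<open>y\<close> could end them, and it cannot be on both sides.\<close>

lemma two_42_special:
  assumes fQ: "fl Q T" and m: "x \<in> T" "a \<in> T" "c \<in> T" and s: "sec Q a b x" "sec Q c d x" and ac: "\<not> adj a c" "a \<noteq> c"
    and lab: "\<And>v. v \<in> T \<Longrightarrow> adj x v \<Longrightarrow> v = a \<or> v = c \<or> v = y"
    and g: "g \<notin> Q" "adj x g" "adj a g" "adj c g"
  shows False
proof -
  obtain z where z: "sec Q x a z" using fl_cont[OF fQ m(2) sec_sym[OF s(1)]] by blast
  obtain w where w: "sec Q x c w" using fl_cont[OF fQ m(3) sec_sym[OF s(2)]] by blast
  have zT: "z \<in> T" "w \<in> T" using fl_mem[OF fQ m(1) z] fl_mem[OF fQ m(1) w] by auto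
  have zz: "z = c \<or> z = y" "w = a \<or> w = y" using lab[OF zT(1)] lab[OF zT(2)] sec_adj[OF z] sec_adj[OF w] by blast+
  have ad: "adj x a" "adj x c" using sec_adj[OF z] sec_adj[OF w] by blast+
  note n = sec_beside[OF z g(2,3,1)] sec_beside[OF w g(2,4,1)]
  have p: "pos x a = Suc (pos x g) \<or> pos x g = Suc (pos x a)" "pos x c = Suc (pos x g) \<or> pos x g = Suc (pos x c)"
    using adj_pos[OF ad(1) g(2)] adj_pos[OF ad(2) g(2)] g by blast+
  have "pos x a \<noteq> pos x c" using pos_inj ad ac by blast
  moreover have "pos x z = pos x c \<or> pos x z = pos x y" "pos x w = pos x a \<or> pos x w = pos x y" using zz by auto
  moreover have "pos x z \<noteq> pos x a" "pos x w \<noteq> pos x c" using sec_pos_neq[OF z] sec_pos_neq[OF w] by auto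
  ultimately show False using n p by linarith
qed

text \<open>\<open>outer_pair\<close> at the four vertices of \<open>S\<close> gives eight outer
  neighbours. Those over the edge \<open>ad\<close> coincide, and so do those over
  \<open>bc\<close>, because the second triangle on each edge has its apex in \<open>P\<close>. The
  other six are distinct: \<open>ab\<close> and \<open>cd\<close> already have one triangle towards
  \<open>P\<close> and one towards \<open>Q\<close>, and the remaining coincidences give a 4-cycle
  in a link or contradict \<open>two_42_special\<close>.\<close>

lemma two_42_count:
  assumes t: "two P Q S T" and c: "card S = 4" and T: "S \<subseteq> T" "T - S = {e, f}" "adj e f"
    and nbE: "\<And>u. u \<in> S \<Longrightarrow> nb u \<subseteq> E \<union> P \<union> Q" and NB: "\<And>u v. u \<in> S \<Longrightarrow> v \<in> T \<Longrightarrow> \<not> bnd u v" and fin: "finite E"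
  shows "card (E - T) \<ge> 6"
proof -
  note fl = two_fl[OF t]
  obtain a b c d x y where k: "c4 P a b c d" "S = {a, b, c, d}" "{x, y} = {e, f}" "adj x y"
    "sec Q a b x" "sec Q b a y" "sec Q c d x" "sec Q d c y" using two_42_structure[OF t c T] by metis
  note ad = c4_adj[OF k(1)]
  have TT: "T = {a, b, c, d, x, y}" using T k(2,3) by blast
  have mS: "a \<in> S" "b \<in> S" "c \<in> S" "d \<in> S" using k(2) by simp_all
  have mT: "a \<in> T" "b \<in> T" "c \<in> T" "d \<in> T" "x \<in> T" "y \<in> T" using TT by simp_all
  have out: "u \<notin> P" "u \<notin> Q" if "u \<in> T" for u using two_out[OF t] that by blast+
  have ps: "sec P a d b" "sec P b c a" "sec P c b d" "sec P d a c" using k(1) sec_sym unfolding c4_def by blast+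
  have xn: "adj a x" "\<not> adj b x" "adj b y" "\<not> adj a y" "adj c x" "\<not> adj d x" "adj d y" "\<not> adj c y"
    using sec_adj[OF k(5)] sec_adj[OF k(6)] sec_adj[OF k(7)] sec_adj[OF k(8)] by blast+
  have ac: "a \<noteq> c" "b \<noteq> d" using k(1) unfolding c4_def by auto
  have la: "v = d \<or> v = b \<or> v = x" if "v \<in> S \<or> v \<in> T" "adj a v" for v
  proof -
    have "v \<in> {a, b, c, d, x, y}" "v \<noteq> c" "v \<noteq> y" "v \<noteq> a" using that T(1) TT ad(9) xn(4) adj_irrefl by (blast, metis+)
    then show ?thesis by blast
  qed
  have lb: "v = c \<or> v = a \<or> v = y" if "v \<in> S \<or> v \<in> T" "adj b v" for v
  proof -
    have "v \<in> {a, b, c, d, x, y}" "v \<noteq> d" "v \<noteq> x" "v \<noteq> b" using that T(1) TT ad(10) xn(2) adj_irrefl by (blast, metis+)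
    then show ?thesis by blast
  qed
  have lc: "v = b \<or> v = d \<or> v = x" if "v \<in> S \<or> v \<in> T" "adj c v" for v
  proof -
    have "v \<in> {a, b, c, d, x, y}" "v \<noteq> a" "v \<noteq> y" "v \<noteq> c" using that T(1) TT ad(11) xn(8) adj_irrefl by (blast, metis+)
    then show ?thesis by blast
  qed
  have ld: "v = a \<or> v = c \<or> v = y" if "v \<in> S \<or> v \<in> T" "adj d v" for v
  proof -
    have "v \<in> {a, b, c, d, x, y}" "v \<noteq> b" "v \<noteq> x" "v \<noteq> d" using that T(1) TT ad(12) xn(6) adj_irrefl by (blast, metis+)
    then show ?thesis by blast
  qed
  obtain gad gax where A: "adj a gad" "adj d gad" "adj a gax" "adj x gax" "gad \<notin> P" "gad \<notin> Q" "gax \<notin> P" "gax \<notin> Q" "gad \<notin> T" "gax \<notin> T" "gad \<noteq> gax"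
    using outer_pair[OF t mS(1) mT(1) ps(1) k(5) la] NB mS mT by metis
  obtain gbc gby where B: "adj b gbc" "adj c gbc" "adj b gby" "adj y gby" "gbc \<notin> P" "gbc \<notin> Q" "gby \<notin> P" "gby \<notin> Q" "gbc \<notin> T" "gby \<notin> T" "gbc \<noteq> gby"
    using outer_pair[OF t mS(2) mT(2) ps(2) k(6) lb] NB mS mT by metis
  obtain gcb gcx where C: "adj c gcb" "adj b gcb" "adj c gcx" "adj x gcx" "gcb \<notin> P" "gcb \<notin> Q" "gcx \<notin> P" "gcx \<notin> Q" "gcb \<notin> T" "gcx \<notin> T" "gcb \<noteq> gcx"
    using outer_pair[OF t mS(3) mT(3) ps(3) k(7) lc] NB mS mT by metis
  obtain gda gdy where D: "adj d gda" "adj a gda" "adj d gdy" "adj y gdy" "gda \<notin> P" "gda \<notin> Q" "gdy \<notin> P" "gdy \<notin> Q" "gda \<notin> T" "gdy \<notin> T" "gda \<noteq> gdy"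
    using outer_pair[OF t mS(4) mT(4) ps(4) k(8) ld] NB mS mT by metis
  have uniq: "g = h" if h: "sec P u v w" "adj u g" "adj v g" "adj u h" "adj v h" "g \<notin> P" "h \<notin> P" for u v w g h
  proof (rule ccontr)
    assume "g \<noteq> h"
    obtain z where "z \<in> P" "adj u z" "adj v z" using sec_mid[OF h(1)] by blast
    then show False using common_at_most_two[OF sec_adj(1)[OF h(1)] h(2,3,4,5), of z] h \<open>g \<noteq> h\<close> by blast
  qed
  have e1: "gad = gda" using uniq[OF ps(1)] A D by blast
  have e2: "gbc = gcb" using uniq[OF ps(2)] B C by blast
  have full: "False" if h: "sec P u v w" "sec Q u v w'" "adj u g" "adj v g" "g \<notin> P" "g \<notin> Q" for u v w w' g
  proof -
    obtain z where z: "z \<in> P" "adj u z" "adj v z" using sec_mid[OF h(1)] by blast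
    obtain z' where z': "z' \<in> Q" "adj u z'" "adj v z'" using sec_mid[OF h(2)] by blast
    show False using common_at_most_two[OF sec_adj(1)[OF h(1)] h(3,4) z(2,3) z'(2,3)] h z z' fl(3) by blast
  qed
  have nab: "\<not> (adj a g \<and> adj b g)" if "g \<notin> P" "g \<notin> Q" for g using full[OF sec_sym[OF ps(1)] k(5)] that by blast
  have ncd: "\<not> (adj c g \<and> adj d g)" if "g \<notin> P" "g \<notin> Q" for g using full[OF sec_sym[OF ps(3)] k(7)] that by blast
  have n1: "gad \<noteq> gbc" using nab[OF A(5,6)] A B by blast
  have n2: "gad \<noteq> gcx" using ncd[OF A(5,6)] A C by blast
  have n3: "gad \<noteq> gby" using nab[OF A(5,6)] A B by blast
  have n4: "gad \<noteq> gdy" using e1 D by blast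
  have n5: "gbc \<noteq> gax" using nab[OF B(5,6)] A B by blast
  have n6: "gbc \<noteq> gcx" using e2 C by blast
  have n7: "gbc \<noteq> gdy" using ncd[OF B(5,6)] B D by blast
  have n8: "gax \<noteq> gby" using nab[OF A(7,8)] A B by blast
  have n9: "gcx \<noteq> gdy" using ncd[OF C(7,8)] C D by blast
  have "x \<notin> S" "y \<notin> S" using k(3) T(2) by blast+
  then have dd: "a \<noteq> y" "x \<noteq> d" "c \<noteq> y" "x \<noteq> b" using mS by auto
  have n10: "gax \<noteq> gdy"
  proof
    assume "gax = gdy"
    then have "adj gax a" "adj gax x" "adj gax y" "adj gax d" using A D adj_sym by auto
    then show False using link_no_four_cycle[of gax a x y d] xn(1) k(4) adj_sym[OF xn(7)] ad(4) dd by blast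
  qed
  have n11: "gcx \<noteq> gby"
  proof
    assume "gcx = gby"
    then have "adj gcx c" "adj gcx x" "adj gcx y" "adj gcx b" using B C adj_sym by auto
    then show False using link_no_four_cycle[of gcx c x y b] xn(5) k(4) adj_sym[OF xn(3)] ad(2) dd by blast
  qed
  have lx: "v = a \<or> v = c \<or> v = y" if "v \<in> T" "adj x v" for v
  proof -
    have "v \<in> {a, b, c, d, x, y}" "v \<noteq> b" "v \<noteq> d" "v \<noteq> x" using that TT xn(2,6) adj_irrefl adj_sym by (simp, metis+)
    then show ?thesis by blast
  qed
  have ly: "v = b \<or> v = d \<or> v = x" if "v \<in> T" "adj y v" for v
  proof -
    have "v \<in> {a, b, c, d, x, y}" "v \<noteq> a" "v \<noteq> c" "v \<noteq> y" using that TT xn(4,8) adj_irrefl adj_sym by (simp, metis+)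
    then show ?thesis by blast
  qed
  have n12: "gax \<noteq> gcx" using two_42_special[OF fl(2) mT(5,1,3) k(5,7) ad(9) ac(1) lx A(8) A(4) A(3)] C by blast
  have n13: "gby \<noteq> gdy" using two_42_special[OF fl(2) mT(6,2,4) k(6,8) ad(10) ac(2) ly B(8) B(4) B(3)] D by blast
  have inE: "g \<in> E - T" if "u \<in> S" "adj u g" "g \<notin> P" "g \<notin> Q" "g \<notin> T" for u g
    using nbE[OF that(1)] that by auto
  have "{gad, gbc, gax, gcx, gby, gdy} \<subseteq> E - T"
    using inE[OF mS(1)] inE[OF mS(2)] inE[OF mS(3)] inE[OF mS(4)] A B C D by blast
  moreover have "card {gad, gbc, gax, gcx, gby, gdy} = 6"
    using n1 n2 n3 n4 n5 n6 n7 n8 n9 n10 n11 n12 n13 A(11) B(11) by auto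
  ultimately show ?thesis using card_mono[of "E - T"] fin by (metis finite_Diff)
qed

text \<open>The map \<open>s\<close> is the successor along the separating cycle, or along two
  cycles whose union separates, hence only a permutation. A vertex of \<open>S \<inter> T\<close>,
  and a vertex of just one frontier whose successor leaves that frontier, is mapped outside
  \<open>S \<union> T\<close>. With \<open>i\<close>, \<open>a\<close>, \<open>b\<close> the sizes
  of \<open>S \<inter> T\<close>, \<open>S - T\<close>, \<open>T - S\<close> and \<open>ra\<close>,
  \<open>rb\<close> the numbers of leaving vertices, \<open>card E\<close> is at least
  \<open>2 * i + (a + ra) + (b + rb)\<close>. The few triples for which this is too small are the
  overlaps excluded above.\<close>

lemma separated_frontiers:
  assumes t: "two P Q S T" and E: "finite E" "S \<subseteq> E" "T \<subseteq> E" "S \<noteq> {}" "T \<noteq> {}"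
    and s: "bij_betw s E E" "\<And>u. u \<in> E \<Longrightarrow> adj u (s u)"
    and nc: "\<And>u. u \<in> S \<Longrightarrow> s u \<notin> T" "\<And>u. u \<in> T \<Longrightarrow> s u \<notin> S"
    and ex: "S - T \<noteq> {} \<Longrightarrow> \<exists>u\<in>S - T. s u \<notin> S" "T - S \<noteq> {} \<Longrightarrow> \<exists>u\<in>T - S. s u \<notin> T"
  defines "kS \<equiv> card S = 4 \<longrightarrow> (\<forall>u\<in>S. s u \<notin> S)" and "kT \<equiv> card T = 4 \<longrightarrow> (\<forall>u\<in>T. s u \<notin> T)"
  shows "card E \<ge> 10" "kS \<Longrightarrow> card E \<ge> 11" "kT \<Longrightarrow> card E \<ge> 11"
    "\<lbrakk>kS; kT; \<And>u. u \<in> S \<union> T \<Longrightarrow> nb u \<subseteq> E \<union> P \<union> Q;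
      \<And>u v e f. u \<in> S \<inter> T \<Longrightarrow> v \<in> S \<union> T \<Longrightarrow> card (S \<inter> T) = 4 \<Longrightarrow> S \<subseteq> T \<and> T - S = {e, f} \<or> T \<subseteq> S \<and> S - T = {e, f} \<Longrightarrow> adj e f \<Longrightarrow> \<not> bnd u v\<rbrakk> \<Longrightarrow> card E \<ge> 12"
proof -
  note fl = two_fl[OF t]
  have fin: "finite S" "finite T" using E finite_subset by blast+
  define U where "U = E - (S \<union> T)"
  define i a b where "i = card (S \<inter> T)" and "a = card (S - T)" and "b = card (T - S)"
  define RS RT where "RS = {u \<in> S - T. s u \<notin> S}" and "RT = {u \<in> T - S. s u \<notin> T}"
  define ra rb where "ra = card RS" and "rb = card RT"
  have cS: "card S = i + a" and cT: "card T = i + b"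
    unfolding i_def a_def b_def using fin card_Int_Diff by (metis, metis Int_commute)
  have cST: "card (S \<union> T) = i + a + b"
  proof -
    have "S \<union> T = S \<union> (T - S)" by blast
    then have "card (S \<union> T) = card S + card (T - S)" using card_Un_disjoint[of S "T - S"] fin by auto
    then show ?thesis using cS b_def by simp
  qed
  have cE: "card E = i + a + b + card U"
  proof -
    have "E = (S \<union> T) \<union> U" "(S \<union> T) \<inter> U = {}" unfolding U_def using E by blast+
    then show ?thesis using card_Un_disjoint[of "S \<union> T" U] fin E(1) cST unfolding U_def by auto
  qed
  have cU: "card U \<ge> i + ra + rb"
  proof -
    let ?R = "S \<inter> T \<union> RS \<union> RT"
    have dis: "S \<inter> T \<inter> RS = {}" "(S \<inter> T \<union> RS) \<inter> RT = {}" unfolding RS_def RT_def by blast+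
    have finR: "finite RS" "finite RT" unfolding RS_def RT_def using fin by auto
    have "card ?R = i + ra + rb"
      using card_Un_disjoint[OF _ _ dis(2)] card_Un_disjoint[OF _ _ dis(1)] fin finR unfolding i_def ra_def rb_def by auto
    moreover have "s ` ?R \<subseteq> U"
    proof
      fix v assume "v \<in> s ` ?R"
      then obtain u where u: "v = s u" "u \<in> ?R" by blast
      have uE: "u \<in> E" using u(2) E unfolding RS_def RT_def by blast
      have "s u \<in> E" using s(1) uE bij_betwE by blast
      moreover have "s u \<notin> S" "s u \<notin> T" using u(2) nc unfolding RS_def RT_def by blast+
      ultimately show "v \<in> U" unfolding U_def using u by blast
    qed
    moreover have "inj_on s ?R"
      using s(1) E unfolding bij_betw_def RS_def RT_def by (auto intro: inj_on_subset)
    ultimately show ?thesis using card_inj_on_le[of s ?R U] E(1) unfolding U_def by auto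
  qed
  have le: "i + a \<ge> 4" "i + b \<ge> 4" using fl_card[OF fl(1) E(4) fin(1)] fl_card[OF fl(2) E(5) fin(2)] cS cT by auto
  have ra1: "a \<ge> 1 \<Longrightarrow> ra \<ge> 1"
  proof -
    assume "a \<ge> 1"
    then have "S - T \<noteq> {}" unfolding a_def by (metis card.empty not_one_le_zero)
    then have "RS \<noteq> {}" using ex(1) unfolding RS_def by blast
    then show ?thesis unfolding ra_def RS_def using fin by (simp add: Suc_leI card_gt_0_iff)
  qed
  have rb1: "b \<ge> 1 \<Longrightarrow> rb \<ge> 1"
  proof -
    assume "b \<ge> 1"
    then have "T - S \<noteq> {}" unfolding b_def by (metis card.empty not_one_le_zero)
    then have "RT \<noteq> {}" using ex(2) unfolding RT_def by blast
    then show ?thesis unfolding rb_def RT_def using fin by (simp add: Suc_leI card_gt_0_iff)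
  qed
  have kSr: "kS \<Longrightarrow> i + a = 4 \<Longrightarrow> ra = a"
  proof -
    assume "kS" "i + a = 4"
    then have "RS = S - T" unfolding kS_def RS_def using cS by auto
    then show ?thesis unfolding ra_def a_def by simp
  qed
  have kTr: "kT \<Longrightarrow> i + b = 4 \<Longrightarrow> rb = b"
  proof -
    assume "kT" "i + b = 4"
    then have "RT = T - S" unfolding kT_def RT_def using cT by auto
    then show ?thesis unfolding rb_def b_def by simp
  qed
  \<comment> \<open>If one of the two vertices does not leave \<open>X\<close>, its successor must
    be the other one, so the two are adjacent. This supplies the edge \<open>ef\<close> for
    \<open>two_3b\<close> and \<open>two_42_count\<close>.\<close>
  have pair: "\<exists>e f. X - Y = {e, f} \<and> adj e f"
    if "card (X - Y) = 2" "card {u \<in> X - Y. s u \<notin> X} \<noteq> 2" "finite X" "X \<subseteq> E" "\<And>u. u \<in> X \<Longrightarrow> s u \<notin> Y" for X Y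
  proof -
    have "{u \<in> X - Y. s u \<notin> X} \<noteq> X - Y" using that by auto
    then obtain u where u: "u \<in> X - Y" "s u \<in> X" by blast
    then have v: "s u \<in> X - Y" "adj u (s u)" using that(4,5) s(2) by blast+
    then have "u \<noteq> s u" using adj_irrefl by metis
    then have "card {u, s u} = 2" by simp
    then have "{u, s u} = X - Y" using card_subset_eq[of "X - Y" "{u, s u}"] that(1,3) u v by auto
    then show ?thesis using v by metis
  qed
  have pT: "\<exists>e f. T - S = {e, f} \<and> adj e f" if "b = 2" "rb \<noteq> 2"
    using pair[of T S] that E fin nc unfolding b_def rb_def RT_def by blast
  have pS: "\<exists>e f. S - T = {e, f} \<and> adj e f" if "a = 2" "ra \<noteq> 2"
    using pair[of S T] that E fin nc unfolding a_def ra_def RS_def by blast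
  have sub: "S \<subseteq> T" if "a = 0" using that fin unfolding a_def by auto
  have subT: "T \<subseteq> S" if "b = 0" using that fin unfolding b_def by auto
  have F1: "\<not> (i = 4 \<and> a = 0 \<and> b = 0)"
  proof
    assume h: "i = 4 \<and> a = 0 \<and> b = 0"
    then have "S = T" using sub subT by blast
    then show False using two_eq4[of P Q S] t h cS by auto
  qed
  have F2: "\<not> (i = 4 \<and> a = 0 \<and> b = 1)"
  proof
    assume h: "i = 4 \<and> a = 0 \<and> b = 1"
    then obtain e where "T - S = {e}" unfolding b_def by (meson card_1_singletonE)
    then have "T = insert e S" "e \<notin> S" using sub h by blast+
    then show False using two_41[OF t] h cS by auto
  qed
  have F2': "\<not> (i = 4 \<and> a = 1 \<and> b = 0)"
  proof
    assume h: "i = 4 \<and> a = 1 \<and> b = 0"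
    then obtain e where "S - T = {e}" unfolding a_def by (meson card_1_singletonE)
    then have "S = insert e T" "e \<notin> T" using subT h by blast+
    then show False using two_41[OF two_sym[OF t]] h cT by auto
  qed
  have F3: "\<not> (i = 5 \<and> a = 0 \<and> b = 0)"
  proof
    assume h: "i = 5 \<and> a = 0 \<and> b = 0"
    then have "S = T" using sub subT by blast
    then show False using two_5[of P Q S] t h cS by auto
  qed
  have F4: "\<not> (i = 3 \<and> a = 1 \<and> b = 1)" using two_3a[OF t] cS cT i_def by auto
  have F5: "i = 3 \<Longrightarrow> a = 1 \<Longrightarrow> b = 2 \<Longrightarrow> rb = 2"
  proof (rule ccontr)
    assume h: "i = 3" "a = 1" "b = 2" "rb \<noteq> 2"
    then obtain e f where ef: "T - S = {e, f}" "adj e f" using pT by blast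
    have "card S = 4" "card (S \<inter> T) = 3" using h cS i_def by auto
    then show False using two_3b[OF t] ef by blast
  qed
  have F5': "i = 3 \<Longrightarrow> a = 2 \<Longrightarrow> b = 1 \<Longrightarrow> ra = 2"
  proof (rule ccontr)
    assume h: "i = 3" "a = 2" "b = 1" "ra \<noteq> 2"
    then obtain e f where ef: "S - T = {e, f}" "adj e f" using pS by blast
    have "card T = 4" "card (T \<inter> S) = 3" using h cT i_def by (auto simp: Int_commute)
    then show False using two_3b[OF two_sym[OF t]] ef by blast
  qed
  have i6: "i \<ge> 6 \<or> i = 5 \<or> i = 4 \<or> i = 3 \<or> i = 2 \<or> i = 1 \<or> i = 0" by linarith
  have le2: "ra \<le> a" "rb \<le> b"
    unfolding ra_def a_def RS_def rb_def b_def RT_def using fin by (auto intro: card_mono)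
  define K where "K = ra + a"
  define M where "M = rb + b"
  have KM: "card E \<ge> 2 * i + K + M" using cE cU K_def M_def by linarith
  have K1: "a \<ge> 1 \<Longrightarrow> K \<ge> a + 1" and M1: "b \<ge> 1 \<Longrightarrow> M \<ge> b + 1" using ra1 rb1 K_def M_def by auto
  have K2: "kS \<Longrightarrow> i \<le> 2 \<Longrightarrow> K \<ge> 6 - i" using kSr K1 le(1) K_def by (cases "i + a = 4") auto
  have M2: "kT \<Longrightarrow> i \<le> 2 \<Longrightarrow> M \<ge> 6 - i" using kTr M1 le(2) M_def by (cases "i + b = 4") auto
  have K0: "i \<le> 3 \<Longrightarrow> K \<ge> 5 - i" and M0: "i \<le> 3 \<Longrightarrow> M \<ge> 5 - i" using K1 M1 le by auto
  have c5: "card E \<ge> 12" if "i = 5"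
  proof -
    have "a \<ge> 1 \<or> b \<ge> 1" using F3 that by auto
    then show ?thesis using K1 M1 KM that by auto
  qed
  have c6: "card E \<ge> 12" if "i \<ge> 6" using KM that by linarith
  have c4: "card E \<ge> 11" if hi: "i = 4"
  proof -
    consider "a \<ge> 1" "b \<ge> 1" | "a = 0" "b \<ge> 2" | "b = 0" "a \<ge> 2"
      using F1 F2 F2' hi by (cases "a = 0"; cases "b = 0"; cases "a = 1"; cases "b = 1") auto
    then show ?thesis using K1 M1 KM hi by cases auto
  qed
  have c3: "card E \<ge> 11" if "i = 3"
  proof -
    have "a \<ge> 1" "b \<ge> 1" "a \<ge> 2 \<or> b \<ge> 2" using le F4 that by auto
    then show ?thesis using K1 M1 KM that by auto
  qed
  have cases_i: "i \<ge> 6 \<or> i = 5 \<or> i = 4 \<or> i = 3 \<or> i \<le> 2" by linarith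
  show "card E \<ge> 10"
  proof (cases "i \<le> 2")
    case True then show ?thesis using K0 M0 KM by auto
  next
    case False then show ?thesis using cases_i c3 c4 c5 c6 by auto
  qed
  show "card E \<ge> 11" if "kS"
  proof (cases "i \<le> 2")
    case True then show ?thesis using K2[OF that] M0 KM by auto
  next
    case False then show ?thesis using cases_i c3 c4 c5 c6 by auto
  qed
  show "card E \<ge> 11" if "kT"
  proof (cases "i \<le> 2")
    case True then show ?thesis using M2[OF that] K0 KM by auto
  next
    case False then show ?thesis using cases_i c3 c4 c5 c6 by auto
  qed
  show "card E \<ge> 12" if k: "kS" "kT" and nbE: "\<And>u. u \<in> S \<union> T \<Longrightarrow> nb u \<subseteq> E \<union> P \<union> Q"
    and NB: "\<And>u v e f. u \<in> S \<inter> T \<Longrightarrow> v \<in> S \<union> T \<Longrightarrow> card (S \<inter> T) = 4 \<Longrightarrow> S \<subseteq> T \<and> T - S = {e, f} \<or> T \<subseteq> S \<and> S - T = {e, f} \<Longrightarrow> adj e f \<Longrightarrow> \<not> bnd u v"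
  proof -
    \<comment> \<open>Here the inequality \<open>KM\<close> yields only 11; the missing vertex comes
      from the six vertices of \<open>two_42_count\<close>.\<close>
    have F6: "card U \<ge> 6" if h: "i = 4" "a = 0" "b = 2" "rb \<noteq> 2"
    proof -
      obtain e f where ef: "T - S = {e, f}" "adj e f" using pT h by blast
      have st: "S \<subseteq> T" using sub h by blast
      then have e: "S \<inter> T = S" "S \<union> T = T" by auto
      have i4: "card (S \<inter> T) = 4" using h i_def by auto
      have nb: "\<not> bnd u v" if "u \<in> S" "v \<in> T" for u v using NB[of u v e f] that e i4 st ef by blast
      have nE: "nb u \<subseteq> E \<union> P \<union> Q" if "u \<in> S" for u using nbE that by blast
      have "card (E - T) \<ge> 6"
        using two_42_count[OF t _ st ef nE nb E(1)] i4 e by simp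
      then show ?thesis unfolding U_def using e by simp
    qed
    have F6': "card U \<ge> 6" if h: "i = 4" "a = 2" "b = 0" "ra \<noteq> 2"
    proof -
      obtain e f where ef: "S - T = {e, f}" "adj e f" using pS h by blast
      have st: "T \<subseteq> S" using subT h by blast
      then have e: "S \<inter> T = T" "S \<union> T = S" by auto
      have i4: "card (S \<inter> T) = 4" using h i_def by auto
      have nb: "\<not> bnd u v" if "u \<in> T" "v \<in> S" for u v using NB[of u v e f] that e i4 st ef by blast
      have nE: "nb u \<subseteq> E \<union> Q \<union> P" if "u \<in> T" for u using nbE that by blast
      have "card (E - S) \<ge> 6"
        using two_42_count[OF two_sym[OF t] _ st ef nE nb E(1)] i4 e by simp
      then show ?thesis unfolding U_def using e by simp
    qed
    have i4: "card E \<ge> 12" if hi: "i = 4"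
    proof -
      consider "a \<ge> 1" "b \<ge> 1" | "a = 0" "b \<ge> 3" | "b = 0" "a \<ge> 3" | "a = 0" "b = 2" "rb = 2" | "a = 2" "b = 0" "ra = 2"
        | "a = 0" "b = 2" "rb \<noteq> 2" | "a = 2" "b = 0" "ra \<noteq> 2"
        using F1 F2 F2' hi by (cases "a = 0"; cases "b = 0"; cases "a = 1"; cases "b = 1"; cases "a = 2"; cases "b = 2") auto
      then show ?thesis
      proof cases
        case 6 then show ?thesis using F6 hi cE by auto
      next
        case 7 then show ?thesis using F6' hi cE by auto
      qed (use K1 M1 KM hi K_def M_def in auto)
    qed
    have i3: "card E \<ge> 12" if hi: "i = 3"
    proof -
      consider "a \<ge> 2" "b \<ge> 2" | "a = 1" "b \<ge> 3" | "a = 1" "b = 2" "rb = 2" | "b = 1" "a \<ge> 3" | "b = 1" "a = 2" "ra = 2"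
        using F4 hi le F5 F5' by (cases "a = 1"; cases "b = 1"; cases "a = 2"; cases "b = 2") auto
      then show ?thesis
        by cases (use K1 M1 KM hi K_def M_def in auto)
    qed
    show "card E \<ge> 12"
    proof (cases "i \<le> 2")
      case True then show ?thesis using K2[OF k(1)] M2[OF k(2)] KM by auto
    next
      case False then show ?thesis using cases_i i3 i4 c5 c6 by auto
    qed
  qed
qed

section \<open>Labels of a vertex: the sets that it touches\<close>

definition tch :: "'a \<Rightarrow> 'a set \<Rightarrow> bool" where "tch u X \<longleftrightarrow> (\<exists>x\<in>X. adj u x)"
definition ajs :: "'a set \<Rightarrow> 'a set \<Rightarrow> bool" where "ajs X Y \<longleftrightarrow> (\<exists>x\<in>X. \<exists>y\<in>Y. adj x y)"
definition L :: "'a set \<Rightarrow> 'a set \<Rightarrow> 'a set" where "L X Y = {u \<in> X. tch u Y}"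

lemma ajs_sym: "ajs X Y \<Longrightarrow> ajs Y X"
  unfolding ajs_def using adj_sym by blast

lemma ajs_L: "ajs X Y \<longleftrightarrow> L X Y \<noteq> {}"
  unfolding ajs_def L_def tch_def by blast

text \<open>The frontier stays inside \<open>X\<close> if no flank outside \<open>X\<close> and
  \<open>Y\<close> can see \<open>Y\<close>; only the flanks of vertices of \<open>X\<close> matter,
  which makes the condition easy to check.\<close>

lemma fl_L:
  assumes "bclosed Y" "X \<inter> Y = {}"
    "\<And>u p. u \<in> X \<Longrightarrow> tch u Y \<Longrightarrow> adj u p \<Longrightarrow> p \<notin> X \<Longrightarrow> p \<notin> Y \<Longrightarrow> \<not> tch p Y"
  shows "fl Y (L X Y)"
  unfolding fl_def
proof (intro conjI ballI allI impI)
  show "L X Y \<inter> Y = {}" using assms(2) unfolding L_def by blast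
  show "\<exists>x\<in>Y. adj u x" if "u \<in> L X Y" for u using that unfolding L_def tch_def by blast
  fix u p x assume h: "u \<in> L X Y" "x \<in> Y" "adj u x" "adj u p" "adj p x" "p \<notin> Y"
  have "tch p Y" using h unfolding tch_def by blast
  then show "p \<in> L X Y" using assms(3)[of u p] h unfolding L_def by blast
qed (fact assms(1))

lemma two_L:
  assumes "bclosed P" "bclosed Q" "E \<inter> P = {}" "E \<inter> Q = {}" "P \<inter> Q = {}" "\<not> ajs P Q"
    "\<And>u. u \<in> E \<Longrightarrow> nb u \<subseteq> E \<union> P \<union> Q"
  shows "two P Q (L E P) (L E Q)"
proof -
  have "fl P (L E P)"
  proof (rule fl_L[OF assms(1,3)])
    fix u p assume "u \<in> E" "adj u p" "p \<notin> E" "p \<notin> P"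
    then have "p \<in> Q" using assms(7)[of u] by auto
    then show "\<not> tch p P" using assms(6) adj_sym unfolding ajs_def tch_def by blast
  qed
  moreover have "fl Q (L E Q)"
  proof (rule fl_L[OF assms(2,4)])
    fix u p assume "u \<in> E" "adj u p" "p \<notin> E" "p \<notin> Q"
    then have "p \<in> P" using assms(7)[of u] by auto
    then show "\<not> tch p Q" using assms(6) unfolding ajs_def tch_def by blast
  qed
  ultimately show ?thesis using assms(3-5) unfolding two_def L_def by blast
qed

text \<open>Both frontiers have at least four vertices, and the ways in which their union could have
  at most five are exactly the overlaps already excluded.\<close>

lemma two_six:
  assumes t: "two P Q S T" and "S \<noteq> {}" "T \<noteq> {}" "finite S" "finite T"
  shows "card (S \<union> T) \<ge> 6"
proof (rule ccontr)
  note fl = two_fl[OF t]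
  define i a b where "i = card (S \<inter> T)" and "a = card (S - T)" and "b = card (T - S)"
  have cS: "card S = i + a" and cT: "card T = i + b"
    unfolding i_def a_def b_def using assms card_Int_Diff by (metis, metis Int_commute)
  have "S \<union> T = S \<union> (T - S)" by blast
  then have "card (S \<union> T) = card S + card (T - S)" using card_Un_disjoint[of S "T - S"] assms by auto
  then have cST: "card (S \<union> T) = i + a + b" using cS b_def by simp
  have le: "i + a \<ge> 4" "i + b \<ge> 4" using fl_card[OF fl(1)] fl_card[OF fl(2)] assms cS cT by auto
  have sub: "a = 0 \<Longrightarrow> S \<subseteq> T" "b = 0 \<Longrightarrow> T \<subseteq> S" using assms unfolding a_def b_def by auto
  assume "\<not> 6 \<le> card (S \<union> T)"
  then have s5: "i + a + b \<le> 5" using cST by simp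
  have "i = 3 \<or> i = 4 \<or> i = 5" using s5 le by linarith
  then show False
  proof (elim disjE)
    assume i: "i = 3"
    then have "a = 1" "b = 1" using s5 le by linarith+
    then show False using two_3a[OF t] cS cT i_def i by auto
  next
    assume i: "i = 5"
    then have "a = 0" "b = 0" using s5 by linarith+
    then have "S = T" "card S = 5" using sub i cS by auto
    then show False using two_5[of P Q S] t by auto
  next
    assume i: "i = 4"
    then have "a + b \<le> 1" using s5 by linarith
    then have "a = 0 \<and> b = 0 \<or> a = 0 \<and> b = 1 \<or> a = 1 \<and> b = 0" by auto
    then show False
    proof (elim disjE conjE)
      assume "a = 0" "b = 0"
      then have "S = T" "card S = 4" using sub i cS by auto
      then show False using two_eq4[of P Q S] t by auto
    next
      assume h: "a = 0" "b = 1"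
      then obtain e where "T - S = {e}" unfolding b_def by (meson card_1_singletonE)
      then have "T = insert e S" "e \<notin> S" using sub h by blast+
      then show False using two_41[OF t] h i cS by auto
    next
      assume h: "a = 1" "b = 0"
      then obtain e where "S - T = {e}" unfolding a_def by (meson card_1_singletonE)
      then have "S = insert e T" "e \<notin> T" using sub h by blast+
      then show False using two_41[OF two_sym[OF t]] h i cT by auto
    qed
  qed
qed

subsection \<open>Short links\<close>

text \<open>The boundary neighbours \<open>y\<close> and \<open>z\<close> are the ends of the link
  of \<open>x\<close>, so a path inside the link that joins them is the whole link. The three claims
  are for paths with no, one and two inner vertices.\<close>

lemma link_short:
  assumes "bnd x y" "bnd x z" "y \<noteq> z" and w: "adj x w"
  shows "adj y z \<Longrightarrow> w = y \<or> w = z"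
    "adj x a \<Longrightarrow> adj y a \<Longrightarrow> adj z a \<Longrightarrow> w = y \<or> w = z \<or> w = a"
    "adj x a \<Longrightarrow> adj y a \<Longrightarrow> adj x b \<Longrightarrow> adj a b \<Longrightarrow> adj z b \<Longrightarrow> a \<noteq> z \<Longrightarrow> b \<noteq> y \<Longrightarrow> w = y \<or> w = z \<or> w = a \<or> w = b"
proof -
  have yz: "adj x y" "adj x z" using assms bnd_adj by blast+
  have e: "pos x y = 0 \<or> Suc (pos x y) = deg x" "pos x z = 0 \<or> Suc (pos x z) = deg x" using assms bnd_iff by blast+
  have ne: "pos x y \<noteq> pos x z" using pos_inj yz assms by blast
  note wl = pos_less[OF w]
  show "w = y \<or> w = z" if "adj y z"
  proof -
    have ad: "pos x y = Suc (pos x z) \<or> pos x z = Suc (pos x y)" using adj_pos yz that by blast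
    have "pos x w = pos x y \<or> pos x w = pos x z" using e ne ad wl by linarith
    then show ?thesis using pos_inj w yz by blast
  qed
  show "w = y \<or> w = z \<or> w = a" if "adj x a" "adj y a" "adj z a"
  proof -
    have ad: "pos x y = Suc (pos x a) \<or> pos x a = Suc (pos x y)" "pos x z = Suc (pos x a) \<or> pos x a = Suc (pos x z)"
      using adj_pos yz that by blast+
    have "pos x w = pos x y \<or> pos x w = pos x z \<or> pos x w = pos x a" using e ne ad wl by linarith
    then show ?thesis using pos_inj w yz that by blast
  qed
  show "w = y \<or> w = z \<or> w = a \<or> w = b" if "adj x a" "adj y a" "adj x b" "adj a b" "adj z b" "a \<noteq> z" "b \<noteq> y"
  proof -
    have ad: "pos x y = Suc (pos x a) \<or> pos x a = Suc (pos x y)" "pos x z = Suc (pos x b) \<or> pos x b = Suc (pos x z)"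
      "pos x a = Suc (pos x b) \<or> pos x b = Suc (pos x a)" using adj_pos yz that by blast+
    have "pos x a \<noteq> pos x z" "pos x b \<noteq> pos x y" using pos_inj[OF that(1) yz(2)] pos_inj[OF that(3) yz(1)] that(6,7) by blast+
    have ab: "pos x a < deg x" "pos x b < deg x" using pos_less that by blast+
    have "pos x y = 0 \<and> Suc (pos x z) = deg x \<or> pos x z = 0 \<and> Suc (pos x y) = deg x" using e ne by linarith
    then have "pos x w = pos x y \<or> pos x w = pos x z \<or> pos x w = pos x a \<or> pos x w = pos x b"
    proof (elim disjE conjE)
      assume h: "pos x y = 0" "Suc (pos x z) = deg x"
      have "pos x a = 1" using ad(1) h by linarith
      moreover have "pos x z = Suc (pos x b)" using ad(2) h ab by linarith
      ultimately have "pos x b = 2" "pos x z = 3" using ad(3) \<open>pos x b \<noteq> pos x y\<close> h by linarith+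
      then show ?thesis using \<open>pos x a = 1\<close> h wl by linarith
    next
      assume h: "pos x z = 0" "Suc (pos x y) = deg x"
      have "pos x b = 1" using ad(2) h by linarith
      moreover have "pos x y = Suc (pos x a)" using ad(1) h ab by linarith
      ultimately have "pos x a = 2" "pos x y = 3" using ad(3) \<open>pos x a \<noteq> pos x z\<close> h by linarith+
      then show ?thesis using \<open>pos x b = 1\<close> h wl by linarith
    qed
    then show ?thesis using pos_inj w yz that by blast
  qed
qed

lemma list4: "length xs = 4 \<Longrightarrow> \<exists>a b c d. xs = [a, b, c, d]"
  by (cases xs; cases "tl xs"; cases "tl (tl xs)"; cases "tl (tl (tl xs))") auto

lemma cyc4: assumes "cyc R [a, b, c, d]" shows "R a b" "R b c" "R c d" "R d a" "distinct [a, b, c, d]"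
proof -
  have h: "\<And>i. i < 4 \<Longrightarrow> R ([a, b, c, d] ! i) ([a, b, c, d] ! (Suc i mod 4))" "distinct [a, b, c, d]"
    using assms unfolding cyc_def by auto
  show "R a b" using h(1)[of 0] by simp
  show "R b c" using h(1)[of 1] by simp
  show "R c d" using h(1)[of 2] by simp
  show "R d a" using h(1)[of 3] by simp
  show "distinct [a, b, c, d]" by (fact h(2))
qed

lemma cons4: "cons [a, b, c, d] u v \<longleftrightarrow> (u, v) \<in> {(a, b), (b, a), (b, c), (c, b), (c, d), (d, c), (d, a), (a, d)}"
proof
  have l: "length [a, b, c, d] = 4" by simp
  assume "cons [a, b, c, d] u v"
  then obtain i where i: "i < 4" "u = [a, b, c, d] ! i \<and> v = [a, b, c, d] ! (Suc i mod 4) \<or> v = [a, b, c, d] ! i \<and> u = [a, b, c, d] ! (Suc i mod 4)"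
    unfolding cons_def l by blast
  have "i = 0 \<or> i = 1 \<or> i = 2 \<or> i = 3" using i(1) by linarith
  then show "(u, v) \<in> {(a, b), (b, a), (b, c), (c, b), (c, d), (d, c), (d, a), (a, d)}"
    using i(2) by (elim disjE) simp_all
next
  have "cons [a, b, c, d] a b" unfolding cons_def by (rule exI[of _ 0]) simp
  moreover have "cons [a, b, c, d] b c" unfolding cons_def by (rule exI[of _ 1]) simp
  moreover have "cons [a, b, c, d] c d" unfolding cons_def by (rule exI[of _ 2]) simp
  moreover have "cons [a, b, c, d] d a" unfolding cons_def by (rule exI[of _ 3]) simp
  moreover assume "(u, v) \<in> {(a, b), (b, a), (b, c), (c, b), (c, d), (d, c), (d, a), (a, d)}"
  ultimately show "cons [a, b, c, d] u v" using cons_sym by blast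
qed

text \<open>With the chord \<open>ac\<close>, \<open>link_short\<close> determines the links of all
  four vertices, and the set is closed under adjacency.\<close>

lemma chordless4_aux:
  assumes c: "cyc bnd [a, b, c, d]" and "adj a c" shows "set [a, b, c, d] = V"
proof -
  note R = cyc4[OF c]
  note A = R(1-4)[THEN bnd_adj] and S = R(1-4)[THEN bnd_sym]
  have d: "a \<noteq> b" "a \<noteq> c" "a \<noteq> d" "b \<noteq> c" "b \<noteq> d" "c \<noteq> d" using R(5) by auto
  have "{a, b, c, d} = V"
  proof (rule closed_set_eq_V)
    show "{a, b, c, d} \<subseteq> V" using A adj_V by blast
    fix u v assume u: "u \<in> {a, b, c, d}" and v: "adj u v"
    have "v \<in> {a, b, c, d}" if "u = a"
      using link_short(2)[OF R(1) S(4) d(5), of v c] v that assms(2) A adj_sym by blast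
    moreover have "v \<in> {a, b, c, d}" if "u = b"
      using link_short(1)[OF S(1) R(2) d(2), of v] v that assms(2) by blast
    moreover have "v \<in> {a, b, c, d}" if "u = c"
      using link_short(2)[OF R(3) S(2) d(5)[symmetric], of v a] v that assms(2) A adj_sym by blast
    moreover have "v \<in> {a, b, c, d}" if "u = d"
      using link_short(1)[OF S(3) R(4) d(2)[symmetric], of v] v that assms(2) adj_sym by blast
    ultimately show "v \<in> {a, b, c, d}" using u by blast
  qed simp
  then show ?thesis by simp
qed

lemma chordless4:
  assumes "cyc bnd qs" "length qs = 4" "set qs \<noteq> V" "x \<in> set qs" "y \<in> set qs" "adj x y"
  shows "cons qs x y"
proof -
  obtain a b c d where q: "qs = [a, b, c, d]" using list4 assms by blast
  have c: "cyc bnd [a, b, c, d]" using assms(1) q by simp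
  have c2: "cyc bnd [b, c, d, a]" using cyc_rotate(1)[OF c, of 1] by simp
  have "\<not> adj a c" "\<not> adj b d" using chordless4_aux[OF c] chordless4_aux[OF c2] assms(3) q by auto
  then show ?thesis using assms(4-6) adj_irrefl adj_sym unfolding q cons4 by auto
qed

text \<open>Two successive vertices of the section would be consecutive on the chordless cycle
  \<open>qs\<close>, and together with \<open>u\<close> and \<open>v\<close> they would permit the
  exchange that \<open>nm\<close> forbids. So the section is a single vertex.\<close>

lemma sec_single:
  assumes q: "cyc bnd qs" "length qs = 4" "set qs \<noteq> V" and s: "sec (set qs) u v p"
    and nm: "\<And>x y. cons qs x y \<Longrightarrow> \<not> (adj u x \<and> adj v x \<and> adj u y)"
  shows "\<exists>w\<in>set qs. adj u w \<and> adj v w \<and> adj p w"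
proof -
  have p: "adj u v" "adj u p" using sec_adj[OF s] by blast+
  have uV: "u \<in> V" using p adj_V by blast
  have d: "Suc (pos u v) < pos u p \<or> Suc (pos u p) < pos u v" using s unfolding sec_def by blast
  define k where "k = (if pos u v < pos u p then Suc (pos u v) else pos u v - 1)"
  define l where "l = (if pos u v < pos u p then Suc (Suc (pos u v)) else pos u v - 2)"
  have k: "k < deg u" "k = Suc (pos u v) \<or> pos u v = Suc k" "pos u v < k \<and> k < pos u p \<or> pos u p < k \<and> k < pos u v"
    "l < deg u" "l = Suc k \<or> k = Suc l" "l = pos u p \<or> (pos u v < l \<and> l < pos u p \<or> pos u p < l \<and> l < pos u v)"
    using d pos_less[OF p(1)] pos_less[OF p(2)] unfolding k_def l_def by (auto split: if_splits)
  obtain w where w: "adj u w" "pos u w = k" using pos_surj[OF uV k(1)] by blast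
  obtain y where y: "adj u y" "pos u y = l" using pos_surj[OF uV k(4)] by blast
  have wQ: "w \<in> set qs" using s w k(3) unfolding sec_def by blast
  have vw: "adj v w" using adj_pos[OF p(1) w(1)] w(2) k(2) by metis
  have wy: "adj w y" using adj_pos[OF w(1) y(1)] w(2) y(2) k(5) by metis
  have "y = p"
  proof (rule ccontr)
    assume "y \<noteq> p"
    then have "l \<noteq> pos u p" using pos_inj[OF y(1) p(2)] y(2) by simp
    then have "y \<in> set qs" using s y k(6) unfolding sec_def by blast
    then have "cons qs w y" using chordless4[OF q wQ _ wy] by blast
    then show False using nm w vw y by blast
  qed
  then show ?thesis using wQ w vw wy adj_sym by blast
qed

text \<open>By \<open>sec_single\<close> the sections at \<open>u\<close> and \<open>v\<close> are
  single vertices. Both stand next to \<open>v\<close> on the same side in the link of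
  \<open>u\<close>, hence they are one vertex, which is then adjacent to all of the induced 4-cycle
  \<open>T\<close>.\<close>

lemma c4_no_merge:
  assumes q: "cyc bnd qs" "length qs = 4" "set qs \<noteq> V" and f: "fl (set qs) T" "card T = 4" and uv: "u \<in> T" "v \<in> T" "adj u v"
    and nm: "\<And>x y. cons qs x y \<Longrightarrow> \<not> (adj u x \<and> adj v x \<and> adj u y)" "\<And>x y. cons qs x y \<Longrightarrow> \<not> (adj u x \<and> adj v x \<and> adj v y)"
  shows False
proof -
  let ?Q = "set qs"
  obtain b c d where k: "c4 ?Q u b c d" "{u, b, c, d} = T" using fl_c4[OF f] c4_at uv(1) by metis
  have vb: "v = b \<or> v = d" using c4_flank[OF k(1)] uv k(2) by blast
  have "\<exists>c d. c4 ?Q u v c d \<and> {u, v, c, d} = T"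
  proof (cases "v = b")
    case True then show ?thesis using k by blast
  next
    case False
    then have "c4 ?Q u v c b" "{u, v, c, b} = T" using vb k c4_refl by auto
    then show ?thesis by blast
  qed
  then obtain c d where k: "c4 ?Q u v c d" "{u, v, c, d} = T" by blast
  note ad = c4_adj[OF k(1)]
  have su: "sec ?Q u v d" and sv: "sec ?Q v u c" using k(1) sec_sym unfolding c4_def by blast+
  obtain w where w: "w \<in> ?Q" "adj u w" "adj v w" "adj d w" using sec_single[OF q su nm(1)] by blast
  obtain w' where w': "w' \<in> ?Q" "adj v w'" "adj u w'" "adj c w'" using sec_single[OF q sv] nm(2) by blast
  have side: "pos u v < pos u x \<longleftrightarrow> pos u v < pos u d" if x: "x \<in> ?Q" "adj u x" "adj v x" for x
  proof -
    have "v \<notin> ?Q" using sec_adj[OF su] by blast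
    then obtain z where z: "sec ?Q u v z" "pos u v < pos u z \<longleftrightarrow> pos u v < pos u x" using fl_step[OF f(1) uv(1) x(1,2) ad(1) x(3)] by blast
    have "z \<in> {u, v, c, d}" using fl_mem(2)[OF f(1) uv(1) z(1)] k(2) by simp
    moreover have "z \<noteq> u" "z \<noteq> v" "z \<noteq> c" using sec_ne[OF z(1)] ad(9) by blast+
    ultimately show ?thesis using z(2) by simp
  qed
  have "pos u w = Suc (pos u v) \<or> pos u v = Suc (pos u w)" "pos u w' = Suc (pos u v) \<or> pos u v = Suc (pos u w')"
    using adj_pos[OF ad(1)] w w' by blast+
  then have "pos u w = pos u w'" using side[OF w(1-3)] side[OF w'(1,3,2)] by linarith
  then have "w = w'" using pos_inj w w' by blast
  then have "adj w u" "adj w v" "adj w c" "adj w d" using w w' adj_sym by blast+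
  moreover have "u \<noteq> c" "v \<noteq> d" using k(1) unfolding c4_def by auto
  ultimately show False using link_no_four_cycle[of w u v c d] ad by blast
qed

subsection \<open>Small boundary cycles and chains\<close>

text \<open>If no vertex sees both parts, the vertices seeing \<open>P1\<close> and those seeing
  \<open>P2\<close> form disjoint frontiers, together 8 vertices. If \<open>u\<close> sees both and
  the conclusion fails, its two neighbours on the cycle see nothing outside, which leaves at most 3
  vertices for the frontier of the complement, although it has at least 4.\<close>

lemma small_cycle:
  assumes x: "cyc bnd xs" "length xs \<le> 5" and P: "bclosed P1" "bclosed P2" "P1 \<inter> P2 = {}" "P1 \<union> P2 = V - set xs"
    and a: "ajs (set xs) P1" "ajs (set xs) P2"
  shows "\<exists>u v. cons xs u v \<and> tch u P1 \<and> tch v P2"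
proof (rule ccontr)
  assume nc: "\<not> ?thesis"
  let ?X = "set xs"
  have fX: "finite (L ?X Y)" for Y unfolding L_def by auto
  have cX: "card ?X \<le> 5" using x card_length le_trans by blast
  have inV: "?X \<subseteq> V" using x cyc_mono cons_ex[OF x(1)] cyc_cons[OF x(1) symp_bnd] bnd_adj adj_V by blast
  show False
  proof (cases "L ?X P1 \<inter> L ?X P2 = {}")
    case True
    have "fl P1 (L ?X P1)"
    proof (rule fl_L[OF P(1)])
      show "?X \<inter> P1 = {}" using P by blast
      fix u p assume h: "u \<in> ?X" "tch u P1" "adj u p" "p \<notin> ?X" "p \<notin> P1"
      then have "p \<in> P2" using P adj_V2 by blast
      then have "u \<in> L ?X P1 \<inter> L ?X P2" using h unfolding L_def tch_def by blast
      then show "\<not> tch p P1" using True by blast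
    qed
    moreover have "fl P2 (L ?X P2)"
    proof (rule fl_L[OF P(2)])
      show "?X \<inter> P2 = {}" using P by blast
      fix u p assume h: "u \<in> ?X" "tch u P2" "adj u p" "p \<notin> ?X" "p \<notin> P2"
      then have "p \<in> P1" using P adj_V2 by blast
      then have "u \<in> L ?X P1 \<inter> L ?X P2" using h unfolding L_def tch_def by blast
      then show "\<not> tch p P2" using True by blast
    qed
    ultimately have "card (L ?X P1) \<ge> 4" "card (L ?X P2) \<ge> 4" using fl_card fX a ajs_L by blast+
    then have "card (L ?X P1 \<union> L ?X P2) \<ge> 8" using card_Un_disjoint[OF fX fX True] by linarith
    moreover have "card (L ?X P1 \<union> L ?X P2) \<le> card ?X" by (rule card_mono) (auto simp: L_def)
    ultimately show False using cX by linarith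
  next
    case False
    then obtain u where u: "u \<in> ?X" "tch u P1" "tch u P2" unfolding L_def by blast
    obtain v w where vw: "v \<noteq> w" "cons xs u v" "cons xs u w" using cons_ex[OF x(1) u(1)] by blast
    let ?L = "L ?X (V - ?X)"
    have "fl (V - ?X) ?L"
      by (rule fl_L) (use bclosed_Diff[OF bclosed_V bcyc_bclosed[OF x(1)]] adj_V2 in auto)
    moreover have "?L \<noteq> {}" using u P(4) unfolding L_def tch_def by blast
    ultimately have "card ?L \<ge> 4" using fl_card fX by blast
    moreover have "?L \<subseteq> ?X - {v, w}"
    proof
      fix y assume y: "y \<in> ?L"
      then have "tch y P1 \<or> tch y P2" using P(4) unfolding L_def tch_def by blast
      then have "y \<noteq> v" "y \<noteq> w" using nc vw u cons_sym by blast+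
      then show "y \<in> ?X - {v, w}" using y unfolding L_def by blast
    qed
    moreover have "card (?X - {v, w}) \<le> 3"
      using vw cons_mem[OF vw(2)] cons_mem[OF vw(3)] cX by (simp add: card_Diff_subset)
    moreover have "finite (?X - {v, w})" by simp
    ultimately show False using card_mono[of "?X - {v, w}" ?L] by linarith
  qed
qed

lemma hpath_end:
  assumes "cyc adj xs" "x \<in> set xs" shows "\<exists>a. hpath (set xs) a x"
  using cons_ex[OF assms] cyc_hpath[OF assms(1)] cons_sym by blast

lemma hpath_chain:
  assumes "cyc adj ys" "cons ys u v" "hpath X a x" "adj x u" "hpath Z z b" "adj v z" "X \<inter> set ys = {}" "X \<inter> Z = {}" "set ys \<inter> Z = {}"
  shows "hpath (X \<union> set ys \<union> Z) a b"
  using hpath_append[OF hpath_append[OF assms(3) cyc_hpath[OF assms(1,2)] assms(4,7)] assms(5,6)] assms(8,9) by blast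

text \<open>Run through \<open>xs\<close>, cross to \<open>u\<close>, run through \<open>ys\<close>
  from \<open>u\<close> to \<open>v\<close>, and cross to \<open>zs\<close>.\<close>

lemma chain3:
  assumes "cyc adj xs" "cyc adj ys" "cyc adj zs" "cons ys u v" "tch u (set xs)" "tch v (set zs)"
    "set xs \<inter> set ys = {}" "set xs \<inter> set zs = {}" "set ys \<inter> set zs = {}"
  shows "\<exists>a b. hpath (set xs \<union> set ys \<union> set zs) a b"
proof -
  obtain x z where x: "x \<in> set xs" "adj u x" "z \<in> set zs" "adj v z" using assms unfolding tch_def by blast
  obtain a b where "hpath (set xs) a x" "hpath (set zs) b z" using hpath_end assms x by metis
  then show ?thesis using hpath_chain[OF assms(2,4) _ adj_sym[OF x(2)] hpath_sym x(4) assms(7-9)] by blast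
qed

lemma join2:
  assumes "cyc adj xs" "cyc adj ys" "ajs (set xs) (set ys)" "set xs \<inter> set ys = {}"
  shows "\<exists>a b. hpath (set xs \<union> set ys) a b"
proof -
  obtain x y where x: "x \<in> set xs" "y \<in> set ys" "adj x y" using assms unfolding ajs_def by blast
  obtain a b where "hpath (set xs) a x" "hpath (set ys) b y" using hpath_end assms x by metis
  then show ?thesis using hpath_append[OF _ hpath_sym x(3) assms(4)] by blast
qed

text \<open>Unlike the symmetric \<open>cons\<close>, the successor gives a permutation of the
  cycle, which the counting arguments need.\<close>

definition nx :: "'a list \<Rightarrow> 'a \<Rightarrow> 'a" where
  "nx xs u = (THE v. \<exists>i<length xs. u = xs ! i \<and> v = xs ! (Suc i mod length xs))"

lemma nx_nth: assumes "distinct xs" "i < length xs" shows "nx xs (xs ! i) = xs ! (Suc i mod length xs)"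
  unfolding nx_def
proof (rule the_equality)
  show "\<exists>j<length xs. xs ! i = xs ! j \<and> xs ! (Suc i mod length xs) = xs ! (Suc j mod length xs)" using assms(2) by blast
  fix v assume "\<exists>j<length xs. xs ! i = xs ! j \<and> v = xs ! (Suc j mod length xs)"
  then show "v = xs ! (Suc i mod length xs)" using assms nth_eq_iff_index_eq by metis
qed

lemma nx_cons: assumes "distinct xs" "u \<in> set xs" shows "cons xs u (nx xs u)"
proof -
  obtain i where "i < length xs" "u = xs ! i" using assms(2) by (metis in_set_conv_nth)
  then show ?thesis using nx_nth[OF assms(1)] unfolding cons_def by blast
qed

lemma cons_nx: assumes "distinct xs" "cons xs u v" shows "v = nx xs u \<or> u = nx xs v"
  using assms nx_nth unfolding cons_def by metis

lemma nx_bij: assumes "cyc R xs" shows "bij_betw (nx xs) (set xs) (set xs)"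
proof -
  have d: "distinct xs" "length xs \<ge> 3" using assms unfolding cyc_def by auto
  have "nx xs ` set xs \<subseteq> set xs" using nx_cons[OF d(1)] cons_mem by blast
  moreover have "inj_on (nx xs) (set xs)"
  proof (rule inj_onI)
    fix u v assume h: "u \<in> set xs" "v \<in> set xs" "nx xs u = nx xs v"
    obtain i j where ij: "i < length xs" "u = xs ! i" "j < length xs" "v = xs ! j" using h by (metis in_set_conv_nth)
    have "Suc i mod length xs = Suc j mod length xs"
      using h(3) nx_nth[OF d(1)] ij nth_eq_iff_index_eq[OF d(1)] d(2) by (metis length_pos_if_in_set h(1) mod_less_divisor)
    then have "i = j" using ij by (auto simp: mod_Suc split: if_splits)
    then show "u = v" using ij by simp
  qed
  ultimately show ?thesis using endo_inj_surj[of "set xs" "nx xs"] unfolding bij_betw_def by blast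
qed

lemma nx_trans:
  assumes "cyc R xs" "S \<subseteq> set xs" "S \<noteq> {}" "\<And>u. u \<in> S \<Longrightarrow> nx xs u \<in> S"
  shows "S = set xs"
proof -
  have d: "distinct xs" "length xs \<ge> 3" using assms unfolding cyc_def by auto
  obtain u where u: "u \<in> S" using assms by blast
  then obtain i where i: "i < length xs" "u = xs ! i" using assms(2) by (metis in_set_conv_nth subsetD)
  have "xs ! ((i + k) mod length xs) \<in> S" for k
  proof (induction k)
    case 0 then show ?case using u i by simp
  next
    case (Suc k)
    have "(i + k) mod length xs < length xs" using d(2) by (intro mod_less_divisor) linarith
    then have "nx xs (xs ! ((i + k) mod length xs)) = xs ! (Suc ((i + k) mod length xs) mod length xs)" using nx_nth d by blast
    also have "Suc ((i + k) mod length xs) mod length xs = (i + Suc k) mod length xs" by (simp add: mod_simps)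
    finally show ?case using assms(4)[OF Suc] by simp
  qed
  note all = this
  have "xs ! j \<in> S" if j: "j < length xs" for j
  proof -
    have "(i + (length xs - i + j)) mod length xs = j" using i j by simp
    then show ?thesis using all[of "length xs - i + j"] by simp
  qed
  then have "set xs \<subseteq> S" by (metis in_set_conv_nth subsetI)
  then show ?thesis using assms(2) by blast
qed

subsection \<open>A cycle separating two boundary cycles\<close>

text \<open>The triangle on the edge \<open>uv\<close> and the next triangle at \<open>u\<close> lead to an edge \<open>xy\<close> of \<open>qs\<close>, so that a cycle
  through \<open>uv\<close> can be merged with \<open>qs\<close> by exchanging the two edges.\<close>

definition tm :: "'a list \<Rightarrow> 'a \<Rightarrow> 'a \<Rightarrow> bool" where
  "tm qs u v \<longleftrightarrow> (\<exists>x y. cons qs x y \<and> adj u x \<and> adj v x \<and> adj u y)"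

lemma tm_square: assumes "cyc bnd ps" "cyc adj zs" "set ps \<inter> set zs = {}" "cons zs u v" "tm ps u v"
  shows "\<exists>ws. cyc adj ws \<and> set ws = set ps \<union> set zs"
proof -
  obtain x y where xy: "cons ps x y" "adj u x" "adj v x" "adj u y" using assms(5) unfolding tm_def by blast
  show ?thesis using merge_cycles[OF cyc_mono[OF assms(1)] assms(2,3) xy(1) cons_sym[OF assms(4)] adj_sym[OF xy(3)] adj_sym[OF xy(4)]] .
qed

lemma c4_no_tm:
  assumes q: "cyc bnd qs" "length qs = 4" "set qs \<noteq> V" and f: "fl (set qs) T" "card T = 4" and uv: "u \<in> T" "v \<in> T" "adj u v"
    and nm: "\<not> tm qs u v" "\<not> tm qs v u"
  shows False
  by (rule c4_no_merge[OF q f uv]) (use nm in \<open>unfold tm_def, blast\<close>)+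

text \<open>For \<open>v\<close> in \<open>S\<close> this is \<open>c4_no_tm\<close>; otherwise
  \<open>uv\<close> is one of the edges \<open>ax\<close>, \<open>cx\<close>, \<open>by\<close>,
  \<open>dy\<close> of the configuration. In \<open>key\<close> the single-vertex sections at both
  ends of the boundary edge are the same vertex, since a boundary edge has only one common
  neighbour, and the link of that vertex contains a 4-cycle.\<close>

lemma two_42_no_bnd:
  assumes t: "two (set ps) (set qs) S T" and c: "card S = 4" and T: "S \<subseteq> T" "T - S = {e, f}" "adj e f"
    and p: "cyc bnd ps" "length ps = 4" "set ps \<noteq> V" and q: "cyc bnd qs" "length qs = 4" "set qs \<noteq> V"
    and H: "\<And>u v. u \<in> T \<Longrightarrow> v \<in> T \<Longrightarrow> bnd u v \<Longrightarrow> \<not> tm ps u v \<and> \<not> tm qs u v"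
    and uv: "u \<in> S" "v \<in> T" "bnd u v"
  shows False
proof (cases "v \<in> S")
  case True
  then show False using c4_no_tm[OF p two_fl(1)[OF t] c uv(1) _ bnd_adj[OF uv(3)]] H[OF _ _ uv(3)] H[OF _ _ bnd_sym[OF uv(3)]] uv T(1) by blast
next
  case False
  note fl = two_fl[OF t]
  obtain a b c d x y where k: "c4 (set ps) a b c d" "S = {a, b, c, d}" "{x, y} = {e, f}" "adj x y"
    "sec (set qs) a b x" "sec (set qs) b a y" "sec (set qs) c d x" "sec (set qs) d c y" using two_42_structure[OF t c T] by metis
  note ad = c4_adj[OF k(1)]
  have TT: "T = {a, b, c, d, x, y}" using T k(2,3) by blast
  have mT: "a \<in> T" "b \<in> T" "c \<in> T" "d \<in> T" "x \<in> T" "y \<in> T" using TT by simp_all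
  have xn: "adj a x" "\<not> adj b x" "adj b y" "\<not> adj a y" "adj c x" "\<not> adj d x" "adj d y" "\<not> adj c y"
    using sec_adj[OF k(5)] sec_adj[OF k(6)] sec_adj[OF k(7)] sec_adj[OF k(8)] by blast+
  have key: False if h: "sec (set qs) i j g" "i \<in> T" "g \<in> T" "bnd i g" "\<And>z. z \<in> T \<Longrightarrow> adj g z \<Longrightarrow> \<not> adj i z \<Longrightarrow> z \<noteq> i \<Longrightarrow> adj j z" for i j g
  proof -
    obtain z where z: "sec (set qs) g i z" using fl_cont[OF fl(2) h(2) sec_sym[OF h(1)]] by blast
    have zT: "z \<in> T" using fl_mem(2)[OF fl(2) h(3) z] .
    have jz: "adj j z" using h(5)[OF zT] sec_adj[OF z] by blast
    obtain w where w: "w \<in> set qs" "adj i w" "adj g w" "adj j w"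
      using sec_single[OF q sec_sym[OF h(1)]] H[OF h(2,3,4)] unfolding tm_def by blast
    obtain w' where w': "w' \<in> set qs" "adj g w'" "adj i w'" "adj z w'"
      using sec_single[OF q z] H[OF h(3,2) bnd_sym[OF h(4)]] unfolding tm_def by blast
    have "w = w'" using bnd_common_unique[OF h(4)] w w' by blast
    then have l: "adj w j" "adj w i" "adj w g" "adj w z" using w w' adj_sym by blast+
    have "adj j i" "adj i g" "adj g z" "adj z j" using sec_adj[OF h(1)] sec_adj[OF z] jz adj_sym by blast+
    moreover have "j \<noteq> g" "i \<noteq> z" using sec_adj[OF h(1)] sec_adj[OF z] by blast+
    ultimately show False using link_no_four_cycle[OF l] by blast
  qed
  have v: "v = x \<or> v = y" using uv(2) False TT k(2) by blast
  have u: "u = a \<or> u = b \<or> u = c \<or> u = d" using uv(1) k(2) by blast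
  have uvx: "adj u v" using uv(3) bnd_adj by blast
  have xx: "adj x z \<longleftrightarrow> adj z x" "adj y z \<longleftrightarrow> adj z y" for z using adj_commute by blast+
  have "u = a \<and> v = x \<or> u = c \<and> v = x \<or> u = b \<and> v = y \<or> u = d \<and> v = y"
    using u v uvx xn by blast
  then show False
  proof (elim disjE conjE)
    assume h: "u = a" "v = x"
    show False
    proof (rule key[OF k(5) mT(1,5)])
      show "bnd a x" using uv h by simp
      fix z assume "z \<in> T" "adj x z" "\<not> adj a z" "z \<noteq> a"
      then have "z = c \<or> z = y" using TT ad xn xx adj_irrefl by blast
      then show "adj b z" using ad xn by blast
    qed
  next
    assume h: "u = c" "v = x"
    show False
    proof (rule key[OF k(7) mT(3,5)])
      show "bnd c x" using uv h by simp
      fix z assume "z \<in> T" "adj x z" "\<not> adj c z" "z \<noteq> c"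
      then have "z = a \<or> z = y" using TT ad xn xx adj_irrefl by blast
      then show "adj d z" using ad xn by blast
    qed
  next
    assume h: "u = b" "v = y"
    show False
    proof (rule key[OF k(6) mT(2,6)])
      show "bnd b y" using uv h by simp
      fix z assume "z \<in> T" "adj y z" "\<not> adj b z" "z \<noteq> b"
      then have "z = d \<or> z = x" using TT ad xn xx adj_irrefl by blast
      then show "adj a z" using ad xn by blast
    qed
  next
    assume h: "u = d" "v = y"
    show False
    proof (rule key[OF k(8) mT(4,6)])
      show "bnd d y" using uv h by simp
      fix z assume "z \<in> T" "adj y z" "\<not> adj d z" "z \<noteq> d"
      then have "z = b \<or> z = x" using TT ad xn xx adj_irrefl by blast
      then show "adj c z" using ad xn by blast
    qed
  qed
qed

text \<open>The set \<open>E\<close> has at least 12, 11 or 10 vertices if two, one or none of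
  \<open>ps\<close> and \<open>qs\<close> have length 4, so the sum is at least 20 in each case. If
  a cycle has length 4, \<open>c4_no_tm\<close> forbids two successive vertices in its frontier when
  that frontier has four vertices. \<open>H\<close> concerns boundary edges inside \<open>E\<close>
  that need not be steps of \<open>s\<close>.\<close>

lemma separating_cycle:
  assumes c: "cyc bnd ps" "cyc bnd qs" "bij_betw s E E" "\<And>u. u \<in> E \<Longrightarrow> adj u (s u)" "finite E"
    and dis: "E \<inter> set ps = {}" "E \<inter> set qs = {}" "set ps \<inter> set qs = {}" and nbE: "\<And>u. u \<in> E \<Longrightarrow> nb u \<subseteq> E \<union> set ps \<union> set qs"
    and neV: "set ps \<noteq> V" "set qs \<noteq> V" and na: "\<not> ajs (set ps) (set qs)" and aj: "ajs E (set ps)" "ajs E (set qs)"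
    and nc: "\<And>u. u \<in> E \<Longrightarrow> \<not> (tch u (set ps) \<and> tch (s u) (set qs)) \<and> \<not> (tch u (set qs) \<and> tch (s u) (set ps))"
    and tr: "\<And>Y. Y \<subseteq> E \<Longrightarrow> Y \<noteq> {} \<Longrightarrow> (\<And>u. u \<in> Y \<Longrightarrow> s u \<in> Y) \<Longrightarrow> L Y (set ps) \<noteq> {} \<and> L Y (set qs) \<noteq> {}"
    and nm: "\<And>u. u \<in> E \<Longrightarrow> \<not> tm ps u (s u) \<and> \<not> tm ps (s u) u \<and> \<not> tm qs u (s u) \<and> \<not> tm qs (s u) u"
    and H: "\<And>u v. u \<in> E \<Longrightarrow> v \<in> E \<Longrightarrow> bnd u v \<Longrightarrow> \<not> tm ps u v \<and> \<not> tm qs u v"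
  shows "card E + length ps + length qs \<ge> 20"
proof -
  let ?P = "set ps" and ?Q = "set qs"
  define S T where "S = L E ?P" and "T = L E ?Q"
  have t: "two ?P ?Q S T" unfolding S_def T_def
    by (rule two_L) (use bcyc_bclosed c dis na nbE in auto)
  note fl = two_fl[OF t]
  have ne: "S \<noteq> {}" "T \<noteq> {}" unfolding S_def T_def using aj ajs_L by auto
  have sub: "S \<subseteq> E" "T \<subseteq> E" unfolding S_def T_def L_def by auto
  have ncS: "\<And>u. u \<in> S \<Longrightarrow> s u \<notin> T" "\<And>u. u \<in> T \<Longrightarrow> s u \<notin> S" using nc unfolding S_def T_def L_def by blast+
  \<comment> \<open>By \<open>tr\<close> a nonempty part of \<open>E\<close> closed under
    \<open>s\<close> carries both labels, whereas \<open>S - T\<close> has no vertex that sees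
    \<open>qs\<close>.\<close>
  have exS: "\<exists>u\<in>S - T. s u \<notin> S" if "S - T \<noteq> {}"
  proof (rule ccontr)
    assume "\<not> ?thesis"
    then have "s u \<in> S - T" if "u \<in> S - T" for u using that ncS(1) by blast
    then have "L (S - T) ?Q \<noteq> {}" using tr[of "S - T"] that sub by blast
    then show False using sub unfolding T_def L_def by blast
  qed
  have exT: "\<exists>u\<in>T - S. s u \<notin> T" if "T - S \<noteq> {}"
  proof (rule ccontr)
    assume "\<not> ?thesis"
    then have "s u \<in> T - S" if "u \<in> T - S" for u using that ncS(2) by blast
    then have "L (T - S) ?P \<noteq> {}" using tr[of "T - S"] that sub by blast
    then show False using sub unfolding S_def L_def by blast
  qed
  have SF1: "card E \<ge> 10" by (rule separated_frontiers(1)[OF t c(5) sub ne c(3)]) (rule c(4) ncS exS exT; assumption)+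
  have SF2: "card E \<ge> 11" if "card S = 4 \<longrightarrow> (\<forall>u\<in>S. s u \<notin> S)"
    by (rule separated_frontiers(2)[OF t c(5) sub ne c(3)]) (rule that | (rule c(4) ncS exS exT; assumption))+
  have SF3: "card E \<ge> 11" if "card T = 4 \<longrightarrow> (\<forall>u\<in>T. s u \<notin> T)"
    by (rule separated_frontiers(3)[OF t c(5) sub ne c(3)]) (rule that | (rule c(4) ncS exS exT; assumption))+
  have len: "length ps \<ge> 4" "length qs \<ge> 4" using bcyc_length c neV by blast+
  have kS: "card S = 4 \<longrightarrow> (\<forall>u\<in>S. s u \<notin> S)" if "length ps = 4"
  proof (intro impI ballI notI)
    fix u assume "card S = 4" "u \<in> S" "s u \<in> S"
    then show False using c4_no_tm[OF c(1) that neV(1) fl(1)] nm c(4) sub by blast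
  qed
  have kT: "card T = 4 \<longrightarrow> (\<forall>u\<in>T. s u \<notin> T)" if "length qs = 4"
  proof (intro impI ballI notI)
    fix u assume "card T = 4" "u \<in> T" "s u \<in> T"
    then show False using c4_no_tm[OF c(2) that neV(2) fl(2)] nm c(4) sub by blast
  qed
  show ?thesis
  proof (cases "length ps = 4")
    case p4: True
    show ?thesis
    proof (cases "length qs = 4")
      case q4: True
      have "card E \<ge> 12"
      proof (rule separated_frontiers(4)[OF t c(5) sub ne c(3)])
        show "card S = 4 \<longrightarrow> (\<forall>u\<in>S. s u \<notin> S)" using kS[OF p4] .
        show "card T = 4 \<longrightarrow> (\<forall>u\<in>T. s u \<notin> T)" using kT[OF q4] .
        fix u assume "u \<in> S \<union> T" then show "nb u \<subseteq> E \<union> ?P \<union> ?Q" using nbE sub by blast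
      next
        fix u v e f assume h: "u \<in> S \<inter> T" "v \<in> S \<union> T" "card (S \<inter> T) = 4" "S \<subseteq> T \<and> T - S = {e, f} \<or> T \<subseteq> S \<and> S - T = {e, f}" "adj e f"
        show "\<not> bnd u v"
        proof
          assume b: "bnd u v"
          show False using h(4)
          proof (elim disjE conjE)
            assume g: "S \<subseteq> T" "T - S = {e, f}"
            then have "card S = 4" "u \<in> S" "v \<in> T" using h by (auto simp: Int_absorb2)
            then show False using two_42_no_bnd[OF t _ g h(5) c(1) p4 neV(1) c(2) q4 neV(2) _ _ _ b] H sub by blast
          next
            assume g: "T \<subseteq> S" "S - T = {e, f}"
            then have "card T = 4" "u \<in> T" "v \<in> S" using h by (auto simp: Int_absorb1)
            then show False using two_42_no_bnd[OF two_sym[OF t] _ g h(5) c(2) q4 neV(2) c(1) p4 neV(1) _ _ _ b] H sub by blast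
          qed
        qed
      qed (rule c(4) ncS exS exT; assumption)+
      then show ?thesis using p4 q4 by simp
    next
      case False then show ?thesis using SF2[OF kS[OF p4]] p4 len by linarith
    qed
  next
    case False
    then have p5: "length ps \<ge> 5" using len by linarith
    show ?thesis
    proof (cases "length qs = 4")
      case True then show ?thesis using SF3[OF kT[OF True]] p5 by linarith
    next
      case False then show ?thesis using SF1 p5 len by linarith
    qed
  qed
qed

text \<open>Consecutive vertices of \<open>zs\<close> with different labels would chain the three
  cycles, and an exchange along \<open>zs\<close> would merge two of them, with an edge left to the
  third. \<open>zs\<close> is any cycle of the graph, so that it may itself arise from merging
  boundary cycles; boundary edges between its vertices may then be missing from it, and
  \<open>H\<close> takes care of them.\<close>

lemma separated_card_ge_20:
  assumes nt: "\<not> (\<exists>a b. hpath V a b)" and c: "cyc bnd ps" "cyc bnd qs" "cyc adj zs"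
    and part: "set ps \<union> set zs \<union> set qs = V" and dis: "set zs \<inter> set ps = {}" "set zs \<inter> set qs = {}" "set ps \<inter> set qs = {}"
    and na: "\<not> ajs (set ps) (set qs)" and aj: "ajs (set zs) (set ps)" "ajs (set zs) (set qs)"
    and H: "\<And>u v. u \<in> set zs \<Longrightarrow> v \<in> set zs \<Longrightarrow> bnd u v \<Longrightarrow> \<not> tm ps u v \<and> \<not> tm qs u v"
  shows "card V \<ge> 20"
proof -
  have d: "distinct zs" "distinct ps" "distinct qs" "3 \<le> length zs" using c unfolding cyc_def by auto
  have nc: "\<not> (tch u (set ps) \<and> tch v (set qs))" if "cons zs u v" for u v
    using chain3[OF cyc_mono[OF c(1)] c(3) cyc_mono[OF c(2)] that] dis part nt by (metis Int_commute)
  have mp: "\<not> tm ps u v" if uv: "cons zs u v" for u v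
  proof
    assume "tm ps u v"
    then obtain ws where ws: "cyc adj ws" "set ws = set ps \<union> set zs" using tm_square[OF c(1,3) _ uv] dis by blast
    have "ajs (set ws) (set qs)" using aj(2) ws(2) unfolding ajs_def by blast
    then show False using join2[OF ws(1) cyc_mono[OF c(2)]] ws(2) dis part nt by (metis Int_Un_distrib2 Un_empty)
  qed
  have mq: "\<not> tm qs u v" if uv: "cons zs u v" for u v
  proof
    assume "tm qs u v"
    then obtain ws where ws: "cyc adj ws" "set ws = set qs \<union> set zs" using tm_square[OF c(2,3) _ uv] dis by blast
    have "ajs (set ws) (set ps)" using aj(1) ws(2) unfolding ajs_def by blast
    moreover have "set ws \<inter> set ps = {}" "set ws \<union> set ps = V" using ws(2) dis part by blast+
    ultimately show False using join2[OF ws(1) cyc_mono[OF c(1)]] nt by metis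
  qed
  have nxc: "cons zs u (nx zs u)" if "u \<in> set zs" for u using nx_cons d that by blast
  have "zs \<noteq> []" using d by auto
  then obtain z where z: "z \<in> set zs" using hd_in_set by blast
  then have "z \<in> V" "z \<notin> set ps" "z \<notin> set qs" using part dis by blast+
  then have neV: "set ps \<noteq> V" "set qs \<noteq> V" by blast+
  have "card (set zs) + length ps + length qs \<ge> 20"
  proof (rule separating_cycle[OF c(1,2) nx_bij[OF c(3)] _ _ dis _ neV na aj])
    show "adj u (nx zs u)" if "u \<in> set zs" for u using nxc[OF that] cyc_cons[OF c(3) symp_adj] by blast
    show "nb u \<subseteq> set zs \<union> set ps \<union> set qs" if "u \<in> set zs" for u using nb_subset part by blast
    show "\<not> (tch u (set ps) \<and> tch (nx zs u) (set qs)) \<and> \<not> (tch u (set qs) \<and> tch (nx zs u) (set ps))" if "u \<in> set zs" for u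
      using nc nxc[OF that] cons_sym by blast
    show "\<not> tm ps u (nx zs u) \<and> \<not> tm ps (nx zs u) u \<and> \<not> tm qs u (nx zs u) \<and> \<not> tm qs (nx zs u) u" if "u \<in> set zs" for u
      using mp mq nxc[OF that] cons_sym by blast
    show "L Y (set ps) \<noteq> {} \<and> L Y (set qs) \<noteq> {}" if "Y \<subseteq> set zs" "Y \<noteq> {}" "\<And>u. u \<in> Y \<Longrightarrow> nx zs u \<in> Y" for Y
      using nx_trans[OF c(3) that] aj ajs_L by simp
  qed (use H in auto)
  moreover have "card V = card (set zs) + length ps + length qs"
  proof -
    have "card V = card (set ps \<union> set zs) + card (set qs)"
      using part card_Un_disjoint[of "set ps \<union> set zs" "set qs"] dis by auto
    also have "card (set ps \<union> set zs) = card (set ps) + card (set zs)" using card_Un_disjoint[of "set ps" "set zs"] dis by auto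
    finally show ?thesis using distinct_card[OF d(2)] distinct_card[OF d(3)] by simp
  qed
  ultimately show ?thesis by simp
qed

subsection \<open>Three boundary cycles\<close>

lemma tm_contra:
  assumes nt: "\<not> (\<exists>a b. hpath V a b)" and c: "cyc bnd ps" "cyc adj zs" "cyc adj qs"
    and part: "set ps \<union> set zs \<union> set qs = V" and dis: "set zs \<inter> set ps = {}" "set zs \<inter> set qs = {}" "set ps \<inter> set qs = {}"
    and aj: "ajs (set zs) (set qs)" and uv: "cons zs u v"
  shows "\<not> tm ps u v"
proof
  assume "tm ps u v"
  then obtain ws where ws: "cyc adj ws" "set ws = set ps \<union> set zs" using tm_square[OF c(1,2) _ uv] dis by blast
  have "ajs (set ws) (set qs)" using aj ws(2) unfolding ajs_def by blast
  moreover have "set ws \<inter> set qs = {}" "set ws \<union> set qs = V" using ws(2) dis part by blast+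
  ultimately show False using join2[OF ws(1) c(3)] nt by metis
qed

lemma separated_bnd_card_ge_20:
  assumes nt: "\<not> (\<exists>a b. hpath V a b)" and c: "cyc bnd ps" "cyc bnd qs" "cyc bnd zs"
    and part: "set ps \<union> set zs \<union> set qs = V" and dis: "set zs \<inter> set ps = {}" "set zs \<inter> set qs = {}" "set ps \<inter> set qs = {}"
    and na: "\<not> ajs (set ps) (set qs)" and aj: "ajs (set zs) (set ps)" "ajs (set zs) (set qs)"
  shows "card V \<ge> 20"
proof (rule separated_card_ge_20[OF nt c(1,2) cyc_mono[OF c(3)] part dis na aj])
  fix u v assume "u \<in> set zs" "bnd u v"
  then have uv: "cons zs u v" using bcyc_cons_iff[OF c(3)] by blast
  have part': "set qs \<union> set zs \<union> set ps = V" "set qs \<inter> set ps = {}" using part dis by blast+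
  show "\<not> tm ps u v \<and> \<not> tm qs u v"
    using tm_contra[OF nt c(1) cyc_mono[OF c(3)] cyc_mono[OF c(2)] part dis aj(2) uv]
      tm_contra[OF nt c(2) cyc_mono[OF c(3)] cyc_mono[OF c(1)] part'(1) dis(2,1) part'(2) aj(1) uv] by blast
qed

lemma rot_hd:
  assumes "cyc R xs" "u \<in> set xs"
  shows "\<exists>ys. cyc R ys \<and> set ys = set xs \<and> length ys = length xs \<and> ys ! 0 = u \<and> (\<forall>a b. cons ys a b \<longleftrightarrow> cons xs a b)"
proof -
  obtain i where i: "i < length xs" "u = xs ! i" using assms(2) by (metis in_set_conv_nth)
  have ne: "xs \<noteq> []" "0 < length xs" using i by auto
  have "rotate i xs ! 0 = u" using nth_rotate[OF ne(2), of i] i by simp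
  then show ?thesis using cyc_rotate[OF assms(1)] cons_rotate[OF ne(1)] by blast
qed

lemma cons_Suc: "Suc i < length xs \<Longrightarrow> cons xs (xs ! i) (xs ! Suc i)"
  unfolding cons_def by (rule exI[of _ i]) simp

lemma cons_last: "xs \<noteq> [] \<Longrightarrow> cons xs (xs ! (length xs - 1)) (xs ! 0)"
  unfolding cons_def by (rule exI[of _ "length xs - 1"]) simp

lemma list5: "length xs = 5 \<Longrightarrow> \<exists>a b c d e. xs = [a, b, c, d, e]"
  by (auto simp: length_Suc_conv eval_nat_numeral)
lemma list6: "length xs = 6 \<Longrightarrow> \<exists>a b c d e f. xs = [a, b, c, d, e, f]"
  by (auto simp: length_Suc_conv eval_nat_numeral)
lemma list7: "length xs = 7 \<Longrightarrow> \<exists>a b c d e f g. xs = [a, b, c, d, e, f, g]"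
  by (auto simp: length_Suc_conv eval_nat_numeral)

lemma cons5: "cons [a, b, c, d, e] a b" "cons [a, b, c, d, e] b c" "cons [a, b, c, d, e] c d" "cons [a, b, c, d, e] d e" "cons [a, b, c, d, e] e a"
  using cons_Suc[of 0 "[a, b, c, d, e]"] cons_Suc[of 1 "[a, b, c, d, e]"] cons_Suc[of 2 "[a, b, c, d, e]"] cons_Suc[of 3 "[a, b, c, d, e]"]
    cons_last[of "[a, b, c, d, e]"] by (simp_all add: eval_nat_numeral)
lemma cons6: "cons [a, b, c, d, e, f] a b" "cons [a, b, c, d, e, f] b c" "cons [a, b, c, d, e, f] c d" "cons [a, b, c, d, e, f] d e"
    "cons [a, b, c, d, e, f] e f" "cons [a, b, c, d, e, f] f a"
  using cons_Suc[of 0 "[a, b, c, d, e, f]"] cons_Suc[of 1 "[a, b, c, d, e, f]"] cons_Suc[of 2 "[a, b, c, d, e, f]"] cons_Suc[of 3 "[a, b, c, d, e, f]"]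
    cons_Suc[of 4 "[a, b, c, d, e, f]"] cons_last[of "[a, b, c, d, e, f]"] by (simp_all add: eval_nat_numeral)
lemma cons7: "cons [a, b, c, d, e, f, g] a b" "cons [a, b, c, d, e, f, g] b c" "cons [a, b, c, d, e, f, g] c d" "cons [a, b, c, d, e, f, g] d e"
    "cons [a, b, c, d, e, f, g] e f" "cons [a, b, c, d, e, f, g] f g" "cons [a, b, c, d, e, f, g] g a"
  using cons_Suc[of 0 "[a, b, c, d, e, f, g]"] cons_Suc[of 1 "[a, b, c, d, e, f, g]"] cons_Suc[of 2 "[a, b, c, d, e, f, g]"] cons_Suc[of 3 "[a, b, c, d, e, f, g]"]
    cons_Suc[of 4 "[a, b, c, d, e, f, g]"] cons_Suc[of 5 "[a, b, c, d, e, f, g]"] cons_last[of "[a, b, c, d, e, f, g]"] by (simp_all add: eval_nat_numeral)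

lemma front_fl: assumes "cyc bnd xs" shows "fl (V - set xs) (L (set xs) (V - set xs))"
  by (rule fl_L) (use bclosed_Diff[OF bclosed_V bcyc_bclosed[OF assms]] adj_V2 in auto)

lemma front_card: assumes "cyc bnd xs" "u \<in> set xs" "tch u (V - set xs)"
  shows "card (L (set xs) (V - set xs)) \<ge> 4"
  by (rule fl_card[OF front_fl[OF assms(1)]]) (use assms in \<open>auto simp: L_def\<close>)

lemma card_le_subset: "A \<subseteq> set xs \<Longrightarrow> card A \<le> length xs"
  by (meson List.finite_set card_length card_mono le_trans)

text \<open>A frontier with four vertices is an induced 4-cycle, so \<open>u\<close> and
  \<open>v\<close> are opposite, and \<open>x\<close>, \<open>y\<close> are the other
  diagonal.\<close>

lemma c4_nonadj:
  assumes "fl X S" "S = {u, v, x, y}" "card S = 4" "\<not> adj u v" shows "\<not> adj x y"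
proof -
  obtain a b c d where k0: "S = {a, b, c, d}" "c4 X a b c d" using fl_c4[OF assms(1,3)] by blast
  have "u \<in> {a, b, c, d}" using k0(1) assms(2) by blast
  then obtain b c d where k: "c4 X u b c d" "{u, b, c, d} = S" using c4_at[OF k0(2)] k0(1) by metis
  note ad = c4_adj[OF k(1)]
  have dis: "distinct [u, b, c, d]" using k(1) unfolding c4_def by blast
  have "card {u, v, x, y} = 4" using assms by simp
  then have dis2: "distinct [u, v, x, y]" by (auto simp: card_insert_if split: if_splits)
  have "v \<in> {u, b, c, d}" using k(2) assms(2) by blast
  moreover have "v \<noteq> b" "v \<noteq> d" "v \<noteq> u" using ad assms(4) dis2 by auto
  ultimately have "v = c" by simp
  then have "x \<in> {b, d}" "y \<in> {b, d}" using k(2) assms(2) dis2 by auto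
  then show ?thesis using ad adj_irrefl by auto
qed

text \<open>At least four vertices of the cycle see the outside, but the neighbours of
  \<open>u\<close> and \<open>v\<close> do not. Unless \<open>u\<close> and \<open>v\<close> are
  consecutive, this leaves at most three vertices, or, on a 7-cycle, exactly \<open>u\<close>,
  \<open>v\<close> and two consecutive ones; then \<open>c4_nonadj\<close> shows that
  \<open>u\<close> and \<open>v\<close> are adjacent.\<close>

lemma isolated_labels_adjacent:
  assumes x: "cyc bnd xs" "length xs = 6 \<or> length xs = 7"
    and u: "u \<in> set xs" "tch u (V - set xs)" and v: "v \<in> set xs" "tch v (V - set xs)" "u \<noteq> v"
    and iso: "\<And>w. cons xs u w \<Longrightarrow> \<not> tch w (V - set xs)" "\<And>w. cons xs v w \<Longrightarrow> \<not> tch w (V - set xs)"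
  shows "adj u v"
proof (rule ccontr)
  assume na: "\<not> adj u v"
  obtain ys where ys: "cyc bnd ys" "set ys = set xs" "length ys = length xs" "ys ! 0 = u" "\<And>a b. cons ys a b \<longleftrightarrow> cons xs a b"
    using rot_hd[OF x(1) u(1)] by blast
  let ?L = "L (set ys) (V - set ys)"
  have l4: "card ?L \<ge> 4" by (rule front_card[OF ys(1)]) (use u ys in auto)
  have nu: "w \<notin> ?L" if "cons ys u w" for w using iso that ys unfolding L_def by auto
  have nv: "w \<notin> ?L" if "cons ys v w" for w using iso that ys unfolding L_def by auto
  have vL: "v \<in> ?L" using v ys(2) unfolding L_def by simp
  have LX: "?L \<subseteq> set ys" unfolding L_def by auto
  have small: False if "?L \<subseteq> set zs" "length zs \<le> 3" for zs using card_le_subset[OF that(1)] that(2) l4 by linarith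
  have full: False if z: "?L \<subseteq> set [u, v, p, q]" "adj p q" for p q
  proof -
    have "card (set [u, v, p, q]) \<le> 4" using card_length[of "[u, v, p, q]"] by simp
    then have "?L = set [u, v, p, q]" using card_seteq[OF _ z(1)] l4 by simp
    then have e: "?L = {u, v, p, q}" by simp
    moreover have "card ?L = 4" using l4 \<open>card (set [u, v, p, q]) \<le> 4\<close> e by simp
    ultimately show False using c4_nonadj[OF front_fl[OF ys(1)]] na z(2) by blast
  qed
  have adjc: "adj p q" if "cons ys p q" for p q using that cyc_cons[OF ys(1) symp_bnd] bnd_adj by blast
  show False
  proof (cases "length xs = 6")
    case True
    then obtain b c d e f where y: "ys = [u, b, c, d, e, f]" using list6 ys(3,4) by (metis nth_Cons_0)
    note C = cons6[of u b c d e f, folded y]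
    have "b \<notin> ?L" "f \<notin> ?L" using nu C cons_sym by blast+
    then have vv: "v = c \<or> v = d \<or> v = e" using vL LX y v(3) by auto
    then show False
    proof (elim disjE)
      assume "v = c" then have "d \<notin> ?L" using nv C by blast
      then have "?L \<subseteq> set [u, c, e]" using LX y \<open>b \<notin> ?L\<close> \<open>f \<notin> ?L\<close> by auto
      then show False using small[of "[u, c, e]"] by simp
    next
      assume "v = d" then have "c \<notin> ?L" using nv C cons_sym by blast
      then have "?L \<subseteq> set [u, d, e]" using LX y \<open>b \<notin> ?L\<close> \<open>f \<notin> ?L\<close> by auto
      then show False using small[of "[u, d, e]"] by simp
    next
      assume "v = e" then have "d \<notin> ?L" using nv C cons_sym by blast
      then have "?L \<subseteq> set [u, c, e]" using LX y \<open>b \<notin> ?L\<close> \<open>f \<notin> ?L\<close> by auto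
      then show False using small[of "[u, c, e]"] by simp
    qed
  next
    case False
    then have "length ys = 7" using x ys by simp
    then obtain b c d e f g where y: "ys = [u, b, c, d, e, f, g]" using list7 ys(4) by (metis nth_Cons_0)
    note C = cons7[of u b c d e f g, folded y]
    have bg: "b \<notin> ?L" "g \<notin> ?L" using nu C cons_sym by blast+
    then have vv: "v = c \<or> v = d \<or> v = e \<or> v = f" using vL LX y v(3) by auto
    then show False
    proof (elim disjE)
      assume h: "v = c" then have "d \<notin> ?L" using nv C by blast
      then have "?L \<subseteq> set [u, v, e, f]" using LX y bg h by auto
      then show False using full adjc C by blast
    next
      assume "v = d" then have "c \<notin> ?L" "e \<notin> ?L" using nv C cons_sym by blast+
      then have "?L \<subseteq> set [u, d, f]" using LX y bg by auto
      then show False using small[of "[u, d, f]"] by simp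
    next
      assume "v = e" then have "d \<notin> ?L" "f \<notin> ?L" using nv C cons_sym by blast+
      then have "?L \<subseteq> set [u, c, e]" using LX y bg by auto
      then show False using small[of "[u, c, e]"] by simp
    next
      assume h: "v = f" then have "e \<notin> ?L" using nv C cons_sym by blast
      then have "?L \<subseteq> set [u, v, c, d]" using LX y bg h by auto
      then show False using full adjc C by blast
    qed
  qed
qed

lemma both_labels_adjacent:
  assumes x: "cyc bnd xs" "length xs = 6 \<or> length xs = 7" and P: "P1 \<union> P2 = V - set xs"
    and nc: "\<And>u v. cons xs u v \<Longrightarrow> \<not> (tch u P1 \<and> tch v P2)"
    and u: "u \<in> set xs" "tch u P1" "tch u P2" and v: "v \<in> set xs" "tch v P1" "tch v P2" "u \<noteq> v"
  shows "adj u v"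
proof (rule isolated_labels_adjacent[OF x])
  have lab: "tch w (V - set xs) \<longleftrightarrow> tch w P1 \<or> tch w P2" for w using P unfolding tch_def by blast
  show "\<not> tch w (V - set xs)" if "cons xs u w" for w using lab nc[of u w] nc[of w u] that cons_sym u by blast
  show "\<not> tch w (V - set xs)" if "cons xs v w" for w using lab nc[of v w] nc[of w v] that cons_sym v by blast
  show "tch u (V - set xs)" "tch v (V - set xs)" using lab u v by blast+
qed (use u v in auto)

text \<open>Two disjoint frontiers would need 8 vertices, so some \<open>u\<close> sees both parts
  and its neighbours on the cycle see neither. At least four vertices see the outside, hence so do
  the three consecutive vertices opposite to \<open>u\<close>. As labels do not change along an
  edge, these three carry one and the same label, and the other label occurs only at
  \<open>u\<close>.\<close>

lemma six_cycle_labels: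
  assumes x: "cyc bnd xs" "length xs = 6" and P: "P1 \<union> P2 = V - set xs" "bclosed P1" "bclosed P2" "P1 \<inter> P2 = {}"
    and a: "ajs (set xs) P1" "ajs (set xs) P2"
    and nc: "\<And>u v. cons xs u v \<Longrightarrow> \<not> (tch u P1 \<and> tch v P2)"
  shows "\<exists>u\<in>set xs. tch u P1 \<and> tch u P2 \<and> (L (set xs) P1 = {u} \<or> L (set xs) P2 = {u})"
proof -
  let ?X = "set xs"
  have fX: "finite (L ?X Y)" for Y unfolding L_def by auto
  have "L ?X P1 \<inter> L ?X P2 \<noteq> {}"
  proof
    assume em: "L ?X P1 \<inter> L ?X P2 = {}"
    have "fl P1 (L ?X P1)"
    proof (rule fl_L[OF P(2)])
      show "?X \<inter> P1 = {}" using P by blast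
      fix u p assume h: "u \<in> ?X" "tch u P1" "adj u p" "p \<notin> ?X" "p \<notin> P1"
      then have "p \<in> P2" using P(1) adj_V2 by blast
      then have "u \<in> L ?X P1 \<inter> L ?X P2" using h unfolding L_def tch_def by blast
      then show "\<not> tch p P1" using em by blast
    qed
    moreover have "fl P2 (L ?X P2)"
    proof (rule fl_L[OF P(3)])
      show "?X \<inter> P2 = {}" using P by blast
      fix u p assume h: "u \<in> ?X" "tch u P2" "adj u p" "p \<notin> ?X" "p \<notin> P2"
      then have "p \<in> P1" using P(1) adj_V2 by blast
      then have "u \<in> L ?X P1 \<inter> L ?X P2" using h unfolding L_def tch_def by blast
      then show "\<not> tch p P2" using em by blast
    qed
    ultimately have "card (L ?X P1) \<ge> 4" "card (L ?X P2) \<ge> 4" using fl_card fX a ajs_L by blast+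
    then have "card (L ?X P1 \<union> L ?X P2) \<ge> 8" using card_Un_disjoint[OF fX fX em] by linarith
    moreover have "L ?X P1 \<union> L ?X P2 \<subseteq> set xs" unfolding L_def by auto
    ultimately show False using card_le_subset[of "L ?X P1 \<union> L ?X P2" xs] x(2) by linarith
  qed
  then obtain u where u: "u \<in> set xs" "tch u P1" "tch u P2" unfolding L_def by blast
  obtain ys where ys: "cyc bnd ys" "set ys = set xs" "length ys = length xs" "ys ! 0 = u" "\<And>a b. cons ys a b \<longleftrightarrow> cons xs a b"
    using rot_hd[OF x(1) u(1)] by blast
  obtain b c d e f where y: "ys = [u, b, c, d, e, f]" using list6 ys(3,4) x(2) by (metis nth_Cons_0)
  let ?L = "L (set ys) (V - set ys)"
  have l4: "card ?L \<ge> 4" by (rule front_card[OF ys(1)]) (use u ys P in \<open>auto simp: tch_def\<close>)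
  have lab: "w \<in> ?L \<longleftrightarrow> tch w P1 \<or> tch w P2" if "w \<in> set xs" for w using that P(1) ys(2) unfolding L_def tch_def by blast
  have nn: "\<not> (tch p P1 \<and> tch q P2)" "\<not> (tch q P1 \<and> tch p P2)" if "cons ys p q" for p q using nc[of p q] nc[of q p] that ys(5) cons_sym by blast+
  note C = cons6[of u b c d e f, folded y]
  have mem: "b \<in> set xs" "c \<in> set xs" "d \<in> set xs" "e \<in> set xs" "f \<in> set xs" using ys(2) y by auto
  have bf: "b \<notin> ?L" "f \<notin> ?L" using lab mem nn[OF C(1)] nn[OF C(6)] u by blast+
  then have "?L \<subseteq> set [u, c, d, e]" unfolding L_def y by auto
  moreover have "card (set [u, c, d, e]) \<le> 4" using card_length[of "[u, c, d, e]"] by simp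
  ultimately have "?L = set [u, c, d, e]" using card_seteq[of "set [u, c, d, e]" ?L] l4 by simp
  then have cde: "tch c P1 \<or> tch c P2" "tch d P1 \<or> tch d P2" "tch e P1 \<or> tch e P2" using lab mem by auto
  have bf': "\<not> tch b P1" "\<not> tch b P2" "\<not> tch f P1" "\<not> tch f P2" using bf lab mem by blast+
  have all: "set xs = {u, b, c, d, e, f}" using ys(2) y by simp
  show ?thesis
  proof (cases "tch d P1")
    case True
    then have "\<not> tch c P2" "\<not> tch e P2" using nn[OF C(3)] nn[OF C(4)] by blast+
    moreover have "\<not> tch d P2" using cde(1) \<open>\<not> tch c P2\<close> nn[OF C(3)] by blast
    ultimately have "L (set xs) P2 = {u}" using all bf' u unfolding L_def by auto
    then show ?thesis using u by blast
  next
    case False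
    then have d2: "tch d P2" using cde by blast
    then have "\<not> tch c P1" "\<not> tch e P1" using nn[OF C(3)] nn[OF C(4)] by blast+
    then have "L (set xs) P1 = {u}" using all bf' u False unfolding L_def by auto
    then show ?thesis using u by blast
  qed
qed

lemma crossing_edge:
  assumes "X \<union> Y = V" "X \<inter> Y = {}" "X \<noteq> {}" "Y \<noteq> {}"
  shows "ajs X Y"
proof (rule ccontr)
  assume n: "\<not> ajs X Y"
  have "X = V"
  proof (rule closed_set_eq_V)
    show "X \<subseteq> V" "X \<noteq> {}" using assms by blast+
    fix u v assume "u \<in> X" "adj u v"
    then show "v \<in> X" using n assms(1) adj_V2 unfolding ajs_def by blast
  qed
  then show False using assms by blast
qed

text \<open>If two of the cycles are not adjacent, the third separates them. Otherwise
  \<open>small_cycle\<close> gives lengths of at least 6, so with at most 19 vertices the lengths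
  are 6, 6 and 6 or 7. On a 6-cycle some label, say \<open>p\<close>, occurs only at one vertex
  \<open>u\<close>. The flanks of a \<open>p\<close>-section at \<open>u\<close> then lie on the
  third cycle and see both other cycles, so they are adjacent by
  \<open>both_labels_adjacent\<close>; but flanks never are.\<close>

lemma three_cycles:
  assumes nt: "\<not> (\<exists>a b. hpath V a b)" and c: "cyc bnd xs" "cyc bnd ys" "cyc bnd zs"
    and part: "set xs \<union> set ys \<union> set zs = V" and dis: "set xs \<inter> set ys = {}" "set xs \<inter> set zs = {}" "set ys \<inter> set zs = {}"
  shows "card V \<ge> 20"
proof (rule ccontr)
  assume n20: "\<not> card V \<ge> 20"
  have ne: "set xs \<noteq> {}" "set ys \<noteq> {}" "set zs \<noteq> {}" using c unfolding cyc_def by auto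
  have cl: False if "\<not> ajs (set p) (set q)" "cyc bnd p" "cyc bnd q" "cyc bnd z" "set p \<union> set q \<union> set z = V"
    "set p \<inter> set q = {}" "set p \<inter> set z = {}" "set q \<inter> set z = {}" "set p \<noteq> {}" "set q \<noteq> {}" for p q z
  proof -
    have "ajs (set p) (set q \<union> set z)" "ajs (set q) (set p \<union> set z)" by (rule crossing_edge; use that in blast)+
    then have "ajs (set z) (set p)" "ajs (set z) (set q)" using that(1) unfolding ajs_def using adj_sym by blast+
    moreover have "set p \<union> set z \<union> set q = V" "set z \<inter> set p = {}" "set z \<inter> set q = {}" using that by blast+
    ultimately show False using separated_bnd_card_ge_20[OF nt that(2,3,4)] that n20 by blast
  qed
  have aj: "ajs (set xs) (set ys)" "ajs (set xs) (set zs)" "ajs (set ys) (set zs)"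
    using cl[of xs ys zs] cl[of xs zs ys] cl[of ys zs xs] c part dis ne by blast+
  have nc: "\<not> (tch u (set p) \<and> tch v (set q))" if "cons z u v" "cyc bnd p" "cyc bnd q" "cyc bnd z" "set p \<union> set z \<union> set q = V"
    "set p \<inter> set z = {}" "set p \<inter> set q = {}" "set z \<inter> set q = {}" for p q z u v
    using chain3[of p z q u v] that cyc_mono nt by metis
  have big: "length z \<ge> 6" if h: "cyc bnd p" "cyc bnd q" "cyc bnd z" "set p \<union> set z \<union> set q = V"
    "set p \<inter> set z = {}" "set p \<inter> set q = {}" "set z \<inter> set q = {}" "ajs (set z) (set p)" "ajs (set z) (set q)" for p q z
  proof (rule ccontr)
    assume "\<not> length z \<ge> 6"
    then have l: "length z \<le> 5" by simp
    have "set p \<union> set q = V - set z" using h by blast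
    then obtain u v where "cons z u v" "tch u (set p)" "tch v (set q)"
      using small_cycle[OF h(3) l bcyc_bclosed[OF h(1)] bcyc_bclosed[OF h(2)]] h by blast
    then show False using nc[OF _ h(1-7)] by blast
  qed
  have p3: "set ys \<union> set xs \<union> set zs = V" "set xs \<union> set ys \<union> set zs = V" "set xs \<union> set zs \<union> set ys = V"
    "set ys \<inter> set xs = {}" "set zs \<inter> set ys = {}" "set zs \<inter> set xs = {}" using part dis by blast+
  have len: "length xs \<ge> 6" "length ys \<ge> 6" "length zs \<ge> 6"
    using big[OF c(2,3,1) p3(1) p3(4) dis(3,2) aj(1,2)] big[OF c(1,3,2) p3(2) dis(1,2,3) ajs_sym[OF aj(1)] aj(3)]
      big[OF c(1,2,3) p3(3) dis(2,1) p3(5) ajs_sym[OF aj(2)] ajs_sym[OF aj(3)]] by blast+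
  have dl: "card (set xs) = length xs" "card (set ys) = length ys" "card (set zs) = length zs"
    using c distinct_card unfolding cyc_def by blast+
  have "card V = card (set xs \<union> set ys) + card (set zs)"
    using part card_Un_disjoint[of "set xs \<union> set ys" "set zs"] dis by auto
  also have "card (set xs \<union> set ys) = card (set xs) + card (set ys)" using card_Un_disjoint[of "set xs" "set ys"] dis by auto
  finally have sum: "length xs + length ys + length zs \<le> 19" using dl n20 by linarith
  have key: False if h: "cyc bnd p" "cyc bnd q" "cyc bnd z" "set p \<union> set z \<union> set q = V"
    "set p \<inter> set z = {}" "set p \<inter> set q = {}" "set z \<inter> set q = {}" "ajs (set z) (set p)" "ajs (set z) (set q)"
    and l: "length z = 6" "length p = 6 \<or> length p = 7" "length q = 6 \<or> length q = 7" for p q z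
  proof -
    have pq: "set p \<union> set q = V - set z" using h by blast
    have sub: "bclosed (set p)" "bclosed (set q)" "bclosed (set z)" using bcyc_bclosed h by blast+
    obtain u where u: "u \<in> set z" "tch u (set p)" "tch u (set q)" "L (set z) (set p) = {u} \<or> L (set z) (set q) = {u}"
      using six_cycle_labels[OF h(3) l(1) pq sub(1,2) h(6) h(8,9)] nc[OF _ h(1-7)] by blast
    have step: False if g: "cyc bnd p" "cyc bnd q" "set p \<union> set z \<union> set q = V"
      "set p \<inter> set z = {}" "set p \<inter> set q = {}" "set z \<inter> set q = {}" "L (set z) (set p) = {u}" "tch u (set p)" "length q = 6 \<or> length q = 7" for p q
    proof -
      obtain x where x: "x \<in> set p" "adj u x" using g(8) unfolding tch_def by blast
      have "u \<notin> set p" using u g by blast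
      then obtain f f' where f: "sec (set p) u f f'" using sec_exists[OF x] bclosed_outside[OF bcyc_bclosed[OF g(1)]] by blast
      have in_q: "y \<in> set q" "tch y (set p)" "tch y (set z)" if s: "sec (set p) u y y'" for y y'
      proof -
        show t: "tch y (set p)" using sec_mid[OF s] unfolding tch_def by blast
        have "y \<notin> set z"
        proof
          assume "y \<in> set z"
          then have "y \<in> L (set z) (set p)" using t unfolding L_def by blast
          then show False using g(7) sec_ne(2)[OF s] by blast
        qed
        moreover have "y \<in> V" "y \<notin> set p" using sec_adj[OF s] adj_V2 by blast+
        ultimately show "y \<in> set q" using g(3) by blast
        show "tch y (set z)" using sec_adj[OF s] u(1) adj_sym unfolding tch_def by blast
      qed
      have q: "set p \<union> set z = V - set q" using g by blast
      have gg: "set p \<union> set q \<union> set z = V" "set q \<inter> set z = {}" using g by blast+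
      have "adj f f'"
        by (rule both_labels_adjacent[OF g(2,9) q])
          (use nc[OF _ g(1) h(3) g(2) gg(1) g(5,4) gg(2)] in_q[OF f] in_q[OF sec_sym[OF f]] sec_adj(5)[OF f] in blast)+
      then show False using sec_adj(6)[OF f] by blast
    qed
    show False using u(4)
    proof
      assume "L (set z) (set p) = {u}"
      then show False using step[OF h(1,2,4,5,6,7)] u(2) l(3) by blast
    next
      assume g: "L (set z) (set q) = {u}"
      have "set q \<union> set z \<union> set p = V" "set q \<inter> set z = {}" "set q \<inter> set p = {}" "set z \<inter> set p = {}" using h by blast+
      then show False using step[OF h(2,1)] g u(3) l(2) by blast
    qed
  qed
  have "length xs = 6 \<or> length ys = 6" "length xs \<le> 7" "length ys \<le> 7" "length zs \<le> 7" using len sum by linarith+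
  then have l67: "length xs = 6 \<or> length xs = 7" "length ys = 6 \<or> length ys = 7" "length zs = 6 \<or> length zs = 7" using len by linarith+
  show False using \<open>length xs = 6 \<or> length ys = 6\<close>
  proof
    assume "length xs = 6"
    then show False using key[OF c(2,3,1) p3(1) p3(4) dis(3,2) aj(1,2)] l67 by blast
  next
    assume "length ys = 6"
    then show False using key[OF c(1,3,2) p3(2) dis(1,2,3) ajs_sym[OF aj(1)] aj(3)] l67 by blast
  qed
qed

subsection \<open>Four boundary cycles\<close>

text \<open>The vertices of the cycle that see \<open>P\<close> or \<open>Q\<close> form two
  frontiers, which by \<open>two_six\<close> have at least six vertices in total.\<close>

lemma small_host:
  assumes "length xs \<le> 5" "bclosed P" "bclosed Q" "set xs \<inter> P = {}" "set xs \<inter> Q = {}" "P \<inter> Q = {}" "\<not> ajs P Q"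
    "\<And>u. u \<in> set xs \<Longrightarrow> nb u \<subseteq> set xs \<union> P \<union> Q" "ajs (set xs) P" "ajs (set xs) Q"
  shows False
proof -
  have t: "two P Q (L (set xs) P) (L (set xs) Q)"
    by (rule two_L) (use assms in \<open>auto simp: Int_commute\<close>)
  have s: "L (set xs) P \<union> L (set xs) Q \<subseteq> set xs" unfolding L_def by auto
  from s have "finite (L (set xs) P)" "finite (L (set xs) Q)" using finite_subset[OF s] by auto
  moreover have "L (set xs) P \<noteq> {}" "L (set xs) Q \<noteq> {}" using assms(9,10) ajs_L by simp_all
  ultimately have "card (L (set xs) P \<union> L (set xs) Q) \<ge> 6" using two_six[OF t] by simp
  then show False using card_le_subset[OF s] assms(1) by linarith
qed

lemma entry4:
  assumes "length xs = 4" "cons xs x y" "adj w x" "adj w y" "t \<in> set xs"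
  shows "\<exists>e. adj w e \<and> cons xs e t"
proof -
  obtain a b c d where xs: "xs = [a, b, c, d]" using list4 assms(1) by blast
  have h: "(x, y) \<in> {(a, b), (b, a), (b, c), (c, b), (c, d), (d, c), (d, a), (a, d)}" "t \<in> {a, b, c, d}"
    using assms(2,5) cons4 xs by auto
  have "cons xs x t \<or> cons xs y t" using h unfolding xs cons4 by auto
  then show ?thesis using assms by blast
qed

lemma wheel4:
  assumes "cyc bnd xs" "length xs = 4" "\<And>x. x \<in> set xs \<Longrightarrow> adj w x"
  shows False
proof -
  obtain a b c d where xs: "xs = [a, b, c, d]" using list4 assms(2) by blast
  show False using cyc4[OF assms(1)[unfolded xs]] bnd_adj assms(3) link_no_four_cycle[of w a b c d] unfolding xs by auto
qed

text \<open>The third vertex of the triangle on a boundary edge is not on the 4-cycle, since this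
  cycle has no chords.\<close>

lemma apex4:
  assumes "cyc bnd xs" "length xs = 4" "set xs \<noteq> V" "cons xs x y"
  shows "\<exists>w. adj w x \<and> adj w y \<and> w \<notin> set xs"
proof -
  have "adj x y" using cyc_cons[OF assms(1) symp_bnd assms(4)] bnd_adj by blast
  then obtain w where w: "adj x w" "adj y w" using adj_imp_common by blast
  have "w \<notin> set xs"
  proof
    assume "w \<in> set xs"
    then have c: "cons xs x w" "cons xs y w" using chordless4[OF assms(1-3)] w cons_mem[OF assms(4)] by blast+
    obtain a b c d where xs: "xs = [a, b, c, d]" using list4 assms(2) by blast
    have "distinct [a, b, c, d]" by (rule cyc4(5)) (use assms(1) xs in simp)
    then show False using c assms(4) unfolding xs cons4 by auto
  qed
  then show ?thesis using w adj_sym by blast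
qed

text \<open>The apexes \<open>t\<close> and \<open>t'\<close> of the two boundary edges at
  \<open>w\<close> lie on the cycle. The link of \<open>w\<close> must leave room for
  \<open>g\<close>, so by \<open>link_short\<close> it has no short path between its ends; on a 4-
  or 5-cycle this fails, and on a 6- or 7-cycle it forces each apex to be close to its edge. Then
  the link of each neighbour of \<open>w\<close> on the cycle consists of cycle vertices
  only.\<close>

lemma ear_unlabelled:
  assumes z: "cyc bnd zs" "length zs \<le> 7" "length zs \<ge> 4" and w: "w \<in> set zs" "adj w g" "g \<notin> set zs"
    and t: "\<And>w'. cons zs w w' \<Longrightarrow> \<exists>t\<in>set zs. adj w t \<and> adj w' t"
  shows "length zs \<ge> 6 \<and> (\<forall>w'. cons zs w w' \<longrightarrow> (\<forall>x. adj w' x \<longrightarrow> x \<in> set zs))"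
proof -
  obtain ys where ys: "cyc bnd ys" "set ys = set zs" "length ys = length zs" "ys ! 0 = w" "\<And>a b. cons ys a b \<longleftrightarrow> cons zs a b"
    using rot_hd[OF z(1) w(1)] by blast
  have B: "bnd p q" if "cons ys p q" for p q using that cyc_cons[OF ys(1) symp_bnd] by blast
  have A: "adj p q" "adj q p" if "cons ys p q" for p q using B[OF that] bnd_adj adj_sym by blast+
  have tt: "\<exists>t\<in>set ys. adj w t \<and> adj w' t" if "cons ys w w'" for w' using t that ys by simp
  have g: "g \<notin> set ys" using w ys by simp
  have ls: "adj p q \<Longrightarrow> False" "adj w a \<Longrightarrow> adj p a \<Longrightarrow> adj q a \<Longrightarrow> a \<in> set ys \<Longrightarrow> False"
    "adj w a \<Longrightarrow> adj p a \<Longrightarrow> adj w b \<Longrightarrow> adj a b \<Longrightarrow> adj q b \<Longrightarrow> a \<noteq> q \<Longrightarrow> b \<noteq> p \<Longrightarrow> a \<in> set ys \<Longrightarrow> b \<in> set ys \<Longrightarrow> False"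
    if "cons ys w p" "cons ys w q" "p \<noteq> q" for p q a b
  proof -
    note l = link_short[OF B[OF that(1)] B[OF that(2)] that(3) w(2)]
    have m: "g \<noteq> p" "g \<noteq> q" using cons_mem[OF that(1)] cons_mem[OF that(2)] g by blast+
    show "adj p q \<Longrightarrow> False" using l(1) m by blast
    show "adj w a \<Longrightarrow> adj p a \<Longrightarrow> adj q a \<Longrightarrow> a \<in> set ys \<Longrightarrow> False" using l(2)[of a] m g by blast
    show "adj w a \<Longrightarrow> adj p a \<Longrightarrow> adj w b \<Longrightarrow> adj a b \<Longrightarrow> adj q b \<Longrightarrow> a \<noteq> q \<Longrightarrow> b \<noteq> p \<Longrightarrow> a \<in> set ys \<Longrightarrow> b \<in> set ys \<Longrightarrow> False"
      using l(3)[of a b] m g by blast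
  qed
  have two: "(\<forall>x. adj p x \<longrightarrow> x \<in> set ys) \<and> (\<forall>x. adj q x \<longrightarrow> x \<in> set ys) \<Longrightarrow> \<forall>w'. cons zs w w' \<longrightarrow> (\<forall>x. adj w' x \<longrightarrow> x \<in> set zs)"
    if "cons ys w p" "cons ys w q" "p \<noteq> q" for p q
    using cons_unique[OF ys(1) that] ys(2,5) by metis
  have d: "distinct ys" using ys(1) unfolding cyc_def by blast
  have short: "x \<in> set ys" if "cons ys p u" "cons ys p v" "u \<noteq> v" "adj u v" "adj p x" for p u v x
    using link_short(1)[OF B[OF that(1)] B[OF that(2)] that(3,5,4)] cons_mem that by blast
  have short2: "x \<in> set ys" if "cons ys p u" "cons ys p v" "u \<noteq> v" "adj p a" "adj u a" "adj v a" "adj p x" "a \<in> set ys" for p u v x a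
    using link_short(2)[OF B[OF that(1)] B[OF that(2)] that(3,7,4-6)] cons_mem that by blast
  have "length ys = 4 \<or> length ys = 5 \<or> length ys = 6 \<or> length ys = 7" using z ys(3) by linarith
  then show ?thesis
  proof (elim disjE)
    assume "length ys = 4"
    then obtain p q r where y: "ys = [w, p, q, r]" using list4 ys(4) by (metis nth_Cons_0)
    have C: "cons ys w p" "cons ys p q" "cons ys q r" "cons ys w r" unfolding y cons4 by auto
    have pr: "p \<noteq> r" using d y by simp
    obtain t where t: "t \<in> set ys" "adj w t" "adj p t" using tt[OF C(1)] by blast
    have "t = q \<or> t = r" using t y adj_irrefl by auto
    then show ?thesis using ls(1,2)[OF C(1,4) pr] t A[OF C(3)] by blast
  next
    assume "length ys = 5"
    then obtain p q r s where y: "ys = [w, p, q, r, s]" using list5 ys(4) by (metis nth_Cons_0)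
    note C = cons5[of w p q r s, folded y]
    have ps: "p \<noteq> s" "q \<noteq> s" "r \<noteq> p" using d y by auto
    note l = ls[OF C(1) cons_sym[OF C(5)] ps(1)]
    have m: "q \<in> set ys" "r \<in> set ys" using y by auto
    obtain t where t: "t \<in> set ys" "adj w t" "adj p t" using tt[OF C(1)] by blast
    have t1: "t = q \<or> t = r \<or> t = s" using t y adj_irrefl by auto
    obtain t' where t': "t' \<in> set ys" "adj w t'" "adj s t'" using tt[OF cons_sym[OF C(5)]] by blast
    have t2: "t' = p \<or> t' = q \<or> t' = r" using t' y adj_irrefl by auto
    have "t \<noteq> s" "t' \<noteq> p" using l(1) t t' adj_sym by blast+
    moreover have "t \<noteq> r" "t' \<noteq> q" using l(2)[of r] l(2)[of q] t t' m A[OF C(2)] A[OF C(4)] by blast+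
    ultimately have "t = q" "t' = r" using t1 t2 by blast+
    then show ?thesis using l(3)[of q r] t t' m ps A[OF C(3)] by blast
  next
    assume l6: "length ys = 6"
    then obtain p q r s v where y: "ys = [w, p, q, r, s, v]" using list6 ys(4) by (metis nth_Cons_0)
    note C = cons6[of w p q r s v, folded y]
    have ps: "p \<noteq> v" "q \<noteq> v" "r \<noteq> p" "r \<noteq> v" "s \<noteq> p" "w \<noteq> q" "w \<noteq> s" using d y by auto
    note l = ls[OF C(1) cons_sym[OF C(6)] ps(1)]
    have m: "q \<in> set ys" "r \<in> set ys" "s \<in> set ys" using y by auto
    obtain t where t: "t \<in> set ys" "adj w t" "adj p t" using tt[OF C(1)] by blast
    have t1: "t = q \<or> t = r \<or> t = s \<or> t = v" using t y adj_irrefl by auto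
    obtain t' where t': "t' \<in> set ys" "adj w t'" "adj v t'" using tt[OF cons_sym[OF C(6)]] by blast
    have t2: "t' = p \<or> t' = q \<or> t' = r \<or> t' = s" using t' y adj_irrefl by auto
    have "t \<noteq> v" "t' \<noteq> p" using l(1) t t' adj_sym by blast+
    moreover have "t \<noteq> s" "t' \<noteq> q" using l(2)[of s] l(2)[of q] t t' m A[OF C(2)] A[OF C(5)] by blast+
    moreover have "\<not> (t = q \<and> t' = r)" "\<not> (t = r \<and> t' = r)" "\<not> (t = r \<and> t' = s)"
      using l(3)[of q r] l(2)[of r] l(3)[of r s] t t' m ps A[OF C(3)] A[OF C(4)] by blast+
    ultimately have "t = q" "t' = s" using t1 t2 by blast+
    then have "\<forall>x. adj p x \<longrightarrow> x \<in> set ys" "\<forall>x. adj v x \<longrightarrow> x \<in> set ys"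
      using short[OF cons_sym[OF C(1)] C(2) ps(6)] short[OF C(6) cons_sym[OF C(5)] ps(7)] t t' by blast+
    then show ?thesis using two[OF C(1) cons_sym[OF C(6)] ps(1)] l6 ys(3) by simp
  next
    assume l7: "length ys = 7"
    then obtain p q r s v u where y: "ys = [w, p, q, r, s, v, u]" using list7 ys(4) by (metis nth_Cons_0)
    note C = cons7[of w p q r s v u, folded y]
    have ps: "p \<noteq> u" "q \<noteq> u" "r \<noteq> p" "r \<noteq> u" "s \<noteq> p" "w \<noteq> q" "w \<noteq> v" "s \<noteq> u" "v \<noteq> p" using d y by auto
    note l = ls[OF C(1) cons_sym[OF C(7)] ps(1)]
    have m: "q \<in> set ys" "r \<in> set ys" "s \<in> set ys" "v \<in> set ys" using y by auto
    obtain t where t: "t \<in> set ys" "adj w t" "adj p t" using tt[OF C(1)] by blast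
    have t1: "t = q \<or> t = r \<or> t = s \<or> t = v \<or> t = u" using t y adj_irrefl by auto
    obtain t' where t': "t' \<in> set ys" "adj w t'" "adj u t'" using tt[OF cons_sym[OF C(7)]] by blast
    have t2: "t' = p \<or> t' = q \<or> t' = r \<or> t' = s \<or> t' = v" using t' y adj_irrefl by auto
    have a: "t \<noteq> u" "t' \<noteq> p" using l(1) t t' adj_sym by blast+
    have b: "t \<noteq> v" "t' \<noteq> q" using l(2)[of v] l(2)[of q] t t' m A[OF C(2)] A[OF C(6)] by blast+
    have c: "\<not> (t = q \<and> t' = r)" "\<not> (t = r \<and> t' = r)" "\<not> (t = r \<and> t' = s)"
      using l(3)[of q r] l(2)[of r] l(3)[of r s] t t' m ps A[OF C(3)] A[OF C(4)] by blast+
    have e: "\<not> (t = s \<and> t' = r)" "\<not> (t = s \<and> t' = s)" "\<not> (t = s \<and> t' = v)"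
      using l(3)[of s r] l(2)[of s] l(3)[of s v] t t' m ps A[OF C(4)] A[OF C(5)] by blast+
    have "t = q \<or> t = r" "t' = s \<or> t' = v" using t1 t2 a b c e by blast+
    have "\<forall>x. adj p x \<longrightarrow> x \<in> set ys" using \<open>t = q \<or> t = r\<close>
      using short[OF cons_sym[OF C(1)] C(2) ps(6)] short2[OF cons_sym[OF C(1)] C(2) ps(6), of r] t m A[OF C(3)] by blast
    moreover have "\<forall>x. adj u x \<longrightarrow> x \<in> set ys" using \<open>t' = s \<or> t' = v\<close>
      using short[OF C(7) cons_sym[OF C(6)] ps(7)] short2[OF C(7) cons_sym[OF C(6)] ps(7), of s] t' m A[OF C(5)] by blast
    ultimately show ?thesis using two[OF C(1) cons_sym[OF C(7)] ps(1)] l7 ys(3) by simp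
  qed
qed

text \<open>A counterexample with exactly four boundary cycles. The following lemmas treat the
  possible graphs of adjacency between the four cycles.\<close>

definition quad :: "'a list \<Rightarrow> 'a list \<Rightarrow> 'a list \<Rightarrow> 'a list \<Rightarrow> bool" where
  "quad a b c d \<longleftrightarrow> \<not> (\<exists>x y. hpath V x y) \<and> card V \<le> 19 \<and> cyc bnd a \<and> cyc bnd b \<and> cyc bnd c \<and> cyc bnd d \<and>
     set a \<union> set b \<union> set c \<union> set d = V \<and> set a \<inter> set b = {} \<and> set a \<inter> set c = {} \<and> set a \<inter> set d = {} \<and>
     set b \<inter> set c = {} \<and> set b \<inter> set d = {} \<and> set c \<inter> set d = {}"

text \<open>These three transpositions generate all permutations of the four cycles.\<close>

lemma quad_swap: "quad a b c d \<Longrightarrow> quad b a c d" "quad a b c d \<Longrightarrow> quad a c b d" "quad a b c d \<Longrightarrow> quad a b d c"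
  unfolding quad_def by (simp_all only: Int_commute Un_ac) blast+

lemma quadD:
  assumes "quad a b c d"
  shows "cyc bnd a" "cyc bnd b" "cyc bnd c" "cyc bnd d" "\<not> (\<exists>x y. hpath V x y)"
    "set a \<union> set b \<union> set c \<union> set d = V"
  using assms unfolding quad_def by blast+

lemma quad_disj:
  assumes "quad a b c d"
  shows "set a \<inter> set b = {}" "set a \<inter> set c = {}" "set a \<inter> set d = {}" "set b \<inter> set c = {}" "set b \<inter> set d = {}" "set c \<inter> set d = {}"
    "set b \<inter> set a = {}" "set c \<inter> set a = {}" "set d \<inter> set a = {}" "set c \<inter> set b = {}" "set d \<inter> set b = {}" "set d \<inter> set c = {}"
  using assms unfolding quad_def by blast+

lemma quad_sub: assumes "quad a b c d" shows "set a \<noteq> V" "length a \<ge> 4"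
proof -
  have "b \<noteq> []" using quadD(2)[OF assms] unfolding cyc_def by auto
  then obtain x where "x \<in> set b" by fastforce
  then have "x \<in> V" "x \<notin> set a" using quad_disj[OF assms] quadD(6)[OF assms] by blast+
  then show "set a \<noteq> V" by blast
  then show "length a \<ge> 4" using bcyc_length quadD(1)[OF assms] by blast
qed

lemma quad_len:
  assumes q: "quad a b c d"
  shows "length a + length b + length c + length d \<le> 19" "length a \<ge> 4" "length b \<ge> 4" "length c \<ge> 4" "length d \<ge> 4"
proof -
  note s = quad_swap
  show "length a \<ge> 4" "length b \<ge> 4" "length c \<ge> 4" "length d \<ge> 4"
    using quad_sub(2)[OF q] quad_sub(2)[OF s(1)[OF q]] quad_sub(2)[OF s(1)[OF s(2)[OF q]]] quad_sub(2)[OF s(1)[OF s(2)[OF s(3)[OF q]]]] by blast+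
  have dl: "card (set x) = length x" if "cyc bnd x" for x using that distinct_card unfolding cyc_def by blast
  note D = quad_disj[OF q]
  have "card V = card (set a \<union> set b \<union> set c \<union> set d)" using quadD(6)[OF q] by simp
  also have "\<dots> = card (set a \<union> set b \<union> set c) + card (set d)" by (rule card_Un_disjoint) (use D in auto)
  also have "card (set a \<union> set b \<union> set c) = card (set a \<union> set b) + card (set c)" by (rule card_Un_disjoint) (use D in auto)
  also have "card (set a \<union> set b) = card (set a) + card (set b)" by (rule card_Un_disjoint) (use D in auto)
  finally show "length a + length b + length c + length d \<le> 19"
    using dl quadD(1-4)[OF q] q unfolding quad_def by simp
qed

text \<open>After the merge three cycles are left. Since \<open>a\<close> and \<open>b\<close> have
  at least 8 vertices, \<open>c\<close> or \<open>d\<close> has length at most 5, and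
  \<open>small_cycle\<close> provides two consecutive vertices on it for a chain.\<close>

lemma quad_merged:
  assumes q: "quad a b c d" and m: "cyc adj ms" "set ms = set a \<union> set b"
    and aj: "ajs (set c) (set d)" "ajs (set ms) (set c)" "ajs (set ms) (set d)"
  shows False
proof -
  have *: False if q: "quad a b c d" and l: "length c \<le> 5"
    and aj: "ajs (set c) (set d)" "ajs (set ms) (set c)" and m: "set ms = set a \<union> set b" for a b c d
  proof -
    note D = quad_disj[OF q]
    have "bclosed (set ms)" unfolding m using bclosed_Un bcyc_bclosed quadD[OF q] by blast
    moreover have "set ms \<inter> set d = {}" "set ms \<union> set d = V - set c" using D quadD(6)[OF q] unfolding m by blast+
    ultimately obtain u v where uv: "cons c u v" "tch u (set ms)" "tch v (set d)"
      using small_cycle[OF quadD(3)[OF q] l _ bcyc_bclosed[OF quadD(4)[OF q]]] aj ajs_sym by blast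
    have "\<exists>x y. hpath (set ms \<union> set c \<union> set d) x y"
      by (rule chain3[OF \<open>cyc adj ms\<close> cyc_mono[OF quadD(3)[OF q]] cyc_mono[OF quadD(4)[OF q]] uv]) (use D m in auto)
    then show False using quadD(5,6)[OF q] unfolding m by simp
  qed
  have "length c \<le> 5 \<or> length d \<le> 5" using quad_len[OF q] by linarith
  then show False using *[OF q] *[OF quad_swap(3)[OF q]] aj ajs_sym m(2) by blast
qed

lemma quad_chain:
  assumes q: "quad a b c d" and b: "cons b u v" "tch u (set a)" and c: "adj v p" "cons c p r" "tch r (set d)"
  shows False
proof -
  note D = quad_disj[OF q]
  obtain x where x: "x \<in> set a" "adj u x" using b(2) unfolding tch_def by blast
  obtain y where y: "y \<in> set d" "adj r y" using c(3) unfolding tch_def by blast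
  obtain a' where a': "hpath (set a) a' x" using hpath_end cyc_mono[OF quadD(1)[OF q]] x by blast
  obtain d' where d': "hpath (set d) d' y" using hpath_end cyc_mono[OF quadD(4)[OF q]] y by blast
  have "hpath (set c \<union> set d) p d'"
    by (rule hpath_append[OF cyc_hpath[OF cyc_mono[OF quadD(3)[OF q]] c(2)] hpath_sym[OF d'] y(2)]) (use D in auto)
  then have "hpath (set a \<union> set b \<union> (set c \<union> set d)) a' d'"
    by (intro hpath_chain[OF cyc_mono[OF quadD(2)[OF q]] b(1) a' adj_sym[OF x(2)] _ c(1)]) (use D in auto)
  then show False using quadD(5,6)[OF q] by (simp add: Un_ac)
qed

lemma quad_out: assumes "quad a b c d" "adj x y" shows "y \<in> set a \<or> y \<in> set b \<or> y \<in> set c \<or> y \<in> set d"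
  using adj_V2[OF assms(2)] quadD(6)[OF assms(1)] by blast

text \<open>Otherwise chain \<open>c\<close>, \<open>b\<close> from \<open>w'\<close> to
  \<open>w\<close>, \<open>a\<close> and \<open>d\<close>. The vertex \<open>w\<close> sees two
  consecutive vertices of the 4-cycle \<open>a\<close>, so one of them is consecutive to the vertex
  \<open>t\<close> that sees \<open>d\<close>.\<close>

lemma apex_neighbours:
  assumes q: "quad a b c d" "length a = 4" and w: "cons a x y" "w \<in> set b" "adj w x" "adj w y"
    and aj: "ajs (set a) (set d)" and w': "cons b w w'"
  shows "\<not> tch w' (set c)"
proof
  assume h: "tch w' (set c)"
  obtain t where t: "t \<in> set a" "tch t (set d)" using aj unfolding ajs_def tch_def by blast
  obtain e where e: "adj w e" "cons a e t" using entry4[OF q(2) w(1,3,4) t(1)] by blast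
  have "quad c b a d" using quad_swap(2)[OF quad_swap(1)[OF quad_swap(2)[OF q(1)]]] .
  then show False using quad_chain cons_sym[OF w'] h e t(2) by blast
qed

text \<open>The triangle on a cycle edge at \<open>w\<close> has its apex in \<open>b\<close>: an
  apex in \<open>a\<close> would allow an exchange, and one in \<open>c\<close> or \<open>d\<close>
  contradicts \<open>apex_neighbours\<close>. So \<open>ear_unlabelled\<close> applies.\<close>

lemma apex_ear:
  assumes q: "quad a b c d" "length a = 4" and w: "cons a x y" "w \<in> set b" "adj w x" "adj w y"
    and aj: "ajs (set a) (set c)" "ajs (set a) (set d)" and nm: "\<And>u v. cons b u v \<Longrightarrow> \<not> tm a u v"
  shows "length b \<ge> 6 \<and> (\<forall>w'. cons b w w' \<longrightarrow> (\<forall>x. adj w' x \<longrightarrow> x \<in> set b))"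
proof (rule ear_unlabelled[OF quadD(2)[OF q(1)] _ _ w(2,3)])
  show "length b \<le> 7" "4 \<le> length b" using quad_len[OF q(1)] q(2) by linarith+
  show "x \<notin> set b" using cons_mem[OF w(1)] quad_disj[OF q(1)] by blast
  fix w' assume w': "cons b w w'"
  have "adj w w'" using cyc_cons[OF quadD(2)[OF q(1)] symp_bnd w'] bnd_adj by blast
  then obtain t where t: "adj w t" "adj w' t" using adj_imp_common by blast
  have "t \<notin> set a"
  proof
    assume "t \<in> set a"
    then obtain e where "adj w e" "cons a e t" using entry4[OF q(2) w(1,3,4)] by blast
    then have "tm a w w'" unfolding tm_def using t cons_sym by blast
    then show False using nm w' by blast
  qed
  moreover have "t \<notin> set c" using apex_neighbours[OF q w aj(2) w'] t unfolding tch_def by blast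
  moreover have "t \<notin> set d" using apex_neighbours[OF quad_swap(3)[OF q(1)] q(2) w aj(1) w'] t unfolding tch_def by blast
  ultimately show "\<exists>t\<in>set b. adj w t \<and> adj w' t" using quad_out[OF q(1) t(1)] t by blast
qed

text \<open>By \<open>apex_ear\<close> the cycles \<open>c\<close> and \<open>d\<close> are too
  short to contain an apex over an edge of \<open>a\<close>, so all apexes lie in \<open>b\<close>.
  Let \<open>x\<close> in \<open>a\<close> see \<open>c\<close>. The apexes of its two boundary
  edges are distinct and not adjacent, since the link of \<open>x\<close> also contains a vertex of
  \<open>c\<close>; but by \<open>isolated_labels_adjacent\<close> they are adjacent.\<close>

lemma four_cycle_three_labels_aux:
  assumes q: "quad a b c d" "length a = 4" "length c \<le> 5" "length d \<le> 5"
    and aj: "ajs (set a) (set b)" "ajs (set a) (set c)" "ajs (set a) (set d)"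
    and nm: "\<And>u v. cons b u v \<Longrightarrow> \<not> tm a u v" "\<And>u v. cons c u v \<Longrightarrow> \<not> tm a u v" "\<And>u v. cons d u v \<Longrightarrow> \<not> tm a u v"
  shows False
proof -
  have qc: "quad a c b d" "quad a d b c" using quad_swap(2)[OF q(1)] quad_swap(2)[OF quad_swap(3)[OF q(1)]] .
  have ap: "\<exists>w\<in>set b. adj w x \<and> adj w y" if xy: "cons a x y" for x y
  proof -
    obtain w where w: "adj w x" "adj w y" "w \<notin> set a" using apex4[OF quadD(1)[OF q(1)] q(2) quad_sub(1)[OF q(1)] xy] by blast
    have "w \<notin> set c" using apex_ear[OF qc(1) q(2) xy _ w(1,2) aj(1,3) nm(2)] q(3) by auto
    moreover have "w \<notin> set d" using apex_ear[OF qc(2) q(2) xy _ w(1,2) aj(1,2) nm(3)] q(4) by auto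
    ultimately show ?thesis using quad_out[OF q(1) adj_sym[OF w(1)]] w by blast
  qed
  have iso: "length b \<ge> 6" "cons b w w' \<Longrightarrow> \<not> tch w' (V - set b)" if "cons a x y" "w \<in> set b" "adj w x" "adj w y" for x y w w'
    using apex_ear[OF q(1,2) that aj(2,3) nm(1)] unfolding tch_def by blast+
  obtain x z where x: "x \<in> set a" "z \<in> set c" "adj x z" using aj(2) unfolding ajs_def by blast
  obtain y y' where y: "y \<noteq> y'" "cons a x y" "cons a x y'" using cons_ex[OF quadD(1)[OF q(1)] x(1)] by blast
  obtain w where w: "w \<in> set b" "adj w x" "adj w y" using ap[OF y(2)] by blast
  obtain w' where w': "w' \<in> set b" "adj w' x" "adj w' y'" using ap[OF y(3)] by blast
  have B: "bnd x y" "bnd x y'" using cyc_cons[OF quadD(1)[OF q(1)] symp_bnd] y by blast+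
  note D = quad_disj[OF q(1)]
  have za: "z \<noteq> y" "z \<noteq> y'" "z \<noteq> w" "z \<noteq> w'" "w \<noteq> y'" "w' \<noteq> y"
    using cons_mem[OF y(2)] cons_mem[OF y(3)] x w w' D by blast+
  note sh = link_short[OF B y(1) x(3)]
  have ne: "w \<noteq> w'" using sh(2)[of w] za w w' adj_sym by blast
  have "set a \<subseteq> V - set b" using quadD(6)[OF q(1)] D by blast
  then have tl: "tch w (V - set b)" "tch w' (V - set b)" using w w' x unfolding tch_def by blast+
  have "length b = 6 \<or> length b = 7" using iso(1)[OF y(2) w] quad_len[OF q(1)] by linarith
  then have "adj w w'"
    using isolated_labels_adjacent[OF quadD(2)[OF q(1)] _ w(1) tl(1) w'(1) tl(2) ne] iso(2)[OF y(2) w] iso(2)[OF y(3) w'] by blast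
  then show False using sh(3)[of w w'] za w w' adj_sym by blast
qed

lemma four_cycle_three_labels:
  assumes q: "quad a b c d" "length a = 4"
    and aj: "ajs (set a) (set b)" "ajs (set a) (set c)" "ajs (set a) (set d)"
    and nm: "\<And>u v. cons b u v \<Longrightarrow> \<not> tm a u v" "\<And>u v. cons c u v \<Longrightarrow> \<not> tm a u v" "\<And>u v. cons d u v \<Longrightarrow> \<not> tm a u v"
  shows False
proof -
  have qc: "quad a c b d" "quad a d b c" using quad_swap(2)[OF q(1)] quad_swap(2)[OF quad_swap(3)[OF q(1)]] .
  consider "length c \<le> 5" "length d \<le> 5" | "length b \<le> 5" "length d \<le> 5" | "length b \<le> 5" "length c \<le> 5"
    using quad_len[OF q(1)] by linarith
  then show False
  proof cases
    case 1 then show False using four_cycle_three_labels_aux[OF q] aj nm by blast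
  next
    case 2 then show False using four_cycle_three_labels_aux[OF qc(1) q(2)] aj nm by blast
  next
    case 3 then show False using four_cycle_three_labels_aux[OF qc(2) q(2)] aj nm by blast
  qed
qed

text \<open>After any merge the three remaining cycles are pairwise adjacent, which
  \<open>quad_merged\<close> excludes, except when \<open>b\<close> and \<open>d\<close> are merged
  while \<open>a\<close> and \<open>c\<close> are not adjacent. In this case the merged cycle
  separates \<open>a\<close> from \<open>c\<close>.\<close>

lemma quad_no_merge:
  assumes q: "quad a b c d" and aj: "ajs (set a) (set b)" "ajs (set a) (set d)" "ajs (set b) (set c)" "ajs (set b) (set d)" "ajs (set c) (set d)"
    and m: "cyc adj ms" "set ms = set x \<union> set y"
    and xy: "(x, y) \<in> {(a, b), (a, c), (a, d), (b, c), (b, d), (c, d)}"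
  shows False
proof -
  have s: "quad a d b c" "quad b c a d" "quad c d a b" "quad a c b d" "quad b d a c"
    using quad_swap[OF q] quad_swap quad_swap by meson+
  note aj' = aj aj[THEN ajs_sym]
  have U: "ajs (set p \<union> set p') Z" if "ajs (set p) Z \<or> ajs (set p') Z" for p p' Z using that unfolding ajs_def by blast
  have ab: False if "cyc adj ms" "set ms = set a \<union> set b" for ms
    using quad_merged[OF q that aj(5)] unfolding that(2) using U aj' by blast
  have ad: False if "cyc adj ms" "set ms = set a \<union> set d" for ms
    using quad_merged[OF s(1) that aj(3)] unfolding that(2) using U aj' by blast
  have bc: False if "cyc adj ms" "set ms = set b \<union> set c" for ms
    using quad_merged[OF s(2) that aj(2)] unfolding that(2) using U aj' by blast
  have cd: False if "cyc adj ms" "set ms = set c \<union> set d" for ms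
    using quad_merged[OF s(3) that aj(1)] unfolding that(2) using U aj' by blast
  have ac: False if "cyc adj ms" "set ms = set a \<union> set c" for ms
    using quad_merged[OF s(4) that aj(4)] unfolding that(2) using U aj' by blast
  have bd: False if ms: "cyc adj ms" "set ms = set b \<union> set d" for ms
  proof (cases "ajs (set a) (set c)")
    case True
    then show False using quad_merged[OF s(5) ms] unfolding ms(2) using U aj' by blast
  next
    case False
    note D = quad_disj[OF q]
    have t: False if h: "cyc bnd z" "cons z u v" "set p \<inter> set z = {}" "cyc bnd p" "tm p u v"
      "(p, z) \<in> {(a, b), (a, d), (c, b), (c, d)}" for p z u v
    proof -
      obtain ws where "cyc adj ws" "set ws = set p \<union> set z" using tm_square[OF h(4) cyc_mono[OF h(1)] h(3,2,5)] by blast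
      then show False using ab ad bc cd h(6) by (auto simp: Un_commute)
    qed
    have "card V \<ge> 20"
    proof (rule separated_card_ge_20[OF quadD(5)[OF q] quadD(1,3)[OF q] ms(1) _ _ _ D(2) False])
      show "set a \<union> set ms \<union> set c = V" using quadD(6)[OF q] unfolding ms(2) by blast
      show "set ms \<inter> set a = {}" "set ms \<inter> set c = {}" using D unfolding ms(2) by blast+
      show "ajs (set ms) (set a)" "ajs (set ms) (set c)" unfolding ms(2) using U aj' by blast+
      fix u v assume h: "u \<in> set ms" "bnd u v"
      have "cons b u v \<or> cons d u v" using h bcyc_cons_iff quadD(2,4)[OF q] unfolding ms(2) by blast
      then show "\<not> tm a u v \<and> \<not> tm c u v"
        using t[of b u v a] t[of b u v c] t[of d u v a] t[of d u v c] quadD(1-4)[OF q] D by auto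
    qed
    then show False using q unfolding quad_def by linarith
  qed
  show False using xy m ab ac ad bc bd cd by auto
qed

section \<open>Three cycles that see only the fourth, and preparations for the other
  patterns\<close>

lemma consecutive_pair:
  assumes "cyc R xs" "S \<subseteq> set xs" "length xs < 2 * card S"
  shows "\<exists>u\<in>S. \<exists>v\<in>S. cons xs u v"
proof (rule ccontr)
  assume n: "\<not> ?thesis"
  have d: "distinct xs" using assms unfolding cyc_def by blast
  have b: "inj_on (nx xs) S" "nx xs ` S \<subseteq> set xs"
    using nx_bij[OF assms(1)] assms(2) unfolding bij_betw_def by (auto intro: inj_on_subset)
  have "S \<inter> nx xs ` S = {}" using n nx_cons[OF d] assms(2) by blast
  then have "card (S \<union> nx xs ` S) = 2 * card S"
    using card_Un_disjoint[of S "nx xs ` S"] card_image[OF b(1)] finite_subset[OF assms(2)] by simp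
  then show False using card_le_subset[of "S \<union> nx xs ` S" xs] assms b by simp
qed

text \<open>The merged cycle retains all edges of \<open>xs\<close> but one, so that a further cycle
  can be merged at another edge of \<open>xs\<close>.\<close>

lemma merge_cycles_keep:
  assumes xs: "cyc adj xs" and ys: "cyc adj ys" and dis: "set xs \<inter> set ys = {}"
    and c: "cons xs u u'" "cons ys v v'" "adj u v" "adj u' v'"
  shows "\<exists>zs. cyc adj zs \<and> set zs = set xs \<union> set ys \<and> (\<forall>a b. cons xs a b \<longrightarrow> {a, b} \<noteq> {u, u'} \<longrightarrow> cons zs a b)"
proof -
  have main: ?thesis if i: "i < length xs" "{u, u'} = {x, x'}" "x = xs ! i" "x' = xs ! (Suc i mod length xs)" and
    c: "cons ys y y'" "adj x y" "adj x' y'" for x x' y y' i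
  proof -
    let ?r = "rotate (Suc i) xs"
    have l: "length xs \<ge> 3" "distinct xs" "xs \<noteq> []" using xs unfolding cyc_def by auto
    have r: "cyc adj ?r" "length ?r = length xs" "set ?r = set xs" using cyc_rotate[OF xs] by blast+
    have hr: "?r ! 0 = x'" using nth_rotate[of 0 xs "Suc i"] i l by simp
    have lr: "?r ! (length xs - 1) = x"
    proof -
      have "?r ! (length xs - 1) = xs ! ((Suc i + (length xs - 1)) mod length xs)" by (rule nth_rotate) (use l in auto)
      also have "Suc i + (length xs - 1) = i + length xs" using i by linarith
      also have "(i + length xs) mod length xs = i" using i by simp
      finally show ?thesis using i by simp
    qed
    obtain p where p: "p \<noteq> []" "distinct p" "set p = set ys" "hd p = y" "last p = y'" "successively adj p"
      using cyc_hpath[OF ys c(1)] unfolding hpath_def by blast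
    let ?z = "?r @ p"
    have "adj (?z ! j) (?z ! (Suc j mod length ?z))" if j: "j < length ?z" for j
    proof -
      consider "Suc j < length xs" | "Suc j = length xs" | "length xs \<le> j" "Suc j < length ?z" | "Suc j = length ?z" using j by fastforce
      then show ?thesis
      proof cases
        case 1
        then have "j < length ?r" "Suc j mod length ?r = Suc j" by auto
        then have "adj (?r ! j) (?r ! Suc j)" using r(1) unfolding cyc_def by metis
        then show ?thesis using 1 by (simp add: nth_append del: rotate_Suc)
      next
        case 2
        then have j: "j = length xs - 1" by simp
        have "?z ! j = x" "?z ! (Suc j mod length ?z) = y" using lr p 2 unfolding j by (auto simp: nth_append hd_conv_nth)
        then show ?thesis using c by simp
      next
        case 3
        then have "adj (p ! (j - length xs)) (p ! Suc (j - length xs))" using p(6) unfolding successively_conv_nth by simp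
        then show ?thesis using 3 by (simp add: nth_append Suc_diff_le)
      next
        case 4
        then have e: "j = length xs + (length p - 1)" using p by (cases p) auto
        moreover have "Suc j mod length ?z = 0" using 4 by (metis mod_self)
        ultimately have "?z ! j = y'" "?z ! (Suc j mod length ?z) = x'" using hr p l by (auto simp: nth_append last_conv_nth simp del: rotate_Suc)
        then show ?thesis using c adj_sym by simp
      qed
    qed
    then have "cyc adj ?z" using l r p dis unfolding cyc_def by auto
    moreover have "cons ?z a b" if ab: "cons xs a b" "{a, b} \<noteq> {u, u'}" for a b
    proof -
      have "cons ?r a b" using ab cons_rotate l(3) by blast
      then obtain j where j: "j < length xs" "a = ?r ! j \<and> b = ?r ! (Suc j mod length xs) \<or> b = ?r ! j \<and> a = ?r ! (Suc j mod length xs)"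
        unfolding cons_def by auto
      have "Suc j \<noteq> length xs"
      proof
        assume e: "Suc j = length xs"
        then have "j = length xs - 1" by simp
        then have "?r ! j = x" "?r ! (Suc j mod length xs) = x'" using lr hr e by simp_all
        then have "{a, b} = {x, x'}" using j(2) by auto
        then show False using ab(2) i(2) by simp
      qed
      then have s: "Suc j < length xs" using j(1) by linarith
      then have "?z ! j = ?r ! j" "?z ! (Suc j mod length ?z) = ?r ! (Suc j mod length xs)" "j < length ?z" by (simp_all add: nth_append)
      then show ?thesis using j(2) unfolding cons_def by metis
    qed
    ultimately show ?thesis using r p by (intro exI[of _ ?z]) auto
  qed
  obtain i where "i < length xs" "u = xs ! i \<and> u' = xs ! (Suc i mod length xs) \<or> u' = xs ! i \<and> u = xs ! (Suc i mod length xs)"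
    using c(1) unfolding cons_def by blast
  then show ?thesis using main[of i u u' v v'] main[of i u' u v' v] c(2-) cons_sym by blast
qed

lemma quad_front:
  assumes q: "quad a b c d" and na: "\<not> ajs (set a) (set b)" "\<not> ajs (set a) (set c)"
  shows "fl (set a) (L (set d) (set a))"
proof (rule fl_L[OF bcyc_bclosed[OF quadD(1)[OF q]] quad_disj(9)[OF q]])
  fix u p assume "adj u p" "p \<notin> set d" "p \<notin> set a"
  then have "p \<in> set b \<union> set c" using quad_out[OF q] by blast
  then show "\<not> tch p (set a)" using na adj_sym unfolding ajs_def tch_def by blast
qed

text \<open>When \<open>a\<close> has length 4, the cycle \<open>d\<close> has at most 7 vertices,
  so four labelled vertices on it include two consecutive ones, against
  \<open>c4_no_tm\<close>.\<close>

lemma quad_front_card: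
  assumes q: "quad a b c d" and na: "\<not> ajs (set a) (set b)" "\<not> ajs (set a) (set c)" and ad: "ajs (set a) (set d)"
    and nm: "\<And>u v. cons d u v \<Longrightarrow> \<not> tm a u v"
  shows "card (L (set d) (set a)) \<ge> 4" "length a = 4 \<Longrightarrow> card (L (set d) (set a)) \<ge> 5"
proof -
  note f = quad_front[OF q na]
  have s: "L (set d) (set a) \<subseteq> set d" unfolding L_def by blast
  have ne: "L (set d) (set a) \<noteq> {}" using ajs_L ajs_sym[OF ad] by blast
  show c4: "card (L (set d) (set a)) \<ge> 4" using fl_card[OF f ne] finite_subset[OF s] by simp
  assume l: "length a = 4"
  show "card (L (set d) (set a)) \<ge> 5"
  proof (rule ccontr)
    assume "\<not> ?thesis"
    then have e: "card (L (set d) (set a)) = 4" using c4 by linarith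
    have "length d \<le> 7" using quad_len[OF q] l by linarith
    then obtain u v where uv: "u \<in> L (set d) (set a)" "v \<in> L (set d) (set a)" "cons d u v"
      using consecutive_pair[OF quadD(4)[OF q] s] e by auto
    have "adj u v" using cyc_cons[OF quadD(4)[OF q] symp_bnd uv(3)] bnd_adj by blast
    then show False using c4_no_tm[OF quadD(1)[OF q] l quad_sub(1)[OF q] f e uv(1,2)] nm uv(3) cons_sym by blast
  qed
qed

text \<open>Orient the three sections at \<open>u\<close> by increasing position. Their last flanks
  and the smallest first flank are four pairwise nonadjacent vertices of \<open>d\<close>, but on at
  most 7 vertices two of them would be consecutive.\<close>

lemma three_sections:
  assumes q: "quad a b c d" "length d \<le> 7" and na: "\<not> ajs (set a) (set b)" "\<not> ajs (set a) (set c)" "\<not> ajs (set b) (set c)"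
    and u: "u \<in> set d" "tch u (set a)" "tch u (set b)" "tch u (set c)"
  shows False
proof -
  note D = quad_disj[OF q(1)]
  have mk: "\<exists>p r. adj u p \<and> adj u r \<and> p \<in> set d \<and> r \<in> set d \<and> Suc (pos u p) < pos u r \<and>
      (\<forall>x. adj u x \<longrightarrow> pos u p < pos u x \<longrightarrow> pos u x < pos u r \<longrightarrow> x \<in> set z)"
    if z: "cyc bnd z" "u \<notin> set z" "tch u (set z)" "\<And>x y. adj x y \<Longrightarrow> x \<in> set z \<Longrightarrow> y \<notin> set z \<Longrightarrow> y \<in> set d" for z
  proof -
    obtain x where "x \<in> set z" "adj u x" using z(3) unfolding tch_def by blast
    then obtain p r where s: "sec (set z) u p r" using sec_exists bclosed_outside[OF bcyc_bclosed[OF z(1)] z(2)] by blast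
    have fl: "y \<in> set d" if s: "sec (set z) u y y'" for y y'
      using sec_mid[OF s] sec_adj[OF s] z(4) adj_sym by blast
    show ?thesis
    proof (cases "pos u p < pos u r")
      case True
      then show ?thesis using s fl[OF s] fl[OF sec_sym[OF s]] unfolding sec_def by (intro exI[of _ p] exI[of _ r]) auto
    next
      case False
      then show ?thesis using s fl[OF s] fl[OF sec_sym[OF s]] unfolding sec_def by (intro exI[of _ r] exI[of _ p]) auto
    qed
  qed
  have un: "u \<notin> set a" "u \<notin> set b" "u \<notin> set c" using u D by blast+
  have od: "y \<in> set d" if "adj x y" "x \<in> set a \<and> y \<notin> set a \<or> x \<in> set b \<and> y \<notin> set b \<or> x \<in> set c \<and> y \<notin> set c" for x y
    using quad_out[OF q(1) that(1)] that na adj_sym unfolding ajs_def by blast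
  obtain p1 r1 where 1: "adj u p1" "adj u r1" "p1 \<in> set d" "r1 \<in> set d" "Suc (pos u p1) < pos u r1"
    "\<And>x. adj u x \<Longrightarrow> pos u p1 < pos u x \<Longrightarrow> pos u x < pos u r1 \<Longrightarrow> x \<in> set a"
    using mk[OF quadD(1)[OF q(1)] un(1) u(2)] od by blast
  obtain p2 r2 where 2: "adj u p2" "adj u r2" "p2 \<in> set d" "r2 \<in> set d" "Suc (pos u p2) < pos u r2"
    "\<And>x. adj u x \<Longrightarrow> pos u p2 < pos u x \<Longrightarrow> pos u x < pos u r2 \<Longrightarrow> x \<in> set b"
    using mk[OF quadD(2)[OF q(1)] un(2) u(3)] od by blast
  obtain p3 r3 where 3: "adj u p3" "adj u r3" "p3 \<in> set d" "r3 \<in> set d" "Suc (pos u p3) < pos u r3"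
    "\<And>x. adj u x \<Longrightarrow> pos u p3 < pos u x \<Longrightarrow> pos u x < pos u r3 \<Longrightarrow> x \<in> set c"
    using mk[OF quadD(3)[OF q(1)] un(3) u(4)] od by blast
  have apart: "Suc (pos u r) < pos u r' \<or> Suc (pos u r') < pos u r"
    if h: "adj u p" "adj u r" "p \<in> set d" "r \<in> set d" "Suc (pos u p) < pos u r" "\<And>x. adj u x \<Longrightarrow> pos u p < pos u x \<Longrightarrow> pos u x < pos u r \<Longrightarrow> x \<in> X"
      "adj u p'" "adj u r'" "p' \<in> set d" "r' \<in> set d" "Suc (pos u p') < pos u r'" "\<And>x. adj u x \<Longrightarrow> pos u p' < pos u x \<Longrightarrow> pos u x < pos u r' \<Longrightarrow> x \<in> Y"
      "X \<inter> Y = {}" "X \<inter> set d = {}" "Y \<inter> set d = {}" for p r p' r' X Y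
  proof (rule ccontr)
    assume n: "\<not> ?thesis"
    have 1: "r' \<notin> X" "r \<notin> Y" using h by blast+
    have "\<not> pos u r' < pos u r" using n h(6)[OF h(8)] 1 h(5) by linarith
    moreover have "\<not> pos u r < pos u r'" using n h(12)[OF h(2)] 1 h(11) by linarith
    ultimately have e: "pos u r = pos u r'" by linarith
    obtain x where x: "adj u x" "pos u x = pos u r - 1" using pos_surj[of u "pos u r - 1"] pos_less[OF h(2)] adj_V h(1) by fastforce
    then have "x \<in> X" "x \<in> Y" using h(6)[OF x(1)] h(12)[OF x(1)] h(5,11) e by linarith+
    then show False using h(13) by blast
  qed
  have r: "Suc (pos u r1) < pos u r2 \<or> Suc (pos u r2) < pos u r1" "Suc (pos u r1) < pos u r3 \<or> Suc (pos u r3) < pos u r1"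
    "Suc (pos u r2) < pos u r3 \<or> Suc (pos u r3) < pos u r2"
    using apart[OF 1 2 D(1,3,5)] apart[OF 1 3 D(2,3,6)] apart[OF 2 3 D(4,5,6)] by blast+
  have nadj: "x \<noteq> y \<and> \<not> adj x y" if "adj u x" "adj u y" "Suc (pos u x) < pos u y \<or> Suc (pos u y) < pos u x" for x y
  proof -
    have "\<not> (pos u x = Suc (pos u y) \<or> pos u y = Suc (pos u x))" "pos u x \<noteq> pos u y" using that(3) by linarith+
    then show ?thesis using adj_pos[OF that(1,2)] by blast
  qed
  obtain p where p: "adj u p" "p \<in> set d" "Suc (pos u p) < pos u r1" "Suc (pos u p) < pos u r2" "Suc (pos u p) < pos u r3"
  proof (cases "pos u p1 \<le> pos u p2 \<and> pos u p1 \<le> pos u p3")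
    case True then show ?thesis using that[of p1] 1 2 3 by linarith
  next
    case False
    then show ?thesis
    proof (cases "pos u p2 \<le> pos u p3")
      case True then show ?thesis using that[of p2] 1 2 3 False by linarith
    next
      case f: False then show ?thesis using that[of p3] 1 2 3 False by linarith
    qed
  qed
  let ?S = "{p, r1, r2, r3}"
  have na': "p \<noteq> r1 \<and> \<not> adj p r1" "p \<noteq> r2 \<and> \<not> adj p r2" "p \<noteq> r3 \<and> \<not> adj p r3"
    "r1 \<noteq> r2 \<and> \<not> adj r1 r2" "r1 \<noteq> r3 \<and> \<not> adj r1 r3" "r2 \<noteq> r3 \<and> \<not> adj r2 r3"
    using nadj[OF p(1) 1(2)] nadj[OF p(1) 2(2)] nadj[OF p(1) 3(2)] nadj[OF 1(2) 2(2)] nadj[OF 1(2) 3(2)] nadj[OF 2(2) 3(2)] r p by blast+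
  have "card ?S = 4" using na' by simp
  moreover have "?S \<subseteq> set d" using p 1 2 3 by blast
  ultimately obtain x y where xy: "x \<in> ?S" "y \<in> ?S" "cons d x y"
    using consecutive_pair[OF quadD(4)[OF q(1)], of ?S] q(2) by auto
  have "adj x y" using cyc_cons[OF quadD(4)[OF q(1)] symp_bnd xy(3)] bnd_adj by blast
  then show False using xy(1,2) na' adj_sym adj_irrefl by auto
qed

text \<open>The merge of \<open>a\<close> and \<open>d\<close> would separate \<open>b\<close> from
  \<open>c\<close>. An exchange of \<open>b\<close> or \<open>c\<close> at an edge of
  \<open>d\<close> uses an edge other than \<open>uv\<close>, because the only triangle on
  \<open>uv\<close> has its apex in \<open>a\<close>; this edge is kept, so \<open>b\<close> or
  \<open>c\<close> could be merged too and joined to the remaining cycle.\<close>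

lemma star_no_merge:
  assumes q: "quad a b c d" and na: "\<not> ajs (set a) (set b)" "\<not> ajs (set a) (set c)" "\<not> ajs (set b) (set c)"
    and aj: "ajs (set a) (set d)" "ajs (set b) (set d)" "ajs (set c) (set d)" and uv: "cons d u v"
  shows "\<not> tm a u v"
proof
  assume t: "tm a u v"
  note D = quad_disj[OF q]
  obtain x y where xy: "cons a x y" "adj u x" "adj v x" "adj u y" using t unfolding tm_def by blast
  obtain ms where ms: "cyc adj ms" "set ms = set d \<union> set a" "\<And>p r. cons d p r \<Longrightarrow> {p, r} \<noteq> {v, u} \<Longrightarrow> cons ms p r"
    using merge_cycles_keep[OF cyc_mono[OF quadD(4)[OF q]] cyc_mono[OF quadD(1)[OF q]] D(9) cons_sym[OF uv] xy(1,3,4)] by blast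
  have buv: "bnd u v" using cyc_cons[OF quadD(4)[OF q] symp_bnd uv] .
  have *: False if h: "cons d p r" "tm e p r" "cyc bnd e" "cyc bnd f" "set e \<inter> set a = {}" "set e \<inter> set d = {}" "set f \<inter> set a = {}" "set f \<inter> set d = {}"
      "set e \<inter> set f = {}" "set a \<union> set e \<union> set f \<union> set d = V" "ajs (set f) (set d)" for p r e f
  proof -
    obtain z where z: "z \<in> set e" "adj p z" "adj r z" using h(2) cons_mem unfolding tm_def by blast
    have "{p, r} \<noteq> {v, u}"
    proof
      assume "{p, r} = {v, u}"
      then have "adj u z" "adj v z" using z by (auto simp: doubleton_eq_iff)
      then have "z = x" using bnd_common_unique[OF buv] xy by blast
      then show False using z(1) cons_mem[OF xy(1)] h(5) by blast
    qed
    then have c: "cons ms p r" using ms(3) h(1) by blast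
    have "set e \<inter> set ms = {}" using h ms(2) by blast
    then obtain ws where ws: "cyc adj ws" "set ws = set e \<union> set ms" using tm_square[OF h(3) ms(1) _ c h(2)] by blast
    have "ajs (set ws) (set f)" using h(11) ajs_sym ws(2) ms(2) unfolding ajs_def by blast
    moreover have "set ws \<inter> set f = {}" "set ws \<union> set f = V" using h ws(2) ms(2) by blast+
    ultimately show False using join2[OF ws(1) cyc_mono[OF h(4)]] quadD(5)[OF q] by metis
  qed
  have nb: "\<not> tm b p r" "\<not> tm c p r" if "cons d p r" for p r
    using *[OF that _ quadD(2,3)[OF q] D(7,5,8,6,4) quadD(6)[OF q] aj(3)]
      *[OF that _ quadD(3,2)[OF q] D(8,6,7,5,10) _ aj(2)] quadD(6)[OF q] by blast+
  have "card V \<ge> 20"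
  proof (rule separated_card_ge_20[OF quadD(5)[OF q] quadD(2,3)[OF q] ms(1) _ _ _ D(4) na(3)])
    show "set b \<union> set ms \<union> set c = V" using quadD(6)[OF q] unfolding ms(2) by blast
    show "set ms \<inter> set b = {}" "set ms \<inter> set c = {}" using D unfolding ms(2) by blast+
    show "ajs (set ms) (set b)" "ajs (set ms) (set c)" unfolding ms(2) using aj ajs_sym unfolding ajs_def by blast+
    fix p r assume h: "p \<in> set ms" "bnd p r"
    show "\<not> tm b p r \<and> \<not> tm c p r"
    proof (cases "p \<in> set d")
      case True
      then show ?thesis using nb h bcyc_cons_iff[OF quadD(4)[OF q]] by blast
    next
      case False
      then have "p \<in> set a" using h ms(2) by blast
      then show ?thesis using na cons_mem unfolding tm_def ajs_def by blast
    qed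
  qed
  then show False using q unfolding quad_def by linarith
qed

text \<open>No vertex of \<open>d\<close> has three labels, so the numbers of labels add up to at
  most \<open>2 * length d\<close>. For each outer cycle its length plus its number of labels on
  \<open>d\<close> is at least 9. Hence 27 is at most the sum of all lengths plus
  \<open>length d\<close>, so \<open>length d\<close> is at least 8, while it is at most 7.\<close>

lemma no_star:
  assumes q: "quad a b c d" and na: "\<not> ajs (set a) (set b)" "\<not> ajs (set a) (set c)" "\<not> ajs (set b) (set c)"
    and aj: "ajs (set a) (set d)" "ajs (set b) (set d)" "ajs (set c) (set d)"
  shows False
proof -
  have na': "\<not> ajs (set b) (set a)" "\<not> ajs (set c) (set a)" "\<not> ajs (set c) (set b)" using na ajs_sym by blast+
  have qb: "quad b a c d" "quad c a b d" using quad_swap(1)[OF q] quad_swap(1)[OF quad_swap(2)[OF q]] .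
  let ?A = "L (set d) (set a)" and ?B = "L (set d) (set b)" and ?C = "L (set d) (set c)"
  have A: "card ?A \<ge> 4" "length a = 4 \<Longrightarrow> card ?A \<ge> 5"
    using quad_front_card[OF q na(1,2) aj(1) star_no_merge[OF q na aj]] by blast+
  have B: "card ?B \<ge> 4" "length b = 4 \<Longrightarrow> card ?B \<ge> 5"
    using quad_front_card[OF qb(1) na'(1) na(3) aj(2) star_no_merge[OF qb(1) na'(1) na(3,2) aj(2,1,3)]] by blast+
  have C: "card ?C \<ge> 4" "length c = 4 \<Longrightarrow> card ?C \<ge> 5"
    using quad_front_card[OF qb(2) na'(2,3) aj(3) star_no_merge[OF qb(2) na'(2,3) na(1) aj(3,1,2)]] by blast+
  note l = quad_len[OF q]
  have l7: "length d \<le> 7" using l by linarith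
  have s: "?A \<subseteq> set d" "?B \<subseteq> set d" "?C \<subseteq> set d" unfolding L_def by blast+
  have f: "finite ?A" "finite ?B" "finite ?C" using s finite_subset by blast+
  have "?A \<inter> ?B \<inter> ?C = {}" using three_sections[OF q l7 na] unfolding L_def by blast
  then have "card (?A \<inter> ?B) + card ?C = card (?A \<inter> ?B \<union> ?C)" using card_Un_disjoint[of "?A \<inter> ?B" ?C] f by simp
  also have "\<dots> \<le> length d" by (rule card_le_subset) (use s in blast)
  finally have "card (?A \<inter> ?B) + card ?C \<le> length d" .
  moreover have "card (?A \<union> ?B) \<le> length d" by (rule card_le_subset) (use s in blast)
  moreover have "card ?A + card ?B = card (?A \<union> ?B) + card (?A \<inter> ?B)" using card_Un_Int f by blast
  ultimately have sum: "card ?A + card ?B + card ?C \<le> 2 * length d" by linarith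
  have A': "length a + card ?A \<ge> 9" using A l by (cases "length a = 4") linarith+
  have B': "length b + card ?B \<ge> 9" using B l by (cases "length b = 4") linarith+
  have C': "length c + card ?C \<ge> 9" using C l by (cases "length c = 4") linarith+
  show False using A' B' C' A(1) B(1) C(1) sum l by linarith
qed

text \<open>Suppose \<open>e\<close> sees another vertex of \<open>Z\<close>. Then its neighbours
  \<open>f\<close> and \<open>h\<close> do not see \<open>B\<close>, so \<open>e\<close> or
  \<open>g\<close> does, and \<open>f\<close>, \<open>h\<close> see no vertex of \<open>Z\<close>
  but \<open>z\<close>. The apexes over the four edges must all be \<open>z\<close>, which is then
  adjacent to the whole 4-cycle.\<close>

lemma pivot4:
  assumes c: "cyc bnd xs" "length xs = 4" "set xs \<noteq> V"
    and out: "\<And>x y. x \<in> set xs \<Longrightarrow> adj x y \<Longrightarrow> y \<in> set xs \<or> y \<in> B \<or> y \<in> Z"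
    and b: "ajs (set xs) B" and p: "\<And>x x' y. cons xs x x' \<Longrightarrow> tch x B \<Longrightarrow> y \<in> Z \<Longrightarrow> adj x' y \<Longrightarrow> y = z"
  shows "L Z (set xs) \<subseteq> {z}"
proof (rule ccontr)
  assume "\<not> ?thesis"
  then obtain y e where y: "y \<in> Z" "y \<noteq> z" "e \<in> set xs" "adj e y" unfolding L_def tch_def using adj_sym by blast
  obtain ys where ys: "cyc bnd ys" "set ys = set xs" "length ys = length xs" "ys ! 0 = e" "\<And>a b. cons ys a b \<longleftrightarrow> cons xs a b"
    using rot_hd[OF c(1) y(3)] by blast
  then obtain f g h where l: "ys = [e, f, g, h]" using list4 c(2) by (metis nth_Cons_0)
  have C: "cons xs e f" "cons xs f g" "cons xs g h" "cons xs h e" using ys(5)[symmetric] unfolding l cons4 by auto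
  have nB: "\<not> tch f B" "\<not> tch h B" using p[OF cons_sym[OF C(1)] _ y(1,4)] p[OF C(4) _ y(1,4)] y(2) by blast+
  have eg: "tch e B \<or> tch g B" using b nB ys(2) unfolding l ajs_def tch_def by auto
  have only: "w = z" if "x = f \<or> x = h" "w \<in> Z" "adj x w" for x w
    using that p[OF C(1), of w] p[OF cons_sym[OF C(2)], of w] p[OF C(3), of w] p[OF cons_sym[OF C(4)], of w] eg by blast
  have ap: "adj z x \<and> adj z x'" if k: "cons xs x x'" "x = f \<or> x = h" for x x'
  proof -
    obtain w where w: "adj w x" "adj w x'" "w \<notin> set xs" using apex4[OF c k(1)] by blast
    have "w \<in> Z" using out[of x w] w k nB adj_sym cons_mem[OF k(1)] unfolding tch_def by blast
    then show ?thesis using only[OF k(2)] w adj_sym by blast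
  qed
  have "adj z x" if "x \<in> set xs" for x
    using that ap[OF cons_sym[OF C(1)]] ap[OF C(2)] ap[OF C(4)] ys(2) unfolding l by auto
  then show False using wheel4[OF c(1,2)] by blast
qed

text \<open>The link of \<open>x\<close> is \<open>y\<close>, \<open>p\<close>, the section,
  \<open>q\<close>, \<open>z\<close> in this order, with \<open>y\<close> and \<open>z\<close> as
  its ends.\<close>

lemma link_section:
  assumes "bnd x y" "bnd x z" "y \<noteq> z" and pq: "adj x p" "adj y p" "adj x q" "adj z q" and s: "sec X x p q" and X: "y \<notin> X" "z \<notin> X" and w: "adj x w"
  shows "w \<in> X \<or> w = y \<or> w = z \<or> w = p \<or> w = q"
proof (rule ccontr)
  assume n: "\<not> ?thesis"
  have yz: "adj x y" "adj x z" using assms bnd_adj by blast+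
  have e: "pos x y = 0 \<or> Suc (pos x y) = deg x" "pos x z = 0 \<or> Suc (pos x z) = deg x" using assms bnd_iff by blast+
  have b: "pos x y < pos x p \<longleftrightarrow> pos x p < pos x q" using sec_beside[OF s yz(1)] pq(2) adj_sym X by blast
  have b': "pos x z < pos x q \<longleftrightarrow> pos x q < pos x p" using sec_beside[OF sec_sym[OF s] yz(2)] pq(4) adj_sym X by blast
  have nb: "\<not> (pos x p < pos x w \<and> pos x w < pos x q) \<and> \<not> (pos x q < pos x w \<and> pos x w < pos x p)" using sec_not_between[OF s w] n by blast
  have ad: "pos x y = Suc (pos x p) \<or> pos x p = Suc (pos x y)" "pos x z = Suc (pos x q) \<or> pos x q = Suc (pos x z)"
    using adj_pos yz pq by blast+
  have ne: "pos x w \<noteq> pos x y" "pos x w \<noteq> pos x z" "pos x w \<noteq> pos x p" "pos x w \<noteq> pos x q"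
    using pos_inj[OF w] yz pq n by blast+
  have l: "pos x w < deg x" "pos x p < deg x" "pos x q < deg x" "pos x y < deg x" "pos x z < deg x" using pos_less w pq yz by blast+
  have pqn: "pos x p \<noteq> pos x q" using sec_pos_neq[OF s] .
  show False
  proof (cases "pos x p < pos x q")
    case True
    then have "pos x p = Suc (pos x y)" "pos x z = Suc (pos x q)" using b b' ad pqn by linarith+
    then show False using e l nb ne True by linarith
  next
    case False
    then have f: "pos x q < pos x p" using pqn by linarith
    then have "pos x y = Suc (pos x p)" "pos x q = Suc (pos x z)" using b b' ad by linarith+
    then show False using e l nb ne f by linarith
  qed
qed

text \<open>Here \<open>b\<close>, \<open>c\<close>, \<open>d\<close> are pairwise adjacent and
  \<open>a\<close> sees only \<open>d\<close>. A change of label on \<open>b\<close> leads to a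
  vertex \<open>y0\<close> of \<open>d\<close> whose neighbours on \<open>d\<close> cannot see
  \<open>a\<close>, for otherwise all four cycles would be chained. Together with the four vertices
  of \<open>d\<close> that see \<open>a\<close> this gives length 6 or 7 for
  \<open>d\<close>.\<close>

lemma no_paw:
  assumes q: "quad a b c d" and l5: "length b \<le> 5" "length c \<le> 5" and na: "\<not> ajs (set a) (set b)" "\<not> ajs (set a) (set c)"
    and aj: "ajs (set a) (set d)" "ajs (set b) (set c)" "ajs (set b) (set d)" "ajs (set c) (set d)"
  shows False
proof -
  note D = quad_disj[OF q] and l = quad_len[OF q]
  have qs: "quad a d b c" "quad c b d a" "quad b c d a"
    using quad_swap[OF q] quad_swap quad_swap by meson+
  have nm: "\<not> tm a u v" if uv: "cons d u v" for u v
  proof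
    assume "tm a u v"
    then obtain ms where ms: "cyc adj ms" "set ms = set a \<union> set d"
      using tm_square[OF quadD(1)[OF q] cyc_mono[OF quadD(4)[OF q]] D(3) uv] by blast
    have "ajs (set ms) (set b)" "ajs (set ms) (set c)" using aj(3,4)[THEN ajs_sym] ms(2) unfolding ajs_def by blast+
    then show False using quad_merged[OF qs(1) ms aj(2)] by blast
  qed
  let ?S = "L (set d) (set a)"
  note f = quad_front[OF q na]
  have card4: "card ?S \<ge> 4" "length a = 4 \<Longrightarrow> card ?S \<ge> 5" using quad_front_card[OF q na aj(1) nm] by blast+
  have sd: "?S \<subseteq> set d" unfolding L_def by blast
  have far: "\<not> tch y' (set a)" if "cons z x x'" "tch x (set o')" "adj x' y" "cons d y y'" "(z, o') = (b, c) \<or> (z, o') = (c, b)" for z o' x x' y y'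
    using that quad_chain[OF qs(2), of x x' y y'] quad_chain[OF qs(3), of x x' y y'] by auto
  obtain x x' y0 where x: "cons b x x'" "tch x (set c)" "adj x' y0" "y0 \<in> set d"
  proof -
    have "bclosed (set d \<union> set a)" using bclosed_Un bcyc_bclosed quadD[OF q] by blast
    moreover have "set c \<inter> (set d \<union> set a) = {}" "set c \<union> (set d \<union> set a) = V - set b" using D quadD(6)[OF q] by blast+
    moreover have "ajs (set b) (set d \<union> set a)" using aj unfolding ajs_def by blast
    ultimately obtain u v where "cons b u v" "tch u (set c)" "tch v (set d \<union> set a)"
      using small_cycle[OF quadD(2)[OF q] l5(1) bcyc_bclosed[OF quadD(3)[OF q]]] aj(2) by blast
    then show ?thesis using that[of u v] na adj_sym cons_mem unfolding tch_def ajs_def by blast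
  qed
  have b0: "x' \<in> set b" using cons_mem[OF x(1)] by blast
  obtain ys where ys: "cyc bnd ys" "set ys = set d" "length ys = length d" "ys ! 0 = y0" "\<And>a b. cons ys a b \<longleftrightarrow> cons d a b"
    using rot_hd[OF quadD(4)[OF q] x(4)] by blast
  have nS: "w \<notin> ?S" if "cons ys y0 w" for w using far[OF x(1-3), of w] that ys(5) unfolding L_def by blast
  have dist: "distinct ys" using ys(1) unfolding cyc_def by blast
  have "length d \<le> 7" using l by linarith
  have "length d \<ge> 6"
  proof -
    obtain v w where vw: "v \<noteq> w" "cons ys y0 v" "cons ys y0 w" using cons_ex[OF ys(1)] x(4) ys(2) by blast
    then have "?S \<inter> {v, w} = {}" using nS by blast
    then have "card (?S \<union> {v, w}) = card ?S + 2" using card_Un_disjoint[of ?S "{v, w}"] vw(1) finite_subset[OF sd] by simp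
    moreover have "card (?S \<union> {v, w}) \<le> length d" by (rule card_le_subset) (use sd vw cons_mem ys(2) in blast)
    ultimately show ?thesis using card4(1) by linarith
  qed
  then consider "length d = 6" | "length d = 7" using \<open>length d \<le> 7\<close> by linarith
  then show False
  proof cases
    case 1
    then obtain d1 d2 d3 d4 d5 where y: "ys = [y0, d1, d2, d3, d4, d5]" using list6 ys(3,4) by (metis nth_Cons_0)
    note C = cons6[of y0 d1 d2 d3 d4 d5, folded y]
    have B: "bnd p r" if "cons ys p r" for p r using that cyc_cons[OF ys(1) symp_bnd] by blast
    have A: "adj p r" "adj r p" if "cons ys p r" for p r using B[OF that] bnd_adj adj_sym by blast+
    have "d1 \<notin> ?S" "d5 \<notin> ?S" using nS C cons_sym by blast+
    then have sub: "?S \<subseteq> set [y0, d2, d3, d4]" using sd ys(2) y by auto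
    have "card (set [y0, d2, d3, d4]) \<le> 4" using card_length[of "[y0, d2, d3, d4]"] by simp
    then have e: "?S = {y0, d2, d3, d4}" "card ?S = 4" using card_seteq[OF _ sub] card_mono[OF _ sub] card4(1) by auto
    have "adj y0 d2" using c4_nonadj[OF f, of y0 d2 d3 d4] e A[OF C(4)] by blast
    \<comment> \<open>The link of \<open>y0\<close> turns out to be \<open>d1\<close>,
      \<open>d2\<close>, a section of \<open>a\<close>, \<open>d4\<close>, \<open>d5\<close>, with
      no room for the neighbour \<open>x'\<close> in \<open>b\<close>.\<close>
    have "?S = {y0, d4, d2, d3}" using e(1) by (simp add: insert_commute)
    then have "adj y0 d4" using c4_nonadj[OF f, of y0 d4 d2 d3] e(2) A[OF C(3)] by blast
    obtain p r s where k: "c4 (set a) y0 p r s" "{y0, p, r, s} = ?S"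
      using fl_c4[OF f e(2)] c4_at e(1) by (metis insertI1)
    have s: "sec (set a) y0 s p" using k(1) unfolding c4_def by blast
    have d24: "d2 \<noteq> d4" using dist y by simp
    have "d2 = p \<or> d2 = s" "d4 = p \<or> d4 = s"
      using c4_flank[OF k(1)] \<open>adj y0 d2\<close> \<open>adj y0 d4\<close> k(2) e(1) by auto
    then have s2: "sec (set a) y0 d2 d4" using s sec_sym d24 by blast
    have m: "d1 \<notin> set a" "d5 \<notin> set a" "d1 \<noteq> d5" using D ys(2) y dist by auto
    have "x' \<in> set a \<or> x' = d1 \<or> x' = d5 \<or> x' = d2 \<or> x' = d4"
      by (rule link_section[OF B[OF C(1)] B[OF cons_sym[OF C(6)]] m(3) \<open>adj y0 d2\<close> _ \<open>adj y0 d4\<close> _ s2 m(1,2) adj_sym[OF x(3)]]) (use A[OF C(2)] A[OF C(5)] in blast)+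
    then have "x' \<in> set a \<or> x' \<in> set d" using ys(2) y by auto
    then show False using b0 D by blast
  next
    case 2
    then have l4: "length a = 4" "length b = 4" "length c = 4" using l by linarith+
    obtain d1 d2 d3 d4 d5 d6 where y: "ys = [y0, d1, d2, d3, d4, d5, d6]" using list7 ys(3,4) 2 by (metis nth_Cons_0)
    note C = cons7[of y0 d1 d2 d3 d4 d5 d6, folded y]
    have "d1 \<notin> ?S" "d6 \<notin> ?S" using nS C cons_sym by blast+
    then have sub: "?S \<subseteq> set [y0, d2, d3, d4, d5]" using sd ys(2) y by auto
    have "card (set [y0, d2, d3, d4, d5]) \<le> 5" using card_length[of "[y0, d2, d3, d4, d5]"] by simp
    then have e: "?S = {y0, d2, d3, d4, d5}" using card_seteq[OF _ sub] card4(2)[OF l4(1)] by auto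
    \<comment> \<open>\<open>?S\<close> misses only the two neighbours \<open>d1\<close> and
      \<open>d6\<close> of \<open>y0\<close>, so \<open>y0\<close> is the one vertex of
      \<open>d\<close> with both neighbours outside \<open>?S\<close>. By \<open>far\<close> it is
      thus the pivot for \<open>b\<close> and for \<open>c\<close>, although the flanks of a section
      of \<open>set b \<union> set c\<close> at \<open>y0\<close> are further vertices of
      \<open>d\<close> that see \<open>b\<close> or \<open>c\<close>.\<close>
    have only: "w = y0" if w: "w \<in> set d" "\<And>w'. cons d w w' \<Longrightarrow> \<not> tch w' (set a)" for w
    proof -
      have w': "w' \<notin> ?S" if "cons ys w w'" for w' using w(2) that ys(5) unfolding L_def by blast
      have "w \<noteq> d1" "w \<noteq> d2" "w \<noteq> d3" "w \<noteq> d4" "w \<noteq> d5" "w \<noteq> d6"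
        using w'[of y0] w'[of d3] w'[of d4] w'[of d5] C cons_sym[OF C(1)] cons_sym[OF C(5)] e by auto
      then show ?thesis using w(1) ys(2) y by auto
    qed
    have cb: "set b \<noteq> V" "set c \<noteq> V" using quad_sub(1)[OF qs(3)] quad_sub(1)[OF qs(2)] by blast+
    have ob: "y \<in> set b \<or> y \<in> set c \<or> y \<in> set d" if "x \<in> set b \<or> x \<in> set c" "adj x y" for x y
      using quad_out[OF q that(2)] that na adj_sym unfolding ajs_def by blast
    have Lb: "L (set d) (set b) \<subseteq> {y0}"
    proof (rule pivot4[OF quadD(2)[OF q] l4(2) cb(1) _ aj(2)])
      show "y \<in> set b \<or> y \<in> set c \<or> y \<in> set d" if "x \<in> set b" "adj x y" for x y using ob that by blast
      show "y = y0" if "cons b x x'" "tch x (set c)" "y \<in> set d" "adj x' y" for x x' y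
        using only[OF that(3)] far[OF that(1,2,4)] by blast
    qed
    have Lc: "L (set d) (set c) \<subseteq> {y0}"
    proof (rule pivot4[OF quadD(3)[OF q] l4(3) cb(2) _ ajs_sym[OF aj(2)]])
      show "y \<in> set c \<or> y \<in> set b \<or> y \<in> set d" if "x \<in> set c" "adj x y" for x y using ob that by blast
      show "y = y0" if "cons c x x'" "tch x (set b)" "y \<in> set d" "adj x' y" for x x' y
        using only[OF that(3)] far[OF that(1,2,4)] by blast
    qed
    have "bclosed (set b \<union> set c)" using bclosed_Un bcyc_bclosed quadD[OF q] by blast
    moreover have "y0 \<notin> set b \<union> set c" using x(4) D by blast
    ultimately obtain p r where s: "sec (set b \<union> set c) y0 p r"
      using sec_exists[of x' "set b \<union> set c" y0] b0 x(3) adj_sym bclosed_outside by blast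
    obtain z where z: "z \<in> set b \<union> set c" "adj p z" using sec_mid[OF s] by blast
    have "p \<in> set d" using ob[of z p] z adj_sym sec_adj(3)[OF s] by blast
    then have "p = y0" using Lb Lc z unfolding L_def tch_def by blast
    then show False using sec_adj(1)[OF s] adj_irrefl by blast
  qed
qed

text \<open>If an apex over an edge of \<open>a\<close> were in \<open>d\<close>, the edge
  \<open>yy'\<close> would chain \<open>c\<close>, \<open>b\<close>, \<open>a\<close> and
  \<open>d\<close>; so all apexes lie in \<open>b\<close>. At a vertex \<open>x\<close> of
  \<open>a\<close> that sees \<open>d\<close> the two apexes are distinct and nonadjacent, because
  the link of \<open>x\<close> must have room for a vertex of \<open>d\<close>.\<close>

lemma apexes_meet_labels:
  assumes q: "quad a b c d" "length a = 4" and ad: "ajs (set a) (set d)" and ac: "\<not> ajs (set a) (set c)"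
    and y: "cons b y y'" "tch y (set a)" "tch y' (set c)"
  shows "cons a x x' \<Longrightarrow> \<exists>w\<in>set b. adj w x \<and> adj w x'"
    "\<exists>w\<in>set b. \<exists>w'\<in>set b. w \<noteq> w' \<and> \<not> cons b w w' \<and> tch w (set a) \<and> tch w' (set a) \<and>
       (\<forall>z. cons b w z \<or> cons b w' z \<longrightarrow> \<not> tch z (set c))"
proof -
  have qc: "quad c b a d" using quad_swap(2)[OF quad_swap(1)[OF quad_swap(2)[OF q(1)]]] .
  note D = quad_disj[OF q(1)]
  have ap: "\<exists>w\<in>set b. adj w x \<and> adj w x'" if xx: "cons a x x'" for x x'
  proof -
    obtain w where w: "adj w x" "adj w x'" "w \<notin> set a" using apex4[OF quadD(1)[OF q(1)] q(2) quad_sub(1)[OF q(1)] xx] by blast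
    have "w \<notin> set c" using ac w(1) cons_mem[OF xx] adj_sym unfolding ajs_def by blast
    moreover have "w \<notin> set d"
    proof
      assume wd: "w \<in> set d"
      obtain p where p: "p \<in> set a" "adj y p" using y(2) unfolding tch_def by blast
      obtain e where e: "adj w e" "cons a e p" using entry4[OF q(2) xx w(1,2) p(1)] by blast
      have "tch e (set d)" using wd e(1) adj_sym unfolding tch_def by blast
      then show False using quad_chain[OF qc cons_sym[OF y(1)] y(3) p(2) cons_sym[OF e(2)]] by blast
    qed
    ultimately show ?thesis using quad_out[OF q(1) adj_sym[OF w(1)]] w by blast
  qed
  then show "cons a x x' \<Longrightarrow> \<exists>w\<in>set b. adj w x \<and> adj w x'" by blast
  obtain x g where x: "x \<in> set a" "g \<in> set d" "adj x g" using ad unfolding ajs_def by blast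
  obtain x1 x2 where x12: "x1 \<noteq> x2" "cons a x x1" "cons a x x2" using cons_ex[OF quadD(1)[OF q(1)] x(1)] by blast
  obtain w where w: "w \<in> set b" "adj w x" "adj w x1" using ap[OF x12(2)] by blast
  obtain w' where w': "w' \<in> set b" "adj w' x" "adj w' x2" using ap[OF x12(3)] by blast
  have B: "bnd x x1" "bnd x x2" using cyc_cons[OF quadD(1)[OF q(1)] symp_bnd] x12 by blast+
  have ne: "g \<noteq> x1" "g \<noteq> x2" "g \<noteq> w" "g \<noteq> w'" "w \<noteq> x2" "w' \<noteq> x1"
    using cons_mem[OF x12(2)] cons_mem[OF x12(3)] x w w' D by blast+
  note sh = link_short[OF B x12(1) x(3)]
  have "w \<noteq> w'" using sh(2)[of w] ne w w' adj_sym by blast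
  moreover have "\<not> adj w w'" using sh(3)[of w w'] ne w w' adj_sym by blast
  moreover have "adj p r" if "cons b p r" for p r using that cyc_cons[OF quadD(2)[OF q(1)] symp_bnd] bnd_adj by blast
  moreover have "\<not> tch z (set c)" if "cons b w z \<or> cons b w' z" for z
    using that apex_neighbours[OF q x12(2) w ad] apex_neighbours[OF q x12(3) w' ad] by blast
  moreover have "tch w (set a)" "tch w' (set a)" using w w' x(1) unfolding tch_def by blast+
  ultimately show "\<exists>w\<in>set b. \<exists>w'\<in>set b. w \<noteq> w' \<and> \<not> cons b w w' \<and> tch w (set a) \<and> tch w' (set a) \<and>
       (\<forall>z. cons b w z \<or> cons b w' z \<longrightarrow> \<not> tch z (set c))" using w(1) w'(1) by blast
qed

text \<open>On a 5-cycle \<open>w1\<close> and \<open>w2\<close> avoid the neighbours of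
  \<open>e\<close>, so being nonconsecutive one of them is \<open>e\<close>; likewise one of
  \<open>v1\<close> and \<open>v2\<close> is \<open>f\<close>. But then \<open>e\<close> also has
  label \<open>S\<close>, which a neighbour of that vertex must not have. The 6-cycle leaves only
  slightly more room.\<close>

lemma alternating_labels_aux:
  assumes b: "cyc R b" "length b = 5 \<or> length b = 6" and ys: "b = e # f # rest" "T e" "S f"
    and w: "w1 \<in> set b" "w2 \<in> set b" "w1 \<noteq> w2" "\<not> cons b w1 w2" "S w1" "S w2" "\<And>z. cons b w1 z \<or> cons b w2 z \<Longrightarrow> \<not> T z"
    and v: "v1 \<in> set b" "v2 \<in> set b" "v1 \<noteq> v2" "\<not> cons b v1 v2" "T v1" "T v2" "\<And>z. cons b v1 z \<or> cons b v2 z \<Longrightarrow> \<not> S z"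
  shows False
proof -
  have wx: "w1 \<noteq> x" "w2 \<noteq> x" if "cons b x y" "T y" for x y using w(7)[of y] that by blast+
  have vx: "v1 \<noteq> x" "v2 \<noteq> x" if "cons b x y" "S y" for x y using v(7)[of y] that by blast+
  have nw: "\<not> (w1 = x \<and> w2 = y)" "\<not> (w1 = y \<and> w2 = x)" if "cons b x y" for x y using w(4) that cons_sym by blast+
  have nv: "\<not> (v1 = x \<and> v2 = y)" "\<not> (v1 = y \<and> v2 = x)" if "cons b x y" for x y using v(4) that cons_sym by blast+
  show False
  proof (cases "length b = 5")
    case True
    then obtain g h i where y: "b = [e, f, g, h, i]" using list5 ys(1) by fastforce
    note C = cons5[of e f g h i, folded y]
    have 1: "w1 = e \<or> w1 = g \<or> w1 = h" "w2 = e \<or> w2 = g \<or> w2 = h"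
      using w(1,2) wx[OF cons_sym[OF C(1)] ys(2)] wx[OF C(5) ys(2)] unfolding y by auto
    have "w1 = e \<or> w2 = e" using 1 nw[OF C(3)] w(3) by blast
    then have Se: "S e" using w by blast
    have 2: "v1 = f \<or> v1 = h \<or> v1 = i" "v2 = f \<or> v2 = h \<or> v2 = i"
      using v(1,2) vx[OF C(1) ys(3)] vx[OF cons_sym[OF C(2)] ys(3)] unfolding y by auto
    have "v1 = f \<or> v2 = f" using 2 nv[OF C(4)] v(3) by blast
    then show False using vx[OF cons_sym[OF C(1)] Se] by blast
  next
    case False
    then obtain g h i j where y: "b = [e, f, g, h, i, j]" using list6 ys(1) b(2) by fastforce
    note C = cons6[of e f g h i j, folded y]
    have 1: "w1 = e \<or> w1 = g \<or> w1 = h \<or> w1 = i" "w2 = e \<or> w2 = g \<or> w2 = h \<or> w2 = i"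
      using w(1,2) wx[OF cons_sym[OF C(1)] ys(2)] wx[OF C(6) ys(2)] unfolding y by auto
    have 2: "v1 = f \<or> v1 = h \<or> v1 = i \<or> v1 = j" "v2 = f \<or> v2 = h \<or> v2 = i \<or> v2 = j"
      using v(1,2) vx[OF C(1) ys(3)] vx[OF cons_sym[OF C(2)] ys(3)] unfolding y by auto
    show False
    proof (cases "w1 = e \<or> w2 = e")
      case True
      then have Se: "S e" using w by blast
      have "v1 \<noteq> f" "v2 \<noteq> f" using vx[OF cons_sym[OF C(1)] Se] by blast+
      then have "(v1 = h \<and> v2 = j) \<or> (v1 = j \<and> v2 = h)" using 2 nv[OF C(4)] nv[OF C(5)] v(3) by blast
      then have T: "T h" "T j" using v by blast+
      then show False using True wx[OF cons_sym[OF C(6)] T(2)] by blast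
    next
      case False
      then have "(w1 = g \<and> w2 = i) \<or> (w1 = i \<and> w2 = g)" using 1 nw[OF C(3)] nw[OF C(4)] w(3) by blast
      then have Sg: "S g" "S i" using w by blast+
      have "v1 \<noteq> h" "v2 \<noteq> h" "v1 \<noteq> f" "v2 \<noteq> f" using vx[OF C(4) Sg(2)] vx[OF C(2) Sg(1)] by blast+
      then show False using 2 nv[OF C(5)] v(3) by blast
    qed
  qed
qed

lemma alternating_labels:
  assumes b: "cyc R b" "length b = 5 \<or> length b = 6" and y: "cons b y y'" "S y" "T y'"
    and w: "w1 \<in> set b" "w2 \<in> set b" "w1 \<noteq> w2" "\<not> cons b w1 w2" "S w1" "S w2" "\<And>z. cons b w1 z \<or> cons b w2 z \<Longrightarrow> \<not> T z"
    and v: "v1 \<in> set b" "v2 \<in> set b" "v1 \<noteq> v2" "\<not> cons b v1 v2" "T v1" "T v2" "\<And>z. cons b v1 z \<or> cons b v2 z \<Longrightarrow> \<not> S z"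
  shows False
proof -
  have two: "\<exists>e f r. xs = e # f # r" if "length xs = 5 \<or> length xs = 6" for xs :: "'a list"
    using that by (cases xs; cases "tl xs") auto
  have d: "distinct b" using b unfolding cyc_def by blast
  have rot: "\<exists>r. cyc R (p # q # r) \<and> set (p # q # r) = set b \<and> length (p # q # r) = length b \<and> (\<forall>x z. cons (p # q # r) x z \<longleftrightarrow> cons b x z)"
    if pq: "q = nx b p" "p \<in> set b" for p q
  proof -
    obtain i where i: "i < length b" "p = b ! i" using pq(2) by (metis in_set_conv_nth)
    let ?r = "rotate i b"
    have ne: "b \<noteq> []" "length b > 1" using i b by auto
    obtain e f r where r: "?r = e # f # r" using two[of ?r] b(2) by auto
    have "?r ! 0 = p" "?r ! 1 = q" using nth_rotate[of 0 b i] nth_rotate[of 1 b i] i ne pq nx_nth[OF d i(1)] by simp_all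
    then have "?r = p # q # r" using r by simp
    then show ?thesis using cyc_rotate[OF b(1), of i] cons_rotate[OF ne(1), of i] by metis
  qed
  have "y = nx b y' \<or> y' = nx b y" using cons_nx[OF d y(1)] by blast
  then show False
  proof
    assume "y = nx b y'"
    then obtain r where r: "cyc R (y' # y # r)" "set (y' # y # r) = set b" "length (y' # y # r) = length b" "\<And>x z. cons (y' # y # r) x z \<longleftrightarrow> cons b x z"
      using rot[of y y'] cons_mem[OF y(1)] by blast
    show False
      by (rule alternating_labels_aux[where T = T and S = S and b = "y' # y # r", OF r(1) _ refl y(3,2), of w1 w2 v1 v2])
        (unfold r(2,3,4), (use b(2) in blast), (fact w v)+)
  next
    assume "y' = nx b y"
    then obtain r where r: "cyc R (y # y' # r)" "set (y # y' # r) = set b" "length (y # y' # r) = length b" "\<And>x z. cons (y # y' # r) x z \<longleftrightarrow> cons b x z"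
      using rot[of y' y] cons_mem[OF y(1)] by blast
    show False
      by (rule alternating_labels_aux[where T = S and S = T and b = "y # y' # r", OF r(1) _ refl y(2,3), of v1 v2 w1 w2])
        (unfold r(2,3,4), (use b(2) in blast), (fact w v)+)
  qed
qed

text \<open>Three of five vertices include two consecutive ones, which carry the same label. The
  other label cannot occur on these two or on their neighbours, so it occurs at most once.\<close>

lemma five_cycle_labels:
  assumes d: "cyc R d" "length d = 5" and S: "S \<subseteq> set d" "card S \<ge> 2" and T: "T \<subseteq> set d" "card T \<ge> 2" and U: "card (S \<union> T) \<ge> 3"
    and nc: "\<And>u v. cons d u v \<Longrightarrow> \<not> (u \<in> S \<and> v \<in> T)"
  shows False
proof -
  have sep: False if h: "cons d u v" "u \<in> S'" "v \<in> S'" "T' \<subseteq> set d" "card T' \<ge> 2" "\<And>u v. cons d u v \<Longrightarrow> \<not> (u \<in> S' \<and> v \<in> T')" for u v S' T'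
  proof -
    have "u \<in> set d" using cons_mem h(1) by blast
    then obtain ys where ys: "cyc R ys" "set ys = set d" "length ys = length d" "ys ! 0 = u" "\<And>a b. cons ys a b \<longleftrightarrow> cons d a b"
      using rot_hd[OF d(1)] by blast
    then obtain p q r s where y: "ys = [u, p, q, r, s]" using list5 d(2) by (metis nth_Cons_0)
    note C = cons5[of u p q r s, folded y, unfolded ys(5)]
    have dis: "p \<noteq> s" using ys(1) y unfolding cyc_def by auto
    have nT: "x \<notin> T'" if "cons d u x \<or> cons d v x" for x using h(2,3,6) that by blast
    have a: "p \<notin> T'" "s \<notin> T'" "u \<notin> T'" using nT C(1) cons_sym[OF C(5)] cons_sym[OF h(1)] by blast+
    have "v = p \<or> v = s" using cons_unique[OF d(1) C(1) cons_sym[OF C(5)] dis h(1)] .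
    then have "q \<notin> T' \<or> r \<notin> T'" using nT C(2) cons_sym[OF C(4)] by blast
    then have "T' \<subseteq> {q} \<or> T' \<subseteq> {r}" using a h(4) ys(2) y by auto
    then show False using h(5) card_mono[of "{q}" T'] card_mono[of "{r}" T'] by auto
  qed
  obtain u v where uv: "u \<in> S \<union> T" "v \<in> S \<union> T" "cons d u v"
    using consecutive_pair[OF d(1), of "S \<union> T"] S T U d(2) by auto
  have nc': "\<not> (x \<in> T \<and> y \<in> S)" if "cons d x y" for x y using nc cons_sym that by blast
  have "u \<in> S \<and> v \<in> S \<or> u \<in> T \<and> v \<in> T" using uv nc nc' by blast
  then show False using sep[OF uv(3) _ _ T nc] sep[OF uv(3) _ _ S nc'] by blast
qed

lemma no_consecutive_labels_4_4:
  assumes q: "quad a b c d" "length a = 4" "length c = 4" "length b = 5 \<or> length b = 6"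
    and aj: "ajs (set a) (set d)" "ajs (set c) (set d)" and ac: "\<not> ajs (set a) (set c)"
    and y: "cons b y y'" "tch y (set a)" "tch y' (set c)"
  shows False
proof -
  have qc: "quad c b a d" using quad_swap(2)[OF quad_swap(1)[OF quad_swap(2)[OF q(1)]]] .
  have ca: "\<not> ajs (set c) (set a)" using ac ajs_sym by blast
  obtain w1 w2 where w: "w1 \<in> set b" "w2 \<in> set b" "w1 \<noteq> w2" "\<not> cons b w1 w2" "tch w1 (set a)" "tch w2 (set a)"
      "\<And>z. cons b w1 z \<or> cons b w2 z \<Longrightarrow> \<not> tch z (set c)"
    using apexes_meet_labels(2)[OF q(1,2) aj(1) ac y] by blast
  obtain v1 v2 where v: "v1 \<in> set b" "v2 \<in> set b" "v1 \<noteq> v2" "\<not> cons b v1 v2" "tch v1 (set c)" "tch v2 (set c)"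
      "\<And>z. cons b v1 z \<or> cons b v2 z \<Longrightarrow> \<not> tch z (set a)"
    using apexes_meet_labels(2)[OF qc q(3) aj(2) ca cons_sym[OF y(1)] y(3,2)] by blast
  show False
    by (rule alternating_labels[OF quadD(2)[OF q(1)] q(4) y(1), of "\<lambda>x. tch x (set a)" "\<lambda>x. tch x (set c)" w1 w2 v1 v2])
      (fact y w v)+
qed

text \<open>On \<open>b\<close> the label \<open>c\<close> occurs only at the apexes
  \<open>w1\<close> and \<open>w2\<close>, and the label \<open>a\<close> at most there and at one
  more vertex. The frontiers of \<open>a\<close> and \<open>c\<close> in
  \<open>set b \<union> set d\<close> have at least 5 and 4 vertices, and their union at least 6. So
  \<open>d\<close> has enough labels for \<open>five_cycle_labels\<close> to give a label change on
  \<open>d\<close> too. Then the apexes over the edges of \<open>a\<close> would lie in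
  \<open>b\<close> and also in \<open>d\<close>.\<close>

lemma no_consecutive_labels_4_5:
  assumes q: "quad a b c d" "length a = 4" "length c = 5" "length b = 5" "length d = 5"
    and aj: "ajs (set a) (set b)" "ajs (set a) (set d)" "ajs (set b) (set c)" "ajs (set c) (set d)" and ac: "\<not> ajs (set a) (set c)"
    and nm: "\<And>u v. cons b u v \<Longrightarrow> \<not> tm a u v"
    and y: "cons b y y'" "tch y (set a)" "tch y' (set c)"
  shows False
proof -
  note D = quad_disj[OF q(1)]
  have qs: "quad a d c b" "quad d c b a" using quad_swap[OF q(1)] quad_swap quad_swap by meson+
  let ?A = "L (set b \<union> set d) (set a)" and ?C = "L (set b \<union> set d) (set c)"
  have sp: "L (set b \<union> set d) X = L (set b) X \<union> L (set d) X" for X unfolding L_def by blast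
  obtain w1 w2 where w: "w1 \<in> set b" "w2 \<in> set b" "w1 \<noteq> w2" "\<not> cons b w1 w2" "tch w1 (set a)" "tch w2 (set a)"
      "\<And>z. cons b w1 z \<or> cons b w2 z \<Longrightarrow> \<not> tch z (set c)"
    using apexes_meet_labels(2)[OF q(1,2) aj(2) ac y] by blast
  obtain ys where ys: "cyc bnd ys" "set ys = set b" "length ys = length b" "ys ! 0 = w1" "\<And>x z. cons ys x z \<longleftrightarrow> cons b x z"
    using rot_hd[OF quadD(2)[OF q(1)] w(1)] by blast
  then obtain p r s t where l: "ys = [w1, p, r, s, t]" using list5 q(4) by (metis nth_Cons_0)
  note C = cons5[of w1 p r s t, folded l, unfolded ys(5)]
  have bs: "set b = {w1, p, r, s, t}" using ys(2) l by simp
  have w2: "w2 = r \<or> w2 = s" using w(2,3,4) bs C(1) cons_sym[OF C(5)] by auto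
  have Lc: "L (set b) (set c) \<subseteq> {w1, w2}"
    using w2 w(7) C(1,2,3,4) cons_sym[OF C(5)] cons_sym[OF C(2)] cons_sym[OF C(3)] bs unfolding L_def by auto
  have "y' \<in> L (set b) (set c)" using y cons_mem unfolding L_def by blast
  then have y': "tch y' (set a)" using Lc w(5,6) by blast
  obtain z z' y0 where z: "cons c z z'" "tch z (set d)" "adj z' y0" "y0 \<in> set b"
  proof -
    have "bclosed (set b \<union> set a)" using bclosed_Un bcyc_bclosed quadD[OF q(1)] by blast
    moreover have "set d \<inter> (set b \<union> set a) = {}" "set d \<union> (set b \<union> set a) = V - set c" using D quadD(6)[OF q(1)] by blast+
    moreover have "ajs (set c) (set b \<union> set a)" using ajs_sym[OF aj(3)] unfolding ajs_def by blast
    moreover have "length c \<le> 5" using q(3) by simp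
    ultimately obtain u v where "cons c u v" "tch u (set d)" "tch v (set b \<union> set a)"
      using small_cycle[OF quadD(3)[OF q(1)] _ bcyc_bclosed[OF quadD(4)[OF q(1)]]] aj(4) by blast
    then show ?thesis using that[of u v] ac adj_sym cons_mem unfolding tch_def ajs_def by blast
  qed
  have y0: "\<not> tch x (set a)" if "cons b y0 x" for x using quad_chain[OF qs(2) z(1,2,3) that] by blast
  have "z' \<in> set c" using cons_mem[OF z(1)] by blast
  then have "y0 \<in> L (set b) (set c)" using z(3,4) adj_sym unfolding L_def tch_def by blast
  then have y0w: "y0 = w1 \<or> y0 = w2" using Lc by blast
  have La: "\<exists>x. L (set b) (set a) \<subseteq> {w1, w2, x}"
    using y0w
  proof
    assume "y0 = w1"
    then have "\<not> tch p (set a)" "\<not> tch t (set a)" using y0 C(1) cons_sym[OF C(5)] by blast+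
    then have "L (set b) (set a) \<subseteq> {w1, r, s}" unfolding L_def bs by auto
    then show ?thesis using w2 by auto
  next
    assume e: "y0 = w2"
    show ?thesis using w2
    proof
      assume "w2 = r"
      then have "\<not> tch p (set a)" "\<not> tch s (set a)" using y0 e C(3) cons_sym[OF C(2)] by blast+
      then have "L (set b) (set a) \<subseteq> {w1, w2, t}" unfolding L_def bs using \<open>w2 = r\<close> by auto
      then show ?thesis by blast
    next
      assume "w2 = s"
      then have "\<not> tch r (set a)" "\<not> tch t (set a)" using y0 e C(4) cons_sym[OF C(3)] by blast+
      then have "L (set b) (set a) \<subseteq> {w1, w2, p}" unfolding L_def bs using \<open>w2 = s\<close> by auto
      then show ?thesis by blast
    qed
  qed
  then obtain x where x: "L (set b) (set a) \<subseteq> {w1, w2, x}" by blast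
  have c3: "card {w1, w2, x} \<le> 3" by (simp add: card_insert_if)
  have c2: "card {w1, w2} \<le> 2" by (simp add: card_insert_if)
  have t: "two (set a) (set c) ?A ?C"
  proof (rule two_L)
    show "bclosed (set a)" "bclosed (set c)" using bcyc_bclosed quadD[OF q(1)] by blast+
    show "nb u \<subseteq> set b \<union> set d \<union> set a \<union> set c" for u using nb_subset quadD(6)[OF q(1)] by blast
  qed (use D ac in auto)
  have fin: "finite (L (set z) X)" for z X unfolding L_def by auto
  have finA: "finite ?A" "finite ?C" unfolding sp using fin by blast+
  have ne: "?A \<noteq> {}" "?C \<noteq> {}" using aj(1,3) ajs_L ajs_sym unfolding sp by blast+
  \<comment> \<open>Both \<open>y\<close> and \<open>y'\<close> see \<open>a\<close>, and they are
    consecutive.\<close>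
  have "card ?A \<noteq> 4"
  proof
    assume e: "card ?A = 4"
    have m: "y \<in> ?A" "y' \<in> ?A" using y y' cons_mem[OF y(1)] unfolding L_def by blast+
    have "adj y y'" using cyc_cons[OF quadD(2)[OF q(1)] symp_bnd y(1)] bnd_adj by blast
    then show False using c4_no_tm[OF quadD(1)[OF q(1)] q(2) quad_sub(1)[OF q(1)] two_fl(1)[OF t] e m] nm y(1) cons_sym by blast
  qed
  then have A5: "card ?A \<ge> 5" using fl_card[OF two_fl(1)[OF t] ne(1) finA(1)] by linarith
  have C4: "card ?C \<ge> 4" using fl_card[OF two_fl(2)[OF t] ne(2) finA(2)] .
  have six: "card (?A \<union> ?C) \<ge> 6" using two_six[OF t ne finA] .
  have cA: "card (L (set b) (set a)) \<le> 3" using card_mono[OF _ x] c3 by simp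
  have cC: "card (L (set b) (set c)) \<le> 2" using card_mono[OF _ Lc] c2 by simp
  have a: "card (L (set d) (set a)) \<ge> 2" using card_Un_le[of "L (set b) (set a)" "L (set d) (set a)"] A5 cA unfolding sp by linarith
  have c: "card (L (set d) (set c)) \<ge> 2" using card_Un_le[of "L (set b) (set c)" "L (set d) (set c)"] C4 cC unfolding sp by linarith
  have "L (set b) (set a) \<union> L (set b) (set c) \<subseteq> {w1, w2, x}" using x Lc by blast
  then have "card (L (set b) (set a) \<union> L (set b) (set c)) \<le> 3" using card_mono[of "{w1, w2, x}"] c3 by (meson finite.intros le_trans)
  moreover have "?A \<union> ?C = (L (set b) (set a) \<union> L (set b) (set c)) \<union> (L (set d) (set a) \<union> L (set d) (set c))" unfolding sp by blast
  ultimately have u: "card (L (set d) (set a) \<union> L (set d) (set c)) \<ge> 3"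
    using six card_Un_le[of "L (set b) (set a) \<union> L (set b) (set c)" "L (set d) (set a) \<union> L (set d) (set c)"] by simp
  show False
  proof (rule five_cycle_labels[OF quadD(4)[OF q(1)] q(5) _ a _ c u])
    show "L (set d) (set a) \<subseteq> set d" "L (set d) (set c) \<subseteq> set d" unfolding L_def by blast+
    fix u v assume uv: "cons d u v"
    show "\<not> (u \<in> L (set d) (set a) \<and> v \<in> L (set d) (set c))"
    proof
      assume h: "u \<in> L (set d) (set a) \<and> v \<in> L (set d) (set c)"
      then have h': "tch u (set a)" "tch v (set c)" unfolding L_def by blast+
      obtain g g' where g: "g \<in> set a" "cons a g g'" using cons_ex[OF quadD(1)[OF q(1)]] quadD(1)[OF q(1)] unfolding cyc_def
        by (metis list.size(3) not_numeral_le_zero last_in_set)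
      obtain w3 where "w3 \<in> set b" "adj w3 g" "adj w3 g'" using apexes_meet_labels(1)[OF q(1,2) aj(2) ac y g(2)] by blast
      moreover obtain w4 where "w4 \<in> set d" "adj w4 g" "adj w4 g'" using apexes_meet_labels(1)[OF qs(1) q(2) aj(1) ac uv h' g(2)] by blast
      moreover have "bnd g g'" using cyc_cons[OF quadD(1)[OF q(1)] symp_bnd g(2)] .
      ultimately have "w3 = w4" using bnd_common_unique adj_sym by blast
      then show False using \<open>w3 \<in> set b\<close> \<open>w4 \<in> set d\<close> D by blast
    qed
  qed
qed

text \<open>With \<open>length a = 4\<close> the lengths leave only two cases, in which neither
  \<open>b\<close> nor \<open>d\<close> has consecutive vertices with labels \<open>a\<close> and
  \<open>c\<close>. So \<open>set b \<union> set d\<close>, with the successor on each cycle,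
  satisfies the hypotheses of \<open>separating_cycle\<close>.\<close>

lemma no_diamond_aux:
  assumes q: "quad a b c d" "length a = 4"
    and aj: "ajs (set a) (set b)" "ajs (set a) (set d)" "ajs (set b) (set c)" "ajs (set b) (set d)" "ajs (set c) (set d)" and ac: "\<not> ajs (set a) (set c)"
    and l5: "length b \<ge> 5" "length d \<ge> 5"
    and nm: "\<And>p r u v. (p, r) \<in> {(a, b), (a, d), (c, b), (c, d)} \<Longrightarrow> cons r u v \<Longrightarrow> \<not> tm p u v"
  shows False
proof -
  note D = quad_disj[OF q(1)] and l = quad_len[OF q(1)]
  have qd: "quad a d c b" using quad_swap[OF q(1)] quad_swap quad_swap by meson
  note aj' = aj[THEN ajs_sym]
  have nc: "\<not> (tch u (set a) \<and> tch v (set c))" if "cons b u v" for u v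
  proof
    assume h: "tch u (set a) \<and> tch v (set c)"
    show False
    proof (cases "length c = 4")
      case True
      then show False using no_consecutive_labels_4_4[OF q True _ aj(2,5) ac that] h l l5 q(2) by linarith
    next
      case False
      then have "length c = 5" "length b = 5" "length d = 5" using l l5 q(2) by linarith+
      then show False using no_consecutive_labels_4_5[OF q _ _ _ aj(1,2,3,5) ac _ that] nm h by blast
    qed
  qed
  have nc': "\<not> (tch u (set a) \<and> tch v (set c))" if "cons d u v" for u v
  proof
    assume h: "tch u (set a) \<and> tch v (set c)"
    show False
    proof (cases "length c = 4")
      case True
      then show False using no_consecutive_labels_4_4[OF qd q(2) True _ aj(1) aj'(3) ac that] h l l5 q(2) by linarith
    next
      case False
      then have "length c = 5" "length b = 5" "length d = 5" using l l5 q(2) by linarith+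
      then show False using no_consecutive_labels_4_5[OF qd q(2) _ _ _ aj(2,1) aj'(5,3) ac _ that] nm h by blast
    qed
  qed
  let ?s = "\<lambda>u. if u \<in> set b then nx b u else nx d u"
  have dis: "distinct b" "distinct d" using quadD[OF q(1)] unfolding cyc_def by blast+
  have bij: "bij_betw ?s (set b \<union> set d) (set b \<union> set d)"
  proof (rule bij_betw_combine)
    show "bij_betw ?s (set b) (set b)" using nx_bij[OF quadD(2)[OF q(1)]] by (rule bij_betw_cong[THEN iffD1, rotated]) simp
    show "bij_betw ?s (set d) (set d)" using nx_bij[OF quadD(4)[OF q(1)]] by (rule bij_betw_cong[THEN iffD1, rotated]) (use D in auto)
  qed (use D in auto)
  have sc: "cons b u (?s u) \<or> cons d u (?s u)" if "u \<in> set b \<union> set d" for u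
    using nx_cons[OF dis(1), of u] nx_cons[OF dis(2), of u] that by auto
  have "card (set b \<union> set d) + length a + length c \<ge> 20"
  proof (rule separating_cycle[OF quadD(1,3)[OF q(1)] bij _ _ _ _ D(2) _ _ _ ac])
    show "adj u (?s u)" if "u \<in> set b \<union> set d" for u
      using sc[OF that] cyc_cons[OF quadD(2)[OF q(1)] symp_bnd] cyc_cons[OF quadD(4)[OF q(1)] symp_bnd] bnd_adj by blast
    show "finite (set b \<union> set d)" by simp
    show "(set b \<union> set d) \<inter> set a = {}" "(set b \<union> set d) \<inter> set c = {}" using D by blast+
    show "nb u \<subseteq> set b \<union> set d \<union> set a \<union> set c" for u using nb_subset quadD(6)[OF q(1)] by blast
    show "set a \<noteq> V" "set c \<noteq> V" using quad_sub(1)[OF q(1)] quad_sub(1)[OF quad_swap(1)[OF quad_swap(2)[OF q(1)]]] by blast+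
    show "ajs (set b \<union> set d) (set a)" "ajs (set b \<union> set d) (set c)" using aj(3) aj'(1) unfolding ajs_def by blast+
    show "\<not> (tch u (set a) \<and> tch (?s u) (set c)) \<and> \<not> (tch u (set c) \<and> tch (?s u) (set a))" if "u \<in> set b \<union> set d" for u
      using sc[OF that] nc[of u "?s u"] nc[of "?s u" u] nc'[of u "?s u"] nc'[of "?s u" u] cons_sym by blast
    show "L Y (set a) \<noteq> {} \<and> L Y (set c) \<noteq> {}" if Y: "Y \<subseteq> set b \<union> set d" "Y \<noteq> {}" "\<And>u. u \<in> Y \<Longrightarrow> ?s u \<in> Y" for Y
    proof -
      have "set b \<subseteq> Y \<or> set d \<subseteq> Y"
      proof (cases "Y \<inter> set b = {}")
        case True
        have "Y \<inter> set d = set d"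
        proof (rule nx_trans[OF quadD(4)[OF q(1)]])
          fix u assume u: "u \<in> Y \<inter> set d"
          then have "u \<notin> set b" using D by blast
          then show "nx d u \<in> Y \<inter> set d" using Y(3)[of u] u nx_cons[OF dis(2), of u] cons_mem by auto
        qed (use Y True in blast)+
        then show ?thesis by blast
      next
        case False
        have "Y \<inter> set b = set b"
        proof (rule nx_trans[OF quadD(2)[OF q(1)]])
          fix u assume u: "u \<in> Y \<inter> set b"
          then show "nx b u \<in> Y \<inter> set b" using Y(3)[of u] u nx_cons[OF dis(1), of u] cons_mem by auto
        qed (use False in blast)+
        then show ?thesis by blast
      qed
      moreover have "L (set b) (set a) \<noteq> {}" "L (set b) (set c) \<noteq> {}" "L (set d) (set a) \<noteq> {}" "L (set d) (set c) \<noteq> {}"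
        using aj aj' ajs_L by blast+
      ultimately show ?thesis unfolding L_def by blast
    qed
    show "\<not> tm a u (?s u) \<and> \<not> tm a (?s u) u \<and> \<not> tm c u (?s u) \<and> \<not> tm c (?s u) u" if "u \<in> set b \<union> set d" for u
      using sc[OF that] nm[of a b u "?s u"] nm[of a b "?s u" u] nm[of a d u "?s u"] nm[of a d "?s u" u]
        nm[of c b u "?s u"] nm[of c b "?s u" u] nm[of c d u "?s u"] nm[of c d "?s u" u] cons_sym by blast
    show "\<not> tm a u v \<and> \<not> tm c u v" if "u \<in> set b \<union> set d" "bnd u v" for u v
    proof -
      have "cons b u v \<or> cons d u v" using that bcyc_cons_iff quadD(2,4)[OF q(1)] by blast
      then show ?thesis using nm[of a b u v] nm[of a d u v] nm[of c b u v] nm[of c d u v] by blast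
    qed
  qed
  moreover have "card (set b \<union> set d) = length b + length d" using card_Un_disjoint[OF _ _ D(5)] distinct_card[OF dis(1)] distinct_card[OF dis(2)] by simp
  ultimately show False using l by linarith
qed

text \<open>All pairs are adjacent except possibly \<open>a\<close> and \<open>c\<close>. No
  exchange is possible by \<open>quad_no_merge\<close>, so a cycle that sees all others has length
  at least 5. This applies to \<open>b\<close> and \<open>d\<close>; hence \<open>a\<close> or
  \<open>c\<close> has length 4, and then \<open>a\<close> and \<open>c\<close> are not
  adjacent.\<close>

lemma no_diamond:
  assumes q: "quad a b c d"
    and aj: "ajs (set a) (set b)" "ajs (set a) (set d)" "ajs (set b) (set c)" "ajs (set b) (set d)" "ajs (set c) (set d)"
  shows False
proof -
  note D = quad_disj[OF q] and l = quad_len[OF q] and aj' = aj[THEN ajs_sym]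
  have qs: "quad b a c d" "quad c a b d" "quad d a b c" "quad c b a d" using quad_swap[OF q] quad_swap quad_swap by meson+
  have nm: "\<not> tm p u v" if h: "p \<in> {a, b, c, d}" "r \<in> {a, b, c, d}" "p \<noteq> r" "cons r u v" for p r u v
  proof
    assume t: "tm p u v"
    have c: "cyc bnd p" "cyc bnd r" using h quadD[OF q] by auto
    have "set p \<inter> set r = {}" using h D by auto
    then obtain ms where ms: "cyc adj ms" "set ms = set p \<union> set r" using tm_square[OF c(1) cyc_mono[OF c(2)] _ h(4) t] by blast
    have ms': "set ms = set r \<union> set p" using ms(2) by blast
    have "(p, r) \<in> {(a, b), (a, c), (a, d), (b, c), (b, d), (c, d)} \<or> (r, p) \<in> {(a, b), (a, c), (a, d), (b, c), (b, d), (c, d)}" using h(1-3) by auto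
    then show False using quad_no_merge[OF q aj ms] quad_no_merge[OF q aj ms(1) ms'] by blast
  qed
  have "a \<noteq> []" "b \<noteq> []" "c \<noteq> []" "d \<noteq> []" using l by auto
  then have ds: "a \<noteq> b" "a \<noteq> c" "a \<noteq> d" "b \<noteq> c" "b \<noteq> d" "c \<noteq> d" using D by auto
  have l5: "length b \<ge> 5" "length d \<ge> 5"
  proof -
    have "length b \<noteq> 4"
      using four_cycle_three_labels[OF qs(1) _ aj'(1) aj(3,4)] nm[of b a] nm[of b c] nm[of b d] ds by blast
    moreover have "length d \<noteq> 4"
      using four_cycle_three_labels[OF qs(3) _ aj'(2,4,5)] nm[of d a] nm[of d b] nm[of d c] ds by blast
    ultimately show "length b \<ge> 5" "length d \<ge> 5" using l by linarith+
  qed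
  have nm': "\<not> tm p u v" if "(p, r) \<in> {(a, b), (a, d), (c, b), (c, d)}" "cons r u v" for p r u v
    using nm[of p r u v] that ds by auto
  have "length a = 4 \<or> length c = 4" using l l5 by linarith
  then show False
  proof
    assume a4: "length a = 4"
    show False
    proof (cases "ajs (set a) (set c)")
      case True
      then show False using four_cycle_three_labels[OF q a4 aj(1) True aj(2)] nm[of a b] nm[of a c] nm[of a d] ds by blast
    next
      case False
      show False by (rule no_diamond_aux[OF q a4 aj False l5]) (use nm' in blast)
    qed
  next
    assume c4: "length c = 4"
    show False
    proof (cases "ajs (set a) (set c)")
      case True
      then show False using four_cycle_three_labels[OF qs(2) c4 ajs_sym[OF True] aj'(3) aj(5)] nm[of c a] nm[of c b] nm[of c d] ds by blast
    next
      case False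
      then have "\<not> ajs (set c) (set a)" using ajs_sym by blast
      then show False by (rule no_diamond_aux[OF qs(4) c4 aj'(3) aj(5) aj'(1) aj(4,2) _ l5]) (use nm' in blast)
    qed
  qed
qed

lemma quad_small:
  assumes q: "quad a b c d" "length a \<le> 5" and ab: "ajs (set a) (set b)"
  shows "ajs (set a) (set c) \<Longrightarrow> \<not> ajs (set a) (set d) \<Longrightarrow> ajs (set b) (set c)"
    "ajs (set a) (set c) \<or> ajs (set a) (set d) \<Longrightarrow> ajs (set b) (set c) \<or> ajs (set b) (set d)"
proof -
  note D = quad_disj[OF q(1)]
  have B: "bclosed (set a)" "bclosed (set b)" "bclosed (set c)" "bclosed (set c \<union> set d)" using bcyc_bclosed bclosed_Un quadD[OF q(1)] by blast+
  show "ajs (set b) (set c)" if h: "ajs (set a) (set c)" "\<not> ajs (set a) (set d)"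
  proof (rule ccontr)
    assume n: "\<not> ?thesis"
    have "nb u \<subseteq> set a \<union> set b \<union> set c" if "u \<in> set a" for u
      using quad_out[OF q(1), of u] h(2) that unfolding ajs_def nb_def by blast
    then show False using small_host[OF q(2) B(2,3) D(1,2,4) n] ab h by blast
  qed
  show "ajs (set b) (set c) \<or> ajs (set b) (set d)" if h: "ajs (set a) (set c) \<or> ajs (set a) (set d)"
  proof (rule ccontr)
    assume n: "\<not> ?thesis"
    then have n': "\<not> ajs (set b) (set c \<union> set d)" unfolding ajs_def by blast
    have "nb u \<subseteq> set a \<union> set b \<union> (set c \<union> set d)" for u using nb_subset quadD(6)[OF q(1)] by blast
    moreover have "set a \<inter> (set c \<union> set d) = {}" "set b \<inter> (set c \<union> set d) = {}" using D by blast+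
    moreover have "ajs (set a) (set c \<union> set d)" using h unfolding ajs_def by blast
    ultimately show False using small_host[OF q(2) B(2,4) D(1) _ _ n'] ab by blast
  qed
qed

text \<open>The graph on the four cycles is connected, and by \<open>quad_small\<close> a cycle of
  length at most 5 is neither a cut vertex nor a vertex of degree 2 with nonadjacent neighbours.
  This excludes the path and the 4-cycle and makes \<open>d\<close> the centre of a star or a paw;
  the remaining graphs contain a diamond.\<close>

lemma no_quad_aux:
  assumes q: "quad a b c d" "length a \<le> 5" "length b \<le> 5" "length c \<le> 5"
  shows False
proof -
  have qs: "quad a c b d" "quad a d b c" "quad b a c d" "quad b c a d" "quad b d a c" "quad c a b d" "quad c b a d" "quad c d a b"
    "quad a b d c" "quad a c d b" "quad b a d c" "quad b c d a" "quad c a d b" "quad c b d a" "quad a d c b" "quad b d c a" "quad c d b a"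
    using quad_swap[OF q(1)] quad_swap quad_swap by meson+
  define ab ac ad bc bd cd where d: "ab = ajs (set a) (set b)" "ac = ajs (set a) (set c)" "ad = ajs (set a) (set d)"
    "bc = ajs (set b) (set c)" "bd = ajs (set b) (set d)" "cd = ajs (set c) (set d)"
  have s: "ajs (set b) (set a) = ab" "ajs (set c) (set a) = ac" "ajs (set d) (set a) = ad"
    "ajs (set c) (set b) = bc" "ajs (set d) (set b) = bd" "ajs (set d) (set c) = cd" using ajs_sym unfolding d by blast+
  note e = d[symmetric] s
  have ne: "set a \<noteq> {}" "set b \<noteq> {}" "set c \<noteq> {}" "set d \<noteq> {}" using quad_len[OF q(1)] by auto
  note D = quad_disj[OF q(1)] and P = quadD(6)[OF q(1)]
  have U: "ajs X (Y \<union> Z) \<longleftrightarrow> ajs X Y \<or> ajs X Z" "ajs (Y \<union> Z) X \<longleftrightarrow> ajs Y X \<or> ajs Z X" for X Y Z unfolding ajs_def by blast+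
  have "ajs (set a) (set b \<union> set c \<union> set d)" "ajs (set b) (set a \<union> set c \<union> set d)" "ajs (set c) (set a \<union> set b \<union> set d)" "ajs (set d) (set a \<union> set b \<union> set c)"
    "ajs (set a \<union> set b) (set c \<union> set d)" "ajs (set a \<union> set c) (set b \<union> set d)" "ajs (set a \<union> set d) (set b \<union> set c)"
    by (rule crossing_edge; use ne D P in blast)+
  then have con: "ab \<or> ac \<or> ad" "ab \<or> bc \<or> bd" "ac \<or> bc \<or> cd" "ad \<or> bd \<or> cd" "ac \<or> ad \<or> bc \<or> bd" "ab \<or> ad \<or> bc \<or> cd" "ab \<or> ac \<or> bd \<or> cd"
    unfolding U e by blast+
  have A: "ab \<and> ac \<and> \<not> ad \<longrightarrow> bc" "ab \<and> ad \<and> \<not> ac \<longrightarrow> bd" "ac \<and> ad \<and> \<not> ab \<longrightarrow> cd"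
    "ab \<and> (ac \<or> ad) \<longrightarrow> bc \<or> bd" "ac \<and> (ab \<or> ad) \<longrightarrow> bc \<or> cd" "ad \<and> (ab \<or> ac) \<longrightarrow> bd \<or> cd"
    using quad_small[OF q(1,2)] quad_small(1)[OF qs(9) q(2)] quad_small(1)[OF qs(10) q(2)] quad_small(2)[OF qs(1) q(2)] quad_small(2)[OF qs(2) q(2)] unfolding e by blast+
  have B: "ab \<and> bc \<and> \<not> bd \<longrightarrow> ac" "ab \<and> bd \<and> \<not> bc \<longrightarrow> ad" "bc \<and> bd \<and> \<not> ab \<longrightarrow> cd"
    "ab \<and> (bc \<or> bd) \<longrightarrow> ac \<or> ad" "bc \<and> (ab \<or> bd) \<longrightarrow> ac \<or> cd" "bd \<and> (ab \<or> bc) \<longrightarrow> ad \<or> cd"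
    using quad_small[OF qs(3) q(3)] quad_small(1)[OF qs(11) q(3)] quad_small(1)[OF qs(12) q(3)] quad_small(2)[OF qs(4) q(3)] quad_small(2)[OF qs(5) q(3)] unfolding e by blast+
  have C: "ac \<and> bc \<and> \<not> cd \<longrightarrow> ab" "ac \<and> cd \<and> \<not> bc \<longrightarrow> ad" "bc \<and> cd \<and> \<not> ac \<longrightarrow> bd"
    "ac \<and> (bc \<or> cd) \<longrightarrow> ab \<or> ad" "bc \<and> (ac \<or> cd) \<longrightarrow> ab \<or> bd" "cd \<and> (ac \<or> bc) \<longrightarrow> ad \<or> bd"
    using quad_small[OF qs(6) q(4)] quad_small(1)[OF qs(13) q(4)] quad_small(1)[OF qs(14) q(4)] quad_small(2)[OF qs(7) q(4)] quad_small(2)[OF qs(8) q(4)] unfolding e by blast+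
  have S: "\<not> (ad \<and> bd \<and> cd \<and> \<not> ab \<and> \<not> ac \<and> \<not> bc)" using no_star[OF q(1)] unfolding e by blast
  have W: "\<not> (ad \<and> bd \<and> cd \<and> \<not> ab \<and> \<not> ac \<and> bc)" "\<not> (ad \<and> bd \<and> cd \<and> \<not> ab \<and> \<not> bc \<and> ac)" "\<not> (ad \<and> bd \<and> cd \<and> \<not> ac \<and> \<not> bc \<and> ab)"
    using no_paw[OF q(1,3,4)] no_paw[OF qs(3) q(2,4)] no_paw[OF qs(6) q(2,3)] unfolding e by blast+
  have K: "\<not> (ab \<and> ad \<and> bc \<and> bd \<and> cd)" "\<not> (ac \<and> ad \<and> bc \<and> bd \<and> cd)" "\<not> (ab \<and> ac \<and> bd \<and> bc \<and> cd)"
    "\<not> (ab \<and> ad \<and> ac \<and> bd \<and> cd)" "\<not> (ab \<and> ac \<and> ad \<and> bc \<and> cd)" "\<not> (ab \<and> ac \<and> ad \<and> bc \<and> bd)"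
    using no_diamond[OF q(1)] no_diamond[OF qs(1)] no_diamond[OF qs(9)] no_diamond[OF qs(3)] no_diamond[OF qs(11)] no_diamond[OF qs(13)] unfolding e by blast+
  show False using con A B C S W K by argo
qed

lemma four_cycles:
  assumes nt: "\<not> (\<exists>a b. hpath V a b)" and c: "cyc bnd a" "cyc bnd b" "cyc bnd c" "cyc bnd d"
    and part: "set a \<union> set b \<union> set c \<union> set d = V" and dis: "set a \<inter> set b = {}" "set a \<inter> set c = {}" "set a \<inter> set d = {}"
      "set b \<inter> set c = {}" "set b \<inter> set d = {}" "set c \<inter> set d = {}"
  shows "card V \<ge> 20"
proof (rule ccontr)
  assume "\<not> ?thesis"
  then have q: "quad a b c d" unfolding quad_def using assms by auto
  have qs: "quad b c d a" "quad a c d b" "quad a b d c" using quad_swap[OF q] quad_swap quad_swap by meson+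
  note l = quad_len[OF q]
  consider "length a \<le> 5" "length b \<le> 5" "length c \<le> 5" | "length b \<le> 5" "length c \<le> 5" "length d \<le> 5"
    | "length a \<le> 5" "length c \<le> 5" "length d \<le> 5" | "length a \<le> 5" "length b \<le> 5" "length d \<le> 5" using l by linarith
  then show False using no_quad_aux[OF q] no_quad_aux[OF qs(1)] no_quad_aux[OF qs(2)] no_quad_aux[OF qs(3)] by cases blast+
qed

end

subsection \<open>Counting edges\<close>

text \<open>The dual tree grows face by face: a new face \<open>g\<close> shares an edge
  \<open>e\<close> with the faces already reached, and no earlier tree edge lies on
  \<open>g\<close>, because both its faces were reached before. So in a set \<open>D\<close> of tree
  edges the newest edge is the only one of \<open>D\<close> on its newest face, which plays the role
  of a leaf.\<close>

lemma dual_spanning_tree: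
  fixes inc :: "'f \<Rightarrow> 'e set"
  assumes fin: "finite F" "F \<noteq> {}"
    and two: "\<And>e f g h. \<lbrakk>f \<in> F; g \<in> F; h \<in> F; e \<in> inc f; e \<in> inc g; e \<in> inc h\<rbrakk> \<Longrightarrow> f = g \<or> f = h \<or> g = h"
    and con: "\<And>G. \<lbrakk>G \<subseteq> F; G \<noteq> {}; G \<noteq> F\<rbrakk> \<Longrightarrow> \<exists>f\<in>G. \<exists>g\<in>F - G. inc f \<inter> inc g \<noteq> {}"
  shows "\<exists>R. R \<subseteq> \<Union> (inc ` F) \<and> finite R \<and> Suc (card R) = card F \<and> (\<forall>D\<subseteq>R. D \<noteq> {} \<longrightarrow> (\<exists>f\<in>F. \<exists>e. inc f \<inter> D = {e}))"
proof -
  have "\<exists>G R. G \<subseteq> F \<and> card G = Suc k \<and> finite R \<and> card R = k \<and> R \<subseteq> \<Union> (inc ` F) \<and>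
      (\<forall>e\<in>R. \<exists>f\<in>G. \<exists>g\<in>G. f \<noteq> g \<and> e \<in> inc f \<and> e \<in> inc g) \<and> (\<forall>D\<subseteq>R. D \<noteq> {} \<longrightarrow> (\<exists>f\<in>F. \<exists>e. inc f \<inter> D = {e}))"
    if "k < card F" for k
    using that
  proof (induction k)
    case 0
    obtain f where "f \<in> F" using fin by blast
    then show ?case by (intro exI[of _ "{f}"] exI[of _ "{}"]) auto
  next
    case (Suc k)
    then obtain G R where G: "G \<subseteq> F" "card G = Suc k" "finite R" "card R = k" "R \<subseteq> \<Union> (inc ` F)"
      "\<And>e. e \<in> R \<Longrightarrow> \<exists>f\<in>G. \<exists>g\<in>G. f \<noteq> g \<and> e \<in> inc f \<and> e \<in> inc g" "\<And>D. D \<subseteq> R \<Longrightarrow> D \<noteq> {} \<Longrightarrow> \<exists>f\<in>F. \<exists>e. inc f \<inter> D = {e}"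
      by auto
    have fG: "finite G" using G(1) fin finite_subset by blast
    have "G \<noteq> {}" "G \<noteq> F" using G(2) Suc.prems by auto
    then obtain f g e where e: "f \<in> G" "g \<in> F" "g \<notin> G" "e \<in> inc f" "e \<in> inc g" using con[OF G(1)] by blast
    have new: "e' \<notin> inc g" if e': "e' \<in> R" for e'
    proof
      assume "e' \<in> inc g"
      moreover obtain h h' where "h \<in> G" "h' \<in> G" "h \<noteq> h'" "e' \<in> inc h" "e' \<in> inc h'" using G(6)[OF e'] by blast
      ultimately show False using two[of h h' g e'] G(1) e(2,3) by blast
    qed
    then have eR: "e \<notin> R" using e(5) by blast
    have "\<exists>f\<in>F. \<exists>x. inc f \<inter> D = {x}" if D: "D \<subseteq> insert e R" "D \<noteq> {}" for D
    proof (cases "e \<in> D")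
      case True
      then have "inc g \<inter> D = {e}" using D new e(5) by blast
      then show ?thesis using e(2) by blast
    next
      case False
      then show ?thesis using D G(7)[of D] by blast
    qed
    moreover have "\<exists>f\<in>insert g G. \<exists>h\<in>insert g G. f \<noteq> h \<and> x \<in> inc f \<and> x \<in> inc h" if "x \<in> insert e R" for x
    proof (cases "x = e")
      case True
      moreover have "f \<noteq> g" using e by blast
      ultimately show ?thesis using e(1,4,5) by (intro bexI[of _ f] bexI[of _ g]) auto
    next
      case False
      then show ?thesis using that G(6)[of x] by (meson insertE insertI2)
    qed
    ultimately show ?case using G e eR fG by (intro exI[of _ "insert g G"] exI[of _ "insert e R"]) (simp, blast)
  qed
  from this[of "card F - 1"] obtain R where "R \<subseteq> \<Union> (inc ` F)" "finite R" "card R = card F - 1"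
    "\<forall>D\<subseteq>R. D \<noteq> {} \<longrightarrow> (\<exists>f\<in>F. \<exists>e. inc f \<inter> D = {e})" using fin by (auto simp: card_gt_0_iff)
  moreover have "card F > 0" using fin by (simp add: card_gt_0_iff)
  ultimately show ?thesis by (intro exI[of _ R]) auto
qed

text \<open>Each vertex added to a growing set costs a new edge. Connectivity is expressed by cuts
  because this form is what the removal of the dual tree preserves.\<close>

lemma connected_card_edges:
  assumes "finite V" "V \<noteq> {}" "finite E" "\<And>X. X \<subseteq> V \<Longrightarrow> X \<noteq> {} \<Longrightarrow> X \<noteq> V \<Longrightarrow> \<exists>x\<in>X. \<exists>y\<in>V - X. {x, y} \<in> E"
  shows "card V \<le> Suc (card E)"
proof -
  have "\<exists>X R. X \<subseteq> V \<and> card X = Suc k \<and> R \<subseteq> E \<and> card R = k \<and> (\<forall>e\<in>R. e \<subseteq> X)" if "k < card V" for k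
    using that
  proof (induction k)
    case 0
    obtain v where "v \<in> V" using assms by blast
    then show ?case by (intro exI[of _ "{v}"] exI[of _ "{}"]) auto
  next
    case (Suc k)
    then obtain X R where X: "X \<subseteq> V" "card X = Suc k" "R \<subseteq> E" "card R = k" "\<forall>e\<in>R. e \<subseteq> X" by auto
    have "X \<noteq> {}" "X \<noteq> V" using X Suc.prems by auto
    then obtain x y where xy: "x \<in> X" "y \<in> V - X" "{x, y} \<in> E" using assms(4)[OF X(1)] by blast
    have "{x, y} \<notin> R" using X xy by blast
    moreover have "finite R" "finite X" using finite_subset[OF X(3) assms(3)] finite_subset[OF X(1) assms(1)] .
    ultimately show ?case using X xy by (intro exI[of _ "insert y X"] exI[of _ "insert {x, y} R"]) auto
  qed
  from this[of "card V - 1"] obtain R where "R \<subseteq> E" "card R = card V - 1" using assms(1,2) by (auto simp: card_gt_0_iff)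
  then have "card V - 1 \<le> card E" using card_mono[OF assms(3)] by metis
  then show ?thesis by linarith
qed

context ll_graph
begin

text \<open>One boundary cycle spans the graph, two are joined by a crossing edge, and five have at
  least 5 * 4 = 20 vertices.\<close>

lemma boundary_cycles:
  assumes nt: "\<not> (\<exists>a b. hpath V a b)"
  shows "\<exists>cs. (\<forall>xs\<in>set cs. cyc bnd xs \<and> set xs \<noteq> V) \<and> distinct (concat cs) \<and> set (concat cs) = V \<and> length cs \<ge> 3 \<and> card V \<ge> 20"
proof -
  obtain cs where cs: "\<forall>xs\<in>set cs. cyc bnd xs" "distinct (concat cs)" "set (concat cs) = V"
    using bcyc_decomposition[OF bclosed_V] by blast
  have neV: "V \<noteq> {}" using card_V by auto
  have ne: "set xs \<noteq> {}" if "cyc bnd xs" for xs using that unfolding cyc_def by auto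
  have "cs \<noteq> []" using cs(3) neV by auto
  moreover have False if e: "cs = [a]" for a
  proof -
    have c: "cyc bnd a" "set a = V" using cs e by auto
    obtain x where "x \<in> set a" using c(2) neV by (metis ex_in_conv)
    then obtain u v where "cons a u v" using cons_ex[OF c(1)] by blast
    then show False using cyc_hpath[OF cyc_mono[OF c(1)]] nt c(2) by metis
  qed
  moreover have False if e: "cs = [a, b]" for a b
  proof -
    have c: "cyc bnd a" "cyc bnd b" "set a \<union> set b = V" "set a \<inter> set b = {}" using cs e by auto
    have "ajs (set a) (set b)" using crossing_edge[OF c(3,4) ne[OF c(1)] ne[OF c(2)]] .
    then show False using join2[OF cyc_mono[OF c(1)] cyc_mono[OF c(2)] _ c(4)] c(3) nt by metis
  qed
  ultimately obtain a b c rest where abc: "cs = a # b # c # rest" by (metis list.exhaust)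
  have pr: "set xs \<noteq> V" if xs: "xs \<in> set cs" for xs
  proof
    assume e: "set xs = V"
    obtain ys zs where sp: "cs = ys @ xs # zs" using xs by (meson split_list)
    then have "ys \<noteq> [] \<or> zs \<noteq> []" using abc by auto
    then obtain w where w: "w \<in> set (ys @ zs)" by (metis append_is_Nil_conv last_in_set)
    then obtain v where v: "v \<in> set w" using ne cs(1) sp by fastforce
    then have "v \<in> set xs" using e cs(3) sp w by auto
    then show False using cs(2) sp w v by auto
  qed
  have "card V \<ge> 20"
  proof (cases rest)
    case Nil
    show ?thesis by (rule three_cycles[OF nt, of a b c]) (use cs abc Nil in auto)
  next
    case (Cons d r)
    show ?thesis
    proof (cases r)
      case Nil
      show ?thesis by (rule four_cycles[OF nt, of a b c d]) (use cs abc Cons Nil in auto)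
    next
      case (Cons e r')
      have cs5: "cs = a # b # c # d # e # r'" using abc Cons \<open>rest = d # r\<close> by simp
      have l: "length xs \<ge> 4" if "xs \<in> set cs" for xs using bcyc_length pr[OF that] cs(1) that by blast
      have "card V = length (concat cs)" using cs distinct_card by metis
      also have "\<dots> \<ge> 20" using l[of a] l[of b] l[of c] l[of d] l[of e] unfolding cs5 by simp
      finally show ?thesis .
    qed
  qed
  then show ?thesis using cs pr abc by (intro exI[of _ cs]) auto
qed

section \<open>Edges, triangles and the dual spanning tree\<close>

definition edges :: "'a set set" where "edges = {{u, v} | u v. adj u v}"
definition bedges :: "'a set set" where "bedges = {{u, v} | u v. bnd u v}"
definition triangles :: "'a set set" where "triangles = {{u, v, w} | u v w. adj u v \<and> adj v w \<and> adj u w}"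

lemma finite_edges: "finite edges" "bedges \<subseteq> edges" "finite triangles"
proof -
  have "edges \<subseteq> Pow V" "triangles \<subseteq> Pow V" unfolding edges_def triangles_def using adj_V adj_V2 by blast+
  then show "finite edges" "finite triangles" using finite_V finite_subset by blast+
  show "bedges \<subseteq> edges" unfolding edges_def bedges_def using bnd_adj by blast
qed

lemma card_bedges: "card bedges = card V"
proof -
  have "(\<Sum>v\<in>V. card {e\<in>bedges. v \<in> e}) = (\<Sum>e\<in>bedges. 2)"
  proof (rule sum_multicount_gen)
    show "finite V" "finite bedges" using finite_V finite_edges finite_subset by blast+
    show "\<forall>e\<in>bedges. card {v \<in> V. v \<in> e} = 2"
    proof
      fix e assume "e \<in> bedges"
      then obtain u v where uv: "e = {u, v}" "adj u v" unfolding bedges_def using bnd_adj by blast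
      have "{v \<in> V. v \<in> e} = {u, v}" using uv adj_V adj_V2 by blast
      moreover have "u \<noteq> v" using uv(2) adj_irrefl by blast
      ultimately show "card {v \<in> V. v \<in> e} = 2" by simp
    qed
  qed
  moreover have "card {e\<in>bedges. v \<in> e} = 2" if v: "v \<in> V" for v
  proof -
    obtain a b where ab: "a \<noteq> b" "{w. bnd v w} = {a, b}" using bnd_ex2[OF v] by blast
    have bv: "bnd v w \<longleftrightarrow> w = a \<or> w = b" for w using ab(2) by (metis insert_iff mem_Collect_eq singletonD)
    have "e \<in> bedges \<and> v \<in> e \<longleftrightarrow> e = {v, a} \<or> e = {v, b}" for e
    proof
      assume "e \<in> bedges \<and> v \<in> e"
      then obtain p q where "e = {p, q}" "bnd p q" "v = p \<or> v = q" unfolding bedges_def by blast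
      then have "\<exists>w. e = {v, w} \<and> bnd v w" using bnd_sym by (metis insert_commute)
      then show "e = {v, a} \<or> e = {v, b}" using bv by metis
    next
      assume "e = {v, a} \<or> e = {v, b}"
      then show "e \<in> bedges \<and> v \<in> e" unfolding bedges_def using bv by blast
    qed
    then have "{e\<in>bedges. v \<in> e} = {{v, a}, {v, b}}" by (simp only: set_eq_iff mem_Collect_eq insert_iff empty_iff simp_thms)
    moreover have "{v, a} \<noteq> {v, b}" using ab(1) by (auto simp: doubleton_eq_iff)
    ultimately show ?thesis by simp
  qed
  ultimately show ?thesis by simp
qed

lemma triangle_iff: assumes "adj u v" shows "f \<in> triangles \<and> {u, v} \<subseteq> f \<longleftrightarrow> (\<exists>w. adj u w \<and> adj v w \<and> f = {u, v, w})"
proof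
  assume f: "f \<in> triangles \<and> {u, v} \<subseteq> f"
  then obtain a b c where abc: "f = {a, b, c}" "adj a b" "adj b c" "adj a c" unfolding triangles_def by blast
  have s: "adj b a" "adj c b" "adj c a" using abc adj_sym by blast+
  have "u \<noteq> v" using assms adj_irrefl by auto
  moreover have "u = a \<or> u = b \<or> u = c" "v = a \<or> v = b \<or> v = c" using f abc(1) by auto
  ultimately consider "u = a" "v = b" | "u = a" "v = c" | "u = b" "v = a" | "u = b" "v = c" | "u = c" "v = a" | "u = c" "v = b" by blast
  then show "\<exists>w. adj u w \<and> adj v w \<and> f = {u, v, w}"
  proof cases
    case 1 then show ?thesis using abc s by (intro exI[of _ c]) auto
  next
    case 2 then show ?thesis using abc s by (intro exI[of _ b]) auto
  next
    case 3 then show ?thesis using abc s by (intro exI[of _ c]) auto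
  next
    case 4 then show ?thesis using abc s by (intro exI[of _ a]) auto
  next
    case 5 then show ?thesis using abc s by (intro exI[of _ b]) auto
  next
    case 6 then show ?thesis using abc s by (intro exI[of _ a]) auto
  qed
next
  assume "\<exists>w. adj u w \<and> adj v w \<and> f = {u, v, w}"
  then show "f \<in> triangles \<and> {u, v} \<subseteq> f" unfolding triangles_def using assms by blast
qed

lemma common_card: assumes "adj u v" shows "card {f \<in> triangles. {u, v} \<subseteq> f} = (if bnd u v then 1 else 2)"
proof -
  let ?C = "{w. adj u w \<and> adj v w}"
  have "f \<in> triangles \<and> {u, v} \<subseteq> f \<longleftrightarrow> f \<in> (\<lambda>w. {u, v, w}) ` ?C" for f unfolding triangle_iff[OF assms] by blast
  then have "{f \<in> triangles. {u, v} \<subseteq> f} = (\<lambda>w. {u, v, w}) ` ?C" by (simp only: set_eq_iff mem_Collect_eq simp_thms)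
  moreover have "inj_on (\<lambda>w. {u, v, w}) ?C"
  proof (rule inj_onI)
    fix x y assume h: "x \<in> ?C" "y \<in> ?C" "{u, v, x} = {u, v, y}"
    then have "x \<noteq> u" "x \<noteq> v" using adj_irrefl by auto
    then show "x = y" using h(3) by blast
  qed
  ultimately have c: "card {f \<in> triangles. {u, v} \<subseteq> f} = card ?C" by (simp add: card_image)
  show ?thesis
  proof (cases "bnd u v")
    case True
    then obtain x where "?C = {x}" unfolding bnd_def by blast
    then show ?thesis using c True by simp
  next
    case False
    obtain x y where xy: "x \<noteq> y" "adj u x" "adj v x" "adj u y" "adj v y" using nonbnd_common[OF assms False] by blast
    have "?C = {x, y}"
    proof
      show "{x, y} \<subseteq> ?C" using xy by blast
      show "?C \<subseteq> {x, y}" using common_at_most_two[of u v x y] xy assms by blast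
    qed
    then show ?thesis using c False xy(1) by simp
  qed
qed

lemma bnd_edge_iff: "{u, v} \<in> bedges \<longleftrightarrow> bnd u v"
  unfolding bedges_def using bnd_sym by (auto simp: doubleton_eq_iff)

text \<open>Count incident pairs of edges and triangles: each triangle has three edges, a boundary
  edge lies in one triangle and any other edge in two.\<close>

lemma card_triangles: "3 * card triangles + card V = 2 * card edges"
proof -
  have "(\<Sum>f\<in>triangles. card {e\<in>edges. e \<subseteq> f}) = (\<Sum>e\<in>edges. if e \<in> bedges then 1 else 2)"
  proof (rule sum_multicount_gen)
    show "finite triangles" "finite edges" using finite_edges by blast+
    show "\<forall>e\<in>edges. card {f \<in> triangles. e \<subseteq> f} = (if e \<in> bedges then 1 else 2)"
    proof
      fix e assume "e \<in> edges"
      then obtain u v where "e = {u, v}" "adj u v" unfolding edges_def by blast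
      then show "card {f \<in> triangles. e \<subseteq> f} = (if e \<in> bedges then 1 else 2)" using common_card bnd_edge_iff by simp
    qed
  qed
  moreover have "card {e\<in>edges. e \<subseteq> f} = 3" if f: "f \<in> triangles" for f
  proof -
    obtain a b c where abc: "f = {a, b, c}" "adj a b" "adj b c" "adj a c" using f unfolding triangles_def by blast
    have ne: "a \<noteq> b" "b \<noteq> c" "a \<noteq> c" using abc adj_irrefl by auto
    have "{e\<in>edges. e \<subseteq> f} = {{a, b}, {b, c}, {a, c}}"
    proof
      show "{{a, b}, {b, c}, {a, c}} \<subseteq> {e\<in>edges. e \<subseteq> f}" using abc unfolding edges_def by auto
      show "{e\<in>edges. e \<subseteq> f} \<subseteq> {{a, b}, {b, c}, {a, c}}"
      proof
        fix e assume "e \<in> {e\<in>edges. e \<subseteq> f}"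
        then obtain u v where uv: "e = {u, v}" "adj u v" "u \<in> {a, b, c}" "v \<in> {a, b, c}" unfolding edges_def abc(1) by blast
        have "u \<noteq> v" using uv(2) adj_irrefl by blast
        then show "e \<in> {{a, b}, {b, c}, {a, c}}" using uv by (auto simp: insert_commute)
      qed
    qed
    moreover have "card {{a, b}, {b, c}, {a, c}} = 3" using ne by (simp add: doubleton_eq_iff)
    ultimately show ?thesis by simp
  qed
  moreover have "(\<Sum>e\<in>edges. if e \<in> bedges then 1 else (2::nat)) + card bedges = 2 * card edges"
  proof -
    have "card bedges = (\<Sum>e\<in>edges. if e \<in> bedges then 1 else 0)"
      using sum.inter_restrict[OF finite_edges(1), of "\<lambda>_. 1 :: nat" bedges] Int_absorb1[OF finite_edges(2)] by simp
    then have "(\<Sum>e\<in>edges. if e \<in> bedges then 1 else (2::nat)) + card bedges = (\<Sum>e\<in>edges. (if e \<in> bedges then 1 else 2) + (if e \<in> bedges then 1 else 0))"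
      by (simp add: sum.distrib)
    also have "\<dots> = (\<Sum>e\<in>edges. 2)" by (rule sum.cong) auto
    finally show ?thesis by simp
  qed
  ultimately show ?thesis using card_bedges by simp
qed

text \<open>Faces are represented by their vertex sets; no boundary cycle has the vertex set of a triangle.\<close>

definition rim :: "'a set \<Rightarrow> 'a set set" where
  "rim f = (if f \<in> triangles then {e \<in> edges. e \<subseteq> f} else {e \<in> bedges. e \<subseteq> f})"

text \<open>If \<open>uv\<close> were the only crossing edge, then, depending on its direction, the
  part of the cycle outside or inside \<open>X\<close> would be closed under the successor and hence
  be the whole cycle.\<close>

lemma cycle_crossing:
  assumes c: "cyc R xs" and uv: "cons xs u v" "u \<in> X" "v \<notin> X"
  shows "\<exists>x y. cons xs x y \<and> x \<in> X \<and> y \<notin> X \<and> {x, y} \<noteq> {u, v}"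
proof (rule ccontr)
  assume n: "\<not> ?thesis"
  have d: "distinct xs" "length xs \<ge> 3" using c unfolding cyc_def by blast+
  have only: "x = u \<and> y = v" if "cons xs x y" "x \<in> X" "y \<notin> X" for x y
    using n that uv(2,3) by (metis doubleton_eq_iff)
  have two: False if h: "nx xs p = q" "nx xs q = p" "p \<in> set xs" "q \<in> set xs" for p q
  proof -
    have "{p, q} = set xs" by (rule nx_trans[OF c]) (use h in auto)
    moreover have "card {p, q} \<le> 2" by (simp add: card_insert_if)
    ultimately show False using distinct_card[OF d(1)] d(2) by simp
  qed
  have m: "u \<in> set xs" "v \<in> set xs" using cons_mem[OF uv(1)] by blast+
  have nc: "cons xs y (nx xs y)" if "y \<in> set xs" for y using nx_cons[OF d(1) that] .
  show False using cons_nx[OF d(1) uv(1)]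
  proof
    assume v: "v = nx xs u"
    have "set xs - X = set xs"
    proof (rule nx_trans[OF c])
      show "set xs - X \<noteq> {}" using m uv by blast
      fix y assume y: "y \<in> set xs - X"
      have "nx xs y \<notin> X"
      proof
        assume "nx xs y \<in> X"
        then have "nx xs y = u" "y = v" using only[OF cons_sym[OF nc]] y by blast+
        then show False using two[of u v] v m by metis
      qed
      then show "nx xs y \<in> set xs - X" using nc[of y] cons_mem y by blast
    qed blast
    then show False using m(1) uv(2) by blast
  next
    assume u: "u = nx xs v"
    have "set xs \<inter> X = set xs"
    proof (rule nx_trans[OF c])
      show "set xs \<inter> X \<noteq> {}" using m uv by blast
      fix y assume y: "y \<in> set xs \<inter> X"
      have "nx xs y \<in> X"
      proof (rule ccontr)
        assume "nx xs y \<notin> X"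
        then have "nx xs y = v" "y = u" using only[OF nc] y by blast+
        then show False using two[of u v] u m by metis
      qed
      then show "nx xs y \<in> set xs \<inter> X" using nc[of y] cons_mem y by blast
    qed blast
    then show False using m(2) uv(3) by blast
  qed
qed

lemma edges_lower_bound:
  assumes cs: "\<forall>xs\<in>set cs. cyc bnd xs \<and> set xs \<noteq> V" "distinct (concat cs)" "set (concat cs) = V"
  shows "card edges + 6 \<ge> 2 * card V + 3 * length cs"
proof -
  let ?C = "set ` set cs" and ?F = "triangles \<union> set ` set cs"
  have t3: "card f = 3" if f: "f \<in> triangles" for f
  proof -
    obtain a b c where abc: "f = {a, b, c}" "adj a b" "adj b c" "adj a c" using f unfolding triangles_def by blast
    then have "a \<noteq> b" "b \<noteq> c" "a \<noteq> c" using adj_irrefl by auto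
    then show ?thesis using abc(1) by simp
  qed
  have c4: "card f \<ge> 4" if f: "f \<in> ?C" for f
    using f cs(1) bcyc_length distinct_card unfolding cyc_def by fastforce
  have dis: "f = g" if fg: "f \<in> ?C" "g \<in> ?C" "v \<in> f" "v \<in> g" for f g v
  proof -
    obtain xs ys where xy: "f = set xs" "g = set ys" "xs \<in> set cs" "ys \<in> set cs" using fg by blast
    then obtain as bs where sp: "cs = as @ xs # bs" by (meson split_list)
    then have "ys = xs \<or> ys \<in> set as \<or> ys \<in> set bs" using xy by auto
    then show ?thesis using cs(2) sp xy fg by auto
  qed
  have rim_c: "rim f = {e \<in> bedges. e \<subseteq> f}" if f: "f \<in> ?C" for f
    using t3[of f] c4[OF f] unfolding rim_def by auto
  have rim_cyc: "{x, y} \<in> rim (set xs) \<longleftrightarrow> cons xs x y" if xs: "xs \<in> set cs" for xs x y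
  proof -
    have c: "cyc bnd xs" using cs(1) xs by blast
    show ?thesis using rim_c[of "set xs"] xs bcyc_cons_iff[OF c] bnd_edge_iff cons_mem[of xs x y] by auto
  qed
  have cof: "\<exists>f\<in>?C. v \<in> f" if "v \<in> V" for v using that cs(3) by auto
  have fin: "finite ?F" using finite_edges by simp
  have card_C: "card ?C = length cs"
  proof -
    have "distinct cs \<and> inj_on set (set cs)"
    proof -
      have "xs \<noteq> []" if "xs \<in> set cs" for xs using cs(1) that unfolding cyc_def by auto
      then show ?thesis using cs(2)
      proof (induction cs)
        case (Cons x l)
        have x: "x \<noteq> []" "set x \<inter> set (concat l) = {}" "distinct (concat l)" using Cons.prems by auto
        have "set x \<notin> set ` set l"
        proof
          assume "set x \<in> set ` set l"
          then have "set x \<subseteq> set (concat l)" by auto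
          then show False using x(1,2) by (metis Int_absorb2 set_empty)
        qed
        then show ?case using Cons.IH Cons.prems x(3) by auto
      qed simp
    qed
    then show ?thesis by (simp add: card_image distinct_card)
  qed
  have "triangles \<inter> ?C = {}" using t3 c4 by fastforce
  then have card_F: "card ?F = card triangles + length cs" using card_Un_disjoint[of triangles ?C] finite_edges card_C by simp
  have rimE: "rim f \<subseteq> edges" for f unfolding rim_def using finite_edges by auto
  have rimS: "e \<subseteq> f" if "e \<in> rim f" for e f using that unfolding rim_def by (auto split: if_splits)
  have "\<exists>R. R \<subseteq> \<Union> (rim ` ?F) \<and> finite R \<and> Suc (card R) = card ?F \<and> (\<forall>D\<subseteq>R. D \<noteq> {} \<longrightarrow> (\<exists>f\<in>?F. \<exists>e. rim f \<inter> D = {e}))"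
  proof (rule dual_spanning_tree[OF fin])
    obtain v where "v \<in> V" using card_V by fastforce
    then obtain f where "f \<in> ?C" using cof by blast
    then show "?F \<noteq> {}" by (metis UnI2 empty_iff)
  next
    fix e f g h assume h: "f \<in> ?F" "g \<in> ?F" "h \<in> ?F" "e \<in> rim f" "e \<in> rim g" "e \<in> rim h"
    obtain u v where uv: "e = {u, v}" "adj u v" using h(4) rimE unfolding edges_def by blast
    have su: "{u, v} \<subseteq> f" "{u, v} \<subseteq> g" "{u, v} \<subseteq> h" using rimS h(4-6) uv(1) by blast+
    have cc: "x = y" if "x \<in> {f, g, h}" "y \<in> {f, g, h}" "x \<in> ?C" "y \<in> ?C" for x y using dis[OF that(3,4), of u] that su by auto
    have bb: "bnd u v" if "x \<in> {f, g, h}" "x \<in> ?C" for x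
    proof -
      have "e \<in> rim x" using that(1) h by auto
      then show ?thesis using rim_c[OF that(2)] uv(1) bnd_edge_iff by simp
    qed
    have tt: "\<exists>w. adj u w \<and> adj v w \<and> x = {u, v, w}" if "x \<in> {f, g, h}" "x \<in> triangles" for x
      using triangle_iff[OF uv(2), of x] that su by auto
    have t2: "x = y" if "x \<in> {f, g, h}" "y \<in> {f, g, h}" "x \<in> triangles" "y \<in> triangles" "bnd u v" for x y
      using tt[OF that(1,3)] tt[OF that(2,4)] bnd_common_unique[OF that(5)] by blast
    show "f = g \<or> f = h \<or> g = h"
    proof (cases "bnd u v")
      case True
      have s: "x = y" if xy: "x \<in> {f, g, h}" "y \<in> {f, g, h}" "(x \<in> triangles) = (y \<in> triangles)" for x y
      proof (cases "x \<in> triangles")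
        case True
        then show ?thesis using t2[OF xy(1,2)] xy(3) \<open>bnd u v\<close> by simp
      next
        case False
        then have "x \<in> ?C" "y \<in> ?C" using xy h(1-3) by auto
        then show ?thesis using cc[OF xy(1,2)] by simp
      qed
      \<comment> \<open>A boundary edge lies on one triangle and one boundary cycle, and two of
        three faces are of the same kind.\<close>
      have "(f \<in> triangles) = (g \<in> triangles) \<or> (f \<in> triangles) = (h \<in> triangles) \<or> (g \<in> triangles) = (h \<in> triangles)" by argo
      moreover have "f = g" if "(f \<in> triangles) = (g \<in> triangles)" by (rule s[OF _ _ that]) auto
      moreover have "f = h" if "(f \<in> triangles) = (h \<in> triangles)" by (rule s[OF _ _ that]) auto
      moreover have "g = h" if "(g \<in> triangles) = (h \<in> triangles)" by (rule s[OF _ _ that]) auto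
      ultimately show ?thesis by argo
    next
      case False
      then have "f \<in> triangles" "g \<in> triangles" "h \<in> triangles" using bb h(1-3) by blast+
      then obtain x y z where "adj u x \<and> adj v x \<and> f = {u, v, x}" "adj u y \<and> adj v y \<and> g = {u, v, y}" "adj u z \<and> adj v z \<and> h = {u, v, z}"
        using tt[of f] tt[of g] tt[of h] by auto
      then show ?thesis using common_at_most_two[of u v x y z] uv(2) by metis
    qed
  next
    fix G assume G: "G \<subseteq> ?F" "G \<noteq> {}" "G \<noteq> ?F"
    show "\<exists>f\<in>G. \<exists>g\<in>?F - G. rim f \<inter> rim g \<noteq> {}"
    proof (rule ccontr)
      assume n: "\<not> ?thesis"
      have closed: "g \<in> G" if "f \<in> G" "g \<in> ?F" "e \<in> rim f" "e \<in> rim g" for f g e using n that by blast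
      have rt: "{v, x} \<in> rim {v, x, y}" "{v, y} \<in> rim {v, x, y}" "{v, x, y} \<in> triangles" if "adj v x" "adj v y" "adj x y" for v x y
      proof -
        show t: "{v, x, y} \<in> triangles" unfolding triangles_def using that by blast
        then show "{v, x} \<in> rim {v, x, y}" "{v, y} \<in> rim {v, x, y}" unfolding rim_def edges_def using that by auto
      qed
      \<comment> \<open>The faces at \<open>v\<close> are the triangles along its link and the
        boundary cycle \<open>w\<close> through \<open>v\<close>. Neighbouring triangles share an
        edge, and the first and last edges lie on \<open>w\<close>, so one face of \<open>G\<close>
        at \<open>v\<close> brings in all of them.\<close>
      define A where "A v = (\<forall>f\<in>?F. v \<in> f \<longrightarrow> f \<in> G)" for v
      have all: "A v" if f: "f \<in> G" "v \<in> f" for f v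
      proof -
        have vV: "v \<in> V" using f G(1) cs(3) adj_V adj_V2 unfolding triangles_def by auto
        have dg: "deg v \<ge> 2" using deg_ge_2[OF vV] .
        let ?x = "\<lambda>i. lk v ! i"
        have ax: "adj v (?x i)" if "i < deg v" for i using link_path_lk[OF vV] that unfolding link_path_def deg_def by (metis mem_Collect_eq nth_mem)
        have aj: "adj (?x i) (?x (Suc i))" if "Suc i < deg v" for i using link_path_lk[OF vV] that unfolding link_path_def deg_def by auto
        have px: "pos v (?x i) = i" if "i < deg v" for i using pos_lk[OF vV that] by blast
        let ?T = "\<lambda>i. {v, ?x i, ?x (Suc i)}"
        obtain w where w: "w \<in> ?C" "v \<in> w" using cof[OF vV] by blast
        have bw: "{v, ?x i} \<in> rim w" if "i = 0 \<or> Suc i = deg v" for i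
        proof -
          have i: "i < deg v" using that dg by linarith
          have "bnd v (?x i)" using bnd_iff[of v "?x i"] ax[OF i] px[OF i] that by simp
          moreover obtain xs where "w = set xs" "xs \<in> set cs" using w by blast
          ultimately show ?thesis using rim_cyc bcyc_cons_iff cs(1) w(2) by blast
        qed
        have T: "{v, ?x i} \<in> rim (?T i)" "{v, ?x (Suc i)} \<in> rim (?T i)" "?T i \<in> ?F" if "Suc i < deg v" for i
          using rt[OF ax[of i] ax[of "Suc i"] aj[of i]] that by auto
        have step: "?T i \<in> G \<longleftrightarrow> ?T (Suc i) \<in> G" if "Suc (Suc i) < deg v" for i
          using closed[OF _ _ T(2)[of i] T(1)[of "Suc i"]] closed[OF _ _ T(1)[of "Suc i"] T(2)[of i]] T(3)[of i] T(3)[of "Suc i"] that by auto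
        have to0: "?T i \<in> G \<longleftrightarrow> ?T 0 \<in> G" if "Suc i < deg v" for i
          using that by (induction i) (use step in auto)
        have w0: "w \<in> G \<longleftrightarrow> ?T 0 \<in> G"
          using closed[OF _ _ bw[of 0] T(1)[of 0]] closed[OF _ _ T(1)[of 0] bw[of 0]] T(3)[of 0] w dg by auto
        have cases: "g = w \<or> (\<exists>i. Suc i < deg v \<and> g = ?T i)" if g: "g \<in> ?F" "v \<in> g" for g
        proof (cases "g \<in> ?C")
          case True
          then show ?thesis using dis w g by blast
        next
          case False
          then obtain a b c where abc: "g = {a, b, c}" "adj a b" "adj b c" "adj a c" using g unfolding triangles_def by blast
          obtain p q where pq: "adj v p" "adj v q" "adj p q" "g = {v, p, q}"
            using g(2) abc adj_sym by (metis insert_commute insert_iff empty_iff)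
          have l: "pos v p < deg v" "pos v q < deg v" "?x (pos v p) = p" "?x (pos v q) = q" using pos_less pq lk_pos by blast+
          have "pos v p = Suc (pos v q) \<or> pos v q = Suc (pos v p)" using adj_pos[OF pq(1,2)] pq(3) by blast
          then show ?thesis
          proof
            assume e: "pos v p = Suc (pos v q)"
            then show ?thesis using l pq(4) by (metis insert_commute)
          next
            assume e: "pos v q = Suc (pos v p)"
            then show ?thesis using l pq(4) by metis
          qed
        qed
        have "?T 0 \<in> G" using cases[of f] f G(1) to0 w0 by blast
        show "A v" unfolding A_def
        proof (intro ballI impI)
          fix g assume "g \<in> ?F" "v \<in> g"
          then show "g \<in> G" using cases[of g] to0 w0 \<open>?T 0 \<in> G\<close> by metis
        qed
      qed
      have "{v \<in> V. A v} = V"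
      proof (rule closed_set_eq_V)
        obtain f where f: "f \<in> G" using G(2) by blast
        then have "f \<in> triangles \<or> f \<in> ?C" using G(1) by blast
        then have "f \<noteq> {}" using t3[of f] c4[of f] by auto
        moreover have "f \<subseteq> V" using f G(1) cs(3) adj_V adj_V2 unfolding triangles_def by auto
        ultimately show "{v \<in> V. A v} \<noteq> {}" using all f by blast
        fix u v assume h: "u \<in> {v \<in> V. A v}" "adj u v"
        then obtain w where w: "adj u w" "adj v w" using adj_imp_common by blast
        have "{u, v, w} \<in> G" using h rt(3)[OF h(2) w] unfolding A_def by auto
        then show "v \<in> {v \<in> V. A v}" using all[of "{u, v, w}" v] adj_V2 h(2) by blast
      qed blast
      then have A: "A v" if "v \<in> V" for v using that by blast
      have "?F \<subseteq> G"
      proof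
        fix f assume f: "f \<in> ?F"
        then have "f \<in> triangles \<or> f \<in> ?C" by blast
        then have "f \<noteq> {}" using t3[of f] c4[of f] by auto
        moreover have "f \<subseteq> V" using f cs(3) adj_V adj_V2 unfolding triangles_def by auto
        ultimately obtain v where "v \<in> V" "v \<in> f" by blast
        then show "f \<in> G" using A f unfolding A_def by blast
      qed
      then show False using G by blast
    qed
  qed
  then obtain R where R: "R \<subseteq> \<Union> (rim ` ?F)" "finite R" "Suc (card R) = card ?F" "\<And>D. D \<subseteq> R \<Longrightarrow> D \<noteq> {} \<Longrightarrow> \<exists>f\<in>?F. \<exists>e. rim f \<inter> D = {e}" by blast
  have RE: "R \<subseteq> edges" using R(1) rimE by blast
  have "card V \<le> Suc (card (edges - R))"
  proof (rule connected_card_edges)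
    show "finite V" "V \<noteq> {}" "finite (edges - R)" using finite_V card_V finite_edges by auto
    fix X assume X: "X \<subseteq> V" "X \<noteq> {}" "X \<noteq> V"
    show "\<exists>x\<in>X. \<exists>y\<in>V - X. {x, y} \<in> edges - R"
    proof (rule ccontr)
      assume n: "\<not> ?thesis"
      \<comment> \<open>If all edges of the cut were deleted, some face would carry exactly one of
        them; but the rim of a face crosses the cut a second time.\<close>
      let ?D = "{{x, y} | x y. x \<in> X \<and> y \<in> V - X \<and> adj x y}"
      have "?D \<subseteq> R" using n unfolding edges_def by blast
      moreover have "ajs X (V - X)" by (rule crossing_edge) (use X in auto)
      then have "?D \<noteq> {}" unfolding ajs_def by blast
      ultimately have "\<exists>f\<in>?F. \<exists>e. rim f \<inter> ?D = {e}" by (rule R(4))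
      then obtain f e where f: "f \<in> ?F" "rim f \<inter> ?D = {e}" by (elim bexE exE)
      have "e \<in> rim f \<inter> ?D" unfolding f(2) by simp
      then have "e \<in> ?D" "e \<in> rim f" by (rule IntD2, rule IntD1)
      then obtain x y where xy: "e = {x, y}" "x \<in> X" "y \<in> V - X" "adj x y" by blast
      have other: "{p, r} = {x, y}" if "{p, r} \<in> rim f" "p \<in> X" "r \<notin> X" for p r
      proof -
        have "{p, r} \<in> edges" using rimE that(1) by (rule subsetD)
        then obtain u v where "{p, r} = {u, v}" "adj u v" unfolding edges_def by blast
        then have "adj p r" using adj_sym by (metis doubleton_eq_iff)
        then have "{p, r} \<in> ?D" using that adj_V2 by blast
        then have "{p, r} \<in> rim f \<inter> ?D" using that(1) by (intro IntI)
        then show ?thesis unfolding f(2) xy(1) by simp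
      qed
      show False
      proof (cases "f \<in> triangles")
        case True
        then obtain z where z: "adj x z" "adj y z" "f = {x, y, z}" using triangle_iff[OF xy(4), of f] rimS[OF \<open>e \<in> rim f\<close>] xy(1) by blast
        have "{x, z} \<in> rim f" "{z, y} \<in> rim f" using True z adj_sym unfolding rim_def edges_def by auto
        then have "z \<in> X \<Longrightarrow> {z, y} = {x, y}" "z \<notin> X \<Longrightarrow> {x, z} = {x, y}" using other xy by blast+
        then show False using z(1,2) adj_irrefl by (auto simp: doubleton_eq_iff)
      next
        case False
        then obtain xs where xs: "f = set xs" "xs \<in> set cs" using f(1) by blast
        have "cons xs x y" using rim_cyc[OF xs(2)] \<open>e \<in> rim f\<close> xy(1) xs(1) by simp
        then obtain p r where "cons xs p r" "p \<in> X" "r \<notin> X" "{p, r} \<noteq> {x, y}"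
          using cycle_crossing[of bnd xs x y X] cs(1) xs(2) xy(2,3) by blast
        then show False using other rim_cyc[OF xs(2)] xs(1) by blast
      qed
    qed
  qed
  moreover have "card (edges - R) = card edges - card R" using card_Diff_subset[OF R(2) RE] .
  moreover have "card R \<le> card edges" using card_mono[OF finite_edges(1) RE] .
  ultimately have "card V + card triangles + length cs \<le> card edges + 2" using R(3) card_F by linarith
  then show ?thesis using card_triangles by linarith
qed

theorem nontraceable_bounds:
  assumes "\<not> (\<exists>a b. hpath V a b)"
  shows "card V \<ge> 20" "card edges \<ge> 2 * card V + 3"
proof -
  obtain cs where cs: "\<forall>xs\<in>set cs. cyc bnd xs \<and> set xs \<noteq> V" "distinct (concat cs)" "set (concat cs) = V" "length cs \<ge> 3" "card V \<ge> 20"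
    using boundary_cycles[OF assms] by blast
  show "card V \<ge> 20" using cs by blast
  show "card edges \<ge> 2 * card V + 3" using edges_lower_bound[OF cs(1-3)] cs(4) by linarith
qed

end

subsection \<open>Extremal graphs\<close>

text \<open>\<open>c\<close> is constant on the pieces of the path outside \<open>S\<close>, and
  every piece but possibly the first is preceded by a vertex of \<open>S\<close>. Recording whether
  the path starts in \<open>S\<close> makes the induction work.\<close>

lemma toughness:
  assumes "successively R p" "\<And>u v. u \<in> set p \<Longrightarrow> v \<in> set p \<Longrightarrow> R u v \<Longrightarrow> u \<notin> S \<Longrightarrow> v \<notin> S \<Longrightarrow> c u = c v"
  shows "card (c ` (set p - S)) \<le> length (filter (\<lambda>x. x \<in> S) p) + (if p = [] \<or> hd p \<in> S then 0 else 1)"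
  using assms
proof (induction p)
  case (Cons x p)
  have IH: "card (c ` (set p - S)) \<le> length (filter (\<lambda>x. x \<in> S) p) + (if p = [] \<or> hd p \<in> S then 0 else 1)"
    by (rule Cons.IH) (use Cons.prems in \<open>auto simp: successively_Cons\<close>)
  show ?case
  proof (cases "x \<in> S")
    case True
    then have "set (x # p) - S = set p - S" by auto
    then show ?thesis using IH True by (auto split: if_splits)
  next
    case False
    then have e: "c ` (set (x # p) - S) = insert (c x) (c ` (set p - S))" by auto
    show ?thesis
    proof (cases "p = [] \<or> hd p \<in> S")
      case True
      then show ?thesis using IH False card_insert_le_m1[of "Suc (card (c ` (set p - S)))"] unfolding e by (auto simp: card_insert_if)
    next
      case p: False
      then have "R x (hd p)" "hd p \<in> set p" using Cons.prems(1) by (auto simp: successively_Cons)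
      then have "c x = c (hd p)" using Cons.prems(2)[of x "hd p"] False p by simp
      then have "c x \<in> c ` (set p - S)" using \<open>hd p \<in> set p\<close> p by simp
      then show ?thesis using IH False p unfolding e by (simp add: insert_absorb)
    qed
  qed
qed simp

text \<open>A hexagon 0, ..., 5 with the chord 03, ears 14, ..., 19 on its six edges, and in each of
  the two quadrangles an annulus ending in a hole with boundary 6, 7, 8, 9 and 10, 11, 12, 13, respectively.
  Each list is the link of its index in path order.\<close>

definition base_links :: "nat list list" where
  "base_links = [[14, 1, 6, 9, 3, 10, 13, 5, 19], [14, 0, 6, 7, 2, 15], [15, 1, 7, 8, 3, 16], [16, 2, 8, 9, 0, 10, 11, 4, 17],
     [17, 3, 11, 12, 5, 18], [18, 4, 12, 13, 0, 19], [7, 1, 0, 9], [6, 1, 2, 8], [7, 2, 3, 9], [6, 0, 3, 8],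
     [11, 3, 0, 13], [10, 3, 4, 12], [11, 4, 5, 13], [10, 0, 5, 12], [0, 1], [1, 2], [2, 3], [3, 4], [4, 5], [5, 0]]"

text \<open>The vertices from 20 on extend the ear 19 to a fan around 0.\<close>

definition fan_links :: "nat \<Rightarrow> nat \<Rightarrow> nat list" where
  "fan_links n v = (if v = 0 then base_links ! 0 @ [20..<n]
     else if v < 19 then base_links ! v
     else if v = 19 then [5, 0] @ (if 20 < n then [20] else [])
     else [v - 1, 0] @ (if Suc v < n then [Suc v] else []))"

definition fan_adj :: "nat \<Rightarrow> nat \<Rightarrow> nat \<Rightarrow> bool" where
  "fan_adj n u v \<longleftrightarrow> u < n \<and> v \<in> set (fan_links n u)"

text \<open>From 6 on this numbers the components left when the hexagon is removed: the two holes,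
  the ears 14 to 18, and the ear 19 with its fan.\<close>

definition fan_colour :: "nat \<Rightarrow> nat" where
  "fan_colour v = (if v < 10 then 0 else if v < 14 then 1 else if v < 19 then v - 12 else 7)"

lemma base_check:
  "\<forall>u\<in>set [0..<20]. distinct (base_links ! u) \<and> base_links ! u \<noteq> [] \<and>
     (\<forall>v\<in>set (base_links ! u). v < 20 \<and> u \<noteq> v \<and> u \<in> set (base_links ! v) \<and> (u < 6 \<or> v < 6 \<or> fan_colour u = fan_colour v)) \<and>
     (u = 0 \<or> 0 \<in> set (base_links ! u) \<or> (\<exists>w\<in>set (base_links ! u). 0 \<in> set (base_links ! w))) \<and>
     (\<forall>i\<in>set [0..<length (base_links ! u)]. \<forall>j\<in>set [0..<length (base_links ! u)].
        (base_links ! u ! j \<in> set (base_links ! (base_links ! u ! i))) = (i = Suc j \<or> j = Suc i))"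
  by code_simp

text \<open>43 = 2 * 20 + 3, each edge being counted at its larger end.\<close>

lemma base_count: "sum_list (map (\<lambda>u. length (filter (\<lambda>v. v < u) (base_links ! u))) [0..<20]) = 43"
  by code_simp

lemma base:
  assumes "u < 20"
  shows "distinct (base_links ! u)" "base_links ! u \<noteq> []"
    "v \<in> set (base_links ! u) \<Longrightarrow> v < 20" "v \<in> set (base_links ! u) \<Longrightarrow> u \<noteq> v" "v \<in> set (base_links ! u) \<Longrightarrow> u \<in> set (base_links ! v)"
    "v \<in> set (base_links ! u) \<Longrightarrow> u \<ge> 6 \<Longrightarrow> v \<ge> 6 \<Longrightarrow> fan_colour u = fan_colour v"
    "u = 0 \<or> 0 \<in> set (base_links ! u) \<or> (\<exists>w\<in>set (base_links ! u). 0 \<in> set (base_links ! w))"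
    "i < length (base_links ! u) \<Longrightarrow> j < length (base_links ! u) \<Longrightarrow>
      base_links ! u ! j \<in> set (base_links ! (base_links ! u ! i)) \<longleftrightarrow> i = Suc j \<or> j = Suc i"
  using base_check[THEN bspec, of u] assms by auto

lemma base0: "base_links ! 0 = [14, 1, 6, 9, 3, 10, 13, 5, 19]" "base_links ! 5 = [18, 4, 12, 13, 0, 19]" "base_links ! 19 = [5, 0]"
  by (simp_all add: base_links_def)

context
  fixes n :: nat assumes n20: "n \<ge> 20"
begin

lemma fan_adj_base: "u < 20 \<Longrightarrow> v < 20 \<Longrightarrow> fan_adj n u v \<longleftrightarrow> v \<in> set (base_links ! u)"
  using n20 base0 unfolding fan_adj_def fan_links_def by (cases "u = 19") auto

lemma fan_adj_high: "u \<ge> 20 \<Longrightarrow> fan_adj n u v \<longleftrightarrow> u < n \<and> v < n \<and> (v = 0 \<or> Suc v = u \<or> v = Suc u)"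
  unfolding fan_adj_def fan_links_def by auto

lemma fan_adj_low: "u < 20 \<Longrightarrow> v \<ge> 20 \<Longrightarrow> fan_adj n u v \<longleftrightarrow> v < n \<and> (u = 0 \<or> u = 19 \<and> v = 20)"
  using n20 base(3)[of u v] base0 unfolding fan_adj_def fan_links_def by auto

lemma fan_adj_less: assumes "fan_adj n u v" shows "u < n" "v < n"
proof -
  show "u < n" using assms unfolding fan_adj_def by blast
  show "v < n"
  proof (cases "v < 20")
    case False
    then show ?thesis using fan_adj_high[of u v] fan_adj_low[of u v] assms by (cases "u < 20") auto
  qed (use n20 in simp)
qed

lemma fan_adj_sym: assumes "fan_adj n u v" shows "fan_adj n v u"
proof -
  note l = fan_adj_less[OF assms]
  show ?thesis
  proof (cases "u < 20"; cases "v < 20")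
    assume "u < 20" "v < 20"
    then show ?thesis using assms fan_adj_base base(5) by blast
  next
    assume h: "u < 20" "\<not> v < 20"
    then show ?thesis using assms fan_adj_low[of u v] fan_adj_high[of v u] l by auto
  next
    assume h: "\<not> u < 20" "v < 20"
    then show ?thesis using assms fan_adj_low[of v u] fan_adj_high[of u v] l by auto
  next
    assume h: "\<not> u < 20" "\<not> v < 20"
    then show ?thesis using assms fan_adj_high[of v u] fan_adj_high[of u v] l by auto
  qed
qed

lemma fan_adj_irrefl: "\<not> fan_adj n u u"
proof (cases "u < 20")
  case True
  then show ?thesis using fan_adj_base[of u u] base(4)[of u u] by blast
next
  case False
  then show ?thesis using fan_adj_high[of u u] by auto
qed

lemma fan_link_zero: "link_path (fan_adj n) 0 (fan_links n 0)"
proof -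
  let ?b = "base_links ! 0" and ?x = "fan_links n 0"
  have x: "?x = ?b @ [20..<n]" "length ?b = 9" by (simp_all add: fan_links_def base0)
  have b: "?b ! i < 20" "?b ! i \<noteq> 0" "?b ! i = 19 \<longleftrightarrow> i = 8" if "i < 9" for i
  proof -
    have "i = 0 \<or> i = 1 \<or> i = 2 \<or> i = 3 \<or> i = 4 \<or> i = 5 \<or> i = 6 \<or> i = 7 \<or> i = 8" using that by linarith
    then show "?b ! i < 20" "?b ! i \<noteq> 0" "?b ! i = 19 \<longleftrightarrow> i = 8" unfolding base0 by auto
  qed
  have lx: "length ?x = n - 11" using x n20 by simp
  have low: "?x ! i = ?b ! i" if "i < 9" for i using that x by (simp add: nth_append)
  \<comment> \<open>The nine base entries are followed by 20, so the offset is 20 - 9 = 11; the last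
    base entry is 19, to which 20 is joined.\<close>
  have high: "?x ! i = i + 11" if "9 \<le> i" "i < length ?x" for i using that x lx by (simp add: nth_append)
  have "fan_adj n (?x ! i) (?x ! j) \<longleftrightarrow> i = Suc j \<or> j = Suc i" if ij: "i < length ?x" "j < length ?x" for i j
  proof (cases "i < 9"; cases "j < 9")
    assume h: "i < 9" "j < 9"
    then show ?thesis using fan_adj_base[of "?b ! i" "?b ! j"] low b base(8)[of 0 i j] x(2) by simp
  next
    assume h: "i < 9" "\<not> j < 9"
    then have "fan_adj n (?x ! i) (?x ! j) \<longleftrightarrow> i = 8 \<and> j + 11 = 20"
      using fan_adj_low[of "?b ! i" "j + 11"] low[of i] high[of j] b[of i] ij lx by auto
    then show ?thesis using h by auto
  next
    assume h: "\<not> i < 9" "j < 9"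
    then have "fan_adj n (?x ! j) (?x ! i) \<longleftrightarrow> j = 8 \<and> i + 11 = 20"
      using fan_adj_low[of "?b ! j" "i + 11"] low[of j] high[of i] b[of j] ij lx by auto
    moreover have "fan_adj n (?x ! i) (?x ! j) \<longleftrightarrow> fan_adj n (?x ! j) (?x ! i)" using fan_adj_sym by blast
    moreover have "j = 8 \<and> i + 11 = 20 \<longleftrightarrow> i = Suc j \<or> j = Suc i" using h by linarith
    ultimately show ?thesis by argo
  next
    assume h: "\<not> i < 9" "\<not> j < 9"
    then show ?thesis using fan_adj_high[of "i + 11" "j + 11"] high[of i] high[of j] ij lx by auto
  qed
  moreover have "distinct ?x" using x base(1,3)[of 0] by force
  moreover have "set ?x = {u. fan_adj n 0 u}" unfolding fan_adj_def using n20 by auto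
  moreover have "?x \<noteq> []" using x(1) base0 by simp
  ultimately show ?thesis unfolding link_path_def by blast
qed

lemma link_path_three:
  assumes "{u. R v u} = {a, b, c}" "R a b" "R b c" "\<not> R a c" "\<And>x y. R x y \<Longrightarrow> R y x" "\<And>x. \<not> R x x" "distinct [a, b, c]"
  shows "link_path R v [a, b, c]"
proof -
  have "R ([a, b, c] ! i) ([a, b, c] ! j) \<longleftrightarrow> i = Suc j \<or> j = Suc i" if "i < 3" "j < 3" for i j
  proof -
    have "i = 0 \<or> i = 1 \<or> i = 2" "j = 0 \<or> j = 1 \<or> j = 2" using that by linarith+
    then show ?thesis using assms(2-6) by (elim disjE) auto
  qed
  then show ?thesis using assms(1,7) unfolding link_path_def by simp
qed

lemma link_path_two:
  assumes "{u. R v u} = {a, b}" "R a b" "\<And>x y. R x y \<Longrightarrow> R y x" "\<And>x. \<not> R x x" "a \<noteq> b"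
  shows "link_path R v [a, b]"
proof -
  have "R ([a, b] ! i) ([a, b] ! j) \<longleftrightarrow> i = Suc j \<or> j = Suc i" if "i < 2" "j < 2" for i j
  proof -
    have "i = 0 \<or> i = 1" "j = 0 \<or> j = 1" using that by linarith+
    then show ?thesis using assms(2-4) by (elim disjE) auto
  qed
  then show ?thesis using assms(1,5) unfolding link_path_def by simp
qed

lemma fan_link: assumes v: "v < n" shows "\<exists>xs. link_path (fan_adj n) v xs"
proof -
  note si = fan_adj_sym fan_adj_irrefl
  consider "v = 0" | "0 < v" "v < 19" | "v \<ge> 19" by linarith
  then show ?thesis
  proof cases
    case 1
    then show ?thesis using fan_link_zero by blast
  next
    case 2
    let ?b = "base_links ! v"
    have v20: "v < 20" using 2 by simp
    have m: "?b ! i < 20" if "i < length ?b" for i using base(3)[OF v20] nth_mem[OF that] by blast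
    have "set ?b = {u. fan_adj n v u}" using 2 v unfolding fan_adj_def fan_links_def by auto
    then have "link_path (fan_adj n) v ?b" unfolding link_path_def
      using base(1,2,8)[OF v20] fan_adj_base[OF m m] by auto
    then show ?thesis by blast
  next
    case 3
    define w where "w = (if v = 19 then 5 else v - 1)"
    have nb: "{u. fan_adj n v u} = (if Suc v < n then {w, 0, Suc v} else {w, 0})"
      using 3 v unfolding fan_adj_def fan_links_def w_def by auto
    have w0: "fan_adj n w 0"
    proof (cases "v \<le> 20")
      case True
      then have "w = 5 \<or> w = 19" using 3 unfolding w_def by auto
      then show ?thesis using fan_adj_base[of w 0] base0 by auto
    next
      case False
      then show ?thesis using fan_adj_high[of w 0] v unfolding w_def by auto
    qed
    have ne: "w \<noteq> 0" "w \<noteq> Suc v" using 3 unfolding w_def by auto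
    show ?thesis
    proof (cases "Suc v < n")
      case True
      have 0: "fan_adj n 0 (Suc v)" using fan_adj_low[of 0 "Suc v"] 3 True by simp
      have 1: "\<not> fan_adj n w (Suc v)"
      proof (cases "v \<le> 20")
        case True
        then have "w = 5 \<or> w = 19" "w = 19 \<Longrightarrow> v = 20" using 3 unfolding w_def by (auto split: if_splits)
        then show ?thesis using fan_adj_low[of w "Suc v"] 3 by auto
      next
        case False
        then show ?thesis using fan_adj_high[of w "Suc v"] unfolding w_def by auto
      qed
      have "link_path (fan_adj n) v [w, 0, Suc v]"
      proof (rule link_path_three[where R = "fan_adj n", OF _ w0 0 1])
        show "{u. fan_adj n v u} = {w, 0, Suc v}" using nb True by simp
        show "distinct [w, 0, Suc v]" using ne by simp
      qed (fact si)+
      then show ?thesis by blast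
    next
      case False
      then have "{u. fan_adj n v u} = {w, 0}" using nb by simp
      then have "link_path (fan_adj n) v [w, 0]" by (rule link_path_two[where R = "fan_adj n", OF _ w0]) (fact si ne)+
      then show ?thesis by blast
    qed
  qed
qed

lemma fan_connected: assumes "u < n" "v < n" shows "(u, v) \<in> {(x, y). fan_adj n x y}\<^sup>*"
proof -
  have to0: "(v, 0) \<in> {(x, y). fan_adj n x y}\<^sup>*" if v: "v < n" for v
  proof (cases "v < 20")
    case True
    have a: "(x, y) \<in> {(x, y). fan_adj n x y}" if "x < 20" "y \<in> set (base_links ! x)" for x y
      using fan_adj_base[of x y] base(3)[of x y] that by simp
    show ?thesis using base(7)[OF True]
    proof (elim disjE bexE)
      assume "0 \<in> set (base_links ! v)"
      then show ?thesis using a[OF True] by blast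
    next
      fix w assume w: "w \<in> set (base_links ! v)" "0 \<in> set (base_links ! w)"
      show ?thesis using a[OF True w(1)] a[OF base(3)[OF True w(1)] w(2)] by (meson converse_rtrancl_into_rtrancl r_into_rtrancl)
    qed simp
  next
    case False
    then show ?thesis using fan_adj_high[of v 0] v by (auto intro!: r_into_rtrancl)
  qed
  have "sym ({(x, y). fan_adj n x y}\<^sup>*)" using fan_adj_sym by (intro sym_rtrancl symI) auto
  then have "(0, v) \<in> {(x, y). fan_adj n x y}\<^sup>*" using to0[OF assms(2)] by (meson symE)
  then show ?thesis using to0[OF assms(1)] by (meson rtrancl_trans)
qed

lemma fan_colour_adj: assumes "fan_adj n u v" "u \<ge> 6" "v \<ge> 6" shows "fan_colour u = fan_colour v"
proof -
  have *: "fan_colour u = fan_colour v" if "fan_adj n u v" "u \<ge> 6" "v \<ge> 6" "u \<ge> 20" for u v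
    using fan_adj_high[OF that(4), of v] that unfolding fan_colour_def by auto
  show ?thesis
  proof (cases "u < 20 \<and> v < 20")
    case True
    then show ?thesis using fan_adj_base[of u v] base(6)[of u v] assms by blast
  next
    case False
    then show ?thesis using *[OF assms] *[OF fan_adj_sym[OF assms(1)]] assms by auto
  qed
qed

text \<open>Six vertices divide a path into at most seven pieces, but removing the hexagon leaves
  eight components.\<close>

lemma fan_nontraceable: "\<not> (\<exists>p. distinct p \<and> set p = {0..<n} \<and> successively (fan_adj n) p)"
proof
  assume "\<exists>p. distinct p \<and> set p = {0..<n} \<and> successively (fan_adj n) p"
  then obtain p where p: "distinct p" "set p = {0..<n}" "successively (fan_adj n) p" by blast
  have "card (fan_colour ` (set p - {0..<6})) \<le> length (filter (\<lambda>x. x \<in> {0..<6}) p) + (if p = [] \<or> hd p \<in> {0..<6} then 0 else 1)"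
    by (rule toughness[OF p(3)]) (use fan_colour_adj in auto)
  also have "length (filter (\<lambda>x. x \<in> {0..<6}) p) = card (set p \<inter> {0..<6})"
    using distinct_length_filter[OF p(1)] by (simp add: Int_commute Int_def)
  also have "\<dots> \<le> 6" using card_mono[of "{0..<6::nat}" "set p \<inter> {0..<6}"] by simp
  finally have "card (fan_colour ` (set p - {0..<6})) \<le> 7" by (auto split: if_splits)
  moreover have "{0..<8} \<subseteq> fan_colour ` (set p - {0..<6})"
  proof
    fix c :: nat assume "c \<in> {0..<8}"
    then have "c = 0 \<or> c = 1 \<or> 2 \<le> c \<and> c \<le> 7" by auto
    then have "\<exists>v\<in>{6..<20}. fan_colour v = c"
    proof (elim disjE)
      assume "2 \<le> c \<and> c \<le> 7"
      then show ?thesis by (intro bexI[of _ "c + 12"]) (auto simp: fan_colour_def)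
    qed (auto simp: fan_colour_def intro: bexI[of _ 6] bexI[of _ 10])
    then show "c \<in> fan_colour ` (set p - {0..<6})" using p(2) n20 by fastforce
  qed
  then have "8 \<le> card (fan_colour ` (set p - {0..<6}))" using card_mono[of "fan_colour ` (set p - {0..<6})" "{0..<8}"] by simp
  ultimately show False by linarith
qed

text \<open>Each vertex \<open>u\<close> from 20 on has exactly the two smaller neighbours 0 and
  \<open>u - 1\<close>, so the count is 43 + 2 * (n - 20).\<close>

lemma fan_card_edges: "card {(u, v). fan_adj n u v \<and> v < u} = 2 * n + 3"
proof -
  let ?D = "\<lambda>u. {v. fan_adj n u v \<and> v < u}"
  have e: "{(u, v). fan_adj n u v \<and> v < u} = Sigma {0..<n} ?D" using fan_adj_less by auto
  have "finite (?D u)" for u by simp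
  then have "card (Sigma {0..<n} ?D) = (\<Sum>u\<in>{0..<n}. card (?D u))" by simp
  also have "\<dots> = (\<Sum>u\<in>{0..<20}. card (?D u)) + (\<Sum>u\<in>{20..<n}. card (?D u))"
    using sum.atLeastLessThan_concat[of 0 20 n "\<lambda>u. card (?D u)"] n20 by simp
  also have "(\<Sum>u\<in>{20..<n}. card (?D u)) = (\<Sum>u\<in>{20..<n}. 2)"
  proof (rule sum.cong)
    fix u assume u: "u \<in> {20..<n}"
    then have "fan_adj n u v \<and> v < u \<longleftrightarrow> v = 0 \<or> v = u - 1" for v using fan_adj_high[of u v] by auto
    then have "?D u = {0, u - 1}" by (simp only: set_eq_iff mem_Collect_eq insert_iff empty_iff simp_thms)
    then show "card (?D u) = 2" using u by auto
  qed simp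
  also have "(\<Sum>u\<in>{0..<20}. card (?D u)) = (\<Sum>u\<in>{0..<20}. length (filter (\<lambda>v. v < u) (base_links ! u)))"
  proof (rule sum.cong)
    fix u :: nat assume u: "u \<in> {0..<20}"
    then have "?D u = set (filter (\<lambda>v. v < u) (base_links ! u))" using fan_adj_base[of u] by auto
    then show "card (?D u) = length (filter (\<lambda>v. v < u) (base_links ! u))"
      using base(1)[of u] u distinct_card[OF distinct_filter, of "base_links ! u" "\<lambda>v. v < u"] by simp
  qed simp
  also have "\<dots> = 43" using base_count by (simp only: interv_sum_list_conv_sum_set_nat atLeast_upt set_upt)
  finally show ?thesis using e n20 by simp
qed

end

subsection \<open>Paths and links in pair graphs\<close>

lemma vwalk_arcs_nth: "set (vwalk_arcs p) = {(p ! i, p ! Suc i) | i. Suc i < length p}"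
proof (induction p rule: vwalk_arcs.induct)
  case (3 x y xs)
  have "{(p ! i, p ! Suc i) | i. Suc i < length p} = insert (x, y) {((y # xs) ! i, (y # xs) ! Suc i) | i. Suc i < length (y # xs)}"
    if p: "p = x # y # xs" for p
  proof (intro equalityI subsetI)
    fix z assume "z \<in> {(p ! i, p ! Suc i) | i. Suc i < length p}"
    then obtain i where "z = (p ! i, p ! Suc i)" "Suc i < length p" by blast
    then show "z \<in> insert (x, y) {((y # xs) ! i, (y # xs) ! Suc i) | i. Suc i < length (y # xs)}"
      using p by (cases i) auto
  next
    fix z assume "z \<in> insert (x, y) {((y # xs) ! i, (y # xs) ! Suc i) | i. Suc i < length (y # xs)}"
    then show "z \<in> {(p ! i, p ! Suc i) | i. Suc i < length p}"
    proof
      assume "z = (x, y)"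
      then show ?thesis using p by (intro CollectI exI[of _ 0]) simp
    next
      assume "z \<in> {((y # xs) ! i, (y # xs) ! Suc i) | i. Suc i < length (y # xs)}"
      then obtain i where "z = ((y # xs) ! i, (y # xs) ! Suc i)" "Suc i < length (y # xs)" by blast
      then show ?thesis using p by (intro CollectI exI[of _ "Suc i"]) simp
    qed
  qed
  then show ?case using 3 by simp
qed auto

lemma vwalk_arcs_successively: "set (vwalk_arcs p) \<subseteq> A \<longleftrightarrow> successively (\<lambda>x y. (x, y) \<in> A) p"
  unfolding vwalk_arcs_nth successively_conv_nth by auto

lemma traceable_iff:
  "traceable (with_proj G) \<longleftrightarrow> (\<exists>p. p \<noteq> [] \<and> distinct p \<and> set p = pverts G \<and> successively (\<lambda>x y. (x, y) \<in> parcs G) p)"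
  unfolding traceable_def vpath_def vwalk_def vwalk_arcs_successively by auto

lemma uedges_with_proj: "uedges (with_proj G) = {{u, v} | u v. (u, v) \<in> parcs G}"
  unfolding uedges_def by force

text \<open>For a listing without repetition, comparing the arcs with the consecutive pairs amounts
  to comparing indices, and this is the form in which links are used throughout.\<close>

lemma path_graph_link:
  "path_graph (with_proj G \<restriction> neighbours (with_proj G) v) \<longleftrightarrow> (\<exists>xs. link_path (\<lambda>x y. (x, y) \<in> parcs G) v xs)"
proof -
  let ?N = "neighbours (with_proj G) v" and ?adj = "\<lambda>x y. (x, y) \<in> parcs G"
  have N: "?N = {u. ?adj v u}" unfolding neighbours_def by simp
  have ends: "arcs_ends (with_proj G \<restriction> ?N) = {(x, y) \<in> parcs G. x \<in> ?N \<and> y \<in> ?N}"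
    by (auto simp: arcs_ends_conv image_iff)
  have eq: "arcs_ends (with_proj G \<restriction> ?N) = set (vwalk_arcs p) \<union> (set (vwalk_arcs p))\<inverse> \<longleftrightarrow>
      (\<forall>i<length p. \<forall>j<length p. ?adj (p ! i) (p ! j) \<longleftrightarrow> i = Suc j \<or> j = Suc i)" if p: "distinct p" "set p = ?N" for p
  proof -
    have arc: "(p ! i, p ! j) \<in> set (vwalk_arcs p) \<union> (set (vwalk_arcs p))\<inverse> \<longleftrightarrow> i = Suc j \<or> j = Suc i"
      if ij: "i < length p" "j < length p" for i j
    proof -
      have "(p ! i, p ! j) \<in> set (vwalk_arcs p) \<longleftrightarrow> j = Suc i" if "i < length p" "j < length p" for i j
        unfolding vwalk_arcs_nth using that nth_eq_iff_index_eq[OF p(1)] by auto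
      then show ?thesis using ij by auto
    qed
    have mem: "p ! i \<in> ?N" if "i < length p" for i using p(2) nth_mem[OF that] by simp
    have sub: "set (vwalk_arcs p) \<union> (set (vwalk_arcs p))\<inverse> \<subseteq> ?N \<times> ?N"
      unfolding vwalk_arcs_nth using mem by (auto dest: Suc_lessD)
    show ?thesis
    proof
      assume e: "arcs_ends (with_proj G \<restriction> ?N) = set (vwalk_arcs p) \<union> (set (vwalk_arcs p))\<inverse>"
      show "\<forall>i<length p. \<forall>j<length p. ?adj (p ! i) (p ! j) \<longleftrightarrow> i = Suc j \<or> j = Suc i"
        using arc mem unfolding e[symmetric] ends by auto
    next
      assume h: "\<forall>i<length p. \<forall>j<length p. ?adj (p ! i) (p ! j) \<longleftrightarrow> i = Suc j \<or> j = Suc i"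
      have "(x, y) \<in> arcs_ends (with_proj G \<restriction> ?N) \<longleftrightarrow> (x, y) \<in> set (vwalk_arcs p) \<union> (set (vwalk_arcs p))\<inverse>" for x y
      proof (cases "x \<in> ?N \<and> y \<in> ?N")
        case True
        then obtain i j where "x = p ! i" "y = p ! j" "i < length p" "j < length p" using p(2) by (metis in_set_conv_nth)
        then show ?thesis using arc[of i j] h True unfolding ends by auto
      next
        case False
        then show ?thesis using sub unfolding ends by blast
      qed
      then show "arcs_ends (with_proj G \<restriction> ?N) = set (vwalk_arcs p) \<union> (set (vwalk_arcs p))\<inverse>" by auto
    qed
  qed
  show ?thesis
  proof
    assume "path_graph (with_proj G \<restriction> ?N)"
    then obtain p where p: "p \<noteq> []" "distinct p" "set p = ?N" "arcs_ends (with_proj G \<restriction> ?N) = set (vwalk_arcs p) \<union> (set (vwalk_arcs p))\<inverse>"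
      unfolding path_graph_def vpath_def vwalk_def by auto
    then have "link_path ?adj v p" unfolding link_path_def using eq[OF p(2,3)] N by simp
    then show "\<exists>xs. link_path ?adj v xs" by blast
  next
    assume "\<exists>xs. link_path ?adj v xs"
    then obtain p where p: "p \<noteq> []" "distinct p" "set p = ?N" "\<forall>i<length p. \<forall>j<length p. ?adj (p ! i) (p ! j) \<longleftrightarrow> i = Suc j \<or> j = Suc i"
      unfolding link_path_def using N by auto
    then have "arcs_ends (with_proj G \<restriction> ?N) = set (vwalk_arcs p) \<union> (set (vwalk_arcs p))\<inverse>" using eq[OF p(2,3)] by blast
    then show "path_graph (with_proj G \<restriction> ?N)" unfolding path_graph_def vpath_def vwalk_def using p by (intro exI[of _ p]) auto
  qed
qed

lemma nontraceable_locally_linear_graph_bounds: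
  assumes G: "nontraceable_locally_linear_graph n G" and n: "n > 0"
  shows "n \<ge> 20" "card (uedges (with_proj G)) \<ge> 2 * n + 3"
proof -
  let ?adj = "\<lambda>x y. (x, y) \<in> parcs G" and ?V = "pverts G"
  have pg: "pair_graph G" and con: "Digraph_Component.connected (with_proj G)" and nt: "\<not> traceable (with_proj G)"
    and ll: "locally_linear (with_proj G)" and cn: "card ?V = n" using G unfolding nontraceable_locally_linear_graph_def by auto
  interpret pair_graph G by fact
  have fin: "finite ?V" using pair_finite_verts .
  have sym: "?adj v u" if "?adj u v" for u v using pair_sym_arcs that unfolding symmetric_def by (auto elim: symE)
  have irr: "\<not> ?adj u u" for u using pair_no_loops[of "(u, u)"] by auto
  have inV: "u \<in> ?V" if "?adj u v" for u v using in_arcsD1 that by blast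
  have link: "\<exists>xs. link_path ?adj v xs" if "v \<in> ?V" for v using ll that unfolding locally_linear_def path_graph_link by simp
  have reach: "(u, v) \<in> {(x, y). ?adj x y}\<^sup>*" if "u \<in> ?V" "v \<in> ?V" for u v
  proof -
    have "strongly_connected (with_proj G)" using symmetric_connected_imp_strongly_connected pair_sym_arcs con by blast
    then have "u \<rightarrow>\<^sup>*\<^bsub>with_proj G\<^esub> v" using that unfolding strongly_connected_def by auto
    then have "(u, v) \<in> (parcs G)\<^sup>*" using reachable_rtranclI by fastforce
    then show ?thesis by simp
  qed
  \<comment> \<open>Every vertex has a neighbour because links are nonempty, so at most two vertices
    would mean a single edge, which is traceable.\<close>
  have "card ?V > 2"
  proof (rule ccontr)
    assume "\<not> card ?V > 2"
    then have c: "card ?V \<le> 2" by simp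
    have "?V \<noteq> {}" using cn n by auto
    then obtain a where a: "a \<in> ?V" by blast
    obtain b where b: "?adj a b" using link[OF a] unfolding link_path_def by (metis ex_in_conv mem_Collect_eq set_empty)
    have ab: "a \<noteq> b" using b irr by blast
    have "{a, b} \<subseteq> ?V" using a inV[OF sym[OF b]] by blast
    then have "{a, b} = ?V" using card_seteq[OF fin] c ab by simp
    then have "traceable (with_proj G)" unfolding traceable_iff using ab b by (intro exI[of _ "[a, b]"]) auto
    then show False using nt by blast
  qed
  then interpret ll_graph ?V ?adj
    using fin sym irr inV reach link by unfold_locales blast+
  have "\<not> (\<exists>a b. hpath ?V a b)" using nt unfolding traceable_iff hpath_def by blast
  note b = nontraceable_bounds[OF this]
  show "n \<ge> 20" using b(1) cn by simp
  have "edges = uedges (with_proj G)" unfolding edges_def uedges_with_proj ..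
  then show "card (uedges (with_proj G)) \<ge> 2 * n + 3" using b(2) cn by simp
qed

text \<open>The vertex type is arbitrary, so the example on the numbers below \<open>n\<close> is
  copied along an injection.\<close>

lemma fan_realisation:
  fixes f :: "nat \<Rightarrow> 'a"
  assumes n: "n \<ge> 20" and f: "inj_on f {0..<n}"
  defines "G \<equiv> \<lparr>pverts = f ` {0..<n}, parcs = {(f u, f v) | u v. fan_adj n u v}\<rparr>"
  shows "nontraceable_locally_linear_graph n G" "card (uedges (with_proj G)) = 2 * n + 3"
proof -
  let ?adj = "\<lambda>x y. (x, y) \<in> parcs G"
  have V: "pverts G = f ` {0..<n}" and A: "parcs G = {(f u, f v) | u v. fan_adj n u v}" unfolding G_def by simp_all
  have ff: "f u = f v \<longleftrightarrow> u = v" if "u < n" "v < n" for u v using f that by (auto simp: inj_on_eq_iff)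
  have lt: "u < n" "v < n" if "fan_adj n u v" for u v using fan_adj_less[OF n that] .
  have adj: "?adj (f u) (f v) \<longleftrightarrow> fan_adj n u v" if "u < n" "v < n" for u v
    unfolding A using that lt ff by auto
  have sub: "parcs G \<subseteq> pverts G \<times> pverts G" unfolding A V using lt by auto
  have fin: "finite (pverts G)" "finite (parcs G)" using finite_subset[OF sub] unfolding V by auto
  have pg: "pair_graph G"
  proof unfold_locales
    show "fst e \<in> pverts G" "snd e \<in> pverts G" if "e \<in> parcs G" for e using sub that by auto
    show "finite (pverts G)" "finite (parcs G)" by (fact fin)+
    show "fst e \<noteq> snd e" if "e \<in> parcs G" for e using that lt ff fan_adj_irrefl[OF n] unfolding A by auto
    have "sym (parcs G)" unfolding A sym_def using fan_adj_sym[OF n] by blast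
    then show "symmetric (with_proj G)" unfolding symmetric_def by simp
  qed
  have "Digraph_Component.connected (with_proj G)" unfolding connected_conv
  proof (intro conjI ballI)
    show "verts (with_proj G) \<noteq> {}" using n unfolding with_proj_simps V by auto
    fix x y assume xy: "x \<in> verts (with_proj G)" "y \<in> verts (with_proj G)"
    then obtain u v where uv: "x = f u" "y = f v" "u < n" "v < n" unfolding with_proj_simps V by auto
    have "(f u, f v) \<in> (parcs G)\<^sup>*" using fan_connected[OF n uv(3,4)]
    proof (induction rule: rtrancl_induct)
      case (step y z)
      then have "(f y, f z) \<in> parcs G" unfolding A by auto
      then show ?case using step by (meson rtrancl_into_rtrancl)
    qed simp
    then have "(x, y) \<in> ((parcs G)\<^sup>s)\<^sup>*" using uv rtrancl_mono[of "parcs G" "(parcs G)\<^sup>s"] unfolding symcl_def by blast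
    then show "(x, y) \<in> rtrancl_on (verts (with_proj G)) ((arcs_ends (with_proj G))\<^sup>s)"
      unfolding with_proj_simps
      by (rule rtrancl_consistent_rtrancl_on) (use xy sub in \<open>auto simp: symcl_def\<close>)
  qed
  moreover have "\<not> traceable (with_proj G)"
  proof
    assume "traceable (with_proj G)"
    then obtain p where p: "distinct p" "set p = f ` {0..<n}" "successively ?adj p" unfolding traceable_iff V by blast
    let ?g = "inv_into {0..<n} f"
    have g: "?g x < n" "f (?g x) = x" if "x \<in> set p" for x
      using that p(2) inv_into_into[of x f "{0..<n}"] f_inv_into_f[of x f "{0..<n}"] by auto
    have "inj_on ?g (set p)" using g(2) by (metis inj_onI)
    then have "distinct (map ?g p)" using p(1) by (simp add: distinct_map)
    moreover have "set (map ?g p) = {0..<n}" using p(2) inv_into_image_cancel[OF f order_refl] by simp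
    moreover have "successively (fan_adj n) (map ?g p)" unfolding successively_map
    proof (rule successively_mono[OF p(3)])
      fix x y assume "x \<in> set p" "y \<in> set p" "?adj x y"
      then show "fan_adj n (?g x) (?g y)" using adj[of "?g x" "?g y"] g by simp
    qed
    ultimately show False using fan_nontraceable[OF n] by blast
  qed
  moreover have "locally_linear (with_proj G)" unfolding locally_linear_def path_graph_link
  proof
    fix x assume "x \<in> verts (with_proj G)"
    then obtain v where v: "x = f v" "v < n" unfolding with_proj_simps V by auto
    obtain xs where xs: "link_path (fan_adj n) v xs" using fan_link[OF n v(2)] by blast
    have l: "u < n" if "u \<in> set xs" for u using xs that lt unfolding link_path_def by blast
    have "inj_on f (set xs)" using f l by (auto intro: inj_on_subset)
    then have "distinct (map f xs)" using xs unfolding link_path_def by (simp add: distinct_map)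
    moreover have "set (map f xs) = {u. ?adj x u}"
    proof -
      have "set xs = {u. fan_adj n v u}" using xs unfolding link_path_def by blast
      then show ?thesis unfolding A v(1) using lt ff v(2) by auto
    qed
    moreover have "?adj (map f xs ! i) (map f xs ! j) \<longleftrightarrow> i = Suc j \<or> j = Suc i" if "i < length (map f xs)" "j < length (map f xs)" for i j
    proof -
      have ij: "i < length xs" "j < length xs" using that by simp_all
      then show ?thesis using adj[OF l[OF nth_mem[OF ij(1)]] l[OF nth_mem[OF ij(2)]]] xs unfolding link_path_def by simp
    qed
    ultimately have "link_path ?adj x (map f xs)" using xs unfolding link_path_def by simp
    then show "\<exists>xs. link_path ?adj x xs" by blast
  qed
  moreover have "card (pverts G) = n" unfolding V using card_image[OF f] by simp
  ultimately show "nontraceable_locally_linear_graph n G" unfolding nontraceable_locally_linear_graph_def using pg by blast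
  \<comment> \<open>Each undirected edge is represented once, by the pair with the larger number
    first.\<close>
  let ?D = "{(u, v). fan_adj n u v \<and> v < u}"
  have "uedges (with_proj G) = (\<lambda>(u, v). {f u, f v}) ` ?D"
  proof (intro equalityI subsetI)
    fix e assume "e \<in> uedges (with_proj G)"
    then obtain u v where uv: "e = {f u, f v}" "fan_adj n u v" unfolding uedges_with_proj A by blast
    then have "u \<noteq> v" using fan_adj_irrefl[OF n] by auto
    then consider "v < u" | "u < v" by linarith
    then show "e \<in> (\<lambda>(u, v). {f u, f v}) ` ?D"
    proof cases
      case 1 then show ?thesis using uv by (intro image_eqI[of _ _ "(u, v)"]) auto
    next
      case 2 then show ?thesis using uv fan_adj_sym[OF n] by (intro image_eqI[of _ _ "(v, u)"]) auto
    qed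
  qed (auto simp: uedges_with_proj A)
  moreover have "inj_on (\<lambda>(u, v). {f u, f v}) ?D"
  proof (rule inj_onI, clarify)
    fix u v u' v' assume h: "fan_adj n u v" "v < u" "fan_adj n u' v'" "v' < u'" "{f u, f v} = {f u', f v'}"
    have l: "u < n" "v < n" "u' < n" "v' < n" using lt h by blast+
    have "f u = f u' \<and> f v = f v' \<or> f u = f v' \<and> f v = f u'" using h(5) by (simp add: doubleton_eq_iff)
    then have "u = u' \<and> v = v' \<or> u = v' \<and> v = u'" using ff l by auto
    then show "u = u' \<and> v = v'" using h(2,4) by auto
  qed
  ultimately show "card (uedges (with_proj G)) = 2 * n + 3" using fan_card_edges[OF n] by (simp only: card_image)
qed

theorem theorem3:
  fixes n :: nat
  assumes "n > 0"
    and "\<exists>G :: 'a pair_pre_digraph. nontraceable_locally_linear_graph n G"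
  shows "(\<exists>G :: 'a pair_pre_digraph. nontraceable_locally_linear_graph n G \<and>
            card (uedges (with_proj G)) = 2 * n + 3) \<and>
         (\<forall>G :: 'a pair_pre_digraph. nontraceable_locally_linear_graph n G \<longrightarrow>
            2 * n + 3 \<le> card (uedges (with_proj G)))"
proof
  \<comment> \<open>The given graph shows that \<open>n\<close> is at least 20 and that the type has
    at least \<open>n\<close> elements, which is what the copy of the example requires.\<close>
  obtain G :: "'a pair_pre_digraph" where G: "nontraceable_locally_linear_graph n G" using assms(2) by blast
  then have c: "card (pverts G) = n" unfolding nontraceable_locally_linear_graph_def by blast
  then have "finite (pverts G)" using assms(1) card_ge_0_finite by metis
  then obtain f where "bij_betw f {0..<n} (pverts G)" using ex_bij_betw_nat_finite c by blast
  then have "inj_on f {0..<n}" by (rule bij_betw_imp_inj_on)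
  then show "\<exists>G :: 'a pair_pre_digraph. nontraceable_locally_linear_graph n G \<and> card (uedges (with_proj G)) = 2 * n + 3"
    using fan_realisation[OF nontraceable_locally_linear_graph_bounds(1)[OF G assms(1)]] by blast
  show "\<forall>G :: 'a pair_pre_digraph. nontraceable_locally_linear_graph n G \<longrightarrow> 2 * n + 3 \<le> card (uedges (with_proj G))"
    using nontraceable_locally_linear_graph_bounds(2) assms(1) by blast
qed

end
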